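(* Suppose $\mathbb{E}[\eta_0]<\infty$. For the unbiased walk ($\beta=1$), the process $(X_{\lfloor nt\rfloor}n^{-1/2})_{t\ge0}$ converges, as $n\to\infty$, in $\mathbb{P}$-distribution on $D([0,\infty),\mathbb{R})$ endowed with the Skorohod metric to a scaled Brownian motion with variance $\Upsilon=\mathbb{E}[\eta_0]^{-1}$. Moreover, $$\lim_{\beta\to1^+}\frac{\nu}{\beta-1}=\frac{\Upsilon}{2},$$ where, for $\beta>1$, $\nu=\nu(\beta)=\frac{\beta-1}{\mathbb{E}[\eta_0](\beta+1)}$ is the speed of the $\beta$-biased walk, i.e. the $\mathbb{P}$-a.s. limit of $X_n/n$.
   Context: Randomly trapped random walk on $\mathbb{Z}$ with bias $\beta\ge1$. Let $Y_0=0$ and $Y_k=\sum_{j=1}^k\chi_j$, where $(\chi_j)_{j\ge1}$ are i.i.d. with $P(\chi_j=-1)=(\beta+1)^{-1}=1-P(\chi_j=1)$. Let $L(x,n)=\sum_{k=0}^n\mathbf{1}_{\{Y_k=x\}}$ for $x\in\mathbb{Z}$. A random environment is a sequence $\omega=(\omega_x)_{x\in\mathbb{Z}}$ of probability measures on $(0,\infty)$ with law $\mathbf{P}=\pi^{\otimes\mathbb{Z}}$, i.e. the $\omega_x$ are i.i.d. with a fixed law $\pi$ (a law on probability measures on $(0,\infty)$, not depending on $\beta$). Given $\omega$, let $(\eta_{x,i})_{x\in\mathbb{Z},i\ge0}$ be independent random variables with $\eta_{x,i}\sim\omega_x$, independent of $Y$. Put $\eta_k=\eta_{Y_k,L(Y_k,k)}$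 for $k\ge0$ (the $k$-th holding time), $S_n=\sum_{k=0}^{n-1}\eta_k$, $S^{-1}_t=\max\{k\ge0:S_k\le t\}$ and $X_t=Y_{S^{-1}_t}$ for real $t\ge0$. $P^\omega$ denotes the law for fixed $\omega$ and $\mathbb{P}(\cdot)=\int P^\omega(\cdot)\,\mathbf{P}(d\omega)$ the annealed law, with expectation $\mathbb{E}$. A scaled Brownian motion with variance $\Upsilon$ is $\sqrt{\Upsilon}$ times a standard Brownian motion. *)

theory Defs
  imports "HOL-Probability.Probability"
begin

text \<open>
  A sample point is a pair of the step sequence chi (indexed by j >= 1) and the array eta of
  potential holding times, where eta (x, i) is the holding time attached to site x and index i.
\<close>

type_synonym sample = "(nat \<Rightarrow> int) \<times> (int \<times> nat \<Rightarrow> real)"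

definition step_pmf :: "real \<Rightarrow> int pmf" where
  "step_pmf \<beta> = map_pmf (\<lambda>b. if b then -1 else 1) (bernoulli_pmf (1 / (\<beta> + 1)))"

abbreviation trap_measures :: "real measure measure" where
  "trap_measures \<equiv> prob_algebra (restrict_space borel {0<..})"

definition environment_law :: "real measure measure \<Rightarrow> (int \<Rightarrow> real measure) measure" where
  "environment_law \<pi> = (\<Pi>\<^sub>M x\<in>UNIV. \<pi>)"

definition quenched_law :: "real \<Rightarrow> (int \<Rightarrow> real measure) \<Rightarrow> sample measure" where
  "quenched_law \<beta> \<omega> =
     (\<Pi>\<^sub>M j\<in>{1..}. measure_pmf (step_pmf \<beta>)) \<Otimes>\<^sub>M (\<Pi>\<^sub>M (x, i)\<in>UNIV. \<omega> x)"

definition annealed_law :: "real \<Rightarrow> real measure measure \<Rightarrow> sample measure" where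
  "annealed_law \<beta> \<pi> = environment_law \<pi> \<bind> quenched_law \<beta>"

definition walk :: "sample \<Rightarrow> nat \<Rightarrow> int" where
  "walk s k = (\<Sum>j=1..k. fst s j)"

definition local_time :: "sample \<Rightarrow> int \<Rightarrow> nat \<Rightarrow> nat" where
  "local_time s x n = (\<Sum>k=0..n. if walk s k = x then 1 else 0)"

definition holding_time :: "sample \<Rightarrow> nat \<Rightarrow> real" where
  "holding_time s k = snd s (walk s k, local_time s (walk s k) k)"

definition clock :: "sample \<Rightarrow> nat \<Rightarrow> real" where
  "clock s n = (\<Sum>k<n. holding_time s k)"

text \<open>
  The set below is infinite only if the clock is bounded, which has annealed probability zero;
  there \<open>Max\<close> is an unspecified constant.
\<close>

definition clock_inverse :: "sample \<Rightarrow> real \<Rightarrow> nat" where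
  "clock_inverse s t = Max {k. clock s k \<le> t}"

definition trapped_walk :: "sample \<Rightarrow> real \<Rightarrow> int" where
  "trapped_walk s t = walk s (clock_inverse s t)"

definition mean_holding_time :: "real \<Rightarrow> real measure measure \<Rightarrow> real" where
  "mean_holding_time \<beta> \<pi> = (\<integral>s. holding_time s 0 \<partial>annealed_law \<beta> \<pi>)"

definition speed :: "real \<Rightarrow> real measure measure \<Rightarrow> real" where
  "speed \<beta> \<pi> = (\<beta> - 1) / (mean_holding_time \<beta> \<pi> * (\<beta> + 1))"

text \<open>
  Functions on the half-line are represented as extensional functions, so that equality in this
  set is equality on the half-line.
\<close>

definition skorohod_space :: "(real \<Rightarrow> real) set" where
  "skorohod_space = {x \<in> extensional {0..}.
     (\<forall>t\<ge>0. continuous (at_right t) x) \<and> (\<forall>t>0. \<exists>l. (x \<longlongrightarrow> l) (at_left t))}"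

text \<open>
  The metric is the one of Billingsley, Convergence of Probability Measures (2nd ed.), Section 16:
  a weighted sum over m >= 1 of the Skorohod (J1) distances on [0,m] of the paths multiplied by
  the cut-off that is 1 on [0,m-1], 0 on [m,infinity) and linear in between.
\<close>

definition time_changes :: "real \<Rightarrow> (real \<Rightarrow> real) set" where
  "time_changes T = {\<tau>. strict_mono_on {0..T} \<tau> \<and> continuous_on {0..T} \<tau> \<and> \<tau> ` {0..T} = {0..T}}"

definition skorohod_dist_on :: "real \<Rightarrow> (real \<Rightarrow> real) \<Rightarrow> (real \<Rightarrow> real) \<Rightarrow> real" where
  "skorohod_dist_on T x y =
     (INF \<tau>\<in>time_changes T.
        max (SUP t\<in>{0..T}. \<bar>\<tau> t - t\<bar>) (SUP t\<in>{0..T}. \<bar>x t - y (\<tau> t)\<bar>))"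

definition cut_off :: "real \<Rightarrow> (real \<Rightarrow> real) \<Rightarrow> real \<Rightarrow> real" where
  "cut_off T x t = max 0 (min 1 (T - t)) * x t"

definition skorohod_dist :: "(real \<Rightarrow> real) \<Rightarrow> (real \<Rightarrow> real) \<Rightarrow> real" where
  "skorohod_dist x y =
     (\<Sum>m. (1 / 2) ^ Suc m *
        min 1 (skorohod_dist_on (real (Suc m)) (cut_off (real (Suc m)) x) (cut_off (real (Suc m)) y)))"

definition skorohod_topology :: "(real \<Rightarrow> real) topology" where
  "skorohod_topology = Metric_space.mtopology skorohod_space skorohod_dist"

definition borel_of_topology :: "'a topology \<Rightarrow> 'a measure" where
  "borel_of_topology T = sigma (topspace T) {U. openin T U}"

definition converges_in_distribution ::
    "'a topology \<Rightarrow> (nat \<Rightarrow> 'b measure) \<Rightarrow> (nat \<Rightarrow> 'b \<Rightarrow> 'a) \<Rightarrow> 'c measure \<Rightarrow> ('c \<Rightarrow> 'a) \<Rightarrow> bool" where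
  "converges_in_distribution T P Z Q V \<longleftrightarrow>
     (\<forall>n. prob_space (P n) \<and> Z n \<in> P n \<rightarrow>\<^sub>M borel_of_topology T) \<and>
     prob_space Q \<and> V \<in> Q \<rightarrow>\<^sub>M borel_of_topology T \<and>
     (\<forall>f. continuous_map T euclideanreal f \<and> bounded (f ` topspace T) \<longrightarrow>
        (\<lambda>n. \<integral>w. f (Z n w) \<partial>P n) \<longlonglongrightarrow> (\<integral>w. f (V w) \<partial>Q))"

definition standard_brownian_motion :: "'a measure \<Rightarrow> (real \<Rightarrow> 'a \<Rightarrow> real) \<Rightarrow> bool" where
  "standard_brownian_motion M B \<longleftrightarrow>
     prob_space M \<and>
     (\<forall>t\<ge>0. B t \<in> borel_measurable M) \<and>
     (\<forall>w\<in>space M. B 0 w = 0 \<and> continuous_on {0..} (\<lambda>t. B t w)) \<and>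
     (\<forall>s t. 0 \<le> s \<and> s < t \<longrightarrow>
        distributed M lborel (\<lambda>w. B t w - B s w) (normal_density 0 (sqrt (t - s)))) \<and>
     (\<forall>t :: nat \<Rightarrow> real. 0 \<le> t 0 \<and> mono t \<longrightarrow>
        prob_space.indep_vars M (\<lambda>_. borel) (\<lambda>i w. B (t (Suc i)) w - B (t i) w) UNIV)"

end

theory Submission
  imports Defs "HOL-Real_Asymp.Real_Asymp"
begin

text \<open>
  Write Y for the embedded walk, S for its clock and \<mu> for the mean holding time. The trapped walk
  is Y read at the inverse of S, so both parts of the theorem come from one fact: S is close to the
  line with slope \<mu>, and its inverse therefore to the line with slope 1/\<mu>.

  Under the annealed law the step sequence is independent of the field of holding times
  (\<open>annealed_law_eq\<close>), and holding times at different sites are independent of each other. Two holding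
  times along the walk can be correlated only when the walk is at the same site at both times. This
  bounds the covariance of truncated holding times by a meeting probability
  (\<open>holding_times_weakly_dependent\<close>). For \<beta> > 1 the meeting probability decays geometrically in the
  time lag, and the argument of Etemadi, which uses only second moments of truncated variables, gives
  S n / n \<rightarrow> \<mu> almost surely (\<open>strong_law_of_large_numbers\<close>). For \<beta> = 1 it tends to 0 with the lag, and
  this gives the same limit in mean (\<open>averages_converge_in_mean\<close>).

  With Y n / n \<rightarrow> (\<beta> - 1)/(\<beta> + 1), the almost sure limit of the clock yields the speed of the biased
  walk (\<open>biased_walk_speed\<close>). Since \<mu> is the same for every \<beta>, the behaviour of the speed near \<beta> = 1
  is that of (\<beta> - 1)/(\<beta> + 1), whose derivative there is 1/2.

  In the invariance principle it suffices to test bounded Lipschitz functions of the path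
  (\<open>converges_in_distribution_skorohod_lipschitz\<close>). The rescaled trapped walk is compared with a
  skeleton: the walk Y sampled at the times n k / (\<mu> N) for k \<le> N T. If S is within one cell of its
  line at the end points of all cells, and Y moves by at most e sqrt n inside each cell, then
  the two paths differ by at most 7 e on [0, T] (\<open>rescaled_path_near_skeleton\<close>). The exceptional event is
  controlled by the Markov inequality for S and by a maximal inequality with fourth moments for Y
  (\<open>prob_irregular_le\<close>): each of the about N T cells contributes a probability of order 1/N^2, so that
  N = T^3 makes the total vanish as T grows. For a fixed mesh the skeleton is a continuous function of
  finitely many independent increments, each with a Gaussian limit, and converges to the Brownian path
  sampled on the mesh (\<open>skeleton_converges\<close>); as the mesh is refined these samples converge to the
  Brownian path itself (\<open>brownian_skeleton_converges\<close>).

  The Brownian motion is built by splitting Gaussian increments at dyadic midpoints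
  (\<open>standard_brownian_motion_brownian_path\<close>).
\<close>

section \<open>The Skorohod space\<close>

lemma bounded_image_realE:
  fixes x :: "'a \<Rightarrow> real"
  assumes "bounded (x ` S)"
  obtains C where "\<And>t. t \<in> S \<Longrightarrow> \<bar>x t\<bar> \<le> C"
proof -
  have "\<exists>C. \<forall>t\<in>S. \<bar>x t\<bar> \<le> C" using assms by (simp add: bounded_iff)
  then show ?thesis using that by blast
qed

lemma time_changesD:
  assumes "\<tau> \<in> time_changes T"
  shows "strict_mono_on {0..T} \<tau>" "continuous_on {0..T} \<tau>" "\<tau> ` {0..T} = {0..T}"
    "t \<in> {0..T} \<Longrightarrow> \<tau> t \<in> {0..T}"
  using assms by (auto simp: time_changes_def)

lemma id_time_change: "(\<lambda>t. t) \<in> time_changes T"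
  by (auto simp: time_changes_def strict_mono_on_def)

lemma time_change_inverse:
  assumes \<tau>: "\<tau> \<in> time_changes T"
  obtains \<sigma> where "\<sigma> \<in> time_changes T" "\<And>t. t \<in> {0..T} \<Longrightarrow> \<sigma> (\<tau> t) = t"
    "\<And>t. t \<in> {0..T} \<Longrightarrow> \<tau> (\<sigma> t) = t"
proof -
  note D = time_changesD[OF \<tau>]
  define \<sigma> where "\<sigma> = the_inv_into {0..T} \<tau>"
  have inj: "inj_on \<tau> {0..T}" using D(1) by (rule strict_mono_on_imp_inj_on)
  have 1: "\<sigma> (\<tau> t) = t" if "t \<in> {0..T}" for t
    unfolding \<sigma>_def using inj that by (rule the_inv_into_f_f)
  have 2: "\<tau> (\<sigma> t) = t" if "t \<in> {0..T}" for t
    unfolding \<sigma>_def by (rule f_the_inv_into_f[OF inj]) (use that D(3) in auto)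
  have img: "\<sigma> ` {0..T} = {0..T}"
  proof -
    have "\<sigma> ` {0..T} = \<sigma> ` (\<tau> ` {0..T})" using D(3) by simp
    also have "\<dots> = {0..T}" using 1 by (force simp: image_image)
    finally show ?thesis .
  qed
  have cont: "continuous_on {0..T} \<sigma>"
    using continuous_on_inv[OF D(2) compact_Icc] 1 D(3) by auto
  have "strict_mono_on {0..T} \<sigma>"
  proof (rule strict_mono_onI)
    fix r s assume rs: "r \<in> {0..T}" "s \<in> {0..T}" "r < s"
    have m: "\<sigma> r \<in> {0..T}" "\<sigma> s \<in> {0..T}" using img rs by auto
    show "\<sigma> r < \<sigma> s"
    proof (rule ccontr)
      assume "\<not> \<sigma> r < \<sigma> s"
      then have "\<tau> (\<sigma> s) \<le> \<tau> (\<sigma> r)"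
        using strict_mono_onD[OF D(1) m(2,1)] by (cases "\<sigma> s = \<sigma> r") auto
      with 2 rs show False by auto
    qed
  qed
  with img cont 1 2 show ?thesis by (intro that[of \<sigma>]) (auto simp: time_changes_def)
qed

lemma time_change_compose:
  assumes "\<tau> \<in> time_changes T" "\<sigma> \<in> time_changes T"
  shows "(\<lambda>t. \<sigma> (\<tau> t)) \<in> time_changes T"
proof -
  note D = time_changesD[OF assms(1)] and E = time_changesD[OF assms(2)]
  have "strict_mono_on {0..T} (\<lambda>t. \<sigma> (\<tau> t))"
    by (intro strict_mono_onI strict_mono_onD[OF E(1)] strict_mono_onD[OF D(1)] D(4))
  moreover have "continuous_on {0..T} (\<lambda>t. \<sigma> (\<tau> t))"
    by (rule continuous_on_compose2[OF E(2) D(2)]) (use D(3) in auto)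
  moreover have "(\<lambda>t. \<sigma> (\<tau> t)) ` {0..T} = {0..T}"
    using D(3) E(3) by (metis image_image)
  ultimately show ?thesis by (simp add: time_changes_def)
qed

lemma time_change_displacement_le:
  assumes "\<tau> \<in> time_changes T" "t \<in> {0..T}" shows "\<bar>\<tau> t - t\<bar> \<le> T"
  using time_changesD(4)[OF assms] assms(2) by (auto simp: abs_le_iff)

lemma time_change_displacement:
  assumes \<tau>: "\<tau> \<in> time_changes T" and T: "0 < T"
  shows "bdd_above ((\<lambda>t. \<bar>\<tau> t - t\<bar>) ` {0..T})" "0 \<le> (SUP t\<in>{0..T}. \<bar>\<tau> t - t\<bar>)"
proof -
  show 1: "bdd_above ((\<lambda>t. \<bar>\<tau> t - t\<bar>) ` {0..T})"
    using time_change_displacement_le[OF \<tau>] by (intro bdd_aboveI2) auto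
  have "\<bar>\<tau> 0 - 0\<bar> \<le> (SUP t\<in>{0..T}. \<bar>\<tau> t - t\<bar>)"
    by (rule cSUP_upper[OF _ 1]) (use T in auto)
  then show "0 \<le> (SUP t\<in>{0..T}. \<bar>\<tau> t - t\<bar>)" by linarith
qed

lemma time_change_difference_bdd:
  fixes x y :: "real \<Rightarrow> real"
  assumes \<tau>: "\<tau> \<in> time_changes T"
    and x: "bounded (x ` {0..T})" and y: "bounded (y ` {0..T})"
  shows "bdd_above ((\<lambda>t. \<bar>x t - y (\<tau> t)\<bar>) ` {0..T})"
proof -
  obtain a where a: "\<And>t. t \<in> {0..T} \<Longrightarrow> \<bar>x t\<bar> \<le> a"
    using bounded_image_realE[OF x] by blast
  obtain b where b: "\<And>t. t \<in> {0..T} \<Longrightarrow> \<bar>y t\<bar> \<le> b"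
    using bounded_image_realE[OF y] by blast
  show "bdd_above ((\<lambda>t. \<bar>x t - y (\<tau> t)\<bar>) ` {0..T})"
  proof (rule bdd_aboveI2)
    fix t assume t: "t \<in> {0..T}"
    show "\<bar>x t - y (\<tau> t)\<bar> \<le> a + b"
      using a[OF t] b[OF time_changesD(4)[OF \<tau> t]] by linarith
  qed
qed

lemma skorohod_dist_on_nonneg:
  assumes "0 < T"
  shows "0 \<le> skorohod_dist_on T x y"
  unfolding skorohod_dist_on_def
  by (intro cINF_greatest) (use id_time_change time_change_displacement(2)[OF _ assms] in \<open>auto simp: max.coboundedI1\<close>)

lemma skorohod_dist_on_le:
  assumes T: "0 < T"
    and \<tau>: "\<tau> \<in> time_changes T"
    and e: "\<And>t. t \<in> {0..T} \<Longrightarrow> \<bar>\<tau> t - t\<bar> \<le> e" "\<And>t. t \<in> {0..T} \<Longrightarrow> \<bar>x t - y (\<tau> t)\<bar> \<le> e"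
  shows "skorohod_dist_on T x y \<le> e"
proof -
  have "skorohod_dist_on T x y \<le> max (SUP t\<in>{0..T}. \<bar>\<tau> t - t\<bar>) (SUP t\<in>{0..T}. \<bar>x t - y (\<tau> t)\<bar>)"
    unfolding skorohod_dist_on_def
  proof (rule cINF_lower[OF _ \<tau>])
    show "bdd_below ((\<lambda>\<tau>. max (SUP t\<in>{0..T}. \<bar>\<tau> t - t\<bar>) (SUP t\<in>{0..T}. \<bar>x t - y (\<tau> t)\<bar>)) ` time_changes T)"
      by (rule bdd_belowI2[of _ 0]) (use time_change_displacement(2)[OF _ T] in \<open>auto simp: max.coboundedI1\<close>)
  qed
  also have "\<dots> \<le> e"
    using T e by (intro max.boundedI cSUP_least) auto
  finally show ?thesis .
qed

lemma skorohod_dist_on_lessD: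
  assumes T: "0 < T" and b: "bounded (x ` {0..T})" "bounded (y ` {0..T})"
    and e: "skorohod_dist_on T x y < e"
  obtains \<tau> where "\<tau> \<in> time_changes T" "\<And>t. t \<in> {0..T} \<Longrightarrow> \<bar>\<tau> t - t\<bar> \<le> e"
    "\<And>t. t \<in> {0..T} \<Longrightarrow> \<bar>x t - y (\<tau> t)\<bar> \<le> e"
proof -
  have "\<exists>r\<in>(\<lambda>\<tau>. max (SUP t\<in>{0..T}. \<bar>\<tau> t - t\<bar>) (SUP t\<in>{0..T}. \<bar>x t - y (\<tau> t)\<bar>)) ` time_changes T. r < e"
    using e unfolding skorohod_dist_on_def by (intro cInf_lessD) (use id_time_change in auto)
  then obtain \<tau> where \<tau>: "\<tau> \<in> time_changes T"
    and 1: "(SUP t\<in>{0..T}. \<bar>\<tau> t - t\<bar>) < e" "(SUP t\<in>{0..T}. \<bar>x t - y (\<tau> t)\<bar>) < e"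
    by auto
  note A = time_change_displacement(1)[OF \<tau> T] time_change_difference_bdd[OF \<tau> b]
  show ?thesis
  proof (rule that[OF \<tau>])
    fix t assume "t \<in> {0..T}"
    then show "\<bar>\<tau> t - t\<bar> \<le> e" "\<bar>x t - y (\<tau> t)\<bar> \<le> e"
      using cSUP_upper[OF _ A(1), of t] cSUP_upper[OF _ A(2), of t] 1 by auto
  qed
qed

lemma skorohod_dist_on_commute: "skorohod_dist_on T x y = skorohod_dist_on T y x"
proof -
  define c where "c x y \<tau> = max (SUP t\<in>{0..T}. \<bar>\<tau> t - t\<bar>) (SUP t\<in>{0..T}. \<bar>x t - y (\<tau> t)\<bar>)"
    for x y \<tau> :: "real \<Rightarrow> real"
  have sub: "c x y ` time_changes T \<subseteq> c y x ` time_changes T" for x y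
  proof
    fix r assume "r \<in> c x y ` time_changes T"
    then obtain \<tau> where \<tau>: "\<tau> \<in> time_changes T" and r: "r = c x y \<tau>" by auto
    obtain \<sigma> where \<sigma>: "\<sigma> \<in> time_changes T" "\<And>t. t \<in> {0..T} \<Longrightarrow> \<sigma> (\<tau> t) = t"
      using time_change_inverse[OF \<tau>] by blast
    have img: "h ` {0..T} = (\<lambda>t. h (\<tau> t)) ` {0..T}" for h :: "real \<Rightarrow> real"
      using time_changesD(3)[OF \<tau>] by (metis image_image)
    have "(\<lambda>s. \<bar>\<sigma> s - s\<bar>) ` {0..T} = (\<lambda>t. \<bar>\<tau> t - t\<bar>) ` {0..T}"
      by (subst img) (auto simp: \<sigma>(2) abs_minus_commute intro!: image_cong)
    moreover have "(\<lambda>s. \<bar>y s - x (\<sigma> s)\<bar>) ` {0..T} = (\<lambda>t. \<bar>x t - y (\<tau> t)\<bar>) ` {0..T}"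
      by (subst img) (auto simp: \<sigma>(2) abs_minus_commute intro!: image_cong)
    ultimately have "c y x \<sigma> = r" unfolding c_def r by presburger
    with \<sigma>(1) show "r \<in> c y x ` time_changes T" by blast
  qed
  have "c x y ` time_changes T = c y x ` time_changes T" using sub by blast
  then show ?thesis unfolding skorohod_dist_on_def c_def by simp
qed

lemma skorohod_dist_on_triangle:
  assumes T: "0 < T" and b: "bounded (x ` {0..T})" "bounded (y ` {0..T})" "bounded (z ` {0..T})"
  shows "skorohod_dist_on T x z \<le> skorohod_dist_on T x y + skorohod_dist_on T y z"
proof (rule field_le_epsilon)
  fix e :: real assume e: "0 < e"
  then have "skorohod_dist_on T x y < skorohod_dist_on T x y + e/2" by simp
  then obtain \<tau> where \<tau>: "\<tau> \<in> time_changes T"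
    "\<And>t. t \<in> {0..T} \<Longrightarrow> \<bar>\<tau> t - t\<bar> \<le> skorohod_dist_on T x y + e/2"
    "\<And>t. t \<in> {0..T} \<Longrightarrow> \<bar>x t - y (\<tau> t)\<bar> \<le> skorohod_dist_on T x y + e/2"
    by (rule skorohod_dist_on_lessD[OF T b(1,2)]) blast
  have "skorohod_dist_on T y z < skorohod_dist_on T y z + e/2" using e by simp
  then obtain \<sigma> where \<sigma>: "\<sigma> \<in> time_changes T"
    "\<And>t. t \<in> {0..T} \<Longrightarrow> \<bar>\<sigma> t - t\<bar> \<le> skorohod_dist_on T y z + e/2"
    "\<And>t. t \<in> {0..T} \<Longrightarrow> \<bar>y t - z (\<sigma> t)\<bar> \<le> skorohod_dist_on T y z + e/2"
    by (rule skorohod_dist_on_lessD[OF T b(2,3)]) blast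
  show "skorohod_dist_on T x z \<le> skorohod_dist_on T x y + skorohod_dist_on T y z + e"
  proof (rule skorohod_dist_on_le[OF T time_change_compose[OF \<tau>(1) \<sigma>(1)]])
    fix t assume t: "t \<in> {0..T}"
    note t' = time_changesD(4)[OF \<tau>(1) t]
    show "\<bar>\<sigma> (\<tau> t) - t\<bar> \<le> skorohod_dist_on T x y + skorohod_dist_on T y z + e"
      using \<tau>(2)[OF t] \<sigma>(2)[OF t'] by linarith
    show "\<bar>x t - z (\<sigma> (\<tau> t))\<bar> \<le> skorohod_dist_on T x y + skorohod_dist_on T y z + e"
      using \<tau>(3)[OF t] \<sigma>(3)[OF t'] by linarith
  qed
qed

lemma bounded_near_one_sided_limit:
  assumes "(x \<longlongrightarrow> (l::real)) (at t within S)"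
  shows "\<exists>d>0. \<exists>C. \<forall>s. s \<in> S \<and> s \<noteq> t \<and> dist s t < d \<longrightarrow> \<bar>x s\<bar> \<le> C"
proof -
  have "eventually (\<lambda>s. dist (x s) l < 1) (at t within S)"
    using assms by (rule tendstoD) simp
  then obtain d where d: "d > 0" "\<And>s. s \<in> S \<Longrightarrow> s \<noteq> t \<Longrightarrow> dist s t < d \<Longrightarrow> dist (x s) l < 1"
    by (auto simp: eventually_at)
  have "\<bar>x s\<bar> \<le> \<bar>l\<bar> + 1" if "s \<in> S" "s \<noteq> t" "dist s t < d" for s
    using d(2)[OF that] by (auto simp: dist_real_def)
  with d(1) show ?thesis by blast
qed

text \<open>
  Near each point the one-sided limits bound the path, and compactness of the interval, in the form
  of Bolzano's bisection principle, joins the local bounds.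
\<close>

lemma skorohod_space_bounded:
  assumes x: "x \<in> skorohod_space" and T: "0 \<le> T"
  shows "bounded (x ` {0..T})"
proof -
  define P where "P a b \<longleftrightarrow> (\<exists>C. \<forall>t\<in>{a..b}. 0 \<le> t \<longrightarrow> \<bar>x t\<bar> \<le> C)" for a b :: real
  have "P 0 T"
    using T
  proof (induction rule: Bolzano[consumes 1, case_names trans local])
    case (trans a b c)
    then obtain C D where "\<forall>t\<in>{a..b}. 0 \<le> t \<longrightarrow> \<bar>x t\<bar> \<le> C" "\<forall>t\<in>{b..c}. 0 \<le> t \<longrightarrow> \<bar>x t\<bar> \<le> D"
      by (auto simp: P_def)
    then have "\<forall>t\<in>{a..c}. 0 \<le> t \<longrightarrow> \<bar>x t\<bar> \<le> max C D"
      by (metis atLeastAtMost_iff le_max_iff_disj linear)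
    then show ?case unfolding P_def by blast
  next
    case (local t)
    have "continuous (at_right t) x" using x local by (auto simp: skorohod_space_def)
    then have r: "(x \<longlongrightarrow> x t) (at_right t)" by (simp add: continuous_within)
    obtain d1 C1 where 1: "d1 > 0" "\<And>s. s \<in> {t<..} \<and> s \<noteq> t \<and> dist s t < d1 \<Longrightarrow> \<bar>x s\<bar> \<le> C1"
      using bounded_near_one_sided_limit[OF r] by blast
    have "\<exists>d2>0. \<exists>C2. \<forall>s. 0 \<le> s \<and> s < t \<and> dist s t < d2 \<longrightarrow> \<bar>x s\<bar> \<le> C2"
    proof (cases "t > 0")
      case True
      then obtain l where "(x \<longlongrightarrow> l) (at_left t)" using x by (auto simp: skorohod_space_def)
      from bounded_near_one_sided_limit[OF this] show ?thesis by (metis lessThan_iff less_irrefl)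
    next
      case False
      then show ?thesis by (intro exI[of _ 1]) auto
    qed
    then obtain d2 C2 where 2: "d2 > 0" "\<And>s. 0 \<le> s \<and> s < t \<and> dist s t < d2 \<Longrightarrow> \<bar>x s\<bar> \<le> C2" by blast
    show ?case
    proof (intro exI[of _ "min d1 d2"] conjI allI impI)
      show "0 < min d1 d2" using 1 2 by auto
      fix a b assume ab: "a \<le> t \<and> t \<le> b \<and> b - a < min d1 d2"
      have "\<bar>x s\<bar> \<le> max \<bar>x t\<bar> (max C1 C2)" if "s \<in> {a..b}" "0 \<le> s" for s
      proof (cases s t rule: linorder_cases)
        case less then show ?thesis using 2(2)[of s] that ab by (force simp: dist_real_def)
      next
        case greater then show ?thesis using 1(2)[of s] that ab by (force simp: dist_real_def)
      qed auto
      then show "P a b" unfolding P_def by blast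
    qed
  qed
  then obtain C where "\<forall>t\<in>{0..T}. \<bar>x t\<bar> \<le> C" unfolding P_def by force
  then show ?thesis by (auto simp: bounded_iff)
qed

lemma cut_off_bounded:
  assumes "x \<in> skorohod_space" "0 < T"
  shows "bounded (cut_off T x ` {0..T})"
proof -
  obtain C where C: "\<And>t. t \<in> {0..T} \<Longrightarrow> \<bar>x t\<bar> \<le> C"
    using bounded_image_realE[OF skorohod_space_bounded[OF assms(1) less_imp_le[OF assms(2)]]] by blast
  have "\<bar>cut_off T x t\<bar> \<le> 1 * C" if "t \<in> {0..T}" for t
    unfolding cut_off_def abs_mult by (rule mult_mono) (use C[OF that] that in auto)
  then show ?thesis unfolding bounded_iff by (intro exI[of _ C]) auto
qed

definition skorohod_term :: "nat \<Rightarrow> (real \<Rightarrow> real) \<Rightarrow> (real \<Rightarrow> real) \<Rightarrow> real" where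
  "skorohod_term m x y =
     min 1 (skorohod_dist_on (real (Suc m)) (cut_off (real (Suc m)) x) (cut_off (real (Suc m)) y))"

lemma skorohod_term_bounds: "0 \<le> skorohod_term m x y" "skorohod_term m x y \<le> 1"
  using skorohod_dist_on_nonneg[of "real (Suc m)"] by (auto simp: skorohod_term_def)

lemma summable_weights: "summable (\<lambda>m. (1 / 2) ^ Suc m :: real)"
  and suminf_weights: "(\<Sum>m. (1 / 2) ^ Suc m :: real) = 1"
  using power_half_series by (auto simp: sums_iff)

lemma skorohod_dist_summable: "summable (\<lambda>m. (1 / 2) ^ Suc m * skorohod_term m x y)"
proof (rule summable_comparison_test'[OF summable_weights])
  fix m :: nat
  show "norm ((1 / 2) ^ Suc m * skorohod_term m x y) \<le> (1 / 2) ^ Suc m"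
    using skorohod_term_bounds[of m x y] by (simp add: abs_mult mult_left_le)
qed

lemma skorohod_dist_eq: "skorohod_dist x y = (\<Sum>m. (1 / 2) ^ Suc m * skorohod_term m x y)"
  by (simp add: skorohod_dist_def skorohod_term_def)

lemma skorohod_dist_nonneg: "0 \<le> skorohod_dist x y"
  unfolding skorohod_dist_eq
  by (rule suminf_nonneg[OF skorohod_dist_summable]) (simp add: skorohod_term_bounds)

lemma skorohod_term_triangle:
  assumes "x \<in> skorohod_space" "y \<in> skorohod_space" "z \<in> skorohod_space"
  shows "skorohod_term m x z \<le> skorohod_term m x y + skorohod_term m y z"
  using skorohod_dist_on_triangle[OF _ cut_off_bounded[OF assms(1)] cut_off_bounded[OF assms(2)]
      cut_off_bounded[OF assms(3)], of "real (Suc m)"]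
    skorohod_dist_on_nonneg[of "real (Suc m)"]
  unfolding skorohod_term_def by (smt (verit) of_nat_0_less_iff zero_less_Suc)

text \<open>
  A time change close to the identity can move t to its left, where y may have another value. The
  point t + d/2, however, stays strictly to the right of t, and by right-continuity the values of both
  paths just after t are close to those at t.
\<close>

lemma skorohod_dist_zero_imp_eq:
  assumes x: "x \<in> skorohod_space" and y: "y \<in> skorohod_space" and 0: "skorohod_dist x y = 0"
  shows "x = y"
proof
  fix t :: real
  show "x t = y t"
  proof (cases "t \<ge> 0")
    case False
    then show ?thesis using x y by (auto simp: skorohod_space_def extensional_def)
  next
    case True
    \<comment> \<open>With this index the cut-off equals 1 on [0, t + 1].\<close>
    define m where "m = Suc (nat \<lceil>t\<rceil>)"
    have m: "t + 1 \<le> real m" unfolding m_def by linarith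
    define T where "T = real (Suc m)"
    have T: "0 < T" "t + 2 \<le> T" using m by (auto simp: T_def)
    have cut: "cut_off T z s = z s" if "s \<le> t + 1" for z s
      using that T unfolding cut_off_def by auto
    have "(1 / 2) ^ Suc m * skorohod_term m x y \<le> skorohod_dist x y"
      unfolding skorohod_dist_eq
      using sum_le_suminf[OF skorohod_dist_summable, of "{m}" x y] by (simp add: skorohod_term_bounds)
    then have "(1 / 2) ^ Suc m * skorohod_term m x y \<le> (1 / 2) ^ Suc m * 0" using 0 by simp
    then have "skorohod_term m x y \<le> 0" by (rule mult_left_le_imp_le) simp
    then have D0: "skorohod_dist_on T (cut_off T x) (cut_off T y) \<le> 0"
      by (auto simp: skorohod_term_def T_def)
    have lim: "\<exists>d>0. \<forall>s. t < s \<and> s < t + d \<longrightarrow> \<bar>z s - z t\<bar> < e"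
      if "z \<in> skorohod_space" "0 < e" for z e
    proof -
      have "(z \<longlongrightarrow> z t) (at_right t)"
        using that True by (auto simp: skorohod_space_def continuous_within)
      then have "eventually (\<lambda>s. dist (z s) (z t) < e) (at_right t)" using that by (auto dest: tendstoD)
      then obtain b where "b > t" "\<forall>s>t. s < b \<longrightarrow> dist (z s) (z t) < e"
        by (auto simp: eventually_at_right_field)
      then show ?thesis by (intro exI[of _ "b - t"]) (auto simp: dist_real_def)
    qed
    have "\<bar>x t - y t\<bar> \<le> 0 + e" if e: "e > 0" for e
    proof -
      obtain d1 where d1: "d1 > 0" "\<And>s. t < s \<Longrightarrow> s < t + d1 \<Longrightarrow> \<bar>x s - x t\<bar> < e/3"
        using lim[OF x, of "e/3"] e by auto
      obtain d2 where d2: "d2 > 0" "\<And>s. t < s \<Longrightarrow> s < t + d2 \<Longrightarrow> \<bar>y s - y t\<bar> < e/3"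
        using lim[OF y, of "e/3"] e by auto
      define d where "d = min 1 (min d1 d2)"
      have d: "d > 0" "d \<le> 1" "d \<le> d1" "d \<le> d2" using d1 d2 by (auto simp: d_def)
      define r where "r = min (d/3) (e/3)"
      have r: "r > 0" "r \<le> d/3" "r \<le> e/3" using d e by (auto simp: r_def)
      have "skorohod_dist_on T (cut_off T x) (cut_off T y) < r" using D0 r by simp
      then obtain \<tau> where \<tau>: "\<And>s. s \<in> {0..T} \<Longrightarrow> \<bar>\<tau> s - s\<bar> \<le> r"
        "\<And>s. s \<in> {0..T} \<Longrightarrow> \<bar>cut_off T x s - cut_off T y (\<tau> s)\<bar> \<le> r"
        by (rule skorohod_dist_on_lessD[OF T(1) cut_off_bounded[OF x T(1)] cut_off_bounded[OF y T(1)]]) blast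
      define s where "s = t + d/2"
      have s: "s \<in> {0..T}" using True T d by (auto simp: s_def)
      have \<tau>s: "t < \<tau> s" "\<tau> s < t + d" using \<tau>(1)[OF s] r d by (auto simp: s_def abs_le_iff)
      have "\<bar>x s - y (\<tau> s)\<bar> \<le> e/3"
        using \<tau>(2)[OF s] r cut[of s x] cut[of "\<tau> s" y] \<tau>s d by (auto simp: s_def)
      moreover have "\<bar>x s - x t\<bar> < e/3" using d1(2)[of s] d by (auto simp: s_def)
      moreover have "\<bar>y (\<tau> s) - y t\<bar> < e/3" using d2(2)[of "\<tau> s"] \<tau>s d by auto
      ultimately show ?thesis by linarith
    qed
    then have "\<bar>x t - y t\<bar> \<le> 0" by (rule field_le_epsilon)
    then show ?thesis by simp
  qed
qed

text \<open>
  The identity is an admissible time change, so the distances on [0, m] with m \<le> T are at most e; the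
  remaining terms of the series have total weight 2 to the power -T.
\<close>

lemma skorohod_dist_le_locally_uniform:
  assumes e: "0 \<le> e" and le: "\<And>t. 0 \<le> t \<Longrightarrow> t \<le> real T \<Longrightarrow> \<bar>x t - y t\<bar> \<le> e"
  shows "skorohod_dist x y \<le> e + (1/2) ^ T"
proof -
  have term_le: "skorohod_term m x y \<le> e" if "m < T" for m
  proof -
    have "skorohod_dist_on (real (Suc m)) (cut_off (real (Suc m)) x) (cut_off (real (Suc m)) y) \<le> e"
    proof (rule skorohod_dist_on_le[OF _ id_time_change])
      fix t assume t: "t \<in> {0..real (Suc m)}"
      have "\<bar>x t - y t\<bar> \<le> e" using t that by (intro le) auto
      then have "\<bar>max 0 (min 1 (real (Suc m) - t))\<bar> * \<bar>x t - y t\<bar> \<le> 1 * e"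
        by (intro mult_mono) auto
      moreover have "cut_off (real (Suc m)) x t - cut_off (real (Suc m)) y t =
          max 0 (min 1 (real (Suc m) - t)) * (x t - y t)"
        by (simp add: cut_off_def algebra_simps)
      ultimately show "\<bar>cut_off (real (Suc m)) x t - cut_off (real (Suc m)) y t\<bar> \<le> e"
        by (simp add: abs_mult)
    qed (use e in auto)
    then show ?thesis by (simp add: skorohod_term_def)
  qed
  have "skorohod_dist x y \<le> (\<Sum>m. (1/2) ^ Suc m * e + (if m < T then 0 else (1/2) ^ Suc m))"
    unfolding skorohod_dist_eq
  proof (rule suminf_le[OF _ skorohod_dist_summable])
    fix m
    show "(1 / 2) ^ Suc m * skorohod_term m x y \<le> (1 / 2) ^ Suc m * e + (if m < T then 0 else (1 / 2) ^ Suc m)"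
    proof (cases "m < T")
      case True then show ?thesis using term_le[OF True] by (simp add: mult_left_mono)
    next
      case False
      have "(1 / 2) ^ Suc m * skorohod_term m x y \<le> (1 / 2) ^ Suc m * 1"
        by (rule mult_left_mono) (auto simp: skorohod_term_bounds)
      also have "\<dots> \<le> (1 / 2) ^ Suc m * e + (1 / 2) ^ Suc m" using e by simp
      finally show ?thesis using False by simp
    qed
    have "summable (\<lambda>m. if m < T then 0 else (1/2) ^ Suc m :: real)"
      by (rule summable_comparison_test'[OF summable_weights]) auto
    then show "summable (\<lambda>m. (1/2) ^ Suc m * e + (if m < T then 0 else (1/2) ^ Suc m))"
      by (intro summable_add summable_mult2 summable_weights)
  qed
  also have "\<dots> = (\<Sum>m. (1/2) ^ Suc m * e) + (\<Sum>m. if m < T then 0 else (1/2) ^ Suc m)"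
    by (intro suminf_add[symmetric] summable_mult2 summable_weights
        summable_comparison_test'[OF summable_weights, where N=0]) auto
  also have "(\<Sum>m. (1/2) ^ Suc m * e) = e"
    using suminf_mult2[OF summable_weights, of e] suminf_weights by simp
  also have "(\<Sum>m. if m < T then 0 else (1/2) ^ Suc m) = ((1/2) ^ T :: real)"
  proof -
    have s: "summable (\<lambda>m. if m < T then 0 else (1/2) ^ Suc m :: real)"
      by (rule summable_comparison_test'[OF summable_weights]) auto
    have "(\<Sum>m. if m < T then 0 else (1/2) ^ Suc m :: real) =
        (\<Sum>m. (1/2) ^ Suc (m + T)) + (\<Sum>m<T. 0)"
      using suminf_split_initial_segment[OF s, of T] by simp
    also have "\<dots> = (\<Sum>m. (1/2) ^ T * (1/2) ^ Suc m)" by (simp add: power_add mult_ac)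
    also have "\<dots> = (1/2) ^ T" using suminf_mult[OF summable_weights, of "(1/2)^T"] suminf_weights by simp
    finally show ?thesis .
  qed
  finally show ?thesis .
qed

interpretation skorohod: Metric_space skorohod_space skorohod_dist
proof
  fix x y z :: "real \<Rightarrow> real"
  show "0 \<le> skorohod_dist x y" by (rule skorohod_dist_nonneg)
  show "skorohod_dist x y = skorohod_dist y x"
    unfolding skorohod_dist_def by (subst skorohod_dist_on_commute) simp
  show "skorohod_dist x y = 0 \<longleftrightarrow> x = y" if "x \<in> skorohod_space" "y \<in> skorohod_space"
  proof
    assume "x = y"
    have "skorohod_dist x x \<le> 0 + (1/2)^T" for T
      by (rule skorohod_dist_le_locally_uniform) auto
    then have "skorohod_dist x x \<le> 0"
      by (intro LIMSEQ_le_const[OF LIMSEQ_realpow_zero[of "1/2::real"]]) auto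
    then show "skorohod_dist x y = 0" using skorohod_dist_nonneg[of x x] \<open>x = y\<close> by simp
  qed (use skorohod_dist_zero_imp_eq that in blast)
  assume "x \<in> skorohod_space" "y \<in> skorohod_space" "z \<in> skorohod_space"
  from skorohod_term_triangle[OF this]
  have "skorohod_dist x z \<le> (\<Sum>m. (1/2) ^ Suc m * skorohod_term m x y + (1/2) ^ Suc m * skorohod_term m y z)"
    unfolding skorohod_dist_eq
    by (intro suminf_le skorohod_dist_summable summable_add)
      (auto simp: distrib_left[symmetric] intro!: mult_left_mono)
  also have "\<dots> = skorohod_dist x y + skorohod_dist y z"
    unfolding skorohod_dist_eq by (intro suminf_add[symmetric] skorohod_dist_summable)
  finally show "skorohod_dist x z \<le> skorohod_dist x y + skorohod_dist y z" .
qed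

section \<open>Random elements of the Skorohod space\<close>

lemma topspace_skorohod: "topspace skorohod_topology = skorohod_space"
  by (simp add: skorohod_topology_def)

lemma borel_of_skorohod_measurable_iff:
  "Y \<in> \<Omega> \<rightarrow>\<^sub>M borel_of_topology skorohod_topology \<longleftrightarrow>
    (\<forall>w\<in>space \<Omega>. Y w \<in> skorohod_space) \<and>
    (\<forall>U. openin skorohod_topology U \<longrightarrow> Y -` U \<inter> space \<Omega> \<in> sets \<Omega>)" (is "?L \<longleftrightarrow> ?R")
proof
  have sub: "{U. openin skorohod_topology U} \<subseteq> Pow (topspace skorohod_topology)"
    by (auto dest: openin_subset)
  show "?L \<Longrightarrow> ?R"
    using sub by (auto simp: borel_of_topology_def topspace_skorohod space_measure_of
        dest: measurable_space intro!: measurable_sets)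
  assume ?R
  then show ?L
    unfolding borel_of_topology_def
    by (intro measurable_measure_of[OF sub]) (auto simp: topspace_skorohod)
qed

text \<open>
  An open set U is the union of the sets of points whose ball of radius 1/j lies in U. The limit is in
  U exactly when, for some j, the approximations eventually lie in the j-th of these sets. The
  hypothesis on preimages is that of maps with countably many measurable values.
\<close>

lemma skorohod_measurable_of_discrete_approximations:
  assumes Y: "\<And>w. w \<in> space \<Omega> \<Longrightarrow> Y w \<in> skorohod_space"
    and R: "\<And>m w. w \<in> space \<Omega> \<Longrightarrow> R m w \<in> skorohod_space"
    and meas: "\<And>m A. R m -` A \<inter> space \<Omega> \<in> sets \<Omega>"
    and lim: "\<And>w. w \<in> space \<Omega> \<Longrightarrow> (\<lambda>m. skorohod_dist (R m w) (Y w)) \<longlonglongrightarrow> 0"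
  shows "Y \<in> \<Omega> \<rightarrow>\<^sub>M borel_of_topology skorohod_topology"
  unfolding borel_of_skorohod_measurable_iff
proof (intro conjI allI impI ballI)
  fix U assume U: "openin skorohod_topology U"
  define V where "V j = {x \<in> skorohod_space. skorohod.mball x (1 / real (Suc j)) \<subseteq> U}" for j
  have "Y -` U \<inter> space \<Omega> = (\<Union>j. \<Union>N. \<Inter>m\<in>{N..}. R m -` V j \<inter> space \<Omega>)"
  proof (intro set_eqI iffI)
    fix w assume w: "w \<in> Y -` U \<inter> space \<Omega>"
    then obtain r where r: "r > 0" "skorohod.mball (Y w) r \<subseteq> U"
      using U by (auto simp: skorohod_topology_def skorohod.openin_mtopology)
    obtain j where j: "1 / real (Suc j) < r / 2"
      using reals_Archimedean[of "r/2"] r by (auto simp: inverse_eq_divide)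
    have "eventually (\<lambda>m. skorohod_dist (R m w) (Y w) < r / 2) sequentially"
      using order_tendstoD(2)[OF lim, of w "r/2"] w r by auto
    then obtain N where N: "\<And>m. m \<ge> N \<Longrightarrow> skorohod_dist (R m w) (Y w) < r / 2"
      by (auto simp: eventually_sequentially)
    have "R m w \<in> V j" if "m \<ge> N" for m
    proof -
      have "skorohod.mball (R m w) (1 / real (Suc j)) \<subseteq> skorohod.mball (Y w) r"
        using N[OF that] j w Y by (intro skorohod.mball_subset) auto
      with r R w show ?thesis by (auto simp: V_def)
    qed
    then show "w \<in> (\<Union>j. \<Union>N. \<Inter>m\<in>{N..}. R m -` V j \<inter> space \<Omega>)" using w by auto
  next
    fix w assume "w \<in> (\<Union>j. \<Union>N. \<Inter>m\<in>{N..}. R m -` V j \<inter> space \<Omega>)"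
    then obtain j N where w: "w \<in> space \<Omega>" and N: "\<And>m. m \<ge> N \<Longrightarrow> R m w \<in> V j"
      by (auto; blast)
    have "eventually (\<lambda>m. skorohod_dist (R m w) (Y w) < 1 / real (Suc j)) sequentially"
      using order_tendstoD(2)[OF lim[OF w], of "1 / real (Suc j)"] by auto
    with eventually_ge_at_top[of N]
    have "eventually (\<lambda>m. N \<le> m \<and> skorohod_dist (R m w) (Y w) < 1 / real (Suc j)) sequentially"
      by eventually_elim simp
    then obtain m where "m \<ge> N" "skorohod_dist (R m w) (Y w) < 1 / real (Suc j)"
      by (auto dest: eventually_happens)
    then have "Y w \<in> skorohod.mball (R m w) (1 / real (Suc j))" using R Y w by simp
    with N[OF \<open>m \<ge> N\<close>] w show "w \<in> Y -` U \<inter> space \<Omega>" by (auto simp: V_def)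
  qed
  also have "\<dots> \<in> sets \<Omega>"
  proof (intro sets.countable_UN image_subsetI)
    show "(\<Inter>m\<in>{N..}. R m -` V j \<inter> space \<Omega>) \<in> sets \<Omega>" for j N
      by (rule sets.countable_INT') (use meas in auto)
  qed
  finally show "Y -` U \<inter> space \<Omega> \<in> sets \<Omega>" .
qed (use Y in auto)

text \<open>
  The number of mesh points of spacing 1/a passed by time t, stopped at K so that a path built from it
  depends on finitely many values.
\<close>

definition staircase :: "real \<Rightarrow> nat \<Rightarrow> real \<Rightarrow> nat" where
  "staircase a K t = min (nat \<lfloor>a * t\<rfloor>) K"

lemma floor_path_in_skorohod_space:
  assumes a: "0 \<le> a"
  shows "(\<lambda>t\<in>{0..}. h (nat \<lfloor>a * t\<rfloor>)) \<in> skorohod_space" (is "?x \<in> _")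
proof -
  have right: "continuous (at_right t) ?x" if "t \<ge> 0" for t
  proof -
    have "((\<lambda>s. a * s) \<longlongrightarrow> a * t) (at_right t)" by (intro tendsto_intros)
    then have "eventually (\<lambda>s. a * s < of_int (\<lfloor>a * t\<rfloor> + 1)) (at_right t)"
      by (rule order_tendstoD) linarith
    moreover have "eventually (\<lambda>s. s > t) (at_right t)" by (simp add: eventually_at_right_less)
    ultimately have "eventually (\<lambda>s. ?x s = ?x t) (at_right t)"
    proof eventually_elim
      case (elim s)
      have "a * t \<le> a * s" using elim a by (intro mult_left_mono) auto
      then have "\<lfloor>a * s\<rfloor> = \<lfloor>a * t\<rfloor>" using elim by linarith
      then show ?case using elim that by simp
    qed
    then show ?thesis unfolding continuous_within by (rule tendsto_eventually)
  qed
  have left: "\<exists>l. (?x \<longlongrightarrow> l) (at_left t)" if "t > 0" for t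
  proof -
    define k where "k = \<lceil>a * t\<rceil> - 1"
    have k: "a = 0 \<or> of_int k < a * t" "a * t \<le> of_int (k + 1)" unfolding k_def by linarith+
    have lim: "((\<lambda>s. a * s) \<longlongrightarrow> a * t) (at_left t)" by (intro tendsto_intros)
    have "eventually (\<lambda>s. a = 0 \<or> of_int k < a * s) (at_left t)"
      using k(1) order_tendstoD(1)[OF lim] by (auto elim: eventually_mono)
    moreover have "eventually (\<lambda>s. s \<in> {0<..<t}) (at_left t)"
      using that eventually_at_left_real by blast
    ultimately have "eventually (\<lambda>s. ?x s = (if a = 0 then h 0 else h (nat k))) (at_left t)"
    proof eventually_elim
      case (elim s)
      show ?case
      proof (cases "a = 0")
        case False
        then have "a * s < a * t" using a elim by simp
        then have "\<lfloor>a * s\<rfloor> = k" using elim False k by linarith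
        then show ?thesis using elim False by simp
      qed (use elim in simp)
    qed
    then show ?thesis by (intro exI) (rule tendsto_eventually)
  qed
  show ?thesis unfolding skorohod_space_def using right left by auto
qed

lemma staircase_path_in_skorohod_space:
  "0 \<le> a \<Longrightarrow> (\<lambda>t\<in>{0..}. h (staircase a K t)) \<in> skorohod_space"
  using floor_path_in_skorohod_space[of a "\<lambda>k. h (min k K)"] by (simp add: staircase_def)

lemma continuous_path_in_skorohod_space:
  assumes "continuous_on {0..} x"
  shows "(\<lambda>t\<in>{0..}. x t) \<in> skorohod_space" (is "?x \<in> _")
proof -
  have lim: "(?x \<longlongrightarrow> x t) (at t within {0..})" if "t \<ge> 0" for t
  proof -
    have "(x \<longlongrightarrow> x t) (at t within {0..})" using assms that by (auto simp: continuous_on)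
    then show ?thesis
      by (rule Lim_transform_eventually) (auto simp: eventually_at_filter intro!: eventuallyI)
  qed
  show ?thesis
    unfolding skorohod_space_def
  proof (intro CollectI conjI allI impI)
    fix t :: real assume t: "0 \<le> t"
    have "(?x \<longlongrightarrow> x t) (at_right t)" by (rule tendsto_within_subset[OF lim[OF t]]) (use t in auto)
    then show "continuous (at_right t) ?x" using t by (simp add: continuous_within)
  next
    fix t :: real assume t: "0 < t"
    have ev: "at_left t = at t within {0..<t}"
      using at_within_nhd[of t "{0<..}" "{..<t}" "{0..<t}"] t by force
    have "(?x \<longlongrightarrow> x t) (at t within {0..<t})" by (rule tendsto_within_subset[OF lim]) (use t in auto)
    then show "\<exists>l. (?x \<longlongrightarrow> l) (at_left t)" unfolding ev by blast
  qed auto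
qed

text \<open>
  Rounding the finitely many sampled values to multiples of 1/(m + 1) gives approximations with
  countably many values.
\<close>

lemma skorohod_measurable_of_staircase_samples:
  assumes Y: "\<And>w. w \<in> space \<Omega> \<Longrightarrow> Y w \<in> skorohod_space"
    and S: "\<And>m k. S m k \<in> borel_measurable \<Omega>"
    and a: "\<And>m. 0 \<le> a m"
    and lim: "\<And>w T e. w \<in> space \<Omega> \<Longrightarrow> 0 < e \<Longrightarrow>
      eventually (\<lambda>m. \<forall>t\<in>{0..real T}. \<bar>S m (staircase (a m) (K m) t) w - Y w t\<bar> \<le> e) sequentially"
  shows "Y \<in> \<Omega> \<rightarrow>\<^sub>M borel_of_topology skorohod_topology"
proof -
  define r where "r m k w = (\<lfloor>real (Suc m) * S m k w\<rfloor>)" for m k w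
  define R where "R m w = (\<lambda>t\<in>{0..}. real_of_int (r m (staircase (a m) (K m) t) w) / real (Suc m))" for m w
  have r_close: "\<bar>real_of_int (r m k w) / real (Suc m) - S m k w\<bar> \<le> 1 / real (Suc m)" for m k w
  proof -
    have "\<bar>real_of_int (r m k w) - real (Suc m) * S m k w\<bar> \<le> 1" unfolding r_def by linarith
    then have "\<bar>real_of_int (r m k w) - real (Suc m) * S m k w\<bar> / real (Suc m) \<le> 1 / real (Suc m)"
      by (rule divide_right_mono) simp
    also have "\<bar>real_of_int (r m k w) - real (Suc m) * S m k w\<bar> / real (Suc m) =
        \<bar>(real_of_int (r m k w) - real (Suc m) * S m k w) / real (Suc m)\<bar>"
      by simp
    also have "(real_of_int (r m k w) - real (Suc m) * S m k w) / real (Suc m) =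
        real_of_int (r m k w) / real (Suc m) - S m k w"
      by (simp add: diff_divide_distrib del: of_nat_Suc)
    finally show ?thesis .
  qed
  show ?thesis
  proof (rule skorohod_measurable_of_discrete_approximations[where R=R, OF Y])
    show "R m w \<in> skorohod_space" for m w
      unfolding R_def by (rule staircase_path_in_skorohod_space[OF a])
  next
    fix m A
    define F where "F = {..K m}"
    define v where "v w = restrict (\<lambda>k. r m k w) F" for w
    have [measurable]: "S m k \<in> borel_measurable \<Omega>" for k by (rule S)
    have v: "v \<in> \<Omega> \<rightarrow>\<^sub>M count_space (F \<rightarrow>\<^sub>E UNIV)"
    proof (subst measurable_count_space_eq_countable)
      show "countable (F \<rightarrow>\<^sub>E (UNIV :: int set))" unfolding F_def by (intro countable_PiE) auto
      have "v -` {z} \<inter> space \<Omega> \<in> sets \<Omega>" if z: "z \<in> F \<rightarrow>\<^sub>E UNIV" for z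
      proof -
        have "v -` {z} \<inter> space \<Omega> = {w \<in> space \<Omega>. \<forall>k\<in>F. r m k w = z k}"
          using z by (auto simp: v_def fun_eq_iff PiE_iff extensional_def)
        also have "\<dots> \<in> sets \<Omega>" unfolding r_def F_def by measurable
        finally show ?thesis .
      qed
      then show "v \<in> space \<Omega> \<rightarrow> F \<rightarrow>\<^sub>E UNIV \<and> (\<forall>z\<in>F \<rightarrow>\<^sub>E UNIV. v -` {z} \<inter> space \<Omega> \<in> sets \<Omega>)"
        by (auto simp: v_def)
    qed
    define \<Phi> where "\<Phi> z = (\<lambda>t\<in>{0..}. real_of_int (z (staircase (a m) (K m) t)) / real (Suc m))" for z :: "nat \<Rightarrow> int"
    have R\<Phi>: "R m w = \<Phi> (v w)" for w
      unfolding R_def \<Phi>_def v_def F_def by (auto simp: fun_eq_iff staircase_def)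
    have "R m -` A \<inter> space \<Omega> = v -` (\<Phi> -` A \<inter> (F \<rightarrow>\<^sub>E UNIV)) \<inter> space \<Omega>"
      using R\<Phi> by (auto simp: v_def)
    also have "\<dots> \<in> sets \<Omega>" using v by (rule measurable_sets) auto
    finally show "R m -` A \<inter> space \<Omega> \<in> sets \<Omega>" .
  next
    fix w assume w: "w \<in> space \<Omega>"
    show "(\<lambda>m. skorohod_dist (R m w) (Y w)) \<longlonglongrightarrow> 0"
    proof (rule LIMSEQ_I)
      fix e :: real assume e: "0 < e"
      obtain T where T: "(1/2) ^ T < e / 3" using e real_arch_pow_inv[of "e/3" "1/2"] by auto
      have "eventually (\<lambda>m. 1 / real (Suc m) < e / 3) sequentially"
        using e by real_asymp
      moreover have "eventually (\<lambda>m. \<forall>t\<in>{0..real T}. \<bar>S m (staircase (a m) (K m) t) w - Y w t\<bar> \<le> e/3) sequentially"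
        using e by (intro lim w) auto
      ultimately have "eventually (\<lambda>m. skorohod_dist (R m w) (Y w) < e) sequentially"
      proof eventually_elim
        case (elim m)
        have "skorohod_dist (R m w) (Y w) \<le> (e/3 + e/3) + (1/2) ^ T"
        proof (rule skorohod_dist_le_locally_uniform)
          fix t assume t: "0 \<le> t" "t \<le> real T"
          have "\<bar>S m (staircase (a m) (K m) t) w - Y w t\<bar> \<le> e/3" using elim(2) t by auto
          moreover have "R m w t = real_of_int (r m (staircase (a m) (K m) t) w) / real (Suc m)"
            using t by (simp add: R_def)
          ultimately show "\<bar>R m w t - Y w t\<bar> \<le> e/3 + e/3"
            using r_close[of m "staircase (a m) (K m) t" w] elim(1) by linarith
        qed (use e in auto)
        then show ?case using T by simp
      qed
      then show "\<exists>no. \<forall>n\<ge>no. norm (skorohod_dist (R n w) (Y w) - 0) < e"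
        by (auto simp: eventually_sequentially skorohod_dist_nonneg)
    qed
  qed
qed

section \<open>Weak convergence tested on Lipschitz functions\<close>

text \<open>
  The inf-convolution of f with k d is k-Lipschitz and lies below f. It approaches f: a
  point y is either close to x, where f y is almost f x by continuity, or so far away that for large k
  the penalty k d x y exceeds the oscillation 2 C of f.
\<close>

lemma bounded_continuous_limit_of_lipschitz:
  assumes "Metric_space M d" "M \<noteq> {}"
    and f: "continuous_map (Metric_space.mtopology M d) euclideanreal f"
    and C: "\<And>x. x \<in> M \<Longrightarrow> \<bar>f x\<bar> \<le> C"
  obtains g :: "nat \<Rightarrow> 'a \<Rightarrow> real" where
    "\<And>k x y. x \<in> M \<Longrightarrow> y \<in> M \<Longrightarrow> \<bar>g k x - g k y\<bar> \<le> real k * d x y"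
    "\<And>k x. x \<in> M \<Longrightarrow> \<bar>g k x\<bar> \<le> C" "\<And>k x. x \<in> M \<Longrightarrow> g k x \<le> f x"
    "\<And>x. x \<in> M \<Longrightarrow> (\<lambda>k. g k x) \<longlonglongrightarrow> f x"
proof -
  interpret Metric_space M d by fact
  define g where "g k x = (INF y\<in>M. f y + real k * d x y)" for k x
  have bdd: "bdd_below ((\<lambda>y. f y + real k * d x y) ` M)" for k x
  proof (rule bdd_belowI2)
    fix y assume "y \<in> M"
    have "0 \<le> real k * d x y" by simp
    with C[OF \<open>y \<in> M\<close>] show "- C \<le> f y + real k * d x y" by linarith
  qed
  have upper: "g k x \<le> f y + real k * d x y" if "y \<in> M" for k x y
    unfolding g_def by (rule cINF_lower[OF bdd that])
  have le: "g k x \<le> f x" if "x \<in> M" for k x using upper[OF that, of k x] that by simp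
  have half: "g k x \<le> g k y + real k * d x y" if "x \<in> M" "y \<in> M" for k x y
  proof -
    have "g k x - real k * d x y \<le> f z + real k * d y z" if z: "z \<in> M" for z
    proof -
      have "real k * d x z \<le> real k * (d x y + d y z)"
        using triangle[OF \<open>x \<in> M\<close> \<open>y \<in> M\<close> z] by (intro mult_left_mono) auto
      with upper[OF z, of k x] show ?thesis by (simp add: algebra_simps)
    qed
    then have "g k x - real k * d x y \<le> g k y"
      unfolding g_def[of k y] by (intro cINF_greatest) (use \<open>M \<noteq> {}\<close> in auto)
    then show ?thesis by simp
  qed
  have lower: "- C \<le> g k x" if "x \<in> M" for k x
    unfolding g_def
  proof (rule cINF_greatest)
    fix y assume "y \<in> M"
    have "0 \<le> real k * d x y" by simp
    with C[OF \<open>y \<in> M\<close>] show "- C \<le> f y + real k * d x y" by linarith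
  qed (use assms in auto)
  show ?thesis
  proof (rule that[of g])
    fix k :: nat and x y assume xy: "x \<in> M" "y \<in> M"
    show "\<bar>g k x - g k y\<bar> \<le> real k * d x y"
      using half[OF xy, of k] half[OF xy(2,1), of k] by (simp add: commute[of y x] abs_le_iff)
  next
    fix k x assume x: "x \<in> M"
    show "\<bar>g k x\<bar> \<le> C" using lower[OF x, of k] le[OF x, of k] C[OF x] by (simp add: abs_le_iff)
  next
    fix x assume x: "x \<in> M"
    show "(\<lambda>k. g k x) \<longlonglongrightarrow> f x"
    proof (rule LIMSEQ_I)
      fix e :: real assume e: "0 < e"
      have "openin mtopology {y \<in> topspace mtopology. f y \<in> {f x - e/2<..}}"
        using f by (rule openin_continuous_map_preimage) (simp add: open_openin[symmetric])
      then obtain r where r: "r > 0" "mball x r \<subseteq> {y \<in> M. f y > f x - e/2}"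
        using x e by (auto simp: openin_mtopology)
      obtain K :: nat where K: "2 * C / r < real K" using reals_Archimedean2 by blast
      have "f x - e/2 \<le> g k x" if k: "k \<ge> K" for k
        unfolding g_def
      proof (rule cINF_greatest)
        fix y assume y: "y \<in> M"
        show "f x - e/2 \<le> f y + real k * d x y"
        proof (cases "d x y < r")
          case True
          then have "f y > f x - e/2" using r x y by auto
          moreover have "0 \<le> real k * d x y" by simp
          ultimately show ?thesis by linarith
        next
          case False
          have "2 * C < real K * r" using K r by (simp add: field_simps)
          also have "\<dots> \<le> real k * d x y" using k False r by (intro mult_mono) auto
          finally show ?thesis using C[OF x] C[OF y] e by linarith
        qed
      qed (use assms in auto)
      then show "\<exists>no. \<forall>n\<ge>no. norm (g n x - f x) < e"
        using le[OF x] e by (intro exI[of _ K]) (force simp: abs_less_iff)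
    qed
  qed (use le in auto)
qed

lemma skorohod_continuous_measurable:
  assumes f: "continuous_map skorohod_topology euclideanreal f"
    and Y: "Y \<in> \<Omega> \<rightarrow>\<^sub>M borel_of_topology skorohod_topology"
  shows "(\<lambda>w. f (Y w)) \<in> borel_measurable \<Omega>"
proof (rule borel_measurableI)
  fix S :: "real set" assume "open S"
  then have "openin skorohod_topology {x \<in> topspace skorohod_topology. f x \<in> S}"
    by (intro openin_continuous_map_preimage[OF f]) (simp add: open_openin[symmetric])
  moreover have "(\<lambda>w. f (Y w)) -` S \<inter> space \<Omega> = Y -` {x \<in> topspace skorohod_topology. f x \<in> S} \<inter> space \<Omega>"
    using Y by (auto simp: borel_of_skorohod_measurable_iff topspace_skorohod)
  ultimately show "(\<lambda>w. f (Y w)) -` S \<inter> space \<Omega> \<in> sets \<Omega>"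
    using Y unfolding borel_of_skorohod_measurable_iff by metis
qed

lemma skorohod_lipschitz_continuous_map:
  assumes L: "\<And>x y. x \<in> skorohod_space \<Longrightarrow> y \<in> skorohod_space \<Longrightarrow> \<bar>f x - f y\<bar> \<le> L * skorohod_dist x y"
  shows "continuous_map skorohod_topology euclideanreal f"
proof -
  have "continuous_map skorohod.mtopology Met_TC.mtopology f"
    unfolding skorohod.metric_continuous_map[OF Met_TC.Metric_space_axioms]
  proof (intro conjI ballI allI impI)
    fix a :: "real \<Rightarrow> real" and e :: real assume a: "a \<in> skorohod_space" "0 < e"
    show "\<exists>\<delta>>0. \<forall>x. x \<in> skorohod_space \<and> skorohod_dist a x < \<delta> \<longrightarrow> dist (f a) (f x) < e"
    proof (intro exI[of _ "e / (\<bar>L\<bar> + 1)"] conjI allI impI)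
      show "0 < e / (\<bar>L\<bar> + 1)" using a by simp
      fix x assume x: "x \<in> skorohod_space \<and> skorohod_dist a x < e / (\<bar>L\<bar> + 1)"
      have "\<bar>f a - f x\<bar> \<le> L * skorohod_dist a x" using L a x by blast
      also have "\<dots> \<le> (\<bar>L\<bar> + 1) * skorohod_dist a x"
        by (intro mult_right_mono skorohod_dist_nonneg) linarith
      also have "\<dots> < e" using x by (simp add: field_simps add_pos_nonneg)
      finally show "dist (f a) (f x) < e" by (simp add: dist_real_def)
    qed
  qed auto
  then show ?thesis by (simp add: skorohod_topology_def)
qed

text \<open>
  The Lipschitz approximations of a bounded continuous f lie below f, so their limits bound the lower
  limit of the expectations of f. Applied to f and to - f this gives convergence.
\<close>

proposition converges_in_distribution_skorohod_lipschitz: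
  assumes P: "\<And>n. prob_space (P n)" "\<And>n. Z n \<in> P n \<rightarrow>\<^sub>M borel_of_topology skorohod_topology"
    and Q: "prob_space Q" "V \<in> Q \<rightarrow>\<^sub>M borel_of_topology skorohod_topology"
    and lim: "\<And>f C L. (\<And>x. x \<in> skorohod_space \<Longrightarrow> \<bar>f x\<bar> \<le> C) \<Longrightarrow>
      (\<And>x y. x \<in> skorohod_space \<Longrightarrow> y \<in> skorohod_space \<Longrightarrow> \<bar>f x - f y\<bar> \<le> L * skorohod_dist x y) \<Longrightarrow>
      (\<lambda>n. \<integral>w. f (Z n w) \<partial>P n) \<longlonglongrightarrow> (\<integral>w. f (V w) \<partial>Q)"
  shows "converges_in_distribution skorohod_topology P Z Q V"
  unfolding converges_in_distribution_def
proof (intro conjI allI impI P Q)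
  fix f :: "(real \<Rightarrow> real) \<Rightarrow> real"
  assume "continuous_map skorohod_topology euclideanreal f \<and> bounded (f ` topspace skorohod_topology)"
  then have f: "continuous_map skorohod_topology euclideanreal f"
    and bdd: "bounded (f ` skorohod_space)" by (auto simp: topspace_skorohod)
  obtain C where C: "\<And>x. x \<in> skorohod_space \<Longrightarrow> \<bar>f x\<bar> \<le> C" using bounded_image_realE[OF bdd] by blast
  have Zs: "Z n w \<in> skorohod_space" if "w \<in> space (P n)" for n w
    using P(2)[of n] that by (simp add: borel_of_skorohod_measurable_iff)
  have Vs: "V w \<in> skorohod_space" if "w \<in> space Q" for w
    using Q(2) that by (simp add: borel_of_skorohod_measurable_iff)
  have ne: "skorohod_space \<noteq> {}" using Vs prob_space.not_empty[OF Q(1)] by blast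
  have intZ: "integrable (P n) (\<lambda>w. h (Z n w))"
    if "continuous_map skorohod_topology euclideanreal h" "\<And>x. x \<in> skorohod_space \<Longrightarrow> \<bar>h x\<bar> \<le> C" for h n
  proof -
    interpret prob_space "P n" by (rule P)
    show ?thesis using that Zs skorohod_continuous_measurable[OF that(1) P(2)]
      by (intro integrable_const_bound[of _ C]) (auto intro!: AE_I2)
  qed
  have intV: "integrable Q (\<lambda>w. h (V w))"
    if "continuous_map skorohod_topology euclideanreal h" "\<And>x. x \<in> skorohod_space \<Longrightarrow> \<bar>h x\<bar> \<le> C" for h
  proof -
    interpret prob_space Q by (rule Q)
    show ?thesis using that Vs skorohod_continuous_measurable[OF that(1) Q(2)]
      by (intro integrable_const_bound[of _ C]) (auto intro!: AE_I2)
  qed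
  have lower: "eventually (\<lambda>n. (\<integral>w. h (V w) \<partial>Q) - e < (\<integral>w. h (Z n w) \<partial>P n)) sequentially"
    if h: "continuous_map skorohod_topology euclideanreal h" "\<And>x. x \<in> skorohod_space \<Longrightarrow> \<bar>h x\<bar> \<le> C"
      and e: "0 < e" for h e
  proof -
    obtain g where g: "\<And>k x y. x \<in> skorohod_space \<Longrightarrow> y \<in> skorohod_space \<Longrightarrow> \<bar>g k x - g k y\<bar> \<le> real k * skorohod_dist x y"
      "\<And>k x. x \<in> skorohod_space \<Longrightarrow> \<bar>g k x\<bar> \<le> C" "\<And>k x. x \<in> skorohod_space \<Longrightarrow> g k x \<le> h x"
      "\<And>x. x \<in> skorohod_space \<Longrightarrow> (\<lambda>k. g k x) \<longlonglongrightarrow> h x"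
      using bounded_continuous_limit_of_lipschitz[OF skorohod.Metric_space_axioms ne h(1)[unfolded skorohod_topology_def] h(2)]
      by blast
    have gc: "continuous_map skorohod_topology euclideanreal (g k)" for k
      using g(1) by (rule skorohod_lipschitz_continuous_map)
    have "(\<lambda>k. \<integral>w. g k (V w) \<partial>Q) \<longlonglongrightarrow> (\<integral>w. h (V w) \<partial>Q)"
    proof (rule integral_dominated_convergence[where w="\<lambda>_. C"])
      interpret prob_space Q by (rule Q)
      show "integrable Q (\<lambda>_. C)" by simp
    qed (use g Vs skorohod_continuous_measurable[OF _ Q(2)] gc h in auto)
    then have "eventually (\<lambda>k. (\<integral>w. h (V w) \<partial>Q) - e < (\<integral>w. g k (V w) \<partial>Q)) sequentially"
      using e by (intro order_tendstoD(1)) auto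
    then obtain k where k: "(\<integral>w. h (V w) \<partial>Q) - e < (\<integral>w. g k (V w) \<partial>Q)"
      by (auto dest: eventually_happens)
    have "(\<lambda>n. \<integral>w. g k (Z n w) \<partial>P n) \<longlonglongrightarrow> (\<integral>w. g k (V w) \<partial>Q)"
      by (rule lim[OF g(2,1)])
    then have "eventually (\<lambda>n. (\<integral>w. h (V w) \<partial>Q) - e < (\<integral>w. g k (Z n w) \<partial>P n)) sequentially"
      using k by (rule order_tendstoD(1))
    then show ?thesis
    proof eventually_elim
      case (elim n)
      have "(\<integral>w. g k (Z n w) \<partial>P n) \<le> (\<integral>w. h (Z n w) \<partial>P n)"
        by (intro integral_mono intZ gc h g Zs)
      with elim show ?case by simp
    qed
  qed
  have mf: "continuous_map skorohod_topology euclideanreal (\<lambda>x. - f x)"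
    using f by (rule continuous_map_minus)
  show "(\<lambda>n. \<integral>w. f (Z n w) \<partial>P n) \<longlonglongrightarrow> (\<integral>w. f (V w) \<partial>Q)"
  proof (rule LIMSEQ_I)
    fix e :: real assume e: "0 < e"
    have "eventually (\<lambda>n. (\<integral>w. - f (V w) \<partial>Q) - e < (\<integral>w. - f (Z n w) \<partial>P n)) sequentially"
      by (rule lower[OF mf _ e]) (use C in auto)
    moreover have "eventually (\<lambda>n. (\<integral>w. f (V w) \<partial>Q) - e < (\<integral>w. f (Z n w) \<partial>P n)) sequentially"
      by (rule lower[OF f _ e]) (use C in auto)
    ultimately have "eventually (\<lambda>n. norm ((\<integral>w. f (Z n w) \<partial>P n) - (\<integral>w. f (V w) \<partial>Q)) < e) sequentially"
      by eventually_elim (auto simp: abs_less_iff)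
    then show "\<exists>no. \<forall>n\<ge>no. norm ((\<integral>w. f (Z n w) \<partial>P n) - (\<integral>w. f (V w) \<partial>Q)) < e"
      by (simp add: eventually_sequentially)
  qed
qed

section \<open>Laws of large numbers for weakly dependent sequences\<close>

lemma averages_tendsto:
  fixes a :: "nat \<Rightarrow> real"
  assumes "a \<longlonglongrightarrow> l"
  shows "(\<lambda>n. (\<Sum>k<n. a k) / real n) \<longlonglongrightarrow> l"
proof (rule LIMSEQ_I)
  fix e :: real assume e: "0 < e"
  obtain N where N: "\<And>k. k \<ge> N \<Longrightarrow> \<bar>a k - l\<bar> < e / 2"
    using LIMSEQ_D[OF assms, of "e/2"] e by (auto simp: real_norm_def)
  define B where "B = (\<Sum>k<N. \<bar>a k - l\<bar>)"
  have "eventually (\<lambda>n. B / real n < e / 2) sequentially"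
    using e by real_asymp
  then have "eventually (\<lambda>n. norm ((\<Sum>k<n. a k) / real n - l) < e) sequentially"
    using eventually_gt_at_top[of 0]
  proof eventually_elim
    case (elim n)
    have "\<bar>a k - l\<bar> \<le> (if k < N then \<bar>a k - l\<bar> else 0) + e / 2" for k
      using N[of k] e by (cases "k < N") auto
    then have "(\<Sum>k<n. \<bar>a k - l\<bar>) \<le> (\<Sum>k<n. (if k < N then \<bar>a k - l\<bar> else 0) + e / 2)"
      by (intro sum_mono) blast
    also have "\<dots> = (\<Sum>k\<in>{k\<in>{..<n}. k < N}. \<bar>a k - l\<bar>) + real n * (e / 2)"
      by (simp add: sum.distrib sum.inter_filter[symmetric])
    also have "(\<Sum>k\<in>{k\<in>{..<n}. k < N}. \<bar>a k - l\<bar>) \<le> B"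
      unfolding B_def by (intro sum_mono2) auto
    finally have 1: "(\<Sum>k<n. \<bar>a k - l\<bar>) \<le> B + real n * (e / 2)" by simp
    have "(\<Sum>k<n. a k) / real n - l = (\<Sum>k<n. a k - l) / real n"
      using elim by (simp add: sum_subtractf field_simps)
    also have "\<bar>\<dots>\<bar> \<le> (\<Sum>k<n. \<bar>a k - l\<bar>) / real n"
      by (simp add: divide_right_mono sum_abs)
    also have "\<dots> \<le> (B + real n * (e / 2)) / real n" using 1 by (rule divide_right_mono) simp
    also have "\<dots> = B / real n + e / 2" using elim by (simp add: add_divide_distrib)
    also have "\<dots> < e" using elim(1) by linarith
    finally show ?case by simp
  qed
  then show "\<exists>no. \<forall>n\<ge>no. norm ((\<Sum>k<n. a k) / real n - l) < e"
    by (simp add: eventually_sequentially)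
qed

text \<open>
  The subsequence along which averages are controlled first.
\<close>

definition geometric_time :: "real \<Rightarrow> nat \<Rightarrow> nat" where
  "geometric_time a n = nat \<lfloor>a ^ n\<rfloor>"

lemma geometric_time_bounds:
  assumes "1 < a"
  shows "real (geometric_time a n) \<le> a ^ n" "a ^ n < real (geometric_time a n) + 1"
    "1 \<le> geometric_time a n" "a ^ n \<le> 2 * real (geometric_time a n)"
proof -
  have 1: "1 \<le> a ^ n" using assms by simp
  then show 2: "real (geometric_time a n) \<le> a ^ n" "a ^ n < real (geometric_time a n) + 1"
    "1 \<le> geometric_time a n"
    unfolding geometric_time_def by linarith+
  then show "a ^ n \<le> 2 * real (geometric_time a n)" by linarith
qed

lemma geometric_time_ratio:
  assumes a: "1 < a"
  shows "(\<lambda>n. real (geometric_time a (Suc n)) / real (geometric_time a n)) \<longlonglongrightarrow> a"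
proof -
  have inv: "(\<lambda>n. (1 / a) ^ n) \<longlonglongrightarrow> 0" using a by (intro LIMSEQ_realpow_zero) auto
  have 1: "(\<lambda>n. real (geometric_time a n) / a ^ n) \<longlonglongrightarrow> 1"
  proof (rule tendsto_sandwich)
    show "(\<lambda>n. 1 - (1 / a) ^ n) \<longlonglongrightarrow> 1" using tendsto_diff[OF tendsto_const inv, of 1] by simp
    show "\<forall>\<^sub>F n in sequentially. 1 - (1 / a) ^ n \<le> real (geometric_time a n) / a ^ n"
    proof (intro always_eventually allI)
      fix n
      have "(a ^ n - 1) / a ^ n \<le> real (geometric_time a n) / a ^ n"
        using a geometric_time_bounds(2)[OF a, of n] by (intro divide_right_mono) auto
      then show "1 - (1 / a) ^ n \<le> real (geometric_time a n) / a ^ n"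
        using a by (simp add: diff_divide_distrib power_one_over)
    qed
    show "\<forall>\<^sub>F n in sequentially. real (geometric_time a n) / a ^ n \<le> 1"
      using a geometric_time_bounds(1)[OF a] by (intro always_eventually allI) (simp add: field_simps)
  qed auto
  have "(\<lambda>n. (real (geometric_time a (Suc n)) / a ^ Suc n) * a / (real (geometric_time a n) / a ^ n)) \<longlonglongrightarrow> 1 * a / 1"
    by (intro tendsto_intros 1 LIMSEQ_Suc[OF 1]) auto
  moreover have "(\<lambda>n. (real (geometric_time a (Suc n)) / a ^ Suc n) * a / (real (geometric_time a n) / a ^ n)) =
      (\<lambda>n. real (geometric_time a (Suc n)) / real (geometric_time a n))"
    using a by (auto simp: fun_eq_iff field_simps)
  ultimately show ?thesis by simp
qed

lemma geometric_time_between: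
  assumes a: "1 < a" and m: "geometric_time a N \<le> m"
  obtains n where "N \<le> n" "geometric_time a n \<le> m" "m < geometric_time a (Suc n)"
proof -
  define A where "A = {n. geometric_time a n \<le> m}"
  obtain n0 where n0: "real m + 1 < a ^ n0" using real_arch_pow[OF a] by blast
  have "A \<subseteq> {..<n0}"
  proof
    fix n assume "n \<in> A"
    then have "a ^ n < real m + 1" using geometric_time_bounds(2)[OF a, of n] by (auto simp: A_def)
    with n0 have "a ^ n < a ^ n0" by simp
    then show "n \<in> {..<n0}" using a by simp
  qed
  then have fin: "finite A" by (rule finite_subset) simp
  have N: "N \<in> A" using m by (simp add: A_def)
  have "Max A \<in> A" using fin N by (intro Max_in) auto
  moreover have "Suc (Max A) \<notin> A" using Max_ge[OF fin, of "Suc (Max A)"] by auto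
  ultimately show ?thesis using Max_ge[OF fin N] by (intro that[of "Max A"]) (auto simp: A_def)
qed

text \<open>
  Between two consecutive geometric times a nondecreasing s is squeezed, which costs a factor a in the
  averages. As a may be taken arbitrarily close to 1, the limit along geometric times determines the
  full limit.
\<close>

lemma averages_tendsto_of_geometric_times:
  fixes s :: "nat \<Rightarrow> real"
  assumes s: "mono s" "0 \<le> s 0"
    and lim: "\<And>j. (\<lambda>n. s (geometric_time (1 + 1 / real (Suc j)) n) / real (geometric_time (1 + 1 / real (Suc j)) n)) \<longlonglongrightarrow> l"
  shows "(\<lambda>m. s m / real m) \<longlonglongrightarrow> l"
proof (rule LIMSEQ_I)
  fix e :: real assume e: "0 < e"
  have s0: "0 \<le> s m" for m using s monoD[OF s(1), of 0 m] by simp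
  have l0: "0 \<le> l" by (rule LIMSEQ_le_const[OF lim[of 0]]) (simp add: s0)
  have "(\<lambda>j. l * (1 + 1 / real (Suc j))) \<longlonglongrightarrow> l" "(\<lambda>j. l / (1 + 1 / real (Suc j))) \<longlonglongrightarrow> l"
    by real_asymp+
  then have "eventually (\<lambda>j. l * (1 + 1 / real (Suc j)) < l + e / 2 \<and> l - e / 2 < l / (1 + 1 / real (Suc j))) sequentially"
    using e by (intro eventually_conj order_tendstoD) auto
  then obtain j where j: "l * (1 + 1 / real (Suc j)) < l + e / 2" "l - e / 2 < l / (1 + 1 / real (Suc j))"
    by (auto dest: eventually_happens)
  define a where "a = 1 + 1 / real (Suc j)"
  have a: "1 < a" by (simp add: a_def)
  let ?k = "geometric_time a"
  have k0: "0 < real (?k n)" for n using geometric_time_bounds(3)[OF a, of n] by simp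
  have L: "(\<lambda>n. s (?k n) / real (?k n)) \<longlonglongrightarrow> l" using lim[of j] by (simp add: a_def)
  have "(\<lambda>n. (s (?k (Suc n)) / real (?k (Suc n))) * (real (?k (Suc n)) / real (?k n))) \<longlonglongrightarrow> l * a"
    by (intro tendsto_mult LIMSEQ_Suc[OF L] geometric_time_ratio[OF a])
  then have U: "(\<lambda>n. s (?k (Suc n)) / real (?k n)) \<longlonglongrightarrow> l * a" using k0 by (simp add: less_imp_neq[symmetric])
  have "(\<lambda>n. (s (?k n) / real (?k n)) / (real (?k (Suc n)) / real (?k n))) \<longlonglongrightarrow> l / a"
    using a by (intro tendsto_divide L geometric_time_ratio[OF a]) auto
  then have D: "(\<lambda>n. s (?k n) / real (?k (Suc n))) \<longlonglongrightarrow> l / a" using k0 by (simp add: less_imp_neq[symmetric])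
  have "eventually (\<lambda>n. s (?k (Suc n)) / real (?k n) < l + e \<and> l - e < s (?k n) / real (?k (Suc n))) sequentially"
    using e j by (intro eventually_conj order_tendstoD(2)[OF U] order_tendstoD(1)[OF D]) (auto simp: a_def)
  then obtain N where N: "\<And>n. n \<ge> N \<Longrightarrow> s (?k (Suc n)) / real (?k n) < l + e \<and> l - e < s (?k n) / real (?k (Suc n))"
    by (auto simp: eventually_sequentially)
  show "\<exists>no. \<forall>n\<ge>no. norm (s n / real n - l) < e"
  proof (intro exI[of _ "?k N"] allI impI)
    fix m assume "?k N \<le> m"
    then obtain n where n: "N \<le> n" "?k n \<le> m" "m < ?k (Suc n)" by (rule geometric_time_between[OF a])
    have m0: "0 < real m" using n(2) k0[of n] by linarith
    have "s m / real m \<le> s (?k (Suc n)) / real (?k n)"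
      using n m0 k0 by (intro frac_le monoD[OF s(1)] s0) auto
    moreover have "s (?k n) / real (?k (Suc n)) \<le> s m / real m"
      using n m0 k0 by (intro frac_le monoD[OF s(1)] s0) auto
    ultimately show "norm (s m / real m - l) < e" using N[OF n(1)] by (auto simp: abs_less_iff)
  qed
qed

text \<open>
  Only the n with a^n at least x contribute. They form a geometric series, dominated by its first term,
  which has the order x^2 / x = x. After integration a first moment thus controls truncated second
  moments.
\<close>

lemma truncated_second_moment_sum:
  assumes a: "1 < a" and x: "0 \<le> x"
  shows "(\<Sum>n<N. (if x \<le> real (geometric_time a n) then x\<^sup>2 else 0) / real (geometric_time a n)) \<le> 2 / (1 - 1 / a) * x"
proof (cases "x = 0")
  case False
  then have x0: "0 < x" using x by simp
  obtain n1 where n1: "x < a ^ n1" using real_arch_pow[OF a] by blast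
  define n0 where "n0 = (LEAST n. x \<le> a ^ n)"
  have n0: "x \<le> a ^ n0" unfolding n0_def by (rule LeastI[of _ n1]) (use n1 in simp)
  have n0_le: "n0 \<le> n" if "x \<le> a ^ n" for n unfolding n0_def using that by (rule Least_le)
  have inv: "0 < 1 / a" "1 / a < 1" using a by auto
  have "(\<Sum>n<N. (if x \<le> real (geometric_time a n) then x\<^sup>2 else 0) / real (geometric_time a n))
      \<le> (\<Sum>n<N. if n0 \<le> n then 2 * x\<^sup>2 * (1 / a) ^ n else 0)"
  proof (rule sum_mono)
    fix n
    note b = geometric_time_bounds[OF a, of n]
    show "(if x \<le> real (geometric_time a n) then x\<^sup>2 else 0) / real (geometric_time a n)
      \<le> (if n0 \<le> n then 2 * x\<^sup>2 * (1 / a) ^ n else 0)"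
    proof (cases "x \<le> real (geometric_time a n)")
      case True
      then have "n0 \<le> n" using b(1) by (intro n0_le) simp
      moreover have "x\<^sup>2 / real (geometric_time a n) \<le> x\<^sup>2 / (a ^ n / 2)"
        using b a by (intro divide_left_mono) auto
      ultimately show ?thesis using True by (simp add: power_one_over field_simps)
    qed (use a in auto)
  qed
  also have "\<dots> = (\<Sum>n\<in>{n\<in>{..<N}. n0 \<le> n}. 2 * x\<^sup>2 * (1 / a) ^ n)"
    by (simp add: sum.inter_filter[symmetric])
  also have "\<dots> \<le> (\<Sum>n\<in>{n0..<n0+N}. 2 * x\<^sup>2 * (1 / a) ^ n)"
    using a by (intro sum_mono2) auto
  also have "\<dots> = (\<Sum>n<N. 2 * x\<^sup>2 * (1 / a) ^ n0 * (1 / a) ^ n)"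
    by (rule sum.reindex_bij_witness[of _ "\<lambda>n. n + n0" "\<lambda>n. n - n0"]) (auto simp: power_add[symmetric])
  also have "\<dots> = 2 * x\<^sup>2 * (1 / a) ^ n0 * (\<Sum>n<N. (1 / a) ^ n)" by (simp add: sum_distrib_left)
  also have "(\<Sum>n<N. (1 / a) ^ n) \<le> (\<Sum>n. (1 / a) ^ n)"
    using inv by (intro sum_le_suminf summable_geometric) auto
  also have "(\<Sum>n. (1 / a) ^ n) = 1 / (1 - 1 / a)" using inv by (intro suminf_geometric) auto
  also have "2 * x\<^sup>2 * (1 / a) ^ n0 * (1 / (1 - 1 / a)) \<le> 2 * x\<^sup>2 * (1 / x) * (1 / (1 - 1 / a))"
    using n0 x0 a by (intro mult_left_mono mult_right_mono) (auto simp: power_one_over frac_le)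
  also have "\<dots> = 2 / (1 - 1 / a) * x" using x0 by (simp add: power2_eq_square)
  finally show ?thesis using a x0 by (simp add: mult_left_mono)
qed simp

text \<open>
  The variables may have infinite variance, so the correlation bound is imposed on bounded functions of
  them. The coefficient c k l measures the dependence between the times k and l; for holding times it
  is the probability that the walk is at the same site at both times.
\<close>

locale weakly_dependent_sequence = prob_space +
  fixes X :: "nat \<Rightarrow> 'a \<Rightarrow> real" and c :: "nat \<Rightarrow> nat \<Rightarrow> real"
  assumes X_measurable [measurable]: "\<And>k. X k \<in> borel_measurable M"
    and X_nonneg: "\<And>k w. w \<in> space M \<Longrightarrow> 0 \<le> X k w"
    and X_identical: "\<And>k. distr M borel (X k) = distr M borel (X 0)"
    and X_integrable: "integrable M (X 0)"
    and X_correlation: "\<And>k l g h B. g \<in> borel_measurable borel \<Longrightarrow> h \<in> borel_measurable borel \<Longrightarrow>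
      (\<And>x. 0 \<le> g x \<and> g x \<le> B) \<Longrightarrow> (\<And>x. 0 \<le> h x \<and> h x \<le> B) \<Longrightarrow>
      expectation (\<lambda>w. g (X k w) * h (X l w)) \<le>
        expectation (\<lambda>w. g (X 0 w)) * expectation (\<lambda>w. h (X 0 w)) +
        c k l * (expectation (\<lambda>w. (g (X 0 w))\<^sup>2) + expectation (\<lambda>w. (h (X 0 w))\<^sup>2))"
begin

lemma expectation_identical:
  assumes [measurable]: "(g :: real \<Rightarrow> real) \<in> borel_measurable borel"
  shows "expectation (\<lambda>w. g (X k w)) = expectation (\<lambda>w. g (X 0 w))"
proof -
  have "expectation (\<lambda>w. g (X k w)) = (\<integral>x. g x \<partial>distr M borel (X k))"
    by (subst integral_distr) auto
  also have "\<dots> = expectation (\<lambda>w. g (X 0 w))" unfolding X_identical[of k] by (subst integral_distr) auto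
  finally show ?thesis .
qed

lemma prob_identical:
  assumes [measurable]: "A \<in> sets borel"
  shows "prob {w \<in> space M. X k w \<in> A} = prob {w \<in> space M. X 0 w \<in> A}"
proof -
  have "measure (distr M borel (X k)) A = measure (distr M borel (X 0)) A" by (simp add: X_identical[of k])
  then show ?thesis by (simp add: measure_distr vimage_def Int_def conj_commute)
qed

lemma integrable_identical:
  "integrable M (X k)"
proof -
  have "integrable (distr M borel (X k)) (\<lambda>x. x)"
    unfolding X_identical[of k] using X_integrable by (subst integrable_distr_eq) auto
  then show ?thesis by (subst (asm) integrable_distr_eq) auto
qed

lemma integrable_bounded_comp:
  assumes [measurable]: "g \<in> borel_measurable borel" and "\<And>x. 0 \<le> g x \<and> g x \<le> (B::real)"
  shows "integrable M (\<lambda>w. g (X k w))"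
  using assms(2) by (intro integrable_const_bound[of _ B]) auto

text \<open>
  When the square is expanded, the product of the means in each correlation bound cancels.
\<close>

lemma variance_of_sum_le:
  fixes g :: "nat \<Rightarrow> real \<Rightarrow> real"
  assumes [measurable]: "\<And>k. g k \<in> borel_measurable borel" and B: "\<And>k x. 0 \<le> g k x \<and> g k x \<le> B"
  shows "integrable M (\<lambda>w. (\<Sum>k<n. g k (X k w) - expectation (\<lambda>w. g k (X 0 w)))\<^sup>2)"
    "expectation (\<lambda>w. (\<Sum>k<n. g k (X k w) - expectation (\<lambda>w. g k (X 0 w)))\<^sup>2) \<le>
      (\<Sum>k<n. \<Sum>l<n. c k l * (expectation (\<lambda>w. (g k (X 0 w))\<^sup>2) + expectation (\<lambda>w. (g l (X 0 w))\<^sup>2)))"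
proof -
  define m where "m k = expectation (\<lambda>w. g k (X 0 w))" for k
  have B0: "0 \<le> B" using B[of 0 0] by linarith
  have i1: "integrable M (\<lambda>w. g k (X k w))" for k using integrable_bounded_comp[of "g k" B k] B by auto
  have i2: "integrable M (\<lambda>w. g k (X k w) * g l (X l w))" for k l
  proof (rule integrable_const_bound[of _ "B * B"])
    show "AE w in M. norm (g k (X k w) * g l (X l w)) \<le> B * B"
      using B B0 by (intro always_eventually allI) (auto simp: abs_mult intro!: mult_mono)
  qed simp
  have eq: "(\<Sum>k<n. g k (X k w) - m k)\<^sup>2 = (\<Sum>k<n. \<Sum>l<n. g k (X k w) * g l (X l w) - m l * g k (X k w) - m k * g l (X l w) + m k * m l)" for w
    unfolding power2_eq_square sum_product by (intro sum.cong refl) (simp add: algebra_simps)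
  have i3: "integrable M (\<lambda>w. g k (X k w) * g l (X l w) - m l * g k (X k w) - m k * g l (X l w) + m k * m l)" for k l
    using i1 i2 by auto
  show "integrable M (\<lambda>w. (\<Sum>k<n. g k (X k w) - expectation (\<lambda>w. g k (X 0 w)))\<^sup>2)"
    unfolding m_def[symmetric] eq by (intro Bochner_Integration.integrable_sum i3)
  have "expectation (\<lambda>w. (\<Sum>k<n. g k (X k w) - m k)\<^sup>2) =
      (\<Sum>k<n. \<Sum>l<n. expectation (\<lambda>w. g k (X k w) * g l (X l w) - m l * g k (X k w) - m k * g l (X l w) + m k * m l))"
    unfolding eq by (subst Bochner_Integration.integral_sum, (intro Bochner_Integration.integrable_sum i3)[1])
      (intro sum.cong refl Bochner_Integration.integral_sum i3)
  also have "\<dots> \<le> (\<Sum>k<n. \<Sum>l<n. c k l * (expectation (\<lambda>w. (g k (X 0 w))\<^sup>2) + expectation (\<lambda>w. (g l (X 0 w))\<^sup>2)))"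
  proof (intro sum_mono)
    fix k l
    have "expectation (\<lambda>w. g k (X k w) * g l (X l w) - m l * g k (X k w) - m k * g l (X l w) + m k * m l) =
        expectation (\<lambda>w. g k (X k w) * g l (X l w)) - m l * expectation (\<lambda>w. g k (X k w))
          - m k * expectation (\<lambda>w. g l (X l w)) + m k * m l"
      using i1 i2 by (simp add: prob_space)
    also have "\<dots> = expectation (\<lambda>w. g k (X k w) * g l (X l w)) - m k * m l"
      using expectation_identical[of "g k" k] expectation_identical[of "g l" l] by (simp add: m_def)
    also have "\<dots> \<le> c k l * (expectation (\<lambda>w. (g k (X 0 w))\<^sup>2) + expectation (\<lambda>w. (g l (X 0 w))\<^sup>2))"
      using X_correlation[of "g k" "g l" B k l] B by (simp add: m_def)
    finally show "expectation (\<lambda>w. g k (X k w) * g l (X l w) - m l * g k (X k w) - m k * g l (X l w) + m k * m l) \<le>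
      c k l * (expectation (\<lambda>w. (g k (X 0 w))\<^sup>2) + expectation (\<lambda>w. (g l (X 0 w))\<^sup>2))" .
  qed
  finally show "expectation (\<lambda>w. (\<Sum>k<n. g k (X k w) - expectation (\<lambda>w. g k (X 0 w)))\<^sup>2) \<le>
      (\<Sum>k<n. \<Sum>l<n. c k l * (expectation (\<lambda>w. (g k (X 0 w))\<^sup>2) + expectation (\<lambda>w. (g l (X 0 w))\<^sup>2)))"
    unfolding m_def .
qed

text \<open>
  Truncation at a fixed level K changes the mean by little, uniformly in the index. The variance of the
  truncated sum is of smaller order than n^2 because the coefficients c are small on average.
\<close>

lemma averages_converge_in_mean:
  assumes c: "(\<lambda>n. (\<Sum>k<n. \<Sum>l<n. c k l) / (real n)\<^sup>2) \<longlonglongrightarrow> 0" and c0: "\<And>k l. 0 \<le> c k l"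
  shows "(\<lambda>n. expectation (\<lambda>w. \<bar>(\<Sum>k<n. X k w) - real n * expectation (X 0)\<bar>) / real n) \<longlonglongrightarrow> 0"
proof (rule LIMSEQ_I)
  fix e :: real assume e: "0 < e"
  define \<mu> where "\<mu> = expectation (X 0)"
  define g where "g K x = max 0 (min x (real K))" for K :: nat and x :: real
  define m where "m K = expectation (\<lambda>w. g K (X 0 w))" for K
  have g_meas [measurable]: "g K \<in> borel_measurable borel" for K unfolding g_def by measurable
  have g_bd: "0 \<le> g K x \<and> g K x \<le> real K" for K x by (auto simp: g_def)
  have g_le: "g K (X k w) \<le> X k w" if "w \<in> space M" for K k w using X_nonneg[OF that, of k] by (auto simp: g_def)
  have "m \<longlonglongrightarrow> \<mu>"
    unfolding m_def \<mu>_def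
  proof (rule integral_dominated_convergence[where w="X 0"])
    show "AE w in M. (\<lambda>K. g K (X 0 w)) \<longlonglongrightarrow> X 0 w"
    proof (intro AE_I2 tendsto_eventually)
      fix w assume w: "w \<in> space M"
      obtain K0 :: nat where "X 0 w \<le> real K0" using real_arch_simple by blast
      then show "\<forall>\<^sub>F K in sequentially. g K (X 0 w) = X 0 w"
        using X_nonneg[OF w, of 0] by (intro eventually_sequentiallyI[of K0]) (auto simp: g_def)
    qed
    show "AE w in M. norm (g K (X 0 w)) \<le> X 0 w" for K using g_le g_bd by (intro AE_I2) auto
  qed (use X_integrable in auto)
  then have "eventually (\<lambda>K. \<mu> - e / 8 < m K) sequentially" using e by (intro order_tendstoD(1)) auto
  then obtain K where K: "\<mu> - e / 8 < m K" by (auto dest: eventually_happens)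
  have m_bd: "0 \<le> m K" unfolding m_def using g_bd by (intro integral_nonneg_AE) auto
  define a where "a n = (\<Sum>k<n. \<Sum>l<n. c k l) / (real n)\<^sup>2" for n
  have "(\<lambda>n. 2 * (real K)\<^sup>2 * a n / e) \<longlonglongrightarrow> 2 * (real K)\<^sup>2 * 0 / e"
    using c e unfolding a_def by (intro tendsto_intros) auto
  then have "eventually (\<lambda>n. 2 * (real K)\<^sup>2 * a n / e < e / 4) sequentially"
    by (rule order_tendstoD(2)) (use e in simp)
  then have "eventually (\<lambda>n. norm (expectation (\<lambda>w. \<bar>(\<Sum>k<n. X k w) - real n * \<mu>\<bar>) / real n) < e) sequentially"
    using eventually_gt_at_top[of 0]
  proof eventually_elim
    case (elim n)
    define U where "U w = (\<Sum>k<n. g K (X k w) - m K)" for w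
    have U2: "integrable M (\<lambda>w. (U w)\<^sup>2)" and EU: "expectation (\<lambda>w. (U w)\<^sup>2) \<le>
        (\<Sum>k<n. \<Sum>l<n. c k l * (expectation (\<lambda>w. (g K (X 0 w))\<^sup>2) + expectation (\<lambda>w. (g K (X 0 w))\<^sup>2)))"
      unfolding U_def m_def using variance_of_sum_le[of "\<lambda>_. g K" "real K" n] g_bd by auto
    have "expectation (\<lambda>w. (g K (X 0 w))\<^sup>2) \<le> expectation (\<lambda>w. (real K)\<^sup>2)"
    proof (rule integral_mono)
      show "integrable M (\<lambda>w. (g K (X 0 w))\<^sup>2)"
        using g_bd by (intro integrable_const_bound[of _ "(real K)\<^sup>2"]) (auto intro!: power_mono)
    qed (use g_bd in \<open>auto intro!: power_mono\<close>)
    then have Eg2: "expectation (\<lambda>w. (g K (X 0 w))\<^sup>2) \<le> (real K)\<^sup>2" by (simp add: prob_space)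
    have "expectation (\<lambda>w. (U w)\<^sup>2) \<le> (\<Sum>k<n. \<Sum>l<n. c k l * (2 * (real K)\<^sup>2))"
      using Eg2 c0 by (intro order_trans[OF EU] sum_mono mult_left_mono) auto
    also have "\<dots> = 2 * (real K)\<^sup>2 * a n * (real n)\<^sup>2"
      using elim by (simp add: a_def sum_distrib_right[symmetric])
    finally have EU': "expectation (\<lambda>w. (U w)\<^sup>2) \<le> 2 * (real K)\<^sup>2 * a n * (real n)\<^sup>2" .
    have iX: "integrable M (X k)" for k by (rule integrable_identical)
    have ig: "integrable M (\<lambda>w. g K (X k w))" for k using integrable_bounded_comp[of "g K" "real K" k] g_bd by auto
    \<comment> \<open>The middle term majorises the absolute value of U by the inequality of arithmetic and geometric
      means; this trades a bound on the second moment of U for one on its first moment.\<close>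
    define V where "V w = (\<Sum>k<n. X k w - g K (X k w)) + (1 / (e * real n) * (U w)\<^sup>2 + e * real n / 4) + real n * (\<mu> - m K)" for w
    have V: "integrable M V"
      unfolding V_def using iX ig U2 by auto
    have le: "\<bar>(\<Sum>k<n. X k w) - real n * \<mu>\<bar> \<le> V w" if w: "w \<in> space M" for w
    proof -
      have m_le: "m K \<le> \<mu>" unfolding m_def \<mu>_def
        using g_le by (intro integral_mono ig X_integrable) auto
      have "(\<Sum>k<n. X k w) - real n * \<mu> = (\<Sum>k<n. X k w - g K (X k w)) + U w - real n * (\<mu> - m K)"
        by (simp add: U_def sum_subtractf algebra_simps)
      moreover have "0 \<le> (\<Sum>k<n. X k w - g K (X k w))" using g_le[OF w] by (intro sum_nonneg) auto
      moreover have "\<bar>U w\<bar> \<le> 1 / (e * real n) * (U w)\<^sup>2 + e * real n / 4"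
      proof -
        have "0 \<le> (\<bar>U w\<bar> - e * real n / 2)\<^sup>2 / (e * real n)" using e by simp
        also have "\<dots> = 1 / (e * real n) * (U w)\<^sup>2 + e * real n / 4 - \<bar>U w\<bar>"
          using e elim by (simp add: power2_eq_square field_simps)
        finally show ?thesis by simp
      qed
      moreover have "0 \<le> real n * (\<mu> - m K)" using m_le by simp
      ultimately show ?thesis unfolding V_def by linarith
    qed
    have "expectation (\<lambda>w. \<bar>(\<Sum>k<n. X k w) - real n * \<mu>\<bar>) \<le> expectation V"
      using le iX V by (intro integral_mono) auto
    also have "\<dots> = (\<Sum>k<n. expectation (X k) - expectation (\<lambda>w. g K (X k w))) +
        (1 / (e * real n) * expectation (\<lambda>w. (U w)\<^sup>2) + e * real n / 4) + real n * (\<mu> - m K)"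
      unfolding V_def using iX ig U2 by (simp add: prob_space)
    also have "(\<Sum>k<n. expectation (X k) - expectation (\<lambda>w. g K (X k w))) = real n * (\<mu> - m K)"
    proof -
      have "expectation (X k) = \<mu>" for k using expectation_identical[of "\<lambda>x. x" k] by (simp add: \<mu>_def)
      moreover have "expectation (\<lambda>w. g K (X k w)) = m K" for k
        using expectation_identical[of "g K" k] by (simp add: m_def)
      ultimately show ?thesis by simp
    qed
    finally have "expectation (\<lambda>w. \<bar>(\<Sum>k<n. X k w) - real n * \<mu>\<bar>) \<le>
       2 * real n * (\<mu> - m K) + 1 / (e * real n) * expectation (\<lambda>w. (U w)\<^sup>2) + e * real n / 4" by simp
    also have "\<dots> \<le> 2 * real n * (e / 8) + 1 / (e * real n) * (2 * (real K)\<^sup>2 * a n * (real n)\<^sup>2) + e * real n / 4"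
      using K EU' e elim by (intro add_mono mult_left_mono) auto
    also have "\<dots> = real n * (e / 4 + 2 * (real K)\<^sup>2 * a n / e + e / 4)"
      using e elim by (simp add: field_simps power2_eq_square)
    finally have "expectation (\<lambda>w. \<bar>(\<Sum>k<n. X k w) - real n * \<mu>\<bar>) / real n \<le> e / 4 + 2 * (real K)\<^sup>2 * a n / e + e / 4"
      using elim by (simp add: field_simps)
    moreover have "0 \<le> expectation (\<lambda>w. \<bar>(\<Sum>k<n. X k w) - real n * \<mu>\<bar>) / real n"
      by (intro divide_nonneg_nonneg integral_nonneg_AE) auto
    ultimately show ?case using elim(1) e by (auto simp: abs_less_iff)
  qed
  then show "\<exists>no. \<forall>n\<ge>no. norm (expectation (\<lambda>w. \<bar>(\<Sum>k<n. X k w) - real n * expectation (X 0)\<bar>) / real n - 0) < e"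
    by (simp add: eventually_sequentially \<mu>_def)
qed

end

lemma (in prob_space) AE_summable_of_summable_expectation:
  assumes V: "\<And>n. integrable M (V n)" "\<And>n w. w \<in> space M \<Longrightarrow> 0 \<le> (V n w :: real)"
    and s: "summable (\<lambda>n. expectation (V n))"
  shows "AE w in M. summable (\<lambda>n. V n w)"
proof -
  have [measurable]: "V n \<in> borel_measurable M" for n using V(1) by auto
  have "(\<integral>\<^sup>+w. (\<Sum>n. ennreal (V n w)) \<partial>M) = (\<Sum>n. \<integral>\<^sup>+w. ennreal (V n w) \<partial>M)"
    by (rule nn_integral_suminf) simp
  also have "\<dots> = (\<Sum>n. ennreal (expectation (V n)))"
    using V by (intro suminf_cong nn_integral_eq_integral) auto
  also have "\<dots> \<noteq> \<infinity>"
    using s V by (subst suminf_ennreal2) (auto intro!: integral_nonneg_AE)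
  finally have "AE w in M. (\<Sum>n. ennreal (V n w)) \<noteq> \<infinity>"
    by (intro nn_integral_PInf_AE) auto
  then show ?thesis
  proof (rule AE_mp, intro AE_I2 impI)
    fix w assume "w \<in> space M" "(\<Sum>n. ennreal (V n w)) \<noteq> \<infinity>"
    then show "summable (\<lambda>n. V n w)" using V(2) by (intro summable_suminf_not_top) auto
  qed
qed

lemma sum_indicator_less_le:
  fixes x :: real assumes "0 \<le> x"
  shows "(\<Sum>k<N. if real k < x then 1 else 0) \<le> x + 1"
proof -
  have "(\<Sum>k<N. if real k < x then 1 else 0) \<le> (if real N \<le> x then real N else x + 1)"
    using assms by (induction N) (auto split: if_splits)
  then show ?thesis by (auto split: if_splits)
qed

lemma filterlim_geometric_time: "1 < a \<Longrightarrow> filterlim (geometric_time a) at_top sequentially"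
  unfolding filterlim_at_top eventually_sequentially
proof
  fix Z assume a: "1 < a"
  obtain n0 where n0: "real Z + 1 < a ^ n0" using real_arch_pow[OF a] by blast
  have "Z \<le> geometric_time a n" if "n \<ge> n0" for n
    using geometric_time_bounds(2)[OF a, of n] power_increasing[OF that, of a] a n0 by linarith
  then show "\<exists>N. \<forall>n\<ge>N. Z \<le> geometric_time a n" by blast
qed

text \<open>
  Etemadi's argument. The k-th variable is truncated at level k; by the first Borel--Cantelli argument
  almost surely only finitely many terms are changed. Along geometric times the variances of the
  truncated averages are summable, by the summation lemma for truncated second moments. Since the
  variables are nonnegative, their sums are monotone, and geometric times suffice.
\<close>

theorem (in weakly_dependent_sequence) strong_law_of_large_numbers:
  assumes c: "\<And>n. (\<Sum>k<n. \<Sum>l<n. c k l) \<le> C * real n" and c0: "\<And>k l. 0 \<le> c k l"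
  shows "AE w in M. (\<lambda>n. (\<Sum>k<n. X k w) / real n) \<longlonglongrightarrow> expectation (X 0)"
proof -
  define \<mu> where "\<mu> = expectation (X 0)"
  define g where "g k x = (if 0 \<le> x \<and> x \<le> real k then x else 0)" for k :: nat and x :: real
  define m where "m k = expectation (\<lambda>w. g k (X 0 w))" for k
  have C0: "0 \<le> C" using c[of 1] c0[of 0 0] by simp
  have g_meas [measurable]: "g k \<in> borel_measurable borel" for k unfolding g_def by measurable
  have g_bd: "0 \<le> g k x \<and> g k x \<le> real k" for k x by (auto simp: g_def)
  have g_mono: "g k x \<le> g n x" if "k \<le> n" for k n x using that by (auto simp: g_def)
  have \<mu>0: "0 \<le> \<mu>" unfolding \<mu>_def using X_nonneg by (intro integral_nonneg_AE) auto
  have "m \<longlonglongrightarrow> \<mu>"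
    unfolding m_def \<mu>_def
  proof (rule integral_dominated_convergence[where w="X 0"])
    show "AE w in M. (\<lambda>K. g K (X 0 w)) \<longlonglongrightarrow> X 0 w"
    proof (intro AE_I2 tendsto_eventually)
      fix w assume w: "w \<in> space M"
      obtain K0 :: nat where "X 0 w \<le> real K0" using real_arch_simple by blast
      then show "\<forall>\<^sub>F K in sequentially. g K (X 0 w) = X 0 w"
        using X_nonneg[OF w, of 0] by (intro eventually_sequentiallyI[of K0]) (auto simp: g_def)
    qed
    show "AE w in M. norm (g K (X 0 w)) \<le> X 0 w" for K
      using X_nonneg by (intro AE_I2) (auto simp: g_def)
  qed (use X_integrable in auto)
  note m_avg = averages_tendsto[OF this]
  define U where "U n w = (\<Sum>k<n. g k (X k w) - m k)" for n w
  define q where "q n = expectation (\<lambda>w. (g n (X 0 w))\<^sup>2)" for n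
  have g2_int: "integrable M (\<lambda>w. (g n (X 0 w))\<^sup>2)" for n
    using g_bd by (intro integrable_const_bound[of _ "(real n)\<^sup>2"]) (auto intro!: power_mono)
  have U: "integrable M (\<lambda>w. (U n w)\<^sup>2)" "expectation (\<lambda>w. (U n w)\<^sup>2) \<le> 2 * C * real n * q n" for n
  proof -
    \<comment> \<open>For k < n this is the truncation at level k, but it is bounded by n for all indices at once.\<close>
    define h where "h k = g (min k n)" for k
    have h: "h k \<in> borel_measurable borel" "0 \<le> h k x \<and> h k x \<le> real n" for k x
      using g_bd[of "min k n" x] by (auto simp: h_def)
    have U_eq: "U n w = (\<Sum>k<n. h k (X k w) - expectation (\<lambda>w. h k (X 0 w)))" for w
      unfolding U_def m_def h_def by (intro sum.cong) auto
    show "integrable M (\<lambda>w. (U n w)\<^sup>2)" unfolding U_eq using variance_of_sum_le(1)[of h "real n" n] h by blast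
    have hq: "expectation (\<lambda>w. (h k (X 0 w))\<^sup>2) \<le> q n" for k
      unfolding q_def h_def using g_bd g_mono by (intro integral_mono g2_int power_mono) auto
    have "expectation (\<lambda>w. (U n w)\<^sup>2) \<le>
      (\<Sum>k<n. \<Sum>l<n. c k l * (expectation (\<lambda>w. (h k (X 0 w))\<^sup>2) + expectation (\<lambda>w. (h l (X 0 w))\<^sup>2)))"
      unfolding U_eq using variance_of_sum_le(2)[of h "real n" n] h by blast
    also have "\<dots> \<le> (\<Sum>k<n. \<Sum>l<n. c k l * (2 * q n))"
    proof (intro sum_mono mult_left_mono c0)
      show "expectation (\<lambda>w. (h k (X 0 w))\<^sup>2) + expectation (\<lambda>w. (h l (X 0 w))\<^sup>2) \<le> 2 * q n" for k l
        using hq[of k] hq[of l] by simp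
    qed
    also have "\<dots> = (\<Sum>k<n. \<Sum>l<n. c k l) * (2 * q n)" by (simp add: sum_distrib_right)
    also have "\<dots> \<le> (C * real n) * (2 * q n)"
      unfolding q_def by (intro mult_right_mono c mult_nonneg_nonneg integral_nonneg_AE) auto
    finally show "expectation (\<lambda>w. (U n w)\<^sup>2) \<le> 2 * C * real n * q n" by simp
  qed
  have "AE w in M. summable (\<lambda>k. indicator {w \<in> space M. real k < X k w} w :: real)"
  proof (rule AE_summable_of_summable_expectation)
    have P: "expectation (indicat_real {w \<in> space M. real k < X k w}) = expectation (\<lambda>w. if real k < X 0 w then 1 else 0)" for k
    proof -
      have "expectation (indicat_real {w \<in> space M. real k < X k w}) = prob {w \<in> space M. X k w \<in> {real k<..}}"
        by simp
      also have "\<dots> = prob {w \<in> space M. X 0 w \<in> {real k<..}}" by (rule prob_identical) simp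
      also have "\<dots> = expectation (indicat_real {w \<in> space M. real k < X 0 w})" by simp
      also have "\<dots> = expectation (\<lambda>w. if real k < X 0 w then 1 else 0)"
        by (intro Bochner_Integration.integral_cong) (auto simp: indicator_def)
      finally show ?thesis .
    qed
    show "summable (\<lambda>k. expectation (indicat_real {w \<in> space M. real k < X k w}))"
      unfolding P
    proof (rule summableI_nonneg_bounded[of _ "\<mu> + 1"])
      fix N
      have i: "integrable M (\<lambda>w. if real k < X 0 w then 1 else 0 :: real)" for k
        by (intro integrable_const_bound[of _ 1]) auto
      have "(\<Sum>k<N. expectation (\<lambda>w. if real k < X 0 w then 1 else 0 :: real)) =
        expectation (\<lambda>w. \<Sum>k<N. if real k < X 0 w then 1 else 0 :: real)"
        by (intro Bochner_Integration.integral_sum[symmetric] i)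
      also have "\<dots> \<le> expectation (\<lambda>w. X 0 w + 1)"
        using X_integrable X_nonneg sum_indicator_less_le
        by (intro integral_mono Bochner_Integration.integrable_sum i) auto
      also have "\<dots> = \<mu> + 1" using X_integrable by (simp add: \<mu>_def prob_space)
      finally show "(\<Sum>k<N. expectation (\<lambda>w. if real k < X 0 w then 1 else 0 :: real)) \<le> \<mu> + 1" .
    qed (auto intro!: integral_nonneg_AE)
    show "integrable M (indicat_real {w \<in> space M. real k < X k w})" for k
      by (intro integrable_const_bound[of _ 1]) (auto simp: indicator_def)
  qed auto
  then have tail: "AE w in M. (\<lambda>n. (\<Sum>k<n. X k w - g k (X k w)) / real n) \<longlonglongrightarrow> 0"
  proof (rule AE_mp, intro AE_I2 impI averages_tendsto tendsto_eventually)
    fix w assume w: "w \<in> space M" "summable (\<lambda>k. indicator {w \<in> space M. real k < X k w} w :: real)"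
    have "eventually (\<lambda>k. indicator {w \<in> space M. real k < X k w} w < (1::real)) sequentially"
      using summable_LIMSEQ_zero[OF w(2)] by (rule order_tendstoD) simp
    then show "\<forall>\<^sub>F k in sequentially. X k w - g k (X k w) = 0"
      by eventually_elim (use w X_nonneg in \<open>auto simp: g_def indicator_def split: if_splits\<close>)
  qed
  have geo: "AE w in M. (\<lambda>n. U (geometric_time a n) w / real (geometric_time a n)) \<longlonglongrightarrow> 0" if a: "1 < a" for a
  proof -
    let ?k = "geometric_time a"
    have k0: "0 < real (?k n)" for n using geometric_time_bounds(3)[OF a, of n] by simp
    have "AE w in M. summable (\<lambda>n. (U (?k n) w / real (?k n))\<^sup>2)"
    proof (rule AE_summable_of_summable_expectation)
      show "integrable M (\<lambda>w. (U (?k n) w / real (?k n))\<^sup>2)" for n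
        using U(1)[of "?k n"] by (simp add: power_divide)
      have E_le: "expectation (\<lambda>w. (U (?k n) w / real (?k n))\<^sup>2) \<le> 2 * C * (q (?k n) / real (?k n))" for n
      proof -
        have "expectation (\<lambda>w. (U (?k n) w / real (?k n))\<^sup>2) = expectation (\<lambda>w. (U (?k n) w)\<^sup>2) / (real (?k n))\<^sup>2"
          by (simp add: power_divide)
        also have "\<dots> \<le> 2 * C * real (?k n) * q (?k n) / (real (?k n))\<^sup>2"
          using U(2)[of "?k n"] by (rule divide_right_mono) simp
        also have "\<dots> = 2 * C * (q (?k n) / real (?k n))" using k0[of n] by (simp add: power2_eq_square)
        finally show ?thesis .
      qed
      show "summable (\<lambda>n. expectation (\<lambda>w. (U (?k n) w / real (?k n))\<^sup>2))"
      proof (rule summableI_nonneg_bounded[of _ "2 * C * (2 / (1 - 1 / a) * \<mu>)"])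
        fix N
        have "(\<Sum>n<N. expectation (\<lambda>w. (U (?k n) w / real (?k n))\<^sup>2)) \<le> (\<Sum>n<N. 2 * C * (q (?k n) / real (?k n)))"
          by (intro sum_mono E_le)
        also have "\<dots> = 2 * C * (\<Sum>n<N. q (?k n) / real (?k n))" by (simp add: sum_distrib_left)
        also have "(\<Sum>n<N. q (?k n) / real (?k n)) = expectation (\<lambda>w. \<Sum>n<N. (g (?k n) (X 0 w))\<^sup>2 / real (?k n))"
          unfolding q_def using g2_int by (subst Bochner_Integration.integral_sum) auto
        also have "\<dots> \<le> expectation (\<lambda>w. 2 / (1 - 1 / a) * X 0 w)"
        proof (intro integral_mono Bochner_Integration.integrable_sum)
          fix w assume w: "w \<in> space M"
          have "(\<Sum>n<N. (g (?k n) (X 0 w))\<^sup>2 / real (?k n)) =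
              (\<Sum>n<N. (if X 0 w \<le> real (?k n) then (X 0 w)\<^sup>2 else 0) / real (?k n))"
            using X_nonneg[OF w, of 0] by (intro sum.cong) (auto simp: g_def)
          also have "\<dots> \<le> 2 / (1 - 1 / a) * X 0 w"
            by (rule truncated_second_moment_sum[OF a X_nonneg[OF w]])
          finally show "(\<Sum>n<N. (g (?k n) (X 0 w))\<^sup>2 / real (?k n)) \<le> 2 / (1 - 1 / a) * X 0 w" .
        qed (use X_integrable g2_int in auto)
        also have "\<dots> = 2 / (1 - 1 / a) * \<mu>" by (simp add: \<mu>_def)
        finally show "(\<Sum>n<N. expectation (\<lambda>w. (U (?k n) w / real (?k n))\<^sup>2)) \<le> 2 * C * (2 / (1 - 1 / a) * \<mu>)"
          using C0 by (simp add: mult_left_mono)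
      qed (auto intro!: integral_nonneg_AE)
    qed auto
    then show ?thesis
    proof (rule AE_mp, intro AE_I2 impI)
      fix w assume "summable (\<lambda>n. (U (?k n) w / real (?k n))\<^sup>2)"
      then have "(\<lambda>n. sqrt ((U (?k n) w / real (?k n))\<^sup>2)) \<longlonglongrightarrow> sqrt 0"
        by (intro tendsto_real_sqrt summable_LIMSEQ_zero)
      then show "(\<lambda>n. U (?k n) w / real (?k n)) \<longlonglongrightarrow> 0"
        by (intro tendsto_rabs_zero_cancel[of "\<lambda>n. U (?k n) w / real (?k n)"]) (simp add: real_sqrt_abs)
    qed
  qed
  have "AE w in M. \<forall>j. (\<lambda>n. U (geometric_time (1 + 1 / real (Suc j)) n) w / real (geometric_time (1 + 1 / real (Suc j)) n)) \<longlonglongrightarrow> 0"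
    unfolding AE_all_countable by (intro allI geo) simp
  with tail show ?thesis
    unfolding \<mu>_def[symmetric] using AE_space
  proof eventually_elim
    case (elim w)
    have split: "(\<Sum>k<n. X k w) / real n =
        (\<Sum>k<n. X k w - g k (X k w)) / real n + U n w / real n + (\<Sum>k<n. m k) / real n" for n
      unfolding add_divide_distrib[symmetric] U_def by (simp add: sum_subtractf)
    show ?case
    proof (rule averages_tendsto_of_geometric_times)
      show "mono (\<lambda>n. \<Sum>k<n. X k w)"
        using X_nonneg elim by (intro monoI sum_mono2) auto
      fix j
      define a where "a = 1 + 1 / real (Suc j)"
      have a: "1 < a" by (simp add: a_def)
      note lim = filterlim_geometric_time[OF a]
      have "(\<lambda>n. (\<Sum>k<geometric_time a n. X k w) / real (geometric_time a n)) \<longlonglongrightarrow> 0 + 0 + \<mu>"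
        unfolding split
        by (intro tendsto_add filterlim_compose[OF elim(1) lim] filterlim_compose[OF m_avg lim])
          (use elim(2) in \<open>auto simp: a_def\<close>)
      then show "(\<lambda>n. (\<Sum>k<geometric_time (1 + 1 / real (Suc j)) n. X k w) /
          real (geometric_time (1 + 1 / real (Suc j)) n)) \<longlonglongrightarrow> \<mu>"
        by (simp add: a_def)
    qed simp
  qed
qed

section \<open>Sums of independent steps\<close>

context prob_space
begin

lemma indep_vars_disjoint_sums:
  fixes \<xi> :: "'i \<Rightarrow> 'a \<Rightarrow> real"
  assumes \<xi>: "indep_vars (\<lambda>_. borel) \<xi> I" and K: "\<And>j. j \<in> L \<Longrightarrow> K j \<subseteq> I" "disjoint_family_on K L"
  shows "indep_vars (\<lambda>_. borel) (\<lambda>j w. \<Sum>i\<in>K j. \<xi> i w) L"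
proof -
  have "indep_vars (\<lambda>_. borel) (\<lambda>j w. (\<Sum>i\<in>K j. restrict (\<lambda>i. \<xi> i w) (K j) i)) L"
  proof (rule indep_vars_compose2[OF indep_vars_restrict[OF \<xi> K]])
    show "(\<lambda>x. \<Sum>i\<in>K j. x i :: real) \<in> borel_measurable (PiM (K j) (\<lambda>_. borel))" if "j \<in> L" for j
      by (intro borel_measurable_sum measurable_component_singleton)
  qed
  then show ?thesis by simp
qed

lemma disjoint_family_consecutive_blocks:
  assumes "mono (a :: nat \<Rightarrow> nat)"
  shows "disjoint_family (\<lambda>i. {a i..<a (Suc i)})"
  unfolding disjoint_family_on_def
proof (intro ballI impI)
  fix m n :: nat assume "m \<noteq> n"
  then consider "Suc m \<le> n" | "Suc n \<le> m" by linarith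
  then show "{a m..<a (Suc m)} \<inter> {a n..<a (Suc n)} = {}"
    using monoD[OF assms, of "Suc m" n] monoD[OF assms, of "Suc n" m] by cases auto
qed

lemma indep_vars_block_sums:
  fixes \<xi> :: "nat \<Rightarrow> 'a \<Rightarrow> real"
  assumes "indep_vars (\<lambda>_. borel) \<xi> UNIV" "mono a"
  shows "indep_vars (\<lambda>_. borel) (\<lambda>j w. \<Sum>i\<in>{a j..<a (Suc j)}. \<xi> i w) UNIV"
  using assms(1) by (rule indep_vars_disjoint_sums) (use disjoint_family_consecutive_blocks[OF assms(2)] in auto)

end

locale centered_steps = prob_space +
  fixes \<xi> :: "nat \<Rightarrow> 'a \<Rightarrow> real"
  assumes indep: "indep_vars (\<lambda>_. borel) \<xi> UNIV"
    and bounded_step: "\<And>i. AE w in M. \<bar>\<xi> i w\<bar> \<le> 1"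
    and centered: "\<And>i. expectation (\<xi> i) = 0"
begin

lemma step_measurable [measurable]: "\<xi> i \<in> borel_measurable M"
  using indep by (auto simp: indep_vars_def)

definition block :: "nat \<Rightarrow> nat \<Rightarrow> 'a \<Rightarrow> real" where
  "block a m w = (\<Sum>i\<in>{a..<a + m}. \<xi> i w)"

lemma block_measurable [measurable]: "block a m \<in> borel_measurable M"
  unfolding block_def by measurable

lemma AE_bounded: "AE w in M. \<forall>i. \<bar>\<xi> i w\<bar> \<le> 1"
  using bounded_step by (simp add: AE_all_countable)

lemma block_le: "\<forall>i. \<bar>\<xi> i w\<bar> \<le> 1 \<Longrightarrow> \<bar>block a m w\<bar> \<le> real m"
  unfolding block_def
  by (rule order_trans[OF sum_abs]) (use sum_bounded_above[of "{a..<a+m}" "\<lambda>i. \<bar>\<xi> i w\<bar>" 1] in simp)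

lemma integrable_monomial:
  assumes [measurable]: "f \<in> borel_measurable M" and f: "AE w in M. \<bar>f w\<bar> \<le> (B::real)"
  shows "integrable M (\<lambda>w. f w * (block a m w) ^ p)"
proof (rule integrable_const_bound[of _ "B * real m ^ p"])
  show "AE w in M. norm (f w * block a m w ^ p) \<le> B * real m ^ p"
    using AE_bounded f
  proof eventually_elim
    case (elim w)
    have "\<bar>f w\<bar> * \<bar>block a m w\<bar> ^ p \<le> B * real m ^ p"
      using elim block_le[OF elim(1)] by (intro mult_mono power_mono) auto
    then show ?case by (simp add: abs_mult power_abs)
  qed
qed simp

text \<open>
  Instances are the first-passage events of the maximal inequality, which are functions of the past.
\<close>

lemma expectation_product_of_past_and_future:
  assumes F: "F \<in> borel_measurable (PiM {..<b} (\<lambda>_. borel))" and B: "AE w in M. \<bar>F (restrict (\<lambda>i. \<xi> i w) {..<b})\<bar> \<le> (B::real)"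
  shows "expectation (\<lambda>w. F (restrict (\<lambda>i. \<xi> i w) {..<b}) * block b m w ^ p) =
    expectation (\<lambda>w. F (restrict (\<lambda>i. \<xi> i w) {..<b})) * expectation (\<lambda>w. block b m w ^ p)"
proof (rule indep_var_lebesgue_integral)
  have "indep_var borel (F \<circ> (\<lambda>w. restrict (\<lambda>i. \<xi> i w) {..<b}))
     borel ((\<lambda>x. (\<Sum>i\<in>{b..<b + m}. x i) ^ p) \<circ> (\<lambda>w. restrict (\<lambda>i. \<xi> i w) {b..<b+m}))"
    by (rule indep_var_compose[OF indep_var_restrict[OF indep]])
      (auto intro!: F borel_measurable_power borel_measurable_sum measurable_component_singleton)
  moreover have "(\<lambda>x. (\<Sum>i\<in>{b..<b + m}. x i) ^ p) \<circ> (\<lambda>w. restrict (\<lambda>i. \<xi> i w) {b..<b+m}) = (\<lambda>w. block b m w ^ p)"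
    by (auto simp: fun_eq_iff block_def)
  ultimately show "indep_var borel (\<lambda>w. F (restrict (\<lambda>i. \<xi> i w) {..<b})) borel (\<lambda>w. block b m w ^ p)"
    by (simp add: comp_def)
  have [measurable]: "(\<lambda>w. F (restrict (\<lambda>i. \<xi> i w) {..<b})) \<in> borel_measurable M"
    by (rule measurable_compose[OF _ F]) measurable
  show "integrable M (\<lambda>w. F (restrict (\<lambda>i. \<xi> i w) {..<b}))"
    using B by (intro integrable_const_bound[of _ B]) auto
  show "integrable M (\<lambda>w. block b m w ^ p)"
    using integrable_monomial[of "\<lambda>_. 1" 1] by simp
qed

lemma block_Suc: "block a (Suc m) w = block a m w + \<xi> (a + m) w"
  by (simp add: block_def)

lemma block_add: "block a (m + n) w = block a m w + block (a + m) n w"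
  unfolding block_def using sum.atLeastLessThan_concat[of a "a+m" "a+m+n" "\<lambda>i. \<xi> i w"] by (simp add: add.assoc)

lemma block_one: "block a (Suc 0) w = \<xi> a w" by (simp add: block_def)

lemma expectation_block_product:
  "expectation (\<lambda>w. block a m w ^ p * block (a + m) n w ^ q) =
    expectation (\<lambda>w. block a m w ^ p) * expectation (\<lambda>w. block (a + m) n w ^ q)"
proof -
  have eq: "(\<Sum>i\<in>{a..<a+m}. restrict (\<lambda>i. \<xi> i w) {..<a+m} i) ^ p = block a m w ^ p" for w
    by (simp add: block_def)
  have "AE w in M. \<bar>block a m w ^ p\<bar> \<le> real m ^ p"
    using AE_bounded by eventually_elim (auto simp: power_abs intro!: power_mono block_le)
  then show ?thesis
    using expectation_product_of_past_and_future[of "\<lambda>x. (\<Sum>i\<in>{a..<a+m}. x i) ^ p" "a + m" "real m ^ p" n q]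
    unfolding eq by (auto intro!: borel_measurable_power borel_measurable_sum measurable_component_singleton)
qed

lemma integrable_block_power: "integrable M (\<lambda>w. block a m w ^ p)"
  using integrable_monomial[of "\<lambda>_. 1" 1] by simp

lemma integrable_block_product: "integrable M (\<lambda>w. block a m w ^ p * block b n w ^ q)"
proof (rule integrable_monomial)
  show "AE w in M. \<bar>block a m w ^ p\<bar> \<le> real m ^ p"
    using AE_bounded by eventually_elim (auto simp: power_abs intro!: power_mono block_le)
qed simp

lemma expectation_block: "expectation (block a m) = 0"
proof -
  have "integrable M (\<xi> i)" for i using integrable_block_power[of i "Suc 0" 1] by (simp add: block_one)
  then show ?thesis unfolding block_def by (simp add: centered)
qed

lemma expectation_step_power_le: "expectation (\<lambda>w. block a (Suc 0) w ^ p) \<le> 1"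
proof -
  have "expectation (\<lambda>w. block a (Suc 0) w ^ p) \<le> expectation (\<lambda>_. 1)"
  proof (rule integral_mono_AE)
    show "AE w in M. block a (Suc 0) w ^ p \<le> 1"
      using bounded_step[of a]
    proof eventually_elim
      case (elim w)
      have "block a (Suc 0) w ^ p \<le> \<bar>block a (Suc 0) w\<bar> ^ p" by (simp add: power_abs[symmetric])
      also have "\<dots> \<le> 1" using elim by (intro power_le_one) (auto simp: block_one)
      finally show ?case .
    qed
  qed (use integrable_block_power in auto)
  then show ?thesis by (simp add: prob_space)
qed

lemma second_moment_block: "expectation (\<lambda>w. block a m w ^ 2) \<le> real m"
proof (induction m)
  case 0
  then show ?case by (simp add: block_def)
next
  case (Suc m)
  let ?S = "block a m" and ?x = "block (a + m) (Suc 0)"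
  have "(block a (Suc m) w)\<^sup>2 = ?S w ^ 2 + 2 * (?S w ^ 1 * ?x w ^ 1) + ?x w ^ 2" for w
    unfolding block_Suc[of a m] block_one by (simp add: power2_eq_square algebra_simps)
  then have "expectation (\<lambda>w. (block a (Suc m) w)\<^sup>2) =
      expectation (\<lambda>w. ?S w ^ 2) + 2 * expectation (\<lambda>w. ?S w ^ 1 * ?x w ^ 1) + expectation (\<lambda>w. ?x w ^ 2)"
    using integrable_block_power integrable_block_product[of _ _ 1 _ _ 1] by simp
  also have "expectation (\<lambda>w. ?S w ^ 1 * ?x w ^ 1) = 0"
    unfolding expectation_block_product by (simp add: expectation_block)
  finally show ?case using Suc expectation_step_power_le[of "a+m" 2] by simp
qed

text \<open>
  The odd mixed moments vanish, since the new step is centred and independent of the block. What remains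
  gives the recursion of 3 m^2, the fourth moment of a Gaussian variable with variance m.
\<close>

lemma fourth_moment_block: "expectation (\<lambda>w. block a m w ^ 4) \<le> 3 * (real m)\<^sup>2"
proof (induction m)
  case 0
  then show ?case by (simp add: block_def)
next
  case (Suc m)
  let ?S = "block a m" and ?x = "block (a + m) (Suc 0)"
  have "(block a (Suc m) w)^4 = ?S w ^ 4 + 4 * (?S w ^ 3 * ?x w ^ 1) + 6 * (?S w ^ 2 * ?x w ^ 2) + 4 * (?S w ^ 1 * ?x w ^ 3) + ?x w ^ 4" for w
    unfolding block_Suc[of a m] block_one
    by (simp add: power2_eq_square power3_eq_cube power4_eq_xxxx algebra_simps)
  then have "expectation (\<lambda>w. (block a (Suc m) w)^4) =
      expectation (\<lambda>w. ?S w ^ 4) + 4 * expectation (\<lambda>w. ?S w ^ 3 * ?x w ^ 1) + 6 * expectation (\<lambda>w. ?S w ^ 2 * ?x w ^ 2)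
      + 4 * expectation (\<lambda>w. ?S w ^ 1 * ?x w ^ 3) + expectation (\<lambda>w. ?x w ^ 4)"
    using integrable_block_power integrable_block_product[of _ _ 3 _ _ 1]
      integrable_block_product[of _ _ 2 _ _ 2] integrable_block_product[of _ _ 1 _ _ 3] by simp
  also have "expectation (\<lambda>w. ?S w ^ 3 * ?x w ^ 1) = 0"
    unfolding expectation_block_product by (simp add: expectation_block)
  also have "expectation (\<lambda>w. ?S w ^ 1 * ?x w ^ 3) = 0"
    unfolding expectation_block_product by (simp add: expectation_block)
  also have "expectation (\<lambda>w. ?S w ^ 2 * ?x w ^ 2) \<le> real m * 1"
    unfolding expectation_block_product
    by (intro mult_mono second_moment_block expectation_step_power_le integral_nonneg_AE) auto
  finally have "expectation (\<lambda>w. (block a (Suc m) w)^4) \<le> 3 * (real m)\<^sup>2 + 6 * real m + 1"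
    using Suc expectation_step_power_le[of "a+m" 4] by simp
  also have "\<dots> \<le> 3 * (real (Suc m))\<^sup>2" by (simp add: power2_eq_square algebra_simps)
  finally show ?case .
qed

text \<open>
  Kolmogorov's argument with fourth powers. At the first passage j the convexity bound
  (x + y)^4 \<ge> x^4 + 4 x^3 y compares the block up to j with the whole block, and the cross term has mean
  zero because the later steps are independent of the past. Fourth powers are needed: for m steps and a
  level L of order sqrt n the bound is of order (m/n)^2, so its sum over n/m blocks still tends
  to 0 with m/n, whereas the second moment would only give a bounded sum.
\<close>

lemma maximal_inequality:
  assumes L: "0 < L"
  shows "prob {w \<in> space M. \<exists>j\<le>m. L \<le> \<bar>block a j w\<bar>} \<le> 3 * (real m)\<^sup>2 / L ^ 4"
proof -
  define A where "A j = {w \<in> space M. L \<le> \<bar>block a j w\<bar> \<and> (\<forall>i<j. \<bar>block a i w\<bar> < L)}" for j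
  have A_meas [measurable]: "A j \<in> sets M" for j unfolding A_def by measurable
  have disj: "disjoint_family_on A {..m}"
    unfolding disjoint_family_on_def
  proof (intro ballI impI equals0I)
    fix i j w assume "i \<noteq> j" and w: "w \<in> A i \<inter> A j"
    then consider "i < j" | "j < i" by linarith
    then show False
    proof cases
      case 1
      with w have "L \<le> \<bar>block a i w\<bar>" "\<bar>block a i w\<bar> < L" unfolding A_def by blast+
      then show False by simp
    next
      case 2
      with w have "L \<le> \<bar>block a j w\<bar>" "\<bar>block a j w\<bar> < L" unfolding A_def by blast+
      then show False by simp
    qed
  qed
  have Un: "{w \<in> space M. \<exists>j\<le>m. L \<le> \<bar>block a j w\<bar>} = (\<Union>j\<in>{..m}. A j)"
  proof (intro set_eqI iffI)
    fix w assume "w \<in> {w \<in> space M. \<exists>j\<le>m. L \<le> \<bar>block a j w\<bar>}"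
    then obtain j where j: "w \<in> space M" "j \<le> m" "L \<le> \<bar>block a j w\<bar>" by auto
    define i where "i = (LEAST j. L \<le> \<bar>block a j w\<bar>)"
    have "L \<le> \<bar>block a i w\<bar>" unfolding i_def by (rule LeastI) (rule j(3))
    moreover have "i \<le> j" unfolding i_def by (rule Least_le) (rule j(3))
    moreover have "\<bar>block a k w\<bar> < L" if "k < i" for k
      using not_less_Least[of k "\<lambda>j. L \<le> \<bar>block a j w\<bar>"] that by (auto simp: i_def)
    ultimately show "w \<in> (\<Union>j\<in>{..m}. A j)" using j by (auto simp: A_def)
  qed (auto simp: A_def)
  have first_passage: "L ^ 4 * prob (A j) \<le> expectation (\<lambda>w. indicator (A j) w * block a m w ^ 4)" if j: "j \<le> m" for j
  proof -
    define F where "F x = (if L \<le> \<bar>\<Sum>k\<in>{a..<a+j}. x k\<bar> \<and> (\<forall>i<j. \<bar>\<Sum>k\<in>{a..<a+i}. x k\<bar> < L) then (\<Sum>k\<in>{a..<a+j}. x k) ^ 3 else 0)"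
      for x :: "nat \<Rightarrow> real"
    have F_eq: "F (restrict (\<lambda>i. \<xi> i w) {..<a+j}) = indicator (A j) w * block a j w ^ 3" if "w \<in> space M" for w
      using that unfolding F_def A_def block_def indicator_def by auto
    have sum_meas: "(\<lambda>x. \<Sum>k\<in>{a..<a+i}. x k) \<in> borel_measurable (PiM {..<a+j} (\<lambda>_. borel :: real measure))" if "i \<le> j" for i
      using that by (intro borel_measurable_sum measurable_component_singleton) auto
    have F_meas: "F \<in> borel_measurable (PiM {..<a+j} (\<lambda>_. borel))"
    proof -
      have [measurable]: "Measurable.pred (PiM {..<a+j} (\<lambda>_. borel)) (\<lambda>x. \<forall>i\<in>{..<j}. \<bar>\<Sum>k\<in>{a..<a+i}. x k :: real\<bar> < L)"
      proof (rule pred_intros_finite)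
        fix i assume "i \<in> {..<j}"
        then have [measurable]: "(\<lambda>x. \<Sum>k\<in>{a..<a+i}. x k) \<in> borel_measurable (PiM {..<a+j} (\<lambda>_. borel :: real measure))"
          by (intro sum_meas) auto
        show "Measurable.pred (PiM {..<a+j} (\<lambda>_. borel)) (\<lambda>x. \<bar>\<Sum>k\<in>{a..<a+i}. x k :: real\<bar> < L)" by measurable
      qed simp
      note [measurable] = sum_meas[OF order_refl]
      have "F = (\<lambda>x. if L \<le> \<bar>\<Sum>k\<in>{a..<a+j}. x k\<bar> \<and> (\<forall>i\<in>{..<j}. \<bar>\<Sum>k\<in>{a..<a+i}. x k\<bar> < L) then (\<Sum>k\<in>{a..<a+j}. x k) ^ 3 else 0)"
        by (auto simp: F_def fun_eq_iff)
      also have "\<dots> \<in> borel_measurable (PiM {..<a+j} (\<lambda>_. borel))" by measurable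
      finally show ?thesis .
    qed
    have F_bd: "AE w in M. \<bar>F (restrict (\<lambda>i. \<xi> i w) {..<a+j})\<bar> \<le> real j ^ 3"
      using AE_bounded AE_space
    proof eventually_elim
      case (elim w)
      then show ?case unfolding F_eq[OF elim(2)]
        by (auto simp: indicator_def power_abs intro!: power_mono block_le)
    qed
    have "expectation (\<lambda>w. F (restrict (\<lambda>i. \<xi> i w) {..<a+j}) * block (a+j) (m-j) w ^ 1) = 0"
      unfolding expectation_product_of_past_and_future[OF F_meas F_bd] by (simp add: expectation_block)
    also have "expectation (\<lambda>w. F (restrict (\<lambda>i. \<xi> i w) {..<a+j}) * block (a+j) (m-j) w ^ 1) =
        expectation (\<lambda>w. indicator (A j) w * block a j w ^ 3 * block (a+j) (m-j) w ^ 1)"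
      by (intro Bochner_Integration.integral_cong refl) (simp add: F_eq)
    finally have cross: "expectation (\<lambda>w. indicator (A j) w * block a j w ^ 3 * block (a+j) (m-j) w ^ 1) = 0" .
    have ind: "\<bar>indicator (A j) w :: real\<bar> \<le> 1" for w by (auto simp: indicator_def)
    have i1: "integrable M (\<lambda>w. indicator (A j) w * block a m w ^ 4)" for m
      using ind by (intro integrable_monomial[of _ 1]) auto
    have i3: "integrable M (\<lambda>w. (indicator (A j) w * block a j w ^ 3) * block (a+j) (m-j) w ^ 1)"
    proof (rule integrable_monomial)
      show "AE w in M. \<bar>indicator (A j) w * block a j w ^ 3\<bar> \<le> real j ^ 3"
        using AE_bounded by eventually_elim (auto simp: indicator_def power_abs intro!: power_mono block_le)
    qed simp
    have "L ^ 4 * prob (A j) = expectation (\<lambda>w. L ^ 4 * indicator (A j) w)" by simp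
    also have "\<dots> \<le> expectation (\<lambda>w. indicator (A j) w * block a j w ^ 4 +
        4 * (indicator (A j) w * block a j w ^ 3 * block (a+j) (m-j) w ^ 1))"
    proof -
      have "expectation (\<lambda>w. L ^ 4 * indicator (A j) w) \<le> expectation (\<lambda>w. indicator (A j) w * block a j w ^ 4)"
      proof (rule integral_mono[OF _ i1])
        fix w assume "w \<in> space M"
        have "L ^ 4 \<le> \<bar>block a j w\<bar> ^ 4" if "w \<in> A j" using that L by (intro power_mono) (auto simp: A_def)
        then show "L ^ 4 * indicator (A j) w \<le> indicator (A j) w * block a j w ^ 4"
          by (auto simp: indicator_def power_abs)
      qed (auto intro!: integrable_const_bound[of _ 1] simp: indicator_def)
      then show ?thesis using i1 i3 cross by simp
    qed
    also have "\<dots> \<le> expectation (\<lambda>w. indicator (A j) w * block a m w ^ 4)"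
    proof (rule integral_mono)
      fix w
      have convex: "x ^ 4 + 4 * (x ^ 3 * y) \<le> (x + y) ^ 4" for x y :: real
      proof -
        have "(x + y) ^ 4 - (x ^ 4 + 4 * (x ^ 3 * y)) = y\<^sup>2 * (2 * x\<^sup>2 + (2 * x + y)\<^sup>2)"
          by (simp add: power2_eq_square power3_eq_cube power4_eq_xxxx algebra_simps)
        moreover have "0 \<le> y\<^sup>2 * (2 * x\<^sup>2 + (2 * x + y)\<^sup>2)" by simp
        ultimately show ?thesis by linarith
      qed
      have "block a m w = block a j w + block (a+j) (m-j) w"
        using block_add[of a j "m-j" w] j by simp
      then show "indicator (A j) w * block a j w ^ 4 + 4 * (indicator (A j) w * block a j w ^ 3 * block (a+j) (m-j) w ^ 1)
          \<le> indicator (A j) w * block a m w ^ 4"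
        using convex[of "block a j w" "block (a+j) (m-j) w"] by (auto simp: indicator_def)
    qed (use i1 i3 in auto)
    finally show ?thesis .
  qed
  have "L ^ 4 * prob {w \<in> space M. \<exists>j\<le>m. L \<le> \<bar>block a j w\<bar>} = (\<Sum>j\<le>m. L ^ 4 * prob (A j))"
    unfolding Un using finite_measure_finite_Union[OF _ _ disj] by (simp add: sum_distrib_left image_subset_iff)
  also have "\<dots> \<le> (\<Sum>j\<le>m. expectation (\<lambda>w. indicator (A j) w * block a m w ^ 4))"
    by (intro sum_mono first_passage) simp
  also have "\<dots> = expectation (\<lambda>w. \<Sum>j\<le>m. indicator (A j) w * block a m w ^ 4)"
    by (intro Bochner_Integration.integral_sum[symmetric] integrable_monomial[of _ 1]) (auto simp: indicator_def)
  also have "\<dots> \<le> expectation (\<lambda>w. block a m w ^ 4)"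
  proof (intro integral_mono Bochner_Integration.integrable_sum integrable_monomial[of _ 1] integrable_block_power)
    fix w
    have "(\<Sum>j\<le>m. indicator (A j) w :: real) = indicator (\<Union>j\<in>{..m}. A j) w"
      using disj by (intro indicator_UN_disjoint[symmetric]) auto
    then show "(\<Sum>j\<le>m. indicator (A j) w * block a m w ^ 4) \<le> block a m w ^ 4"
      by (simp add: sum_distrib_right[symmetric] indicator_def)
  qed (auto simp: indicator_def)
  also have "\<dots> \<le> 3 * (real m)\<^sup>2" by (rule fourth_moment_block)
  finally show ?thesis using L by (simp add: field_simps)
qed

end

text \<open>
  The argument of r is the distance of k and l, written with truncated subtraction. For fixed k each
  distance occurs for at most two values of l.
\<close>

lemma sum_of_distances_le:
  fixes r :: "nat \<Rightarrow> real"
  assumes r: "\<And>m. 0 \<le> r m"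
  shows "(\<Sum>k<n. \<Sum>l<n. r ((k - l) + (l - k))) \<le> 2 * real n * (\<Sum>m<n. r m)"
proof -
  have "(\<Sum>l<n. r ((k - l) + (l - k))) \<le> 2 * (\<Sum>m<n. r m)" if k: "k < n" for k
  proof -
    have "(\<Sum>l<n. r ((k - l) + (l - k))) = (\<Sum>l\<in>{..<k}. r ((k - l) + (l - k))) + (\<Sum>l\<in>{k..<n}. r ((k - l) + (l - k)))"
      using k by (subst sum.union_disjoint[symmetric]) (auto intro!: sum.cong)
    also have "(\<Sum>l\<in>{..<k}. r ((k - l) + (l - k))) = (\<Sum>m\<in>{0<..k}. r m)"
      by (rule sum.reindex_bij_witness[of _ "\<lambda>m. k - m" "\<lambda>l. k - l"]) auto
    also have "(\<Sum>l\<in>{k..<n}. r ((k - l) + (l - k))) = (\<Sum>m\<in>{..<n-k}. r m)"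
      by (rule sum.reindex_bij_witness[of _ "\<lambda>m. m + k" "\<lambda>l. l - k"]) auto
    also have "(\<Sum>m\<in>{0<..k}. r m) \<le> (\<Sum>m<n. r m)" using k r by (intro sum_mono2) auto
    also have "(\<Sum>m\<in>{..<n-k}. r m) \<le> (\<Sum>m<n. r m)" using r by (intro sum_mono2) auto
    finally show ?thesis by simp
  qed
  then have "(\<Sum>k<n. \<Sum>l<n. r ((k - l) + (l - k))) \<le> (\<Sum>k<n. 2 * (\<Sum>m<n. r m))"
    by (intro sum_mono) auto
  then show ?thesis by simp
qed

locale sign_steps = prob_space +
  fixes \<xi> :: "nat \<Rightarrow> 'a \<Rightarrow> real" and v :: real
  assumes indep: "indep_vars (\<lambda>_. borel) \<xi> UNIV"
    and sign: "\<And>i. AE w in M. \<xi> i w = -1 \<or> \<xi> i w = 1"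
    and mean: "\<And>i. expectation (\<xi> i) = v"
begin

lemma sign_step_measurable [measurable]: "\<xi> i \<in> borel_measurable M"
  using indep by (auto simp: indep_vars_def)

lemma integrable_sign_step: "integrable M (\<xi> i)"
  using sign[of i] by (intro integrable_const_bound[of _ 1]) auto

text \<open>
  Exponential Markov inequality. The parameter A minimises the Laplace transform of a step, and the
  minimum 2 A / (A^2 + 1) is less than 1.
\<close>

lemma prob_block_eq_0_le:
  assumes A: "1 < A" and v: "v = (A\<^sup>2 - 1) / (A\<^sup>2 + 1)"
  shows "prob {w \<in> space M. (\<Sum>i\<in>{a..<a+m}. \<xi> i w) = 0} \<le> (2 * A / (A\<^sup>2 + 1)) ^ m"
proof -
  define s where "s = ln A"
  have s: "exp s = A" using A by (simp add: s_def)
  have sq: "0 < A\<^sup>2 + 1" by (intro add_nonneg_pos) auto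
  have vA: "v * (A\<^sup>2 + 1) = A\<^sup>2 - 1" using v sq by simp
  have pos: "AE w in M. \<forall>i. \<xi> i w = -1 \<or> \<xi> i w = 1" using sign by (simp add: AE_all_countable)
  have lin: "AE w in M. exp (- s * \<xi> i w) = (A + 1 / A) / 2 - \<xi> i w * ((A - 1 / A) / 2)" for i
    using sign[of i] by eventually_elim (use s in \<open>auto simp: exp_minus inverse_eq_divide field_simps\<close>)
  have E: "expectation (\<lambda>w. exp (- s * \<xi> i w)) = 2 * A / (A\<^sup>2 + 1)" for i
  proof -
    have "expectation (\<lambda>w. exp (- s * \<xi> i w)) = expectation (\<lambda>w. (A + 1 / A) / 2 - \<xi> i w * ((A - 1 / A) / 2))"
      by (intro integral_cong_AE lin) auto
    also have "\<dots> = (A + 1 / A) / 2 - v * ((A - 1 / A) / 2)"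
      using integrable_sign_step[of i] mean[of i] by (simp add: prob_space)
    also have "\<dots> = 2 * A / (A\<^sup>2 + 1)"
    proof -
      have "((A + 1 / A) / 2 - v * ((A - 1 / A) / 2)) * (A\<^sup>2 + 1) =
          (A + 1 / A) / 2 * (A\<^sup>2 + 1) - (A\<^sup>2 - 1) * ((A - 1 / A) / 2)"
        unfolding vA[symmetric] by (simp add: algebra_simps)
      also have "\<dots> = 2 * A" using A by (simp add: field_simps power2_eq_square)
      finally show ?thesis using sq by (simp add: field_simps)
    qed
    finally show ?thesis .
  qed
  have int: "integrable M (\<lambda>w. exp (- s * \<xi> i w))" for i
    using sign[of i] by (intro integrable_const_bound[of _ "exp \<bar>s\<bar>"]) auto
  have ind: "indep_vars (\<lambda>_. borel) (\<lambda>i w. exp (- s * \<xi> i w)) {a..<a+m}"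
    by (rule indep_vars_compose2[OF indep_vars_subset[OF indep]]) auto
  have "prob {w \<in> space M. (\<Sum>i\<in>{a..<a+m}. \<xi> i w) = 0} = expectation (indicat_real {w \<in> space M. (\<Sum>i\<in>{a..<a+m}. \<xi> i w) = 0})"
    by simp
  also have "\<dots> \<le> expectation (\<lambda>w. \<Prod>i\<in>{a..<a+m}. exp (- s * \<xi> i w))"
  proof (rule integral_mono)
    show "integrable M (\<lambda>w. \<Prod>i\<in>{a..<a+m}. exp (- s * \<xi> i w))"
      by (rule indep_vars_integrable[OF _ ind int]) simp
    fix w
    have "(\<Prod>i\<in>{a..<a+m}. exp (- s * \<xi> i w)) = exp (- s * (\<Sum>i\<in>{a..<a+m}. \<xi> i w))"
      by (simp add: exp_sum sum_distrib_left)
    then show "indicat_real {w \<in> space M. (\<Sum>i\<in>{a..<a+m}. \<xi> i w) = 0} w \<le> (\<Prod>i\<in>{a..<a+m}. exp (- s * \<xi> i w))"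
      by (auto simp: indicator_def)
  qed (auto intro!: integrable_const_bound[of _ 1] simp: indicator_def)
  also have "\<dots> = (\<Prod>i\<in>{a..<a+m}. expectation (\<lambda>w. exp (- s * \<xi> i w)))"
    by (rule indep_vars_lebesgue_integral[OF _ ind int]) simp
  also have "\<dots> = (2 * A / (A\<^sup>2 + 1)) ^ m" unfolding E by simp
  finally show ?thesis .
qed

end

section \<open>Gaussian limits of the simple random walk\<close>

text \<open>
  Scaling the standard normal law includes the variance 0, where no density exists.
\<close>

definition gaussian :: "real \<Rightarrow> real measure" where
  "gaussian c = distr std_normal_distribution borel (\<lambda>x. sqrt c * x)"

lemma real_distribution_gaussian: "real_distribution (gaussian c)"
proof -
  interpret real_distribution std_normal_distribution by (rule real_dist_normal_dist)
  show ?thesis unfolding gaussian_def by (intro real_distribution_distr) simp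
qed

lemma char_distr_scaled:
  assumes [measurable]: "X \<in> borel_measurable M"
  shows "char (distr M borel (\<lambda>w. c * X w)) u = char (distr M borel X) (u * c)"
  unfolding char_def by (simp add: integral_distr mult_ac)

lemma char_gaussian:
  assumes "0 \<le> c" shows "char (gaussian c) u = complex_of_real (exp (- c * u\<^sup>2 / 2))"
proof -
  have "distr std_normal_distribution borel (\<lambda>x. x) = std_normal_distribution"
    by (rule distr_id2) simp
  then have "char (gaussian c) u = char std_normal_distribution (u * sqrt c)"
    unfolding gaussian_def by (subst char_distr_scaled) (auto simp: )
  also have "\<dots> = complex_of_real (exp (- (u * sqrt c)\<^sup>2 / 2))" by (simp add: char_std_normal_distribution)
  finally show ?thesis using assms by (simp add: power_mult_distrib mult.commute)
qed

lemma gaussian_eq_density: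
  assumes "0 < c" shows "gaussian c = density lborel (normal_density 0 (sqrt c))"
proof -
  interpret prob_space std_normal_distribution
    using real_dist_normal_dist by (simp add: real_distribution_def)
  have "distributed std_normal_distribution lborel (\<lambda>x. x) std_normal_density"
    by (simp add: distributed_def distr_id2)
  from normal_density_affine[OF this, of "sqrt c" 0] assms
  have "distributed std_normal_distribution lborel (\<lambda>x. sqrt c * x) (normal_density 0 (sqrt c))" by simp
  then have "distr std_normal_distribution lborel (\<lambda>x. sqrt c * x) = density lborel (normal_density 0 (sqrt c))"
    by (simp add: distributed_def)
  moreover have "distr std_normal_distribution lborel (\<lambda>x. sqrt c * x) = gaussian c"
    unfolding gaussian_def by (intro distr_cong) auto
  ultimately show ?thesis by simp
qed

lemma cos_power_tendsto:
  assumes l: "(\<lambda>n. real (l n) / real n) \<longlonglongrightarrow> c"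
  shows "(\<lambda>n. cos (u / sqrt (real n)) ^ l n) \<longlonglongrightarrow> exp (- c * u\<^sup>2 / 2)"
proof -
  have lim: "(\<lambda>n. real n * ln (cos (u / sqrt (real n)))) \<longlonglongrightarrow> - u\<^sup>2 / 2"
    by (cases "u = 0") (simp, real_asymp simp: power2_eq_square)
  have "(\<lambda>n. cos (u / sqrt (real n))) \<longlonglongrightarrow> 1" by (cases "u = 0") (simp, real_asymp)
  then have pos: "eventually (\<lambda>n. 0 < cos (u / sqrt (real n))) sequentially" by (rule order_tendstoD) simp
  have "(\<lambda>n. exp ((real (l n) / real n) * (real n * ln (cos (u / sqrt (real n)))))) \<longlonglongrightarrow> exp (c * (- u\<^sup>2 / 2))"
    by (intro tendsto_exp tendsto_mult l lim)
  moreover have "eventually (\<lambda>n. exp ((real (l n) / real n) * (real n * ln (cos (u / sqrt (real n))))) = cos (u / sqrt (real n)) ^ l n) sequentially"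
    using pos eventually_gt_at_top[of 0]
  proof eventually_elim
    case (elim n)
    have "exp ((real (l n) / real n) * (real n * ln (cos (u / sqrt (real n))))) = exp (real (l n) * ln (cos (u / sqrt (real n))))"
      using elim by simp
    also have "\<dots> = cos (u / sqrt (real n)) ^ l n" using elim by (simp add: exp_of_nat_mult)
    finally show ?case .
  qed
  ultimately show ?thesis by (simp add: tendsto_cong)
qed

locale simple_random_walk_steps = sign_steps M \<xi> 0 for M and \<xi> :: "nat \<Rightarrow> 'a \<Rightarrow> real"
begin

sublocale centered_steps M \<xi>
proof
  show "AE w in M. \<bar>\<xi> i w\<bar> \<le> 1" for i using sign[of i] by eventually_elim auto
qed (use indep mean in auto)

lemma char_step: "char (distr M borel (\<xi> i)) u = complex_of_real (cos u)"
proof -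
  have "char (distr M borel (\<xi> i)) u = expectation (\<lambda>w. iexp (u * \<xi> i w))"
    unfolding char_def by (subst integral_distr) auto
  also have "\<dots> = expectation (\<lambda>w. complex_of_real (cos u) + \<i> * complex_of_real (sin u) * complex_of_real (\<xi> i w))"
  proof (rule integral_cong_AE)
    show "AE w in M. iexp (u * \<xi> i w) = complex_of_real (cos u) + \<i> * complex_of_real (sin u) * complex_of_real (\<xi> i w)"
      using sign[of i]
    proof eventually_elim
      case (elim w)
      then show ?case by (auto simp: exp_Euler cos_of_real sin_of_real)
    qed
  qed auto
  also have "\<dots> = complex_of_real (cos u)"
    using integrable_sign_step[of i] mean[of i] by (simp add: prob_space)
  finally show ?thesis .
qed

lemma char_block: "char (distr M borel (block a m)) u = complex_of_real (cos u ^ m)"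
proof -
  have "char (distr M borel (\<lambda>w. \<Sum>i\<in>{a..<a+m}. \<xi> i w)) u = (\<Prod>i\<in>{a..<a+m}. char (distr M borel (\<xi> i)) u)"
    by (rule char_distr_sum[OF indep_vars_subset[OF indep]]) simp
  then show ?thesis by (simp add: char_step block_def[abs_def])
qed

text \<open>
  The characteristic function of a block of m steps is the m-th power of a cosine; Levy's continuity
  theorem applies.
\<close>

lemma weak_conv_block:
  assumes l: "(\<lambda>n. real (l n) / real n) \<longlonglongrightarrow> c" and c: "0 \<le> c"
  shows "weak_conv_m (\<lambda>n. distr M borel (\<lambda>w. block (a n) (l n) w / sqrt (real n))) (gaussian c)"
proof (rule levy_continuity)
  show "real_distribution (distr M borel (\<lambda>w. block (a n) (l n) w / sqrt (real n)))" for n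
    by (intro real_distribution_distr) simp
  show "real_distribution (gaussian c)" by (rule real_distribution_gaussian)
  fix u
  have "char (distr M borel (\<lambda>w. block (a n) (l n) w / sqrt (real n))) u = complex_of_real (cos (u / sqrt (real n)) ^ l n)" for n
    using char_distr_scaled[of "block (a n) (l n)" M "1 / sqrt (real n)" u] char_block[of "a n" "l n" "u / sqrt (real n)"] by simp
  then show "(\<lambda>n. char (distr M borel (\<lambda>w. block (a n) (l n) w / sqrt (real n))) u) \<longlonglongrightarrow> char (gaussian c) u"
    unfolding char_gaussian[OF c] by (simp only: tendsto_of_real_iff cos_power_tendsto[OF l])
qed

lemma prob_block_eq_0_shift:
  "prob {w \<in> space M. block a m w = 0} = prob {w \<in> space M. block 0 m w = 0}"
proof -
  have "distr M borel (block a m) = distr M borel (block 0 m)"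
    by (rule Levy_uniqueness) (auto intro!: real_distribution_distr simp: fun_eq_iff char_block)
  then have "measure (distr M borel (block a m)) {0} = measure (distr M borel (block 0 m)) {0}" by simp
  then show ?thesis by (simp add: measure_distr vimage_def Int_def conj_commute)
qed

text \<open>
  The Gaussian limit has no atom at 0. Tent functions of width 1/k, which majorise the indicator of 0,
  carry this over to the walk.
\<close>

lemma prob_block_eq_0_tendsto: "(\<lambda>m. prob {w \<in> space M. block 0 m w = 0}) \<longlonglongrightarrow> 0"
proof -
  let ?\<mu> = "\<lambda>n. distr M borel (\<lambda>w. block 0 n w / sqrt (real n))"
  have one: "(\<lambda>n. real n / real n) \<longlonglongrightarrow> 1" by real_asymp
  have wc: "weak_conv_m ?\<mu> (gaussian 1)" by (rule weak_conv_block[OF one]) simp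
  interpret G: real_distribution "gaussian 1" by (rule real_distribution_gaussian)
  have rd: "real_distribution (?\<mu> n)" for n by (intro real_distribution_distr) simp
  define f where "f k x = max 0 (1 - real k * \<bar>x\<bar>)" for k :: nat and x :: real
  have f_meas [measurable]: "f k \<in> borel_measurable borel" for k unfolding f_def by measurable
  have f_bd: "0 \<le> f k x" "f k x \<le> 1" for k x by (auto simp: f_def)
  have "(\<lambda>k. \<integral>x. f k x \<partial>gaussian 1) \<longlonglongrightarrow> (\<integral>x. indicator {0} x \<partial>gaussian 1)"
  proof (rule integral_dominated_convergence[where w="\<lambda>_. 1"])
    show "AE x in gaussian 1. (\<lambda>k. f k x) \<longlonglongrightarrow> indicator {0} x"
    proof (intro AE_I2)
      fix x :: real
      show "(\<lambda>k. f k x) \<longlonglongrightarrow> indicator {0} x"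
      proof (cases "x = 0")
        case False
        obtain K :: nat where K: "1 < real K * \<bar>x\<bar>" using ex_less_of_nat_mult[of "\<bar>x\<bar>" 1] False by auto
        have "eventually (\<lambda>k. f k x = 0) sequentially"
        proof (rule eventually_sequentiallyI[of K])
          fix k assume "K \<le> k"
          then have "real K * \<bar>x\<bar> \<le> real k * \<bar>x\<bar>" by (intro mult_right_mono) auto
          with K show "f k x = 0" by (simp add: f_def)
        qed
        then show ?thesis using False by (simp add: tendsto_eventually)
      qed (simp add: f_def)
    qed
  qed (use f_bd in auto)
  also have "(\<integral>x. indicator {0} x \<partial>gaussian 1) = (0::real)"
  proof -
    have "emeasure (gaussian 1) {0} = 0"
      unfolding gaussian_eq_density[OF zero_less_one]
      by (simp add: emeasure_density nn_integral_null_set finite_imp_null_set_lborel)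
    then show ?thesis by (simp add: measure_def)
  qed
  finally have fk: "(\<lambda>k. \<integral>x. f k x \<partial>gaussian 1) \<longlonglongrightarrow> 0" .
  show ?thesis
  proof (rule LIMSEQ_I)
    fix e :: real assume e: "0 < e"
    obtain k where k: "(\<integral>x. f k x \<partial>gaussian 1) < e"
      using order_tendstoD(2)[OF fk e] by (auto dest: eventually_happens)
    have "(\<lambda>n. \<integral>x. f k x \<partial>?\<mu> n) \<longlonglongrightarrow> (\<integral>x. f k x \<partial>gaussian 1)"
      using f_bd by (intro weak_conv_imp_integral_bdd_continuous_conv[OF rd G.real_distribution_axioms wc, where B=1])
        (auto simp: f_def intro!: continuous_intros)
    then have "eventually (\<lambda>n. (\<integral>x. f k x \<partial>?\<mu> n) < e) sequentially" using k by (rule order_tendstoD)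
    then have "eventually (\<lambda>n. norm (prob {w \<in> space M. block 0 n w = 0} - 0) < e) sequentially"
    proof eventually_elim
      case (elim n)
      have "prob {w \<in> space M. block 0 n w = 0} = expectation (indicat_real {w \<in> space M. block 0 n w = 0})" by simp
      also have "\<dots> \<le> expectation (\<lambda>w. f k (block 0 n w / sqrt (real n)))"
      proof (rule integral_mono)
        show "integrable M (\<lambda>w. f k (block 0 n w / sqrt (real n)))"
          using f_bd by (intro integrable_const_bound[of _ 1]) auto
        show "indicat_real {w \<in> space M. block 0 n w = 0} w \<le> f k (block 0 n w / sqrt (real n))" for w
          using f_bd by (auto simp: indicator_def f_def)
      qed (auto intro!: integrable_const_bound[of _ 1] simp: indicator_def)
      also have "\<dots> = (\<integral>x. f k x \<partial>?\<mu> n)" by (subst integral_distr) auto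
      finally show ?case using elim by simp
    qed
    then show "\<exists>no. \<forall>n\<ge>no. norm (prob {w \<in> space M. block 0 n w = 0} - 0) < e"
      by (simp add: eventually_sequentially)
  qed
qed

end

section \<open>Independence\<close>

lemma product_coordinates_indep:
  assumes N: "\<And>i. i \<in> I \<Longrightarrow> prob_space (N i)" and I: "I \<noteq> {}" and S: "\<And>i. i \<in> I \<Longrightarrow> sets (N i) = sets (S i)"
  shows "prob_space.indep_vars (PiM I N) S (\<lambda>i w. w i) I"
proof -
  interpret prob_space "PiM I N" by (rule prob_space_PiM) (rule N)
  have rv: "(\<lambda>w. w i) \<in> PiM I N \<rightarrow>\<^sub>M S i" if "i \<in> I" for i
    using measurable_component_singleton[OF that, of N] S[OF that] by (simp cong: measurable_cong_sets)
  show ?thesis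
  proof (subst indep_vars_iff_distr_eq_PiM'[OF I rv])
    have "distr (PiM I N) (PiM I S) (\<lambda>x. \<lambda>i\<in>I. x i) = distr (PiM I N) (PiM I N) (\<lambda>x. x)"
      by (intro distr_cong sets_PiM_cong) (auto simp: S space_PiM PiE_restrict)
    also have "\<dots> = PiM I N" by (simp add: distr_id)
    also have "\<dots> = PiM I (\<lambda>i. distr (PiM I N) (S i) (\<lambda>x. x i))"
    proof (rule PiM_cong[OF refl])
      fix i assume i: "i \<in> I"
      have "distr (PiM I N) (S i) (\<lambda>x. x i) = distr (PiM I N) (N i) (\<lambda>x. x i)"
        by (intro distr_cong) (auto simp: S i)
      also have "\<dots> = N i" using N i by (rule distr_PiM_component)
      finally show "N i = distr (PiM I N) (S i) (\<lambda>x. x i)" by simp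
    qed
    finally show "distr (PiM I N) (PiM I S) (\<lambda>x. \<lambda>i\<in>I. x i) = PiM I (\<lambda>i. distr (PiM I N) (S i) (\<lambda>x. x i))" .
  qed
qed

context prob_space
begin

text \<open>
  A finite subfamily meets finitely many of the groups J l. The probability of an intersection factors
  over the groups first, and then inside each group.
\<close>

lemma indep_vars_UN:
  fixes Y :: "'i \<Rightarrow> 'a \<Rightarrow> real"
  assumes disj: "disjoint_family_on J L" and within: "\<And>l. l \<in> L \<Longrightarrow> indep_vars (\<lambda>_. borel) Y (J l)"
    and across: "indep_vars (\<lambda>l. PiM (J l) (\<lambda>_. borel)) (\<lambda>l w. restrict (\<lambda>j. Y j w) (J l)) L"
  shows "indep_vars (\<lambda>_. borel) Y (\<Union>l\<in>L. J l)"
  unfolding indep_vars_def2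
proof (intro conjI ballI indep_setsI)
  have rv: "random_variable borel (Y j)" if "j \<in> (\<Union>l\<in>L. J l)" for j
    using that within unfolding indep_vars_def2 by blast
  then show "random_variable borel (Y j)" if "j \<in> (\<Union>l\<in>L. J l)" for j using that .
  show "{Y j -` A \<inter> space M |A. A \<in> sets borel} \<subseteq> events" if "j \<in> (\<Union>l\<in>L. J l)" for j
    using rv[OF that] by (auto intro: measurable_sets)
  fix A F
  assume F: "F \<noteq> {}" "F \<subseteq> (\<Union>l\<in>L. J l)" "finite F"
    and A: "\<forall>j\<in>F. A j \<in> {Y j -` A \<inter> space M |A. A \<in> sets borel}"
  have "\<forall>j\<in>F. \<exists>B. B \<in> sets borel \<and> A j = Y j -` B \<inter> space M" using A by auto
  then obtain B where B: "\<And>j. j \<in> F \<Longrightarrow> B j \<in> sets borel" "\<And>j. j \<in> F \<Longrightarrow> A j = Y j -` B j \<inter> space M"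
    by metis
  define G where "G = {l\<in>L. J l \<inter> F \<noteq> {}}"
  have G_L: "G \<subseteq> L" by (auto simp: G_def)
  have "\<forall>j\<in>F. \<exists>l\<in>L. j \<in> J l" using F by auto
  then obtain k where k: "\<And>j. j \<in> F \<Longrightarrow> k j \<in> L \<and> j \<in> J (k j)" by metis
  have "G \<subseteq> k ` F"
  proof
    fix l assume "l \<in> G"
    then obtain j where j: "l \<in> L" "j \<in> J l" "j \<in> F" by (auto simp: G_def)
    then have "l = k j" using k[of j] disj by (auto simp: disjoint_family_on_def)
    then show "l \<in> k ` F" using j by auto
  qed
  then have fin: "finite G" using F finite_surj by blast
  have "k j \<in> G" if "j \<in> F" for j using k[OF that] that by (auto simp: G_def)
  with k have F_eq: "F = (\<Union>l\<in>G. J l \<inter> F)" by blast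
  have ne: "G \<noteq> {}" using F F_eq by auto
  define C where "C l = {x \<in> space (PiM (J l) (\<lambda>_. borel)). \<forall>j\<in>J l \<inter> F. x j \<in> B j}" for l
  have C: "C l \<in> sets (PiM (J l) (\<lambda>_. borel))" for l
  proof -
    have "C l = space (PiM (J l) (\<lambda>_. borel)) \<inter> (\<Inter>j\<in>J l \<inter> F. {x \<in> space (PiM (J l) (\<lambda>_. borel)). x j \<in> B j})"
      by (auto simp: C_def)
    also have "\<dots> \<in> sets (PiM (J l) (\<lambda>_. borel))"
    proof (cases "J l \<inter> F = {}")
      case False
      have "{x \<in> space (PiM (J l) (\<lambda>_. borel)). x j \<in> B j} \<in> sets (PiM (J l) (\<lambda>_. borel))" if "j \<in> J l \<inter> F" for j
        by (rule sets_Collect_single'[of _ _ "\<lambda>_. borel"]) (use that B in auto)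
      then show ?thesis using False F by (intro sets.Int sets.finite_INT) auto
    qed simp
    finally show ?thesis .
  qed
  have pre: "(\<lambda>w. restrict (\<lambda>j. Y j w) (J l)) -` C l \<inter> space M = (\<Inter>j\<in>J l \<inter> F. A j)" if "l \<in> G" for l
  proof -
    have "J l \<inter> F \<noteq> {}" using that by (auto simp: G_def)
    moreover have "A j = Y j -` B j \<inter> space M" if "j \<in> J l \<inter> F" for j using B that by auto
    ultimately show ?thesis by (auto simp: C_def space_PiM)
  qed
  have one: "prob (\<Inter>j\<in>J l \<inter> F. A j) = (\<Prod>j\<in>J l \<inter> F. prob (A j))" if l: "l \<in> G" for l
  proof -
    have "prob (\<Inter>j\<in>J l \<inter> F. Y j -` B j \<inter> space M) = (\<Prod>j\<in>J l \<inter> F. prob (Y j -` B j \<inter> space M))"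
      using l F B by (intro indep_varsD[OF within, of l]) (auto simp: G_def)
    then show ?thesis using B by simp
  qed
  have "prob (\<Inter>j\<in>F. A j) = prob (\<Inter>l\<in>G. (\<lambda>w. restrict (\<lambda>j. Y j w) (J l)) -` C l \<inter> space M)"
  proof -
    have "(\<Inter>j\<in>F. A j) = (\<Inter>l\<in>G. \<Inter>j\<in>J l \<inter> F. A j)" using F_eq by blast
    then show ?thesis using pre by simp
  qed
  also have "\<dots> = (\<Prod>l\<in>G. prob ((\<lambda>w. restrict (\<lambda>j. Y j w) (J l)) -` C l \<inter> space M))"
    by (rule indep_varsD[OF across ne fin G_L C])
  also have "\<dots> = (\<Prod>l\<in>G. \<Prod>j\<in>J l \<inter> F. prob (A j))" using pre one by simp
  also have "\<dots> = (\<Prod>j\<in>(\<Union>l\<in>G. J l \<inter> F). prob (A j))"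
  proof (intro prod.UNION_disjoint[symmetric] ballI impI)
    fix i j assume "i \<in> G" "j \<in> G" "i \<noteq> j"
    then have "J i \<inter> J j = {}" using disj G_L by (auto simp: disjoint_family_on_def)
    then show "J i \<inter> F \<inter> (J j \<inter> F) = {}" by auto
  qed (use fin F in auto)
  also have "\<dots> = (\<Prod>j\<in>F. prob (A j))" using F_eq by simp
  finally show "prob (\<Inter>j\<in>F. A j) = (\<Prod>j\<in>F. prob (A j))" .
qed

text \<open>
  Independence is determined by closed sets, whose indicators are decreasing limits of continuous
  functions of the distance to the set. For bounded continuous functions the product formula passes to
  almost sure limits.
\<close>

lemma indep_vars_limit:
  fixes X :: "nat \<Rightarrow> 'i \<Rightarrow> 'a \<Rightarrow> real"
  assumes ind: "\<And>n. indep_vars (\<lambda>_. borel) (X n) I"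
    and Y: "\<And>i. i \<in> I \<Longrightarrow> random_variable borel (Y i)"
    and lim: "\<And>i. i \<in> I \<Longrightarrow> AE w in M. (\<lambda>n. X n i w) \<longlonglongrightarrow> Y i w"
  shows "indep_vars (\<lambda>_. borel) Y I"
proof -
  have fin: "indep_vars (\<lambda>_. borel) Y J" if J: "J \<subseteq> I" "J \<noteq> {}" "finite J" for J
  proof -
    define g where "g k A x = (if A = {} then 0 else max 0 (1 - real k * infdist x A))" for k :: nat and A :: "real set" and x
    have g_bd: "0 \<le> g k A x" "g k A x \<le> 1" for k A x by (auto simp: g_def infdist_nonneg)
    have g_abs: "\<bar>g k A x\<bar> \<le> 1" for k A x using g_bd[of k A x] by simp
    have g_cont: "isCont (g k A) x" for k A x
      by (cases "A = {}") (auto simp: g_def[abs_def] intro!: continuous_intros)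
    have g_meas [measurable]: "g k A \<in> borel_measurable borel" for k A
      by (intro borel_measurable_continuous_onI continuous_at_imp_continuous_on) (simp add: g_cont)
    have g_lim: "(\<lambda>k. g k A x) \<longlonglongrightarrow> indicator A x" if A: "closed A" for A x
    proof (cases "x \<in> A \<or> A = {}")
      case True
      then show ?thesis by (cases "A = {}") (auto simp: g_def[abs_def] infdist_zero)
    next
      case False
      then have "0 < infdist x A" using A infdist_pos_not_in_closed by blast
      then obtain K :: nat where K: "1 < real K * infdist x A" using ex_less_of_nat_mult by blast
      have "eventually (\<lambda>k. g k A x = 0) sequentially"
      proof (rule eventually_sequentiallyI[of K])
        fix k assume "K \<le> k"
        then have "real K * infdist x A \<le> real k * infdist x A" by (intro mult_right_mono) (auto simp: infdist_nonneg)
        with K show "g k A x = 0" by (simp add: g_def)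
      qed
      then show ?thesis using False by (simp add: tendsto_eventually)
    qed
    have X_meas [measurable]: "random_variable borel (X n i)" if "i \<in> J" for n i
      using ind[of n] J that by (auto simp: indep_vars_def2)
    have Y_meas [measurable]: "random_variable borel (Y i)" if "i \<in> J" for i using Y J that by auto
    have prod_bd: "\<bar>\<Prod>j\<in>J. h j\<bar> \<le> 1" if "\<And>j. 0 \<le> h j" "\<And>j. h j \<le> (1::real)" for h
      using that by (auto simp: abs_prod intro!: prod_le_1)
    have int1: "integrable M (\<lambda>_. 1 :: real)" by simp
    show ?thesis
    proof (subst indep_vars_finite[OF J(2,3), where E="\<lambda>_. Collect closed"])
      show "\<forall>A\<in>J \<rightarrow> Collect closed. prob (\<Inter>j\<in>J. Y j -` A j \<inter> space M) = (\<Prod>j\<in>J. prob (Y j -` A j \<inter> space M))"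
      proof
        fix A :: "'i \<Rightarrow> real set" assume "A \<in> J \<rightarrow> Collect closed"
        then have A: "\<And>j. j \<in> J \<Longrightarrow> closed (A j)" by auto
        have step: "expectation (\<lambda>w. \<Prod>j\<in>J. g k (A j) (Y j w)) = (\<Prod>j\<in>J. expectation (\<lambda>w. g k (A j) (Y j w)))" for k
        proof (rule LIMSEQ_unique)
          have AE: "AE w in M. \<forall>j\<in>J. (\<lambda>n. X n j w) \<longlonglongrightarrow> Y j w"
            using lim J by (intro AE_finite_allI) auto
          show "(\<lambda>n. expectation (\<lambda>w. \<Prod>j\<in>J. g k (A j) (X n j w))) \<longlonglongrightarrow> expectation (\<lambda>w. \<Prod>j\<in>J. g k (A j) (Y j w))"
          proof (rule integral_dominated_convergence[OF _ _ int1])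
            show "AE w in M. (\<lambda>n. \<Prod>j\<in>J. g k (A j) (X n j w)) \<longlonglongrightarrow> (\<Prod>j\<in>J. g k (A j) (Y j w))"
              using AE
            proof eventually_elim
              case (elim w)
              then show ?case by (intro tendsto_prod isCont_tendsto_compose[OF g_cont]) auto
            qed
          qed (auto intro!: borel_measurable_prod AE_I2 prod_bd g_bd simp: abs_prod[symmetric])
          have "expectation (\<lambda>w. \<Prod>j\<in>J. g k (A j) (X n j w)) = (\<Prod>j\<in>J. expectation (\<lambda>w. g k (A j) (X n j w)))" for n
          proof (rule indep_vars_lebesgue_integral[OF J(3)])
            show "indep_vars (\<lambda>_. borel) (\<lambda>i w. g k (A i) (X n i w)) J"
              by (rule indep_vars_compose2[OF indep_vars_subset[OF ind J(1)]]) simp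
            show "integrable M (\<lambda>w. g k (A i) (X n i w))" if "i \<in> J" for i
              using g_bd that by (intro integrable_const_bound[of _ 1]) auto
          qed
          moreover have "(\<lambda>n. \<Prod>j\<in>J. expectation (\<lambda>w. g k (A j) (X n j w))) \<longlonglongrightarrow> (\<Prod>j\<in>J. expectation (\<lambda>w. g k (A j) (Y j w)))"
          proof (intro tendsto_prod integral_dominated_convergence[OF _ _ int1])
            show "AE w in M. (\<lambda>n. g k (A j) (X n j w)) \<longlonglongrightarrow> g k (A j) (Y j w)" if "j \<in> J" for j
              using AE by eventually_elim (use that in \<open>auto intro!: isCont_tendsto_compose[OF g_cont]\<close>)
          qed (use g_bd in auto)
          ultimately show "(\<lambda>n. expectation (\<lambda>w. \<Prod>j\<in>J. g k (A j) (X n j w))) \<longlonglongrightarrow> (\<Prod>j\<in>J. expectation (\<lambda>w. g k (A j) (Y j w)))"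
            by simp
        qed
        have L: "(\<lambda>k. expectation (\<lambda>w. \<Prod>j\<in>J. g k (A j) (Y j w))) \<longlonglongrightarrow> expectation (\<lambda>w. \<Prod>j\<in>J. indicator (A j) (Y j w))"
        proof (rule integral_dominated_convergence[OF _ _ int1])
          show "(\<lambda>w. \<Prod>j\<in>J. indicator (A j) (Y j w) :: real) \<in> borel_measurable M"
          proof (rule borel_measurable_prod)
            fix j assume j: "j \<in> J"
            have [measurable]: "A j \<in> sets borel" using A[OF j] by simp
            show "(\<lambda>w. indicator (A j) (Y j w) :: real) \<in> borel_measurable M" using j by measurable
          qed
        qed (auto intro!: borel_measurable_prod AE_I2 prod_bd g_bd tendsto_prod g_lim A simp: abs_prod[symmetric])
        have R: "(\<lambda>k. expectation (\<lambda>w. g k (A j) (Y j w))) \<longlonglongrightarrow> expectation (\<lambda>w. indicator (A j) (Y j w))" if j: "j \<in> J" for j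
        proof (rule integral_dominated_convergence[OF _ _ int1])
          have [measurable]: "A j \<in> sets borel" using A[OF j] by simp
          show "(\<lambda>w. indicator (A j) (Y j w) :: real) \<in> borel_measurable M" using j by measurable
        qed (use j in \<open>auto intro!: AE_I2 g_abs g_lim A\<close>)
        have "expectation (\<lambda>w. \<Prod>j\<in>J. indicator (A j) (Y j w)) = (\<Prod>j\<in>J. expectation (\<lambda>w. indicator (A j) (Y j w)) :: real)"
          by (rule LIMSEQ_unique[OF L]) (unfold step, intro tendsto_prod R)
        moreover have "expectation (\<lambda>w. \<Prod>j\<in>J. indicator (A j) (Y j w)) = prob (\<Inter>j\<in>J. Y j -` A j \<inter> space M)"
        proof -
          have "expectation (\<lambda>w. \<Prod>j\<in>J. indicator (A j) (Y j w)) = expectation (indicat_real (\<Inter>j\<in>J. Y j -` A j \<inter> space M))"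
            using J by (intro Bochner_Integration.integral_cong refl) (auto simp: indicator_def prod_zero_iff)
          also have "\<dots> = prob (\<Inter>j\<in>J. Y j -` A j \<inter> space M)"
            using J by (simp add: Int_absorb1 subset_iff)
          finally show ?thesis .
        qed
        moreover have "expectation (\<lambda>w. indicator (A j) (Y j w)) = prob (Y j -` A j \<inter> space M)" for j
        proof -
          have "expectation (\<lambda>w. indicator (A j) (Y j w)) = expectation (indicat_real (Y j -` A j \<inter> space M))"
            by (intro Bochner_Integration.integral_cong refl) (auto simp: indicator_def)
          then show ?thesis by simp
        qed
        ultimately show "prob (\<Inter>j\<in>J. Y j -` A j \<inter> space M) = (\<Prod>j\<in>J. prob (Y j -` A j \<inter> space M))" by simp
      qed
    qed (auto simp: borel_eq_closed Int_stable_def intro!: Y_meas[unfolded borel_eq_closed])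
  qed
  show ?thesis
    unfolding indep_vars_def2
  proof (intro conjI ballI Y)
    show "indep_sets (\<lambda>i. {Y i -` A \<inter> space M |A. A \<in> sets borel}) I"
      using fin unfolding indep_vars_def2 by (subst indep_sets_finite_index_sets) blast
  qed
qed

lemma indep_vars_insert_two:
  fixes Y :: "'i \<Rightarrow> 'a \<Rightarrow> real"
  assumes ind: "indep_var borel (Y p) borel (Y q)" and pq: "p \<noteq> q"
  shows "indep_vars (\<lambda>_. borel) Y {p, q}"
  unfolding indep_vars_def2
proof (intro conjI ballI indep_setsI)
  have rv: "random_variable borel (Y p)" "random_variable borel (Y q)"
    using ind unfolding indep_var_distribution_eq by auto
  then show "random_variable borel (Y i)" if "i \<in> {p, q}" for i using that by auto
  show "{Y i -` A \<inter> space M |A. A \<in> sets borel} \<subseteq> events" if "i \<in> {p, q}" for i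
    using rv that by (auto intro: measurable_sets)
  fix A F assume F: "F \<noteq> {}" "F \<subseteq> {p, q}" "finite F" and A: "\<forall>j\<in>F. A j \<in> {Y j -` A \<inter> space M |A. A \<in> sets borel}"
  from F consider "F = {p}" | "F = {q}" | "F = {p, q}" by blast
  then show "prob (\<Inter>j\<in>F. A j) = (\<Prod>j\<in>F. prob (A j))"
  proof cases
    case 3
    then obtain P Q where PQ: "P \<in> sets borel" "A p = Y p -` P \<inter> space M" "Q \<in> sets borel" "A q = Y q -` Q \<inter> space M"
      using A by auto
    have "(\<Inter>j\<in>F. A j) = (\<lambda>w. (Y p w, Y q w)) -` (P \<times> Q) \<inter> space M" using 3 PQ by auto
    then show ?thesis using 3 pq PQ indep_varD[OF ind PQ(1,3)] by simp
  qed auto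
qed

lemma indep_vars_singleton:
  assumes "random_variable borel (Y i)"
  shows "indep_vars (\<lambda>_. borel) Y {i}"
  unfolding indep_vars_def2
proof (intro conjI ballI indep_setsI)
  fix A F assume F: "F \<noteq> {}" "F \<subseteq> {i}"
  then have "F = {i}" by auto
  then show "prob (\<Inter>j\<in>F. A j) = (\<Prod>j\<in>F. prob (A j))" by simp
qed (use assms in \<open>auto intro: measurable_sets\<close>)

lemma distr_pair_snd:
  assumes "prob_space N"
  shows "distr (M \<Otimes>\<^sub>M N) N snd = N"
proof (rule measure_eqI)
  interpret N: prob_space N by fact
  fix A assume "A \<in> sets (distr (M \<Otimes>\<^sub>M N) N snd)"
  then have A: "A \<in> sets N" by simp
  have "snd -` A \<inter> space (M \<Otimes>\<^sub>M N) = space M \<times> A"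
    using sets.sets_into_space[OF A] by (auto simp: space_pair_measure)
  then show "emeasure (distr (M \<Otimes>\<^sub>M N) N snd) A = emeasure N A"
    using A by (simp add: emeasure_distr N.emeasure_pair_measure_Times emeasure_space_1)
qed simp

end

section \<open>Rotation of Gaussian pairs\<close>

text \<open>
  Since (u + v)^2 + (u - v)^2 = 2 u^2 + 2 v^2, the product density separates in the new variables; the
  factor 2 is the Jacobian determinant. The change of variables is made in one coordinate at a time,
  with an exchange of the order of integration in between.
\<close>

lemma gaussian_rotation_density:
  assumes a: "0 < a"
  shows "distr (gaussian a \<Otimes>\<^sub>M gaussian a) (borel \<Otimes>\<^sub>M borel) (\<lambda>(x, y). ((x + y) / 2, (x - y) / 2)) =
    gaussian (a / 2) \<Otimes>\<^sub>M gaussian (a / 2)"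
proof (rule measure_eqI)
  define f where "f = normal_density 0 (sqrt a)"
  define g where "g = normal_density 0 (sqrt (a / 2))"
  have ga: "gaussian a = density lborel f" "gaussian (a / 2) = density lborel g"
    unfolding f_def g_def using a by (simp_all add: gaussian_eq_density)
  have [measurable]: "f \<in> borel_measurable borel" "g \<in> borel_measurable borel" by (simp_all add: f_def g_def)
  have f0: "0 \<le> f x" "0 \<le> g x" for x by (simp_all add: f_def g_def normal_density_nonneg)
  interpret real_distribution "gaussian a" by (rule real_distribution_gaussian)
  interpret G: real_distribution "gaussian (a/2)" by (rule real_distribution_gaussian)
  have sets_g [measurable_cong]: "sets (gaussian b) = sets borel" for b by (simp add: gaussian_def)
  show "sets (distr (gaussian a \<Otimes>\<^sub>M gaussian a) (borel \<Otimes>\<^sub>M borel) (\<lambda>(x, y). ((x + y) / 2, (x - y) / 2))) =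
    sets (gaussian (a / 2) \<Otimes>\<^sub>M gaussian (a / 2))"
    by (simp add: sets_g cong: sets_pair_measure_cong)
  fix A assume "A \<in> sets (distr (gaussian a \<Otimes>\<^sub>M gaussian a) (borel \<Otimes>\<^sub>M borel) (\<lambda>(x, y). ((x + y) / 2, (x - y) / 2)))"
  then have A [measurable]: "A \<in> sets (borel \<Otimes>\<^sub>M borel)" by simp
  define h where "h u v = (indicator A (u, v) :: ennreal)" for u v :: real
  have h_meas [measurable]: "(\<lambda>(u, v). h u v) \<in> borel_measurable (borel \<Otimes>\<^sub>M borel)"
    unfolding h_def by (simp add: case_prod_beta)
  have A_pair: "A \<in> sets (gaussian (a / 2) \<Otimes>\<^sub>M gaussian (a / 2))"
    using A by (simp add: sets_g cong: sets_pair_measure_cong)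
  have T [measurable]: "(\<lambda>(x, y). ((x + y) / 2, (x - y) / 2)) \<in> gaussian a \<Otimes>\<^sub>M gaussian a \<rightarrow>\<^sub>M borel \<Otimes>\<^sub>M (borel :: real measure)"
    by measurable
  have "emeasure (distr (gaussian a \<Otimes>\<^sub>M gaussian a) (borel \<Otimes>\<^sub>M borel) (\<lambda>(x, y). ((x + y) / 2, (x - y) / 2))) A =
      (\<integral>\<^sup>+p. indicator A p \<partial>distr (gaussian a \<Otimes>\<^sub>M gaussian a) (borel \<Otimes>\<^sub>M borel) (\<lambda>(x, y). ((x + y) / 2, (x - y) / 2)))"
    by simp
  also have "\<dots> = (\<integral>\<^sup>+p. (case p of (x, y) \<Rightarrow> h ((x + y) / 2) ((x - y) / 2)) \<partial>(gaussian a \<Otimes>\<^sub>M gaussian a))"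
    by (subst nn_integral_distr) (auto simp: h_def case_prod_unfold)
  also have "\<dots> = (\<integral>\<^sup>+x. \<integral>\<^sup>+y. h ((x + y) / 2) ((x - y) / 2) \<partial>gaussian a \<partial>gaussian a)"
    by (subst nn_integral_fst[symmetric]) (auto simp: case_prod_unfold)
  also have "\<dots> = (\<integral>\<^sup>+x. \<integral>\<^sup>+y. ennreal (f x) * (ennreal (f y) * h ((x + y) / 2) ((x - y) / 2)) \<partial>lborel \<partial>lborel)"
    unfolding ga by (simp add: nn_integral_density nn_integral_cmult)
  also have "\<dots> = (\<integral>\<^sup>+x. \<integral>\<^sup>+u. 2 * (ennreal (f x) * (ennreal (f (2 * u - x)) * h u (x - u))) \<partial>lborel \<partial>lborel)"
  proof (rule nn_integral_cong)
    fix x :: real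
    have "(\<integral>\<^sup>+y. ennreal (f x) * (ennreal (f y) * h ((x + y) / 2) ((x - y) / 2)) \<partial>lborel) =
      \<bar>2::real\<bar> * (\<integral>\<^sup>+u. ennreal (f x) * (ennreal (f (- x + 2 * u)) * h ((x + (- x + 2 * u)) / 2) ((x - (- x + 2 * u)) / 2)) \<partial>lborel)"
      by (rule nn_integral_real_affine) auto
    also have "\<dots> = (\<integral>\<^sup>+u. 2 * (ennreal (f x) * (ennreal (f (2 * u - x)) * h u (x - u))) \<partial>lborel)"
    proof -
      have e: "- x + 2 * u = 2 * u - x" "(x + (2 * u - x)) / 2 = u" "(x - (2 * u - x)) / 2 = x - u" for u
        by (simp_all add: field_simps)
      show ?thesis unfolding e by (subst nn_integral_cmult[symmetric]) (auto simp: mult_ac)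
    qed
    finally show "(\<integral>\<^sup>+y. ennreal (f x) * (ennreal (f y) * h ((x + y) / 2) ((x - y) / 2)) \<partial>lborel) =
      (\<integral>\<^sup>+u. 2 * (ennreal (f x) * (ennreal (f (2 * u - x)) * h u (x - u))) \<partial>lborel)" .
  qed
  also have "\<dots> = (\<integral>\<^sup>+u. \<integral>\<^sup>+x. 2 * (ennreal (f x) * (ennreal (f (2 * u - x)) * h u (x - u))) \<partial>lborel \<partial>lborel)"
    by (rule lborel_pair.Fubini') measurable
  also have "\<dots> = (\<integral>\<^sup>+u. \<integral>\<^sup>+v. 2 * (ennreal (f (u + v)) * (ennreal (f (u - v)) * h u v)) \<partial>lborel \<partial>lborel)"
  proof (rule nn_integral_cong)
    fix u :: real
    show "(\<integral>\<^sup>+x. 2 * (ennreal (f x) * (ennreal (f (2 * u - x)) * h u (x - u))) \<partial>lborel) =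
        (\<integral>\<^sup>+v. 2 * (ennreal (f (u + v)) * (ennreal (f (u - v)) * h u v)) \<partial>lborel)"
      by (subst nn_integral_real_affine[of _ 1 u]) auto
  qed
  also have "\<dots> = (\<integral>\<^sup>+u. \<integral>\<^sup>+v. ennreal (g u) * (ennreal (g v) * h u v) \<partial>lborel \<partial>lborel)"
  proof (intro nn_integral_cong)
    fix u v :: real
    have "2 * (f (u + v) * f (u - v)) = g u * g v"
      unfolding f_def g_def normal_density_def using a
      by (simp add: exp_add[symmetric] real_sqrt_mult[symmetric] power2_eq_square field_simps)
    then have "2 * (ennreal (f (u + v)) * ennreal (f (u - v))) = ennreal (g u) * ennreal (g v)"
      using f0 by (simp add: ennreal_mult'[symmetric] ennreal_numeral[symmetric] del: ennreal_numeral)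
    then show "2 * (ennreal (f (u + v)) * (ennreal (f (u - v)) * h u v)) = ennreal (g u) * (ennreal (g v) * h u v)"
      by (simp add: mult.assoc[symmetric])
  qed
  also have "\<dots> = (\<integral>\<^sup>+u. \<integral>\<^sup>+v. h u v \<partial>gaussian (a / 2) \<partial>gaussian (a / 2))"
    unfolding ga by (simp add: nn_integral_density nn_integral_cmult)
  also have "\<dots> = (\<integral>\<^sup>+p. (case p of (u, v) \<Rightarrow> h u v) \<partial>(gaussian (a / 2) \<Otimes>\<^sub>M gaussian (a / 2)))"
    by (subst G.nn_integral_fst[symmetric]) (auto simp: case_prod_unfold)
  also have "\<dots> = emeasure (gaussian (a / 2) \<Otimes>\<^sub>M gaussian (a / 2)) A"
    using A_pair by (simp add: h_def case_prod_unfold)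
  finally show "emeasure (distr (gaussian a \<Otimes>\<^sub>M gaussian a) (borel \<Otimes>\<^sub>M borel) (\<lambda>(x, y). ((x + y) / 2, (x - y) / 2))) A =
      emeasure (gaussian (a / 2) \<Otimes>\<^sub>M gaussian (a / 2)) A" .
qed

text \<open>
  This is the splitting of a Brownian increment X at the midpoint of its interval with the help of a
  fresh Gaussian variable Z.
\<close>

lemma (in prob_space) gaussian_rotation:
  assumes ind: "indep_var borel X borel Z" and X: "distr M borel X = gaussian a" and Z: "distr M borel Z = gaussian a"
    and a: "0 < a"
  shows "indep_var borel (\<lambda>w. (X w + Z w) / 2) borel (\<lambda>w. (X w - Z w) / 2)"
    "distr M borel (\<lambda>w. (X w + Z w) / 2) = gaussian (a / 2)" "distr M borel (\<lambda>w. (X w - Z w) / 2) = gaussian (a / 2)"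
proof -
  have rv [measurable]: "X \<in> borel_measurable M" "Z \<in> borel_measurable M"
    using ind unfolding indep_var_distribution_eq by auto
  interpret G: real_distribution "gaussian (a/2)" by (rule real_distribution_gaussian)
  have sets_g [measurable_cong]: "sets (gaussian b) = sets borel" for b by (simp add: gaussian_def)
  have "distr M (borel \<Otimes>\<^sub>M borel) (\<lambda>w. (X w, Z w)) = gaussian a \<Otimes>\<^sub>M gaussian a"
    using ind X Z unfolding indep_var_distribution_eq by simp
  then have "distr (distr M (borel \<Otimes>\<^sub>M borel) (\<lambda>w. (X w, Z w))) (borel \<Otimes>\<^sub>M borel) (\<lambda>(x, y). ((x + y) / 2, (x - y) / 2)) =
      gaussian (a / 2) \<Otimes>\<^sub>M gaussian (a / 2)"
    by (simp add: gaussian_rotation_density[OF a])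
  then have J: "distr M (borel \<Otimes>\<^sub>M borel) (\<lambda>w. ((X w + Z w) / 2, (X w - Z w) / 2)) = gaussian (a / 2) \<Otimes>\<^sub>M gaussian (a / 2)"
    by (subst (asm) distr_distr) (auto simp: comp_def)
  have "distr M borel (\<lambda>w. (X w + Z w) / 2) = distr (distr M (borel \<Otimes>\<^sub>M borel) (\<lambda>w. ((X w + Z w) / 2, (X w - Z w) / 2))) borel fst"
    by (subst distr_distr) (auto simp: comp_def)
  also have "\<dots> = distr (gaussian (a / 2) \<Otimes>\<^sub>M gaussian (a / 2)) (gaussian (a / 2)) fst"
    unfolding J by (intro distr_cong) (auto simp: sets_g)
  also have "\<dots> = gaussian (a / 2)" by (rule G.distr_pair_fst)
  finally show U: "distr M borel (\<lambda>w. (X w + Z w) / 2) = gaussian (a / 2)" .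
  have "distr M borel (\<lambda>w. (X w - Z w) / 2) = distr (distr M (borel \<Otimes>\<^sub>M borel) (\<lambda>w. ((X w + Z w) / 2, (X w - Z w) / 2))) borel snd"
    by (subst distr_distr) (auto simp: comp_def)
  also have "\<dots> = distr (gaussian (a / 2) \<Otimes>\<^sub>M gaussian (a / 2)) (gaussian (a / 2)) snd"
    unfolding J by (intro distr_cong) (auto simp: sets_g)
  also have "\<dots> = gaussian (a / 2)" by (rule G.distr_pair_snd) (rule G.prob_space_axioms)
  finally show V: "distr M borel (\<lambda>w. (X w - Z w) / 2) = gaussian (a / 2)" .
  show "indep_var borel (\<lambda>w. (X w + Z w) / 2) borel (\<lambda>w. (X w - Z w) / 2)"
    unfolding indep_var_distribution_eq U V J by simp
qed

section \<open>Brownian motion\<close>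

definition white_noise :: "(real \<Rightarrow> real) measure" where
  "white_noise = PiM UNIV (\<lambda>_. std_normal_distribution)"

text \<open>
  The noise is a double array; it is stored at the real coordinates that are codes of pairs of natural
  numbers.
\<close>

definition noise :: "nat \<Rightarrow> nat \<Rightarrow> (real \<Rightarrow> real) \<Rightarrow> real" where
  "noise n k w = w (real (prod_encode (n, k)))"

text \<open>
  The increment of the Brownian path over the k-th dyadic interval of length 2 to the power -n. An
  increment of level n and a fresh noise variable of the same variance are rotated into the increments
  over the two halves.
\<close>

fun dyadic_increment :: "nat \<Rightarrow> nat \<Rightarrow> (real \<Rightarrow> real) \<Rightarrow> real" where
  "dyadic_increment 0 k w = noise 0 k w"
| "dyadic_increment (Suc n) k w =
    (dyadic_increment n (k div 2) w + (if even k then 1 else -1) * (sqrt ((1/2) ^ n) * noise (Suc n) (k div 2) w)) / 2"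

interpretation white_noise: prob_space white_noise
  unfolding white_noise_def using real_dist_normal_dist by (intro prob_space_PiM) (auto simp: real_distribution_def)

lemma noise_indep: "white_noise.indep_vars (\<lambda>_. borel) (\<lambda>(n, k). noise n k) UNIV"
proof -
  have "white_noise.indep_vars (\<lambda>_. borel) (\<lambda>i w. w i) (UNIV :: real set)"
    unfolding white_noise_def using real_dist_normal_dist
    by (intro product_coordinates_indep) (auto simp: real_distribution_def)
  then have "white_noise.indep_vars (\<lambda>l. PiM {real (prod_encode l)} (\<lambda>_. borel))
      (\<lambda>l w. restrict (\<lambda>i. w i) {real (prod_encode l)}) (UNIV :: (nat \<times> nat) set)"
    by (rule white_noise.indep_vars_restrict) (auto simp: disjoint_family_on_def prod_encode_eq)
  then have "white_noise.indep_vars (\<lambda>_. borel) (\<lambda>l w. restrict (\<lambda>i. w i) {real (prod_encode l)} (real (prod_encode l)))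
      (UNIV :: (nat \<times> nat) set)"
    by (rule white_noise.indep_vars_compose2) (auto intro: measurable_component_singleton)
  moreover have "(\<lambda>l w. restrict (\<lambda>i. w i) {real (prod_encode l)} (real (prod_encode l))) = (\<lambda>(n, k). noise n k)"
    by (auto simp: fun_eq_iff noise_def)
  ultimately show ?thesis by simp
qed

lemma noise_measurable [measurable]: "noise n k \<in> borel_measurable white_noise"
  using noise_indep unfolding white_noise.indep_vars_def2 by force

lemma dyadic_increment_measurable [measurable]: "dyadic_increment n k \<in> borel_measurable white_noise"
proof (induction n arbitrary: k)
  case 0
  have "dyadic_increment 0 k = noise 0 k" by (simp add: fun_eq_iff)
  then show ?case by simp
next
  case (Suc n)
  note [measurable] = Suc
  have "dyadic_increment (Suc n) k = (\<lambda>w. (dyadic_increment n (k div 2) w +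
      (if even k then 1 else -1) * (sqrt ((1/2) ^ n) * noise (Suc n) (k div 2) w)) / 2)"
    by (simp add: fun_eq_iff)
  also have "\<dots> \<in> borel_measurable white_noise" by measurable
  finally show ?case .
qed

lemma gaussian_1: "gaussian 1 = std_normal_distribution"
  using gaussian_eq_density[of 1] by simp

lemma distr_noise: "distr white_noise borel (noise n k) = gaussian 1"
proof -
  have "distr white_noise borel (noise n k) = distr white_noise std_normal_distribution (\<lambda>w. w (real (prod_encode (n, k))))"
    by (rule distr_cong) (auto simp: noise_def)
  also have "\<dots> = std_normal_distribution"
    unfolding white_noise_def using real_dist_normal_dist by (intro distr_PiM_component) (auto simp: real_distribution_def)
  finally show ?thesis by (simp add: gaussian_1)
qed

lemma distr_scaled_noise: "distr white_noise borel (\<lambda>w. sqrt a * noise n k w) = gaussian a"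
proof -
  have "distr white_noise borel (\<lambda>w. sqrt a * noise n k w) = distr (distr white_noise borel (noise n k)) borel (\<lambda>x. sqrt a * x)"
    by (subst distr_distr) (auto simp: comp_def)
  also have "\<dots> = gaussian a" unfolding distr_noise gaussian_1 by (simp add: gaussian_def)
  finally show ?thesis .
qed

text \<open>
  The increments of level n together with the noise of all later levels. Independence of this whole
  family is what passes from one level to the next.
\<close>

definition level_family :: "nat \<Rightarrow> nat \<times> nat \<Rightarrow> (real \<Rightarrow> real) \<Rightarrow> real" where
  "level_family n = (\<lambda>(m, k). if m = n then dyadic_increment n k else noise m k)"

lemma level_family_measurable [measurable]: "level_family n l \<in> borel_measurable white_noise"
  by (cases l) (simp add: level_family_def)

text \<open>
  In the step from n to n + 1 each increment of level n and the noise variable used to split it are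
  replaced by their rotation. Different pairs are built from disjoint sets of variables of the old
  family, and the two members of a pair are independent by the rotation of Gaussian pairs.
\<close>

lemma level_family_properties:
  "white_noise.indep_vars (\<lambda>_. borel) (level_family n) ({n..} \<times> UNIV) \<and>
   (\<forall>k. distr white_noise borel (dyadic_increment n k) = gaussian ((1/2) ^ n))"
proof (induction n)
  case 0
  have "level_family 0 = (\<lambda>(n, k). noise n k)" by (auto simp: level_family_def fun_eq_iff)
  moreover have "dyadic_increment 0 k = noise 0 k" for k by (simp add: fun_eq_iff)
  ultimately show ?case using noise_indep by (simp add: distr_noise)
next
  case (Suc n)
  let ?X = "level_family n" and ?Y = "level_family (Suc n)"
  define s where "s = sqrt ((1/2) ^ n :: real)"
  have pos: "0 < ((1/2) ^ n :: real)" by simp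
  note ind = conjunct1[OF Suc]
  have lawX: "distr white_noise borel (?X (n, k)) = gaussian ((1/2) ^ n)" for k
    using conjunct2[OF Suc] by (simp add: level_family_def)
  \<comment> \<open>The new variables with indices in J l are functions of the old ones with indices in K l.\<close>
  define J where "J = (\<lambda>(m, k :: nat). if m = Suc n then {(m, 2 * k), (m, 2 * k + 1)} else {(m, k)})"
  define K where "K = (\<lambda>(m, k :: nat). if m = Suc n then {(n, k), (m, k)} else {(m, k)})"
  define L where "L = {Suc n..} \<times> (UNIV :: nat set)"
  have Y_even: "?Y (Suc n, 2 * k) = (\<lambda>w. (?X (n, k) w + s * ?X (Suc n, k) w) / 2)" for k
    by (simp add: level_family_def fun_eq_iff s_def)
  have Y_odd: "?Y (Suc n, 2 * k + 1) = (\<lambda>w. (?X (n, k) w - s * ?X (Suc n, k) w) / 2)" for k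
    by (simp add: level_family_def fun_eq_iff s_def)
  have Y_later: "?Y (m, k) = ?X (m, k)" if "m \<noteq> Suc n" "m \<noteq> n" for m k
    using that by (simp add: level_family_def)
  have pair: "white_noise.indep_var borel (?X (n, k)) borel (\<lambda>w. s * ?X (Suc n, k) w)" for k
  proof -
    have "white_noise.indep_var borel ((\<lambda>x. x (n, k)) \<circ> (\<lambda>w. restrict (\<lambda>i. ?X i w) {(n, k)}))
       borel ((\<lambda>x. s * x (Suc n, k)) \<circ> (\<lambda>w. restrict (\<lambda>i. ?X i w) {(Suc n, k)}))"
      by (rule white_noise.indep_var_compose[OF white_noise.indep_var_restrict[OF ind]])
        (auto intro!: borel_measurable_times measurable_component_singleton)
    then show ?thesis by (simp add: comp_def)
  qed
  have lawZ: "distr white_noise borel (\<lambda>w. s * ?X (Suc n, k) w) = gaussian ((1/2) ^ n)" for k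
    using distr_scaled_noise[of "(1/2) ^ n" "Suc n" k] by (simp add: level_family_def s_def)
  note rotation = white_noise.gaussian_rotation[OF pair lawX lawZ pos]
  have "white_noise.indep_vars (\<lambda>_. borel) ?Y (\<Union>l\<in>L. J l)"
  proof (rule white_noise.indep_vars_UN)
    show "disjoint_family_on J L"
      unfolding disjoint_family_on_def J_def by (auto split: if_splits)
    show "white_noise.indep_vars (\<lambda>_. borel) ?Y (J l)" if l: "l \<in> L" for l
    proof (cases "fst l = Suc n")
      case True
      then have "J l = {(Suc n, 2 * snd l), (Suc n, 2 * snd l + 1)}" by (auto simp: J_def case_prod_beta)
      moreover have "white_noise.indep_vars (\<lambda>_. borel) ?Y {(Suc n, 2 * snd l), (Suc n, 2 * snd l + 1)}"
        by (rule white_noise.indep_vars_insert_two) (unfold Y_even Y_odd, rule rotation, simp)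
      ultimately show ?thesis by simp
    next
      case False
      then have "J l = {l}" by (auto simp: J_def case_prod_beta)
      then show ?thesis by (simp add: white_noise.indep_vars_singleton)
    qed
    define G where "G l x = (\<lambda>j\<in>J l. if fst l = Suc n
        then (x (n, snd l) + (if even (snd j) then 1 else -1) * (s * x (Suc n, snd l))) / 2 else x l)"
      for l and x :: "nat \<times> nat \<Rightarrow> real"
    have "white_noise.indep_vars (\<lambda>l. PiM (J l) (\<lambda>_. borel)) (\<lambda>l w. G l (restrict (\<lambda>i. ?X i w) (K l))) L"
    proof (rule white_noise.indep_vars_compose2[OF white_noise.indep_vars_restrict[OF ind]])
      show "K l \<subseteq> {n..} \<times> UNIV" if "l \<in> L" for l using that by (auto simp: K_def L_def case_prod_beta)
      show "disjoint_family_on K L" unfolding disjoint_family_on_def K_def L_def by (auto split: if_splits)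
      show "G l \<in> PiM (K l) (\<lambda>_. borel) \<rightarrow>\<^sub>M PiM (J l) (\<lambda>_. borel)" if "l \<in> L" for l
        unfolding G_def
      proof (rule measurable_restrict)
        fix j assume "j \<in> J l"
        show "(\<lambda>x. if fst l = Suc n then (x (n, snd l) + (if even (snd j) then 1 else -1) * (s * x (Suc n, snd l))) / 2 else x l)
            \<in> borel_measurable (PiM (K l) (\<lambda>_. borel))"
        proof (cases "fst l = Suc n")
          case True
          then have "(\<lambda>x. x (n, snd l)) \<in> borel_measurable (PiM (K l) (\<lambda>_. borel :: real measure))"
            "(\<lambda>x. x (Suc n, snd l)) \<in> borel_measurable (PiM (K l) (\<lambda>_. borel :: real measure))"
            by (auto intro!: measurable_component_singleton simp: K_def case_prod_beta)
          then show ?thesis using True by simp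
        next
          case False
          then have "l \<in> K l" by (auto simp: K_def case_prod_beta)
          then show ?thesis using False by (simp add: measurable_component_singleton)
        qed
      qed
    qed
    moreover have "G l (restrict (\<lambda>i. ?X i w) (K l)) = restrict (\<lambda>j. ?Y j w) (J l)" if l: "l \<in> L" for l w
    proof (cases "fst l = Suc n")
      case True
      then obtain k where l': "l = (Suc n, k)" by (cases l) auto
      show ?thesis
        unfolding l' G_def using Y_even[of k] Y_odd[of k] by (auto simp: J_def K_def fun_eq_iff restrict_def)
    next
      case False
      then have "fst l \<noteq> n" using l by (auto simp: L_def)
      then have "?Y l = ?X l" using False Y_later[of "fst l" "snd l"] by simp
      then show ?thesis
        using False by (auto simp: G_def J_def K_def fun_eq_iff restrict_def case_prod_beta)
    qed
    ultimately show "white_noise.indep_vars (\<lambda>l. PiM (J l) (\<lambda>_. borel)) (\<lambda>l w. restrict (\<lambda>j. ?Y j w) (J l)) L"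
      by (subst white_noise.indep_vars_cong[OF refl _ refl]) (auto simp: fun_eq_iff)
  qed
  also have "(\<Union>l\<in>L. J l) = {Suc n..} \<times> UNIV"
  proof (intro set_eqI iffI)
    fix l assume l: "l \<in> {Suc n..} \<times> (UNIV :: nat set)"
    show "l \<in> (\<Union>l\<in>L. J l)"
    proof (cases "fst l = Suc n")
      case True
      have "snd l = 2 * (snd l div 2) \<or> snd l = 2 * (snd l div 2) + 1" by presburger
      then have "l \<in> J (Suc n, snd l div 2)" using True by (cases l) (auto simp: J_def)
      then show ?thesis by (auto simp: L_def)
    next
      case False
      then have "l \<in> J l" by (auto simp: J_def case_prod_beta)
      then show ?thesis using l by (auto simp: L_def)
    qed
  qed (auto simp: L_def J_def split: if_splits)
  finally have indY: "white_noise.indep_vars (\<lambda>_. borel) ?Y ({Suc n..} \<times> UNIV)" .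
  have "distr white_noise borel (dyadic_increment (Suc n) k) = gaussian ((1/2) ^ Suc n)" for k
  proof -
    have Y: "dyadic_increment (Suc n) k = ?Y (Suc n, k)" by (simp add: level_family_def fun_eq_iff)
    obtain j where "k = 2 * j \<or> k = 2 * j + 1" by (metis oddE evenE)
    then have "distr white_noise borel (?Y (Suc n, k)) = gaussian ((1/2) ^ n / 2)"
      using rotation(2,3)[of j] Y_even[of j] Y_odd[of j] by auto
    then show ?thesis unfolding Y by simp
  qed
  with indY show ?case by blast
qed

lemma dyadic_increment_indep: "white_noise.indep_vars (\<lambda>_. borel) (dyadic_increment n) UNIV"
proof -
  have "white_noise.indep_vars (\<lambda>l. PiM {(n, l)} (\<lambda>_. borel)) (\<lambda>l w. restrict (\<lambda>i. level_family n i w) {(n, l)}) UNIV"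
    by (rule white_noise.indep_vars_restrict[OF conjunct1[OF level_family_properties[of n]]]) (auto simp: disjoint_family_on_def)
  then have "white_noise.indep_vars (\<lambda>_. borel) (\<lambda>l w. restrict (\<lambda>i. level_family n i w) {(n, l)} (n, l)) UNIV"
    by (rule white_noise.indep_vars_compose2) (auto intro: measurable_component_singleton)
  moreover have "(\<lambda>l w. restrict (\<lambda>i. level_family n i w) {(n, l)} (n, l)) = dyadic_increment n"
    by (auto simp: fun_eq_iff level_family_def)
  ultimately show ?thesis by simp
qed

lemma distr_dyadic_increment: "distr white_noise borel (dyadic_increment n k) = gaussian ((1/2) ^ n)"
  using level_family_properties[of n] by blast

lemma char_distr_eq_expectation:
  assumes "X \<in> borel_measurable M"
  shows "char (distr M borel X) u = (\<integral>w. iexp (u * X w) \<partial>M)"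
  using assms unfolding char_def by (subst integral_distr) auto

text \<open>
  The approximation of the Brownian path at the k-th dyadic point of level n.
\<close>

definition dyadic_walk :: "nat \<Rightarrow> nat \<Rightarrow> (real \<Rightarrow> real) \<Rightarrow> real" where
  "dyadic_walk n k w = (\<Sum>j<k. dyadic_increment n j w)"

lemma dyadic_walk_measurable [measurable]: "dyadic_walk n k \<in> borel_measurable white_noise"
  unfolding dyadic_walk_def by measurable

lemma dyadic_walk_refine: "dyadic_walk (Suc n) (2 * k) w = dyadic_walk n k w"
proof (induction k)
  case (Suc k)
  have "dyadic_walk (Suc n) (2 * Suc k) w = dyadic_walk (Suc n) (2 * k) w + dyadic_increment n k w"
    by (simp add: dyadic_walk_def field_simps)
  then show ?case using Suc by (simp add: dyadic_walk_def)
qed (simp add: dyadic_walk_def)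

definition dyadic_index :: "nat \<Rightarrow> real \<Rightarrow> nat" where
  "dyadic_index n t = nat \<lfloor>2 ^ n * t\<rfloor>"

lemma dyadic_index_bounds:
  assumes "0 \<le> t"
  shows "real (dyadic_index n t) \<le> 2 ^ n * t" "2 ^ n * t < real (dyadic_index n t) + 1"
  using assms unfolding dyadic_index_def by (auto simp: of_nat_nat)

lemma dyadic_index_Suc:
  assumes "0 \<le> t"
  shows "dyadic_index (Suc n) t = 2 * dyadic_index n t \<or> dyadic_index (Suc n) t = 2 * dyadic_index n t + 1"
proof -
  have "real (dyadic_index (Suc n) t) < 2 * real (dyadic_index n t) + 2"
    "2 * real (dyadic_index n t) < real (dyadic_index (Suc n) t) + 1"
    using dyadic_index_bounds[OF assms, of n] dyadic_index_bounds[OF assms, of "Suc n"] by auto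
  then show ?thesis by linarith
qed

lemma dyadic_index_tendsto:
  assumes "0 \<le> t"
  shows "(\<lambda>n. real (dyadic_index n t) * (1/2) ^ n) \<longlonglongrightarrow> t"
proof (rule tendsto_sandwich)
  show "(\<lambda>n. t - (1/2) ^ n) \<longlonglongrightarrow> t"
    using tendsto_diff[OF tendsto_const LIMSEQ_realpow_zero[of "1/2 :: real"], of t] by simp
  show "\<forall>\<^sub>F n in sequentially. t - (1/2) ^ n \<le> real (dyadic_index n t) * (1/2) ^ n"
  proof (intro always_eventually allI)
    fix n
    have "(2 ^ n * t - 1) * (1/2) ^ n \<le> real (dyadic_index n t) * (1/2) ^ n"
      using dyadic_index_bounds(2)[OF assms, of n] by (intro mult_right_mono) auto
    then show "t - (1/2) ^ n \<le> real (dyadic_index n t) * (1/2) ^ n" by (simp add: field_simps power_one_over)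
  qed
  show "\<forall>\<^sub>F n in sequentially. real (dyadic_index n t) * (1/2) ^ n \<le> t"
    using dyadic_index_bounds(1)[OF assms] by (intro always_eventually allI) (simp add: field_simps power_one_over)
qed auto

text \<open>
  The base 9/10 lies between 1 and the fourth root of 1/2. The first bound makes the increments of
  successive levels summable; the second makes the exceptional probabilities, obtained from fourth
  moments and about T 2^n increments, summable as well.
\<close>

definition regular_noise :: "(real \<Rightarrow> real) set" where
  "regular_noise = {w \<in> space white_noise. \<forall>T. eventually (\<lambda>n. \<forall>k\<le>T * 2 ^ n. \<bar>dyadic_increment n k w\<bar> \<le> (9/10) ^ n) sequentially}"

lemma regular_noise_measurable [measurable]: "regular_noise \<in> sets white_noise"
  unfolding regular_noise_def eventually_sequentially by measurable

lemma prob_dyadic_increment_large: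
  "white_noise.prob {w \<in> space white_noise. (9/10) ^ n < \<bar>dyadic_increment n k w\<bar>} \<le> 3 * ((1/4) / (9/10) ^ 4) ^ n"
proof -
  have std: "integrable std_normal_distribution (\<lambda>x. x ^ 4)" "(\<integral>x. x ^ 4 \<partial>std_normal_distribution) = 3"
    using std_normal_distribution_even_moments[of 2] by (simp_all add: fact_numeral)
  have law: "distr white_noise borel (dyadic_increment n k) = gaussian ((1/2) ^ n)" by (rule distr_dyadic_increment)
  have eq4: "(\<lambda>x. (sqrt ((1/2) ^ n) * x) ^ 4) = (\<lambda>x. (1/4) ^ n * x ^ 4 :: real)"
  proof
    fix x :: real
    have "sqrt ((1/2) ^ n) ^ 4 = ((sqrt ((1/2) ^ n))\<^sup>2)\<^sup>2" by (simp only: power_mult[symmetric]) simp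
    also have "\<dots> = (1/4) ^ n" by (simp add: power2_eq_square power_mult_distrib[symmetric])
    finally show "(sqrt ((1/2) ^ n) * x) ^ 4 = (1/4) ^ n * x ^ 4" by (simp add: power_mult_distrib)
  qed
  have int: "integrable (gaussian ((1/2) ^ n)) (\<lambda>x. x ^ 4)" "(\<integral>x. x ^ 4 \<partial>gaussian ((1/2) ^ n)) = 3 * (1/4) ^ n"
    unfolding gaussian_def using std by (simp_all add: integrable_distr_eq integral_distr eq4)
  have i: "integrable white_noise (\<lambda>w. dyadic_increment n k w ^ 4)"
    using int(1) unfolding law[symmetric] by (simp add: integrable_distr_eq)
  have E: "white_noise.expectation (\<lambda>w. dyadic_increment n k w ^ 4) = 3 * (1/4) ^ n"
    using int(2) unfolding law[symmetric] by (simp add: integral_distr)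
  have "white_noise.prob {w \<in> space white_noise. (9/10) ^ n < \<bar>dyadic_increment n k w\<bar>}
      \<le> white_noise.prob {w \<in> space white_noise. ((9/10) ^ n) ^ 4 \<le> dyadic_increment n k w ^ 4}"
  proof (rule white_noise.finite_measure_mono)
    show "{w \<in> space white_noise. (9/10) ^ n < \<bar>dyadic_increment n k w\<bar>} \<subseteq>
        {w \<in> space white_noise. ((9/10) ^ n) ^ 4 \<le> dyadic_increment n k w ^ 4}"
    proof safe
      fix w assume "(9/10) ^ n < \<bar>dyadic_increment n k w\<bar>"
      then have "((9/10) ^ n) ^ 4 \<le> \<bar>dyadic_increment n k w\<bar> ^ 4" by (intro power_mono) auto
      then show "((9/10) ^ n) ^ 4 \<le> dyadic_increment n k w ^ 4" by (simp add: power_abs)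
    qed
  qed measurable
  also have "\<dots> \<le> white_noise.expectation (\<lambda>w. dyadic_increment n k w ^ 4) / ((9/10) ^ n) ^ 4"
    by (rule integral_Markov_inequality_measure[OF i, where A="{}"]) auto
  also have "\<dots> = 3 * ((1/4) / (9/10) ^ 4) ^ n"
  proof -
    have "((9/10) ^ n) ^ 4 = ((9/10) ^ 4 :: real) ^ n" by (simp only: power_mult[symmetric] mult.commute)
    moreover have "3 * (1/4) ^ n / c ^ n = 3 * ((1/4) / c) ^ n" for c :: real by (simp add: power_divide)
    ultimately show ?thesis unfolding E by simp
  qed
  finally show ?thesis .
qed

lemma AE_regular_noise: "AE w in white_noise. w \<in> regular_noise"
proof -
  have "AE w in white_noise. eventually (\<lambda>n. \<forall>k\<le>T * 2 ^ n. \<bar>dyadic_increment n k w\<bar> \<le> (9/10) ^ n) sequentially" for T :: nat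
  proof -
    define A where "A n = {w \<in> space white_noise. \<exists>k\<le>T * 2 ^ n. (9/10) ^ n < \<bar>dyadic_increment n k w\<bar>}" for n
    have A: "A n \<in> sets white_noise" for n unfolding A_def by measurable
    define r where "r = 2 * ((1/4) / (9/10) ^ 4 :: real)"
    have r: "0 < r" "r < 1" by (simp_all add: r_def power4_eq_xxxx)
    have A_le: "white_noise.prob (A n) \<le> 3 * (real T + 1) * r ^ n" for n
    proof -
      have "white_noise.prob (A n) = white_noise.prob (\<Union>k\<in>{..T * 2 ^ n}. {w \<in> space white_noise. (9/10) ^ n < \<bar>dyadic_increment n k w\<bar>})"
        unfolding A_def by (intro arg_cong[where f="white_noise.prob"]) auto
      also have "\<dots> \<le> (\<Sum>k\<le>T * 2 ^ n. white_noise.prob {w \<in> space white_noise. (9/10) ^ n < \<bar>dyadic_increment n k w\<bar>})"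
        by (rule white_noise.finite_measure_subadditive_finite) auto
      also have "\<dots> \<le> (\<Sum>k\<le>T * 2 ^ n. 3 * ((1/4) / (9/10) ^ 4) ^ n)"
        by (intro sum_mono prob_dyadic_increment_large)
      also have "\<dots> = (real T * 2 ^ n + 1) * (3 * ((1/4) / (9/10) ^ 4) ^ n)" by (simp add: algebra_simps)
      also have "\<dots> \<le> ((real T + 1) * 2 ^ n) * (3 * ((1/4) / (9/10) ^ 4) ^ n)"
        by (intro mult_right_mono) (auto simp: algebra_simps)
      also have "\<dots> = 3 * (real T + 1) * r ^ n" unfolding r_def power_mult_distrib by simp
      finally show ?thesis .
    qed
    have "summable (\<lambda>n. white_noise.prob (A n))"
    proof (rule summable_comparison_test')
      show "summable (\<lambda>n. 3 * (real T + 1) * r ^ n)" using r by (intro summable_mult summable_geometric) auto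
      show "norm (white_noise.prob (A n)) \<le> 3 * (real T + 1) * r ^ n" if "n \<ge> 0" for n using A_le[of n] by simp
    qed
    then have "AE w in white_noise. eventually (\<lambda>n. w \<in> space white_noise - A n) sequentially"
      by (intro borel_cantelli_AE1 A) (simp_all add: white_noise.emeasure_eq_measure)
    then show ?thesis
      by eventually_elim (auto elim!: eventually_mono simp: A_def not_less)
  qed
  then have "AE w in white_noise. \<forall>T. eventually (\<lambda>n. \<forall>k\<le>T * 2 ^ n. \<bar>dyadic_increment n k w\<bar> \<le> (9/10) ^ n) sequentially"
    by (simp add: AE_all_countable)
  with AE_space show ?thesis by eventually_elim (auto simp: regular_noise_def)
qed

text \<open>
  On the null set where the noise is not regular the path is constant, so that every path is continuous.
\<close>

definition brownian_path :: "real \<Rightarrow> (real \<Rightarrow> real) \<Rightarrow> real" where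
  "brownian_path t w = (if w \<in> regular_noise then lim (\<lambda>n. dyadic_walk n (dyadic_index n t) w) else 0)"

lemma brownian_path_measurable [measurable]: "brownian_path t \<in> borel_measurable white_noise"
  unfolding brownian_path_def by measurable

lemma small_power:
  fixes c e :: real
  assumes c: "0 < c" and e: "0 < e"
  obtains n where "c * (9/10) ^ n < e" "N \<le> n"
proof -
  obtain k where k: "(9/10) ^ k < e / c" using real_arch_pow_inv[of "e / c" "9/10"] c e by auto
  have "(9/10 :: real) ^ (N + k) \<le> (9/10) ^ k" by (intro power_decreasing) auto
  with k have "(9/10) ^ (N + k) < e / c" by linarith
  then show ?thesis using c by (intro that[of "N + k"]) (simp_all add: field_simps)
qed

text \<open>
  Passing to the next level changes the approximation at t by at most one increment of that level. The
  changes are therefore bounded by a geometric series.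
\<close>

lemma dyadic_walk_approximation:
  assumes w: "w \<in> regular_noise"
  shows "\<exists>N. (\<forall>n\<ge>N. \<forall>k\<le>T * 2 ^ n. \<bar>dyadic_increment n k w\<bar> \<le> (9/10) ^ n) \<and>
    (\<forall>t. 0 \<le> t \<and> t \<le> real T \<longrightarrow> (\<lambda>n. dyadic_walk n (dyadic_index n t) w) \<longlonglongrightarrow> brownian_path t w) \<and>
    (\<forall>n\<ge>N. \<forall>t. 0 \<le> t \<and> t \<le> real T \<longrightarrow> \<bar>dyadic_walk n (dyadic_index n t) w - brownian_path t w\<bar> \<le> 10 * (9/10) ^ n)"
proof -
  obtain N where N: "\<And>n k. n \<ge> N \<Longrightarrow> k \<le> T * 2 ^ n \<Longrightarrow> \<bar>dyadic_increment n k w\<bar> \<le> (9/10) ^ n"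
    using w unfolding regular_noise_def eventually_sequentially by blast
  have conv: "(\<lambda>n. dyadic_walk n (dyadic_index n t) w) \<longlonglongrightarrow> brownian_path t w \<and>
      (\<forall>n\<ge>N. \<bar>dyadic_walk n (dyadic_index n t) w - brownian_path t w\<bar> \<le> 10 * (9/10) ^ n)" if t: "0 \<le> t" "t \<le> real T" for t
  proof -
    define a where "a n = dyadic_walk n (dyadic_index n t) w" for n
    have step: "\<bar>a (Suc n) - a n\<bar> \<le> (9/10) ^ Suc n" if n: "n \<ge> N" for n
    proof (cases "dyadic_index (Suc n) t = 2 * dyadic_index n t")
      case True
      then show ?thesis by (simp add: a_def dyadic_walk_refine)
    next
      case False
      then have i: "dyadic_index (Suc n) t = 2 * dyadic_index n t + 1" using dyadic_index_Suc[OF t(1), of n] by auto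
      have "2 ^ n * t \<le> 2 ^ n * real T" using t by (intro mult_left_mono) auto
      then have "2 * real (dyadic_index n t) \<le> 2 * (2 ^ n * real T)"
        using dyadic_index_bounds(1)[OF t(1), of n] by linarith
      then have "real (2 * dyadic_index n t) \<le> real T * 2 ^ Suc n" by (simp add: mult_ac)
      then have "2 * dyadic_index n t \<le> T * 2 ^ Suc n" by (metis of_nat_le_iff of_nat_mult of_nat_numeral of_nat_power)
      then have "\<bar>dyadic_increment (Suc n) (2 * dyadic_index n t) w\<bar> \<le> (9/10) ^ Suc n" using n by (intro N) auto
      moreover have "a (Suc n) = a n + dyadic_increment (Suc n) (2 * dyadic_index n t) w"
        unfolding a_def i using dyadic_walk_refine[of n "dyadic_index n t" w] by (simp add: dyadic_walk_def)
      ultimately show ?thesis by simp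
    qed
    \<comment> \<open>The sum of (9/10)^i over n < i \<le> n + m is 9 ((9/10)^n - (9/10)^(n + m)).\<close>
    have far: "\<bar>a (n + m) - a n\<bar> \<le> 10 * (9/10) ^ n - 10 * (9/10) ^ (n + m)" if "n \<ge> N" for n m
    proof (induction m)
      case (Suc m)
      have "\<bar>a (Suc (n + m)) - a (n + m)\<bar> \<le> (9/10) ^ Suc (n + m)" using that by (intro step) auto
      moreover have "0 \<le> ((9/10) ^ (n + m) :: real)" by simp
      ultimately show ?case using Suc unfolding add_Suc_right power_Suc by linarith
    qed simp
    have "Cauchy a"
    proof (rule CauchyI)
      fix e :: real assume e: "0 < e"
      obtain K where K: "20 * (9/10) ^ K < e" "N \<le> K" by (rule small_power[OF _ e, of 20 N]) auto
      have near: "\<bar>a m - a K\<bar> < e / 2" if "m \<ge> K" for m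
      proof -
        have "\<bar>a (K + (m - K)) - a K\<bar> \<le> 10 * (9/10) ^ K - 10 * (9/10) ^ (K + (m - K))" using K by (intro far)
        also have "\<dots> \<le> 10 * (9/10) ^ K" by simp
        finally show ?thesis using that K by simp
      qed
      show "\<exists>M. \<forall>m\<ge>M. \<forall>n\<ge>M. norm (a m - a n) < e"
      proof (intro exI[of _ K] allI impI)
        fix m n assume "K \<le> m" "K \<le> n"
        with near[of m] near[of n] show "norm (a m - a n) < e" unfolding real_norm_def by linarith
      qed
    qed
    then have "a \<longlonglongrightarrow> lim a" by (intro convergent_LIMSEQ_iff[THEN iffD1] Cauchy_convergent)
    moreover have "brownian_path t w = lim a" using w unfolding brownian_path_def a_def[abs_def] by (rule if_P)
    ultimately have lim: "a \<longlonglongrightarrow> brownian_path t w" by simp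
    have "\<bar>a n - brownian_path t w\<bar> \<le> 10 * (9/10) ^ n" if n: "n \<ge> N" for n
    proof (rule LIMSEQ_le_const2)
      show "(\<lambda>m. \<bar>a n - a (m + n)\<bar>) \<longlonglongrightarrow> \<bar>a n - brownian_path t w\<bar>"
        by (intro tendsto_intros LIMSEQ_ignore_initial_segment lim)
      show "\<exists>M. \<forall>m\<ge>M. \<bar>a n - a (m + n)\<bar> \<le> 10 * (9/10) ^ n"
      proof (intro exI allI impI)
        fix m
        have "\<bar>a (n + m) - a n\<bar> \<le> 10 * (9/10) ^ n - 10 * (9/10) ^ (n + m)" using n by (rule far)
        also have "\<dots> \<le> 10 * (9/10) ^ n" by simp
        finally show "\<bar>a n - a (m + n)\<bar> \<le> 10 * (9/10) ^ n" by (simp add: abs_minus_commute add.commute)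
      qed
    qed
    with lim show ?thesis by (simp add: a_def[abs_def])
  qed
  show ?thesis by (rule exI[of _ N]) (use N conv in auto)
qed

lemma brownian_path_0: "brownian_path 0 w = 0"
  by (simp add: brownian_path_def dyadic_index_def dyadic_walk_def)

lemma brownian_path_continuous: "continuous_on {0..} (\<lambda>t. brownian_path t w)"
proof (cases "w \<in> regular_noise")
  case True
  show ?thesis
    unfolding continuous_on_iff
  proof (intro ballI allI impI)
    fix t e :: real assume t: "t \<in> {0..}" and e: "0 < e"
    obtain T :: nat where T: "t + 1 \<le> real T" using real_arch_simple by blast
    obtain N where N: "\<forall>n\<ge>N. \<forall>k\<le>T * 2 ^ n. \<bar>dyadic_increment n k w\<bar> \<le> (9/10) ^ n"
    "\<forall>t. 0 \<le> t \<and> t \<le> real T \<longrightarrow> (\<lambda>n. dyadic_walk n (dyadic_index n t) w) \<longlonglongrightarrow> brownian_path t w"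
    "\<forall>n\<ge>N. \<forall>t. 0 \<le> t \<and> t \<le> real T \<longrightarrow> \<bar>dyadic_walk n (dyadic_index n t) w - brownian_path t w\<bar> \<le> 10 * (9/10) ^ n"
      using dyadic_walk_approximation[OF True, of T] by (elim exE conjE) (rule that)
    \<comment> \<open>Two approximation errors of 10 (9/10)^n and one increment of at most (9/10)^n add up to 21 (9/10)^n.\<close>
    obtain n where n: "21 * (9/10) ^ n < e" "N \<le> n" by (rule small_power[OF _ e, of 21 N]) auto
    have key: "\<bar>brownian_path r w - brownian_path s w\<bar> < e" if rs: "0 \<le> r" "r \<le> s" "s \<le> real T" "s < r + (1/2) ^ n" for r s
    proof -
      have "2 ^ n * s < 2 ^ n * r + 1" using rs(4) mult_strict_left_mono[OF rs(4), of "2 ^ n :: real"]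
        by (simp add: distrib_left power_one_over)
      moreover have "2 ^ n * r \<le> 2 ^ n * s" using rs by simp
      ultimately have "dyadic_index n s = dyadic_index n r \<or> dyadic_index n s = Suc (dyadic_index n r)"
        using dyadic_index_bounds[of r n] dyadic_index_bounds[of s n] rs by linarith
      moreover have "\<bar>dyadic_increment n (dyadic_index n r) w\<bar> \<le> (9/10) ^ n"
      proof (rule N(1)[rule_format, OF n(2)])
        have "2 ^ n * r \<le> 2 ^ n * real T" using rs by (intro mult_left_mono) auto
        then have "real (dyadic_index n r) \<le> 2 ^ n * real T"
          using dyadic_index_bounds(1)[OF rs(1), of n] by linarith
        then have "real (dyadic_index n r) \<le> real T * 2 ^ n" by (simp add: mult.commute)
        then show "dyadic_index n r \<le> T * 2 ^ n" by (metis of_nat_le_iff of_nat_mult of_nat_numeral of_nat_power)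
      qed
      ultimately have "\<bar>dyadic_walk n (dyadic_index n s) w - dyadic_walk n (dyadic_index n r) w\<bar> \<le> (9/10) ^ n"
        by (auto simp: dyadic_walk_def)
      with N(3)[rule_format, OF n(2), of r] N(3)[rule_format, OF n(2), of s] rs n(1) show ?thesis by linarith
    qed
    show "\<exists>d>0. \<forall>s\<in>{0..}. dist s t < d \<longrightarrow> dist (brownian_path s w) (brownian_path t w) < e"
    proof (intro exI[of _ "(1/2) ^ n"] conjI ballI impI)
      fix s :: real assume s: "s \<in> {0..}" "dist s t < (1/2) ^ n"
      have "(1/2) ^ n \<le> (1 :: real)" by (intro power_le_one) auto
      then show "dist (brownian_path s w) (brownian_path t w) < e"
        using key[of s t] key[of t s] s t T unfolding dist_real_def
        by (cases "s \<le> t") (auto simp: abs_minus_commute abs_less_iff)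
    qed simp
  qed
qed (simp add: brownian_path_def)

lemma dyadic_walk_tendsto_brownian_path:
  assumes "0 \<le> t" shows "AE w in white_noise. (\<lambda>n. dyadic_walk n (dyadic_index n t) w) \<longlonglongrightarrow> brownian_path t w"
  using AE_regular_noise
proof eventually_elim
  case (elim w)
  obtain T :: nat where T: "t \<le> real T" using real_arch_simple by blast
  obtain N where "\<forall>t. 0 \<le> t \<and> t \<le> real T \<longrightarrow> (\<lambda>n. dyadic_walk n (dyadic_index n t) w) \<longlonglongrightarrow> brownian_path t w"
    using dyadic_walk_approximation[OF elim, of T] by (elim exE conjE) (rule that)
  with assms T show ?case by blast
qed

lemma dyadic_walk_difference:
  assumes "a \<le> b"
  shows "dyadic_walk n b w - dyadic_walk n a w = (\<Sum>j\<in>{a..<b}. dyadic_increment n j w)"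
  using sum.atLeastLessThan_concat[of 0 a b "\<lambda>j. dyadic_increment n j w"] assms
  by (simp add: dyadic_walk_def lessThan_atLeast0)

lemma dyadic_index_mono: "s \<le> t \<Longrightarrow> dyadic_index n s \<le> dyadic_index n t"
  unfolding dyadic_index_def by (intro nat_mono floor_mono) simp

lemma distr_brownian_increment:
  assumes st: "0 \<le> s" "s \<le> t"
  shows "distr white_noise borel (\<lambda>w. brownian_path t w - brownian_path s w) = gaussian (t - s)"
proof (rule Levy_uniqueness)
  show "real_distribution (distr white_noise borel (\<lambda>w. brownian_path t w - brownian_path s w))"
    by (intro white_noise.real_distribution_distr) simp
  show "real_distribution (gaussian (t - s))" by (rule real_distribution_gaussian)
  show "char (distr white_noise borel (\<lambda>w. brownian_path t w - brownian_path s w)) = char (gaussian (t - s))"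
  proof
    fix u
    let ?I = "\<lambda>n. {dyadic_index n s..<dyadic_index n t}"
    have c: "char (distr white_noise borel (\<lambda>w. \<Sum>j\<in>?I n. dyadic_increment n j w)) u =
        complex_of_real (exp (- (real (dyadic_index n t) * (1/2) ^ n - real (dyadic_index n s) * (1/2) ^ n) * u\<^sup>2 / 2))" for n
    proof -
      have "char (distr white_noise borel (\<lambda>w. \<Sum>j\<in>?I n. dyadic_increment n j w)) u =
          (\<Prod>j\<in>?I n. char (distr white_noise borel (dyadic_increment n j)) u)"
        by (rule white_noise.char_distr_sum[OF white_noise.indep_vars_subset[OF dyadic_increment_indep]]) simp
      also have "\<dots> = complex_of_real (exp (- ((1/2) ^ n) * u\<^sup>2 / 2) ^ (dyadic_index n t - dyadic_index n s))"
        by (simp add: distr_dyadic_increment char_gaussian)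
      also have "exp (- ((1/2) ^ n) * u\<^sup>2 / 2) ^ (dyadic_index n t - dyadic_index n s) =
          exp (- (real (dyadic_index n t) * (1/2) ^ n - real (dyadic_index n s) * (1/2) ^ n) * u\<^sup>2 / 2)"
        using dyadic_index_mono[OF st(2), of n]
        by (simp add: exp_of_nat_mult[symmetric] of_nat_diff left_diff_distrib diff_divide_distrib)
      finally show ?thesis .
    qed
    have "(\<lambda>n. char (distr white_noise borel (\<lambda>w. \<Sum>j\<in>?I n. dyadic_increment n j w)) u) \<longlonglongrightarrow>
        complex_of_real (exp (- (t - s) * u\<^sup>2 / 2))"
      unfolding c using st by (intro tendsto_intros dyadic_index_tendsto) auto
    moreover have "(\<lambda>n. char (distr white_noise borel (\<lambda>w. \<Sum>j\<in>?I n. dyadic_increment n j w)) u) \<longlonglongrightarrow>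
        char (distr white_noise borel (\<lambda>w. brownian_path t w - brownian_path s w)) u"
    proof -
      have "(\<lambda>n. \<integral>w. iexp (u * (\<Sum>j\<in>?I n. dyadic_increment n j w)) \<partial>white_noise) \<longlonglongrightarrow>
          (\<integral>w. iexp (u * (brownian_path t w - brownian_path s w)) \<partial>white_noise)"
      proof (rule integral_dominated_convergence[where w="\<lambda>_. 1"])
        show "AE w in white_noise. (\<lambda>n. iexp (u * (\<Sum>j\<in>?I n. dyadic_increment n j w))) \<longlonglongrightarrow>
            iexp (u * (brownian_path t w - brownian_path s w))"
          using dyadic_walk_tendsto_brownian_path[OF st(1)] dyadic_walk_tendsto_brownian_path[OF order_trans[OF st]]
        proof eventually_elim
          case (elim w)
          then show ?case
            unfolding dyadic_walk_difference[OF dyadic_index_mono[OF st(2)], symmetric] by (intro tendsto_intros)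
        qed
      qed auto
      then show ?thesis by (simp add: char_distr_eq_expectation)
    qed
    ultimately have "char (distr white_noise borel (\<lambda>w. brownian_path t w - brownian_path s w)) u =
        complex_of_real (exp (- (t - s) * u\<^sup>2 / 2))"
      by (rule LIMSEQ_unique[rotated])
    then show "char (distr white_noise borel (\<lambda>w. brownian_path t w - brownian_path s w)) u = char (gaussian (t - s)) u"
      using st by (simp add: char_gaussian)
  qed
qed

theorem standard_brownian_motion_brownian_path: "standard_brownian_motion white_noise brownian_path"
  unfolding standard_brownian_motion_def
proof (intro conjI allI impI ballI)
  fix s t :: real assume st: "0 \<le> s \<and> s < t"
  have "distr white_noise lborel (\<lambda>w. brownian_path t w - brownian_path s w) =
      distr white_noise borel (\<lambda>w. brownian_path t w - brownian_path s w)"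
    by (rule distr_cong) auto
  then show "distributed white_noise lborel (\<lambda>w. brownian_path t w - brownian_path s w) (normal_density 0 (sqrt (t - s)))"
    using st distr_brownian_increment[of s t] gaussian_eq_density[of "t - s"] by (simp add: distributed_def)
next
  fix t :: "nat \<Rightarrow> real" assume t: "0 \<le> t 0 \<and> mono t"
  have t0: "0 \<le> t i" for i using t monoD[of t 0 i] by auto
  show "white_noise.indep_vars (\<lambda>_. borel) (\<lambda>i w. brownian_path (t (Suc i)) w - brownian_path (t i) w) UNIV"
  proof (rule white_noise.indep_vars_limit)
    have mono: "mono (\<lambda>i. dyadic_index n (t i))" for n using t by (auto intro!: monoI dyadic_index_mono dest: monoD)
    show "white_noise.indep_vars (\<lambda>_. borel)
        (\<lambda>i w. \<Sum>j\<in>{dyadic_index n (t i)..<dyadic_index n (t (Suc i))}. dyadic_increment n j w) UNIV" for n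
      by (rule white_noise.indep_vars_block_sums[OF dyadic_increment_indep mono])
    show "AE w in white_noise. (\<lambda>n. \<Sum>j\<in>{dyadic_index n (t i)..<dyadic_index n (t (Suc i))}. dyadic_increment n j w)
        \<longlonglongrightarrow> brownian_path (t (Suc i)) w - brownian_path (t i) w" for i
      using dyadic_walk_tendsto_brownian_path[OF t0[of i]] dyadic_walk_tendsto_brownian_path[OF t0[of "Suc i"]]
    proof eventually_elim
      case (elim w)
      have "t i \<le> t (Suc i)" using t monoD[of t i "Suc i"] by simp
      then show ?case
        unfolding dyadic_walk_difference[OF dyadic_index_mono[OF \<open>t i \<le> t (Suc i)\<close>], symmetric]
        using elim by (intro tendsto_intros)
    qed
  qed simp
qed (auto simp: brownian_path_0 brownian_path_continuous white_noise.prob_space_axioms)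

section \<open>The annealed law\<close>

abbreviation pos_real :: "real measure" where
  "pos_real \<equiv> restrict_space borel {0<..}"

lemma environment_space:
  assumes \<pi>: "\<pi> \<in> space (prob_algebra trap_measures)"
  shows "prob_space \<pi>" "sets \<pi> = sets trap_measures" "prob_space (environment_law \<pi>)"
    "sets (environment_law \<pi>) = sets (PiM UNIV (\<lambda>_. trap_measures))"
proof -
  show 1: "prob_space \<pi>" "sets \<pi> = sets trap_measures" using \<pi> by (auto simp: space_prob_algebra)
  then show "prob_space (environment_law \<pi>)" unfolding environment_law_def by (intro prob_space_PiM)
  show "sets (environment_law \<pi>) = sets (PiM UNIV (\<lambda>_. trap_measures))"
    unfolding environment_law_def using 1 by (intro sets_PiM_cong) auto
qed

definition quenched_holding :: "(int \<Rightarrow> real measure) \<Rightarrow> (int \<times> nat \<Rightarrow> real) measure" where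
  "quenched_holding \<omega> = (\<Pi>\<^sub>M (x, i)\<in>UNIV. \<omega> x)"

definition holding_law :: "real measure measure \<Rightarrow> (int \<times> nat \<Rightarrow> real) measure" where
  "holding_law \<pi> = environment_law \<pi> \<bind> quenched_holding"

definition step_law :: "real \<Rightarrow> (nat \<Rightarrow> int) measure" where
  "step_law \<beta> = (\<Pi>\<^sub>M j\<in>{1..}. measure_pmf (step_pmf \<beta>))"

lemma environment_component:
  assumes \<pi>: "\<pi> \<in> space (prob_algebra trap_measures)" and \<omega>: "\<omega> \<in> space (environment_law \<pi>)"
  shows "prob_space (\<omega> x)" "sets (\<omega> x) = sets pos_real" "space (\<omega> x) = space pos_real"
proof -
  have "space (environment_law \<pi>) = space (PiM UNIV (\<lambda>_. trap_measures))"
    by (rule sets_eq_imp_space_eq[OF environment_space(4)[OF \<pi>]])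
  then have "\<omega> x \<in> space trap_measures" using \<omega> by (auto simp: space_PiM)
  then show "prob_space (\<omega> x)" and s: "sets (\<omega> x) = sets pos_real" by (auto simp: space_prob_algebra)
  show "space (\<omega> x) = space pos_real" by (rule sets_eq_imp_space_eq[OF s])
qed

text \<open>
  The product sigma-algebra is generated by rectangles with finite base. The quenched probability of a
  rectangle is a finite product of evaluations of the environment, each measurable.
\<close>

lemma quenched_holding_measurable:
  assumes \<pi>: "\<pi> \<in> space (prob_algebra trap_measures)"
  shows "quenched_holding \<in> environment_law \<pi> \<rightarrow>\<^sub>M prob_algebra (PiM UNIV (\<lambda>_. pos_real))"
proof (rule measurable_prob_algebra_generated[OF sets_PiM Int_stable_prod_algebra prod_algebra_sets_into_space])
  fix \<omega> assume \<omega>: "\<omega> \<in> space (environment_law \<pi>)"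
  note \<omega>x = environment_component[OF \<pi> \<omega>]
  show "prob_space (quenched_holding \<omega>)" unfolding quenched_holding_def by (intro prob_space_PiM) (auto simp: \<omega>x)
  show "sets (quenched_holding \<omega>) = sets (PiM UNIV (\<lambda>_. pos_real))"
    unfolding quenched_holding_def by (intro sets_PiM_cong) (auto simp: \<omega>x)
next
  fix A :: "(int \<times> nat \<Rightarrow> real) set" assume "A \<in> prod_algebra UNIV (\<lambda>_. pos_real)"
  then obtain J E where J: "finite J" "A = prod_emb UNIV (\<lambda>_. pos_real) J (Pi\<^sub>E J E)" "\<And>i. i \<in> J \<Longrightarrow> E i \<in> sets pos_real"
    by (rule prod_algebraE) blast
  have "emeasure (quenched_holding \<omega>) A = (\<Prod>l\<in>J. emeasure (\<omega> (fst l)) (E l))" if \<omega>: "\<omega> \<in> space (environment_law \<pi>)" for \<omega>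
  proof -
    note \<omega>x = environment_component[OF \<pi> \<omega>]
    have "A = prod_emb UNIV (\<lambda>(x, i). \<omega> x) J (Pi\<^sub>E J E)" unfolding J(2) by (auto simp: prod_emb_def \<omega>x case_prod_beta)
    then have "emeasure (quenched_holding \<omega>) A = (\<Prod>l\<in>J. emeasure ((\<lambda>(x, i). \<omega> x) l) (E l))"
      unfolding quenched_holding_def using J(1,3) \<omega>x by (simp only:) (intro emeasure_PiM_emb, auto)
    then show ?thesis by (simp add: case_prod_beta)
  qed
  moreover have "(\<lambda>\<omega>. \<Prod>l\<in>J. emeasure (\<omega> (fst l)) (E l)) \<in> borel_measurable (environment_law \<pi>)"
  proof (rule borel_measurable_prod_ennreal)
    fix l assume l: "l \<in> J"
    have "(\<lambda>\<omega>. \<omega> (fst l)) \<in> PiM UNIV (\<lambda>_. trap_measures) \<rightarrow>\<^sub>M trap_measures"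
      by (rule measurable_component_singleton) simp
    then have "(\<lambda>\<omega>. \<omega> (fst l)) \<in> environment_law \<pi> \<rightarrow>\<^sub>M trap_measures"
      using environment_space(4)[OF \<pi>] by (simp cong: measurable_cong_sets)
    then have 1: "(\<lambda>\<omega>. \<omega> (fst l)) \<in> environment_law \<pi> \<rightarrow>\<^sub>M subprob_algebra pos_real"
      by (rule measurable_prob_algebraD)
    show "(\<lambda>\<omega>. emeasure (\<omega> (fst l)) (E l)) \<in> borel_measurable (environment_law \<pi>)"
      using measurable_compose[OF 1 measurable_emeasure_subprob_algebra[OF J(3)[OF l]]] .
  qed
  ultimately show "(\<lambda>\<omega>. emeasure (quenched_holding \<omega>) A) \<in> borel_measurable (environment_law \<pi>)"
    by (subst measurable_cong)
qed

lemma holding_law_space: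
  assumes \<pi>: "\<pi> \<in> space (prob_algebra trap_measures)"
  shows "prob_space (holding_law \<pi>)" "sets (holding_law \<pi>) = sets (PiM UNIV (\<lambda>_. pos_real))"
proof -
  interpret E: prob_space "environment_law \<pi>" by (rule environment_space(3)[OF \<pi>])
  have in_sp: "environment_law \<pi> \<in> space (prob_algebra (environment_law \<pi>))"
    by (simp add: space_prob_algebra E.prob_space_axioms)
  show "prob_space (holding_law \<pi>)" unfolding holding_law_def
    by (rule prob_space_bind'[OF in_sp quenched_holding_measurable[OF \<pi>]])
  show "sets (holding_law \<pi>) = sets (PiM UNIV (\<lambda>_. pos_real))" unfolding holding_law_def
    by (rule sets_bind'[OF in_sp quenched_holding_measurable[OF \<pi>]])
qed

lemma prob_space_step_law: "prob_space (step_law \<beta>)"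
  unfolding step_law_def by (intro prob_space_PiM) (rule measure_pmf.prob_space_axioms)

text \<open>
  The law of the steps does not depend on the environment. Averaging over the environment therefore
  acts on the factor of the holding times alone.
\<close>

theorem annealed_law_eq:
  assumes \<pi>: "\<pi> \<in> space (prob_algebra trap_measures)"
  shows "annealed_law \<beta> \<pi> = step_law \<beta> \<Otimes>\<^sub>M holding_law \<pi>"
proof -
  interpret E: prob_space "environment_law \<pi>" by (rule environment_space(3)[OF \<pi>])
  interpret S: prob_space "step_law \<beta>" by (rule prob_space_step_law)
  interpret H: prob_space "holding_law \<pi>" by (rule holding_law_space(1)[OF \<pi>])
  have in_sp: "environment_law \<pi> \<in> space (prob_algebra (environment_law \<pi>))"
    by (simp add: space_prob_algebra E.prob_space_axioms)
  have S_in: "(\<lambda>_. step_law \<beta>) \<in> environment_law \<pi> \<rightarrow>\<^sub>M prob_algebra (step_law \<beta>)"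
    by (rule measurable_const) (simp add: space_prob_algebra S.prob_space_axioms)
  have q: "quenched_law \<beta> = (\<lambda>\<omega>. step_law \<beta> \<Otimes>\<^sub>M quenched_holding \<omega>)"
    by (simp add: fun_eq_iff quenched_law_def step_law_def quenched_holding_def)
  have K: "quenched_law \<beta> \<in> environment_law \<pi> \<rightarrow>\<^sub>M prob_algebra (step_law \<beta> \<Otimes>\<^sub>M PiM UNIV (\<lambda>_. pos_real))"
    unfolding q by (rule measurable_pair_prob[OF S_in quenched_holding_measurable[OF \<pi>]])
  show ?thesis
  proof (rule pair_measure_eqI[symmetric])
    show "sets (step_law \<beta> \<Otimes>\<^sub>M holding_law \<pi>) = sets (annealed_law \<beta> \<pi>)"
      unfolding annealed_law_def sets_bind'[OF in_sp K] using holding_law_space(2)[OF \<pi>]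
      by (intro sets_pair_measure_cong) auto
    fix A B assume A: "A \<in> sets (step_law \<beta>)" and B: "B \<in> sets (holding_law \<pi>)"
    have B': "B \<in> sets (PiM UNIV (\<lambda>_. pos_real))" using B holding_law_space(2)[OF \<pi>] by simp
    have "emeasure (annealed_law \<beta> \<pi>) (A \<times> B) = (\<integral>\<^sup>+\<omega>. emeasure (quenched_law \<beta> \<omega>) (A \<times> B) \<partial>environment_law \<pi>)"
      unfolding annealed_law_def using A B' by (intro emeasure_bind_prob_algebra[OF in_sp K]) auto
    also have "\<dots> = (\<integral>\<^sup>+\<omega>. emeasure (step_law \<beta>) A * emeasure (quenched_holding \<omega>) B \<partial>environment_law \<pi>)"
    proof (rule nn_integral_cong)
      fix \<omega> assume "\<omega> \<in> space (environment_law \<pi>)"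
      from measurable_space[OF quenched_holding_measurable[OF \<pi>] this]
      have Q: "prob_space (quenched_holding \<omega>)" "sets (quenched_holding \<omega>) = sets (PiM UNIV (\<lambda>_. pos_real))"
        by (auto simp: space_prob_algebra)
      interpret Q: prob_space "quenched_holding \<omega>" by (rule Q)
      show "emeasure (quenched_law \<beta> \<omega>) (A \<times> B) = emeasure (step_law \<beta>) A * emeasure (quenched_holding \<omega>) B"
        unfolding q using A B' Q(2) by (intro Q.emeasure_pair_measure_Times) auto
    qed
    also have "\<dots> = emeasure (step_law \<beta>) A * (\<integral>\<^sup>+\<omega>. emeasure (quenched_holding \<omega>) B \<partial>environment_law \<pi>)"
      using measurable_compose[OF measurable_prob_algebraD[OF quenched_holding_measurable[OF \<pi>]]
          measurable_emeasure_subprob_algebra[OF B']]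
      by (intro nn_integral_cmult)
    also have "(\<integral>\<^sup>+\<omega>. emeasure (quenched_holding \<omega>) B \<partial>environment_law \<pi>) = emeasure (holding_law \<pi>) B"
      unfolding holding_law_def by (rule emeasure_bind_prob_algebra[OF in_sp quenched_holding_measurable[OF \<pi>] B', symmetric])
    finally show "emeasure (step_law \<beta>) A * emeasure (holding_law \<pi>) B = emeasure (annealed_law \<beta> \<pi>) (A \<times> B)" ..
  qed (rule S.sigma_finite_measure_axioms H.sigma_finite_measure_axioms)+
qed

text \<open>
  Integration against the annealed law of a single holding time.
\<close>

definition trap_mean :: "real measure measure \<Rightarrow> (real \<Rightarrow> ennreal) \<Rightarrow> ennreal" where
  "trap_mean \<pi> f = (\<integral>\<^sup>+\<nu>. (\<integral>\<^sup>+r. f r \<partial>\<nu>) \<partial>\<pi>)"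

lemma trap_integral_measurable:
  assumes \<pi>: "\<pi> \<in> space (prob_algebra trap_measures)" and f: "f \<in> borel_measurable (borel :: real measure)"
  shows "(\<lambda>\<nu>. \<integral>\<^sup>+r. f r \<partial>\<nu>) \<in> borel_measurable \<pi>"
proof -
  have "f \<in> borel_measurable pos_real" using f by (rule measurable_restrict_space1)
  then have "(\<lambda>\<nu>. \<integral>\<^sup>+r. f r \<partial>\<nu>) \<in> borel_measurable (subprob_algebra pos_real)"
    by (rule nn_integral_measurable_subprob_algebra)
  then have "(\<lambda>\<nu>. \<integral>\<^sup>+r. f r \<partial>\<nu>) \<in> borel_measurable trap_measures"
    unfolding prob_algebra_def by (rule measurable_restrict_space1)
  then show ?thesis using environment_space(2)[OF \<pi>] by (simp cong: measurable_cong_sets)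
qed

lemma nn_integral_holding_law:
  assumes \<pi>: "\<pi> \<in> space (prob_algebra trap_measures)"
    and F: "F \<in> borel_measurable (PiM UNIV (\<lambda>_. pos_real))"
  shows "(\<integral>\<^sup>+\<eta>. F \<eta> \<partial>holding_law \<pi>) = (\<integral>\<^sup>+\<omega>. \<integral>\<^sup>+\<eta>. F \<eta> \<partial>quenched_holding \<omega> \<partial>environment_law \<pi>)"
  unfolding holding_law_def
  by (rule nn_integral_bind[OF F measurable_prob_algebraD[OF quenched_holding_measurable[OF \<pi>]]])

lemma coordinate_borel: "(\<lambda>\<eta>. \<eta> l) \<in> borel_measurable (PiM UNIV (\<lambda>_. pos_real))"
proof -
  have "(\<lambda>\<eta>. \<eta> l) \<in> PiM UNIV (\<lambda>_. pos_real) \<rightarrow>\<^sub>M pos_real" by (rule measurable_component_singleton) simp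
  then show ?thesis by (rule measurable_restrict_space2_iff[THEN iffD1, THEN conjunct1])
qed

lemma nn_integral_environment_coordinate:
  assumes \<pi>: "\<pi> \<in> space (prob_algebra trap_measures)" and F: "F \<in> borel_measurable \<pi>"
  shows "(\<integral>\<^sup>+\<omega>. F (\<omega> x) \<partial>environment_law \<pi>) = (\<integral>\<^sup>+\<nu>. F \<nu> \<partial>\<pi>)"
proof -
  have "distr (environment_law \<pi>) \<pi> (\<lambda>\<omega>. \<omega> x) = \<pi>"
    unfolding environment_law_def using environment_space(1)[OF \<pi>] by (intro distr_PiM_component) auto
  then have "(\<integral>\<^sup>+\<nu>. F \<nu> \<partial>\<pi>) = (\<integral>\<^sup>+\<nu>. F \<nu> \<partial>distr (environment_law \<pi>) \<pi> (\<lambda>\<omega>. \<omega> x))" by simp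
  also have "\<dots> = (\<integral>\<^sup>+\<omega>. F (\<omega> x) \<partial>environment_law \<pi>)"
    using F by (intro nn_integral_distr) (auto simp: environment_law_def)
  finally show ?thesis ..
qed

lemma nn_integral_two_coordinates:
  assumes N: "\<And>i. prob_space (N i)" and pq: "p \<noteq> q"
    and f: "f \<in> borel_measurable (N p)" and g: "g \<in> borel_measurable (N q)"
  shows "(\<integral>\<^sup>+w. f (w p) * g (w q) \<partial>PiM UNIV N) = (\<integral>\<^sup>+w. f (w p) \<partial>PiM UNIV N) * (\<integral>\<^sup>+w. g (w q) \<partial>PiM UNIV N :: ennreal)"
proof -
  interpret prob_space "PiM UNIV N" by (rule prob_space_PiM) (rule N)
  have "indep_vars N (\<lambda>i w. w i) UNIV" by (rule product_coordinates_indep) (use N in auto)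
  then have "indep_vars N (\<lambda>i w. w i) {p, q}" by (rule indep_vars_subset) simp
  then have "indep_vars (\<lambda>_. borel) (\<lambda>i w. (if i = p then f else g) (w i)) {p, q}"
    by (rule indep_vars_compose2[where Y="\<lambda>i. if i = p then f else g"]) (use f g in auto)
  then have "(\<integral>\<^sup>+w. (\<Prod>i\<in>{p, q}. (if i = p then f else g) (w i)) \<partial>PiM UNIV N) =
      (\<Prod>i\<in>{p, q}. \<integral>\<^sup>+w. (if i = p then f else g) (w i) \<partial>PiM UNIV N)"
    by (intro indep_vars_nn_integral) auto
  then show ?thesis using pq by simp
qed

lemma nn_integral_quenched_coordinate:
  assumes \<pi>: "\<pi> \<in> space (prob_algebra trap_measures)" and \<omega>: "\<omega> \<in> space (environment_law \<pi>)"
    and f: "f \<in> borel_measurable borel"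
  shows "(\<integral>\<^sup>+\<eta>. f (\<eta> l) \<partial>quenched_holding \<omega>) = (\<integral>\<^sup>+r. f r \<partial>\<omega> (fst l))"
proof -
  note \<omega>x = environment_component[OF \<pi> \<omega>]
  have fm: "f \<in> borel_measurable (\<omega> x)" for x
    using measurable_restrict_space1[OF f, of "{0<..}"] \<omega>x(2)[of x] by (simp cong: measurable_cong_sets)
  have "distr (quenched_holding \<omega>) (\<omega> (fst l)) (\<lambda>\<eta>. \<eta> l) = \<omega> (fst l)"
    unfolding quenched_holding_def using distr_PiM_component[of UNIV "\<lambda>(x, i). \<omega> x" l] \<omega>x by (simp add: case_prod_beta)
  then have "(\<integral>\<^sup>+r. f r \<partial>\<omega> (fst l)) = (\<integral>\<^sup>+r. f r \<partial>distr (quenched_holding \<omega>) (\<omega> (fst l)) (\<lambda>\<eta>. \<eta> l))" by simp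
  also have "\<dots> = (\<integral>\<^sup>+\<eta>. f (\<eta> l) \<partial>quenched_holding \<omega>)"
    using measurable_component_singleton[of l UNIV "\<lambda>(x, i). \<omega> x"] fm
    by (intro nn_integral_distr) (simp_all add: quenched_holding_def case_prod_beta)
  finally show ?thesis ..
qed

lemma nn_integral_holding_coordinate:
  assumes \<pi>: "\<pi> \<in> space (prob_algebra trap_measures)" and f: "f \<in> borel_measurable borel"
  shows "(\<integral>\<^sup>+\<eta>. f (\<eta> l) \<partial>holding_law \<pi>) = trap_mean \<pi> f"
proof -
  have "(\<integral>\<^sup>+\<eta>. f (\<eta> l) \<partial>holding_law \<pi>) = (\<integral>\<^sup>+\<omega>. \<integral>\<^sup>+\<eta>. f (\<eta> l) \<partial>quenched_holding \<omega> \<partial>environment_law \<pi>)"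
    by (rule nn_integral_holding_law[OF \<pi> measurable_compose[OF coordinate_borel f]])
  also have "\<dots> = (\<integral>\<^sup>+\<omega>. \<integral>\<^sup>+r. f r \<partial>\<omega> (fst l) \<partial>environment_law \<pi>)" by (rule nn_integral_cong) (rule nn_integral_quenched_coordinate[OF \<pi> _ f])
  also have "\<dots> = trap_mean \<pi> f"
    unfolding trap_mean_def by (rule nn_integral_environment_coordinate[OF \<pi> trap_integral_measurable[OF \<pi> f]])
  finally show ?thesis .
qed

text \<open>
  Given the environment the two holding times are independent, and the environments at the two sites
  are independent of each other.
\<close>

lemma nn_integral_holding_different_sites:
  assumes \<pi>: "\<pi> \<in> space (prob_algebra trap_measures)"
    and f: "f \<in> borel_measurable borel" and g: "g \<in> borel_measurable borel" and xy: "fst l \<noteq> fst m"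
  shows "(\<integral>\<^sup>+\<eta>. f (\<eta> l) * g (\<eta> m) \<partial>holding_law \<pi>) = trap_mean \<pi> f * trap_mean \<pi> g"
proof -
  have quenched: "(\<integral>\<^sup>+\<eta>. f (\<eta> l) * g (\<eta> m) \<partial>quenched_holding \<omega>) = (\<integral>\<^sup>+r. f r \<partial>\<omega> (fst l)) * (\<integral>\<^sup>+r. g r \<partial>\<omega> (fst m))"
    if \<omega>: "\<omega> \<in> space (environment_law \<pi>)" for \<omega>
  proof -
    note \<omega>x = environment_component[OF \<pi> \<omega>]
    have borel: "h \<in> borel_measurable (\<omega> x)" if "h \<in> borel_measurable borel" for h :: "real \<Rightarrow> ennreal" and x
      using measurable_restrict_space1[OF that, of "{0<..}"] \<omega>x(2)[of x] by (simp cong: measurable_cong_sets)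
    have "(\<integral>\<^sup>+\<eta>. f (\<eta> l) * g (\<eta> m) \<partial>quenched_holding \<omega>) =
        (\<integral>\<^sup>+\<eta>. f (\<eta> l) \<partial>quenched_holding \<omega>) * (\<integral>\<^sup>+\<eta>. g (\<eta> m) \<partial>quenched_holding \<omega>)"
      unfolding quenched_holding_def
    proof (rule nn_integral_two_coordinates[of "\<lambda>(x, i). \<omega> x" l m f g])
      show "prob_space (case i of (x, i) \<Rightarrow> \<omega> x)" for i :: "int \<times> nat" using \<omega>x(1) by (cases i) simp
      show "l \<noteq> m" using xy by blast
      show "f \<in> borel_measurable (case l of (x, i) \<Rightarrow> \<omega> x)" using borel[OF f] by (cases l) simp
      show "g \<in> borel_measurable (case m of (x, i) \<Rightarrow> \<omega> x)" using borel[OF g] by (cases m) simp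
    qed
    then show ?thesis
      unfolding nn_integral_quenched_coordinate[OF \<pi> \<omega> f, of l] nn_integral_quenched_coordinate[OF \<pi> \<omega> g, of m] .
  qed
  have F: "(\<lambda>\<eta>. f (\<eta> l) * g (\<eta> m)) \<in> borel_measurable (PiM UNIV (\<lambda>_. pos_real))"
    by (intro borel_measurable_times_ennreal measurable_compose[OF coordinate_borel] f g)
  have "(\<integral>\<^sup>+\<eta>. f (\<eta> l) * g (\<eta> m) \<partial>holding_law \<pi>) =
      (\<integral>\<^sup>+\<omega>. (\<integral>\<^sup>+r. f r \<partial>\<omega> (fst l)) * (\<integral>\<^sup>+r. g r \<partial>\<omega> (fst m)) \<partial>environment_law \<pi>)"
    unfolding nn_integral_holding_law[OF \<pi> F] by (rule nn_integral_cong) (rule quenched)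
  also have "\<dots> = (\<integral>\<^sup>+\<omega>. (\<integral>\<^sup>+r. f r \<partial>\<omega> (fst l)) \<partial>environment_law \<pi>) * (\<integral>\<^sup>+\<omega>. (\<integral>\<^sup>+r. g r \<partial>\<omega> (fst m)) \<partial>environment_law \<pi>)"
    unfolding environment_law_def
  proof (rule nn_integral_two_coordinates[of "\<lambda>_. \<pi>" "fst l" "fst m" "\<lambda>\<nu>. \<integral>\<^sup>+r. f r \<partial>\<nu>" "\<lambda>\<nu>. \<integral>\<^sup>+r. g r \<partial>\<nu>"])
    show "prob_space \<pi>" by (rule environment_space(1)[OF \<pi>])
  qed (rule xy trap_integral_measurable[OF \<pi>] f g)+
  also have "\<dots> = trap_mean \<pi> f * trap_mean \<pi> g"
    unfolding trap_mean_def
    unfolding nn_integral_environment_coordinate[OF \<pi> trap_integral_measurable[OF \<pi> f]]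
      nn_integral_environment_coordinate[OF \<pi> trap_integral_measurable[OF \<pi> g]] ..
  finally show ?thesis .
qed

section \<open>Holding times along the walk\<close>

text \<open>
  The pair of site and visit number at step k, as a function of the step sequence only. The second
  component of the sample does not enter the walk and is filled with an arbitrary value.
\<close>

definition site :: "(nat \<Rightarrow> int) \<Rightarrow> nat \<Rightarrow> int \<times> nat" where
  "site \<sigma> k = (walk (\<sigma>, undefined) k, local_time (\<sigma>, undefined) (walk (\<sigma>, undefined) k) k)"

lemma walk_fst: "walk s k = walk (fst s, \<eta>) k" by (simp add: walk_def)

lemma holding_time_eq_site: "holding_time s k = snd s (site (fst s) k)"
  unfolding holding_time_def site_def local_time_def using walk_fst[of s] by simp

lemma count_space_sum_measurable:
  fixes f :: "'i \<Rightarrow> 'a \<Rightarrow> 'b :: {countable, comm_monoid_add}"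
  assumes "\<And>i. i \<in> I \<Longrightarrow> f i \<in> M \<rightarrow>\<^sub>M count_space UNIV"
  shows "(\<lambda>w. \<Sum>i\<in>I. f i w) \<in> M \<rightarrow>\<^sub>M count_space UNIV"
  using assms
proof (induction I rule: infinite_finite_induct)
  case (insert i I)
  have "(\<lambda>w. f i w + (\<Sum>i\<in>I. f i w)) \<in> M \<rightarrow>\<^sub>M count_space UNIV"
  proof (rule measurable_compose_countable[where f="\<lambda>a w. f i w + a"])
    show "(\<lambda>w. f i w + a) \<in> M \<rightarrow>\<^sub>M count_space UNIV" for a
      by (rule measurable_compose[of "f i"]) (use insert.prems in auto)
    show "(\<lambda>w. \<Sum>i\<in>I. f i w) \<in> M \<rightarrow>\<^sub>M count_space UNIV" using insert by auto
  qed
  then show ?case using insert by simp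
qed auto

lemma step_coordinate_measurable: "1 \<le> j \<Longrightarrow> (\<lambda>\<sigma>. \<sigma> j) \<in> step_law \<beta> \<rightarrow>\<^sub>M count_space UNIV"
  unfolding step_law_def
  using measurable_component_singleton[of j "{1..}" "\<lambda>_. measure_pmf (step_pmf \<beta>)"] by simp

lemma walk_measurable_steps: "(\<lambda>\<sigma>. walk (\<sigma>, \<eta>) k) \<in> step_law \<beta> \<rightarrow>\<^sub>M count_space UNIV"
  unfolding walk_def by (rule count_space_sum_measurable) (simp add: step_coordinate_measurable)

lemma site_measurable: "(\<lambda>\<sigma>. site \<sigma> k) \<in> step_law \<beta> \<rightarrow>\<^sub>M count_space UNIV"
proof -
  have lt: "(\<lambda>\<sigma>. local_time (\<sigma>, undefined) x k) \<in> step_law \<beta> \<rightarrow>\<^sub>M count_space UNIV" for x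
    unfolding local_time_def
    by (intro count_space_sum_measurable measurable_compose[OF walk_measurable_steps]) simp
  have "(\<lambda>\<sigma>. (x, local_time (\<sigma>, undefined) x k)) \<in> step_law \<beta> \<rightarrow>\<^sub>M count_space UNIV" for x
    by (rule measurable_compose[OF lt]) simp
  then show ?thesis unfolding site_def
    by (rule measurable_compose_countable[OF _ walk_measurable_steps])
qed

locale random_traps =
  fixes \<pi> :: "real measure measure"
  assumes \<pi>: "\<pi> \<in> space (prob_algebra trap_measures)"
begin

lemma annealed_prob: "prob_space (annealed_law \<beta> \<pi>)"
  unfolding annealed_law_eq[OF \<pi>] using prob_space_step_law holding_law_space(1)[OF \<pi>] by (rule prob_space_pair)

lemma annealed_fst: "fst \<in> annealed_law \<beta> \<pi> \<rightarrow>\<^sub>M step_law \<beta>"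
  unfolding annealed_law_eq[OF \<pi>] by (rule measurable_fst)

lemma annealed_distr_fst: "distr (annealed_law \<beta> \<pi>) (step_law \<beta>) fst = step_law \<beta>"
  unfolding annealed_law_eq[OF \<pi>] by (rule prob_space.distr_pair_fst[OF holding_law_space(1)[OF \<pi>]])

lemma walk_measurable: "(\<lambda>s. walk s k) \<in> annealed_law \<beta> \<pi> \<rightarrow>\<^sub>M count_space UNIV"
  using measurable_compose[OF annealed_fst walk_measurable_steps] walk_fst by simp

lemma coordinate_measurable_holding: "(\<lambda>\<eta>. \<eta> l) \<in> borel_measurable (holding_law \<pi>)"
  using coordinate_borel holding_law_space(2)[OF \<pi>] by (simp cong: measurable_cong_sets)

lemma holding_time_measurable: "(\<lambda>s. holding_time s k) \<in> borel_measurable (annealed_law \<beta> \<pi>)"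
  unfolding annealed_law_eq[OF \<pi>] holding_time_eq_site
proof (rule measurable_compose_countable[where f="\<lambda>l s. snd s l"])
  show "(\<lambda>s. snd s l) \<in> borel_measurable (step_law \<beta> \<Otimes>\<^sub>M holding_law \<pi>)" for l
    by (rule measurable_compose[OF measurable_snd coordinate_measurable_holding])
  show "(\<lambda>s. site (fst s) k) \<in> step_law \<beta> \<Otimes>\<^sub>M holding_law \<pi> \<rightarrow>\<^sub>M count_space UNIV"
    by (rule measurable_compose[OF measurable_fst site_measurable])
qed

lemma holding_time_positive:
  assumes "s \<in> space (annealed_law \<beta> \<pi>)" shows "0 < holding_time s k"
proof -
  have "snd s \<in> space (holding_law \<pi>)" using assms unfolding annealed_law_eq[OF \<pi>] by (auto simp: space_pair_measure)
  then have "snd s \<in> space (PiM UNIV (\<lambda>_. pos_real))" using sets_eq_imp_space_eq[OF holding_law_space(2)[OF \<pi>]] by simp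
  then have "snd s l \<in> {0<..}" for l by (auto simp: space_PiM space_restrict_space)
  then show ?thesis unfolding holding_time_eq_site by simp
qed

lemma nn_integral_annealed:
  assumes "f \<in> borel_measurable (annealed_law \<beta> \<pi>)"
  shows "(\<integral>\<^sup>+s. f s \<partial>annealed_law \<beta> \<pi>) = (\<integral>\<^sup>+\<sigma>. \<integral>\<^sup>+\<eta>. f (\<sigma>, \<eta>) \<partial>holding_law \<pi> \<partial>step_law \<beta>)"
proof -
  interpret H: prob_space "holding_law \<pi>" by (rule holding_law_space(1)[OF \<pi>])
  show ?thesis using assms unfolding annealed_law_eq[OF \<pi>] by (rule H.nn_integral_fst[symmetric])
qed

lemma nn_integral_holding_time:
  assumes f: "f \<in> borel_measurable borel"
  shows "(\<integral>\<^sup>+s. f (holding_time s k) \<partial>annealed_law \<beta> \<pi>) = trap_mean \<pi> f"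
proof -
  interpret S: prob_space "step_law \<beta>" by (rule prob_space_step_law)
  have "(\<integral>\<^sup>+s. f (holding_time s k) \<partial>annealed_law \<beta> \<pi>) =
      (\<integral>\<^sup>+\<sigma>. \<integral>\<^sup>+\<eta>. f (\<eta> (site \<sigma> k)) \<partial>holding_law \<pi> \<partial>step_law \<beta>)"
    by (subst nn_integral_annealed[OF measurable_compose[OF holding_time_measurable f]]) (simp add: holding_time_eq_site)
  also have "\<dots> = trap_mean \<pi> f"
    unfolding nn_integral_holding_coordinate[OF \<pi> f] by (simp add: S.emeasure_space_1)
  finally show ?thesis .
qed

text \<open>
  Given the walk, two holding times at different sites are independent of each other. When the walk is
  at the same site at both times, the product is bounded by the sum of the squares.
\<close>

lemma nn_integral_holding_time_product:
  assumes f: "f \<in> borel_measurable borel" and g: "g \<in> borel_measurable borel"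
  shows "(\<integral>\<^sup>+s. f (holding_time s k) * g (holding_time s l) \<partial>annealed_law \<beta> \<pi>) \<le>
    trap_mean \<pi> f * trap_mean \<pi> g +
    emeasure (annealed_law \<beta> \<pi>) {s \<in> space (annealed_law \<beta> \<pi>). walk s k = walk s l} *
      (trap_mean \<pi> (\<lambda>r. (f r)\<^sup>2) + trap_mean \<pi> (\<lambda>r. (g r)\<^sup>2))"
proof -
  interpret S: prob_space "step_law \<beta>" by (rule prob_space_step_law)
  interpret A: prob_space "annealed_law \<beta> \<pi>" by (rule annealed_prob)
  let ?C = "trap_mean \<pi> (\<lambda>r. (f r)\<^sup>2) + trap_mean \<pi> (\<lambda>r. (g r)\<^sup>2)"
  define W where "W = {\<sigma> \<in> space (step_law \<beta>). walk (\<sigma>, undefined) k = walk (\<sigma>, undefined) l}"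
  have f2: "(\<lambda>r. (f r)\<^sup>2) \<in> borel_measurable borel" and g2: "(\<lambda>r. (g r)\<^sup>2) \<in> borel_measurable borel"
    unfolding power2_eq_square using f g by auto
  have walk_meas: "(\<lambda>\<sigma>. (walk (\<sigma>, undefined) k, walk (\<sigma>, undefined) l)) \<in> step_law \<beta> \<rightarrow>\<^sub>M count_space UNIV"
  proof (rule measurable_compose_countable[where f="\<lambda>a \<sigma>. (a, walk (\<sigma>, undefined) l)"])
    show "(\<lambda>\<sigma>. (a, walk (\<sigma>, undefined) l)) \<in> step_law \<beta> \<rightarrow>\<^sub>M count_space UNIV" for a
      by (rule measurable_compose[OF walk_measurable_steps]) simp
  qed (rule walk_measurable_steps)
  have W: "W \<in> sets (step_law \<beta>)"
  proof -
    have "W = (\<lambda>\<sigma>. (walk (\<sigma>, undefined) k, walk (\<sigma>, undefined) l)) -` {p. fst p = snd p} \<inter> space (step_law \<beta>)"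
      by (auto simp: W_def)
    also have "\<dots> \<in> sets (step_law \<beta>)" by (rule measurable_sets[OF walk_meas]) simp
    finally show ?thesis .
  qed
  have W_prob: "emeasure (step_law \<beta>) W = emeasure (annealed_law \<beta> \<pi>) {s \<in> space (annealed_law \<beta> \<pi>). walk s k = walk s l}"
  proof -
    have "emeasure (step_law \<beta>) W = emeasure (distr (annealed_law \<beta> \<pi>) (step_law \<beta>) fst) W" by (simp add: annealed_distr_fst)
    also have "\<dots> = emeasure (annealed_law \<beta> \<pi>) (fst -` W \<inter> space (annealed_law \<beta> \<pi>))"
      by (rule emeasure_distr[OF annealed_fst W])
    also have "fst -` W \<inter> space (annealed_law \<beta> \<pi>) = {s \<in> space (annealed_law \<beta> \<pi>). walk s k = walk s l}"
      using measurable_space[OF annealed_fst] by (auto simp: W_def walk_fst[of _ _ undefined, symmetric])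
    finally show ?thesis .
  qed
  have "(\<integral>\<^sup>+s. f (holding_time s k) * g (holding_time s l) \<partial>annealed_law \<beta> \<pi>) =
      (\<integral>\<^sup>+\<sigma>. \<integral>\<^sup>+\<eta>. f (\<eta> (site \<sigma> k)) * g (\<eta> (site \<sigma> l)) \<partial>holding_law \<pi> \<partial>step_law \<beta>)"
    by (subst nn_integral_annealed[OF borel_measurable_times_ennreal[OF
        measurable_compose[OF holding_time_measurable f] measurable_compose[OF holding_time_measurable g]]])
      (simp add: holding_time_eq_site)
  also have "\<dots> \<le> (\<integral>\<^sup>+\<sigma>. trap_mean \<pi> f * trap_mean \<pi> g + indicator W \<sigma> * ?C \<partial>step_law \<beta>)"
  proof (rule nn_integral_mono)
    fix \<sigma> assume \<sigma>: "\<sigma> \<in> space (step_law \<beta>)"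
    show "(\<integral>\<^sup>+\<eta>. f (\<eta> (site \<sigma> k)) * g (\<eta> (site \<sigma> l)) \<partial>holding_law \<pi>) \<le> trap_mean \<pi> f * trap_mean \<pi> g + indicator W \<sigma> * ?C"
    proof (cases "\<sigma> \<in> W")
      case False
      then have "fst (site \<sigma> k) \<noteq> fst (site \<sigma> l)" using \<sigma> by (auto simp: W_def site_def)
      then show ?thesis using nn_integral_holding_different_sites[OF \<pi> f g] by simp
    next
      case True
      have mult_le: "a * b \<le> a\<^sup>2 + b\<^sup>2" for a b :: ennreal
      proof (cases "a \<le> b")
        case True
        then have "a * b \<le> b\<^sup>2" unfolding power2_eq_square by (rule mult_right_mono) simp
        then show ?thesis by (rule order_trans) simp
      next
        case False
        then have "a * b \<le> a\<^sup>2" unfolding power2_eq_square by (intro mult_left_mono) auto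
        then show ?thesis by (rule order_trans) simp
      qed
      have "(\<integral>\<^sup>+\<eta>. f (\<eta> (site \<sigma> k)) * g (\<eta> (site \<sigma> l)) \<partial>holding_law \<pi>) \<le>
          (\<integral>\<^sup>+\<eta>. (f (\<eta> (site \<sigma> k)))\<^sup>2 + (g (\<eta> (site \<sigma> l)))\<^sup>2 \<partial>holding_law \<pi>)"
        by (intro nn_integral_mono mult_le)
      also have "\<dots> = (\<integral>\<^sup>+\<eta>. (f (\<eta> (site \<sigma> k)))\<^sup>2 \<partial>holding_law \<pi>) + (\<integral>\<^sup>+\<eta>. (g (\<eta> (site \<sigma> l)))\<^sup>2 \<partial>holding_law \<pi>)"
        by (intro nn_integral_add measurable_compose[OF coordinate_measurable_holding f2]
            measurable_compose[OF coordinate_measurable_holding g2])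
      also have "\<dots> = ?C"
        unfolding nn_integral_holding_coordinate[OF \<pi> f2] nn_integral_holding_coordinate[OF \<pi> g2] ..
      also have "\<dots> \<le> trap_mean \<pi> f * trap_mean \<pi> g + indicator W \<sigma> * ?C" using True by simp
      finally show ?thesis .
    qed
  qed
  also have "\<dots> = trap_mean \<pi> f * trap_mean \<pi> g + emeasure (step_law \<beta>) W * ?C"
    using W by (subst nn_integral_add) (auto simp: S.emeasure_space_1 nn_integral_multc)
  finally show ?thesis unfolding W_prob .
qed

lemma mean_holding_time_eq: "mean_holding_time \<beta> \<pi> = enn2real (trap_mean \<pi> ennreal)"
proof -
  have "mean_holding_time \<beta> \<pi> = enn2real (\<integral>\<^sup>+s. ennreal (holding_time s 0) \<partial>annealed_law \<beta> \<pi>)"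
    unfolding mean_holding_time_def
    by (rule integral_eq_nn_integral[OF holding_time_measurable]) (auto intro!: AE_I2 less_imp_le holding_time_positive)
  then show ?thesis by (subst (asm) nn_integral_holding_time) auto
qed

end

locale integrable_random_traps = random_traps +
  assumes finite_mean: "trap_mean \<pi> ennreal < \<infinity>"
begin

definition meeting_prob :: "real \<Rightarrow> nat \<Rightarrow> nat \<Rightarrow> real" where
  "meeting_prob \<beta> k l = measure (annealed_law \<beta> \<pi>) {s \<in> space (annealed_law \<beta> \<pi>). walk s k = walk s l}"

lemma integrable_holding_time: "integrable (annealed_law \<beta> \<pi>) (\<lambda>s. holding_time s k)"
proof (rule integrableI_bounded[OF holding_time_measurable])
  have "(\<integral>\<^sup>+s. ennreal (norm (holding_time s k)) \<partial>annealed_law \<beta> \<pi>) = (\<integral>\<^sup>+s. ennreal (holding_time s k) \<partial>annealed_law \<beta> \<pi>)"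
    by (intro nn_integral_cong) (simp add: less_imp_le holding_time_positive)
  also have "\<dots> = trap_mean \<pi> ennreal" by (rule nn_integral_holding_time) simp
  finally show "(\<integral>\<^sup>+s. ennreal (norm (holding_time s k)) \<partial>annealed_law \<beta> \<pi>) < \<infinity>" using finite_mean by simp
qed

lemma mean_holding_time_positive: "0 < mean_holding_time \<beta> \<pi>"
proof -
  interpret A: prob_space "annealed_law \<beta> \<pi>" by (rule annealed_prob)
  have "mean_holding_time \<beta> \<pi> \<noteq> 0"
  proof
    assume "mean_holding_time \<beta> \<pi> = 0"
    then have "AE s in annealed_law \<beta> \<pi>. holding_time s 0 = 0"
      unfolding mean_holding_time_def
      by (subst (asm) integral_nonneg_eq_0_iff_AE[OF integrable_holding_time])
        (auto intro!: AE_I2 less_imp_le holding_time_positive)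
    moreover have "AE s in annealed_law \<beta> \<pi>. holding_time s 0 > 0" by (rule AE_I2) (rule holding_time_positive)
    ultimately have "AE s in annealed_law \<beta> \<pi>. False" by eventually_elim simp
    then show False by simp
  qed
  moreover have "0 \<le> mean_holding_time \<beta> \<pi>" unfolding mean_holding_time_eq by simp
  ultimately show ?thesis by simp
qed

theorem holding_times_weakly_dependent:
  "weakly_dependent_sequence (annealed_law \<beta> \<pi>) (\<lambda>k s. holding_time s k) (meeting_prob \<beta>)"
proof -
  interpret A: prob_space "annealed_law \<beta> \<pi>" by (rule annealed_prob)
  show ?thesis
  proof
    show "(\<lambda>s. holding_time s k) \<in> borel_measurable (annealed_law \<beta> \<pi>)" for k by (rule holding_time_measurable)
    show "0 \<le> holding_time w k" if "w \<in> space (annealed_law \<beta> \<pi>)" for k w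
      using holding_time_positive[OF that] by (rule less_imp_le)
    show "distr (annealed_law \<beta> \<pi>) borel (\<lambda>s. holding_time s k) = distr (annealed_law \<beta> \<pi>) borel (\<lambda>s. holding_time s 0)" for k
    proof (rule measure_eqI)
      fix B assume "B \<in> sets (distr (annealed_law \<beta> \<pi>) borel (\<lambda>s. holding_time s k))"
      then have B: "B \<in> sets borel" by simp
      have "emeasure (distr (annealed_law \<beta> \<pi>) borel (\<lambda>s. holding_time s k)) B = trap_mean \<pi> (indicator B)" for k
      proof -
        have "emeasure (distr (annealed_law \<beta> \<pi>) borel (\<lambda>s. holding_time s k)) B =
            (\<integral>\<^sup>+r. indicator B r \<partial>distr (annealed_law \<beta> \<pi>) borel (\<lambda>s. holding_time s k))" using B by simp
        also have "\<dots> = (\<integral>\<^sup>+s. indicator B (holding_time s k) \<partial>annealed_law \<beta> \<pi>)"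
          using B by (intro nn_integral_distr holding_time_measurable) auto
        also have "\<dots> = trap_mean \<pi> (indicator B)" using B by (intro nn_integral_holding_time) auto
        finally show ?thesis .
      qed
      then show "emeasure (distr (annealed_law \<beta> \<pi>) borel (\<lambda>s. holding_time s k)) B =
          emeasure (distr (annealed_law \<beta> \<pi>) borel (\<lambda>s. holding_time s 0)) B" by simp
    qed simp
    show "integrable (annealed_law \<beta> \<pi>) (\<lambda>s. holding_time s 0)" by (rule integrable_holding_time)
    fix k l :: nat and g h :: "real \<Rightarrow> real" and B :: real
    assume g [measurable]: "g \<in> borel_measurable borel" and h [measurable]: "h \<in> borel_measurable borel"
      and gB: "\<And>x. 0 \<le> g x \<and> g x \<le> B" and hB: "\<And>x. 0 \<le> h x \<and> h x \<le> B"
    note [measurable] = holding_time_measurable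
    have B0: "0 \<le> B" using gB[of 0] by linarith
    have E1: "ennreal (A.expectation (\<lambda>w. f (holding_time w 0))) = trap_mean \<pi> (\<lambda>r. ennreal (f r))"
      if f: "f \<in> borel_measurable borel" "\<And>x. 0 \<le> f x \<and> f x \<le> C" for f :: "real \<Rightarrow> real" and C
    proof -
      have "integrable (annealed_law \<beta> \<pi>) (\<lambda>w. f (holding_time w 0))"
        using f by (intro A.integrable_const_bound[of _ C]) auto
      then have "ennreal (A.expectation (\<lambda>w. f (holding_time w 0))) = (\<integral>\<^sup>+w. ennreal (f (holding_time w 0)) \<partial>annealed_law \<beta> \<pi>)"
        using f by (subst nn_integral_eq_integral) auto
      also have "\<dots> = trap_mean \<pi> (\<lambda>r. ennreal (f r))" using f(1) by (intro nn_integral_holding_time) simp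
      finally show ?thesis .
    qed
    have sq: "0 \<le> (f x)\<^sup>2 \<and> (f x)\<^sup>2 \<le> B\<^sup>2" if "\<And>x. 0 \<le> f x \<and> f x \<le> B" for f :: "real \<Rightarrow> real" and x
      using that by (auto intro!: power_mono)
    have "integrable (annealed_law \<beta> \<pi>) (\<lambda>w. g (holding_time w k) * h (holding_time w l))"
      using gB hB B0 by (intro A.integrable_const_bound[of _ "B * B"]) (auto simp: abs_mult intro!: mult_mono)
    then have "ennreal (A.expectation (\<lambda>w. g (holding_time w k) * h (holding_time w l))) =
        (\<integral>\<^sup>+w. ennreal (g (holding_time w k) * h (holding_time w l)) \<partial>annealed_law \<beta> \<pi>)"
      using gB hB by (intro nn_integral_eq_integral[symmetric]) auto
    also have "\<dots> = (\<integral>\<^sup>+w. ennreal (g (holding_time w k)) * ennreal (h (holding_time w l)) \<partial>annealed_law \<beta> \<pi>)"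
      using gB hB by (simp add: ennreal_mult)
    also have "\<dots> \<le> trap_mean \<pi> (\<lambda>r. ennreal (g r)) * trap_mean \<pi> (\<lambda>r. ennreal (h r)) +
        emeasure (annealed_law \<beta> \<pi>) {s \<in> space (annealed_law \<beta> \<pi>). walk s k = walk s l} *
        (trap_mean \<pi> (\<lambda>r. (ennreal (g r))\<^sup>2) + trap_mean \<pi> (\<lambda>r. (ennreal (h r))\<^sup>2))"
      by (rule nn_integral_holding_time_product) auto
    also have "(\<lambda>r. (ennreal (g r))\<^sup>2) = (\<lambda>r. ennreal ((g r)\<^sup>2))" using gB by (simp add: ennreal_power)
    also have "(\<lambda>r. (ennreal (h r))\<^sup>2) = (\<lambda>r. ennreal ((h r)\<^sup>2))" using hB by (simp add: ennreal_power)
    also have "trap_mean \<pi> (\<lambda>r. ennreal (g r)) = ennreal (A.expectation (\<lambda>w. g (holding_time w 0)))"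
      by (rule E1[symmetric, OF g gB])
    also have "trap_mean \<pi> (\<lambda>r. ennreal (h r)) = ennreal (A.expectation (\<lambda>w. h (holding_time w 0)))"
      by (rule E1[symmetric, OF h hB])
    also have "trap_mean \<pi> (\<lambda>r. ennreal ((g r)\<^sup>2)) = ennreal (A.expectation (\<lambda>w. (g (holding_time w 0))\<^sup>2))"
      by (rule E1[symmetric, of _ "B\<^sup>2"]) (use sq[OF gB] in auto)
    also have "trap_mean \<pi> (\<lambda>r. ennreal ((h r)\<^sup>2)) = ennreal (A.expectation (\<lambda>w. (h (holding_time w 0))\<^sup>2))"
      by (rule E1[symmetric, of _ "B\<^sup>2"]) (use sq[OF hB] in auto)
    also have "emeasure (annealed_law \<beta> \<pi>) {s \<in> space (annealed_law \<beta> \<pi>). walk s k = walk s l} = ennreal (meeting_prob \<beta> k l)"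
      by (simp add: meeting_prob_def A.emeasure_eq_measure)
    also have "ennreal (A.expectation (\<lambda>w. g (holding_time w 0))) * ennreal (A.expectation (\<lambda>w. h (holding_time w 0))) +
        ennreal (meeting_prob \<beta> k l) * (ennreal (A.expectation (\<lambda>w. (g (holding_time w 0))\<^sup>2)) + ennreal (A.expectation (\<lambda>w. (h (holding_time w 0))\<^sup>2))) =
      ennreal (A.expectation (\<lambda>w. g (holding_time w 0)) * A.expectation (\<lambda>w. h (holding_time w 0)) +
        meeting_prob \<beta> k l * (A.expectation (\<lambda>w. (g (holding_time w 0))\<^sup>2) + A.expectation (\<lambda>w. (h (holding_time w 0))\<^sup>2)))"
      using gB hB by (simp add: ennreal_mult ennreal_plus meeting_prob_def integral_nonneg_AE)
    finally show "A.expectation (\<lambda>w. g (holding_time w k) * h (holding_time w l)) \<le>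
        A.expectation (\<lambda>w. g (holding_time w 0)) * A.expectation (\<lambda>w. h (holding_time w 0)) +
        meeting_prob \<beta> k l * (A.expectation (\<lambda>w. (g (holding_time w 0))\<^sup>2) + A.expectation (\<lambda>w. (h (holding_time w 0))\<^sup>2))"
      using gB hB by (subst (asm) ennreal_le_iff) (auto simp: meeting_prob_def intro!: add_nonneg_nonneg mult_nonneg_nonneg integral_nonneg_AE)
  qed
qed

end

lemma indep_vars_pullback:
  assumes M: "prob_space M" and N: "prob_space N" and T: "T \<in> M \<rightarrow>\<^sub>M N" and D: "distr M N T = N"
    and r: "inj r" "range r \<subseteq> I" and ind: "prob_space.indep_vars N S X I"
  shows "prob_space.indep_vars M (\<lambda>i. S (r i)) (\<lambda>i w. X (r i) (T w)) UNIV"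
proof -
  interpret M: prob_space M by fact
  interpret N: prob_space N by fact
  have rv: "X (r i) \<in> N \<rightarrow>\<^sub>M S (r i)" for i using ind r by (auto simp: N.indep_vars_def2)
  show ?thesis
    unfolding M.indep_vars_def2
  proof (intro conjI ballI M.indep_setsI)
    show rvM: "(\<lambda>w. X (r i) (T w)) \<in> M \<rightarrow>\<^sub>M S (r i)" for i by (rule measurable_compose[OF T rv])
    show "{(\<lambda>w. X (r i) (T w)) -` A \<inter> space M |A. A \<in> sets (S (r i))} \<subseteq> M.events" for i
      using rvM[of i] by (auto intro: measurable_sets)
    fix A J assume J: "J \<noteq> {}" "J \<subseteq> UNIV" "finite J"
      and A: "\<forall>j\<in>J. A j \<in> {(\<lambda>w. X (r j) (T w)) -` A \<inter> space M |A. A \<in> sets (S (r j))}"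
    then have "\<forall>j\<in>J. \<exists>B. B \<in> sets (S (r j)) \<and> A j = (\<lambda>w. X (r j) (T w)) -` B \<inter> space M" by auto
    then obtain B where B: "\<And>j. j \<in> J \<Longrightarrow> B j \<in> sets (S (r j))" "\<And>j. j \<in> J \<Longrightarrow> A j = (\<lambda>w. X (r j) (T w)) -` B j \<inter> space M"
      by metis
    define C where "C j = X (r j) -` B j \<inter> space N" for j
    have C: "C j \<in> sets N" if "j \<in> J" for j unfolding C_def by (rule measurable_sets[OF rv B(1)[OF that]])
    have AC: "A j = T -` C j \<inter> space M" if "j \<in> J" for j
      using B(2)[OF that] measurable_space[OF T] by (auto simp: C_def)
    have meas: "measure M (T -` E \<inter> space M) = measure N E" if "E \<in> sets N" for E
      using measure_distr[OF T that] by (simp add: D)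
    have "(\<Inter>j\<in>J. A j) = T -` (\<Inter>j\<in>J. C j) \<inter> space M" using J AC by auto
    then have "measure M (\<Inter>j\<in>J. A j) = measure N (\<Inter>j\<in>J. C j)"
      using J C meas[of "\<Inter>j\<in>J. C j"] by (simp add: sets.finite_INT)
    also have "\<dots> = measure N (\<Inter>i\<in>r ` J. X i -` B (the_inv r i) \<inter> space N)"
      using r(1) by (intro arg_cong[where f="measure N"]) (auto simp: C_def the_inv_f_f)
    also have "\<dots> = (\<Prod>i\<in>r ` J. measure N (X i -` B (the_inv r i) \<inter> space N))"
      using J B(1) r by (intro N.indep_varsD[OF ind]) (auto simp: the_inv_f_f)
    also have "\<dots> = (\<Prod>j\<in>J. measure N (C j))"
      using r(1) by (subst prod.reindex) (auto simp: C_def the_inv_f_f inj_on_def)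
    also have "\<dots> = (\<Prod>j\<in>J. measure M (A j))" using AC meas C by simp
    finally show "measure M (\<Inter>j\<in>J. A j) = (\<Prod>j\<in>J. measure M (A j))" .
  qed
qed

definition walk_step :: "nat \<Rightarrow> sample \<Rightarrow> real" where
  "walk_step i s = real_of_int (fst s (Suc i))"

lemma walk_eq_sum_steps: "real_of_int (walk s k) = (\<Sum>i<k. walk_step i s)"
  unfolding walk_def walk_step_def of_int_sum
  by (rule sum.reindex_bij_witness[of _ Suc "\<lambda>j. j - 1"]) auto

theorem (in random_traps) walk_sign_steps:
  assumes \<beta>: "0 < \<beta>"
  shows "sign_steps (annealed_law \<beta> \<pi>) walk_step ((\<beta> - 1) / (\<beta> + 1))"
proof -
  interpret A: prob_space "annealed_law \<beta> \<pi>" by (rule annealed_prob)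
  interpret S: prob_space "step_law \<beta>" by (rule prob_space_step_law)
  let ?S = "\<lambda>_. count_space UNIV :: int measure"
  have ind: "S.indep_vars ?S (\<lambda>i w. w i) {1..}"
    unfolding step_law_def by (rule product_coordinates_indep) (auto intro: measure_pmf.prob_space_axioms)
  have coord: "(\<lambda>s. fst s (Suc i)) \<in> annealed_law \<beta> \<pi> \<rightarrow>\<^sub>M count_space UNIV" for i
    by (rule measurable_compose[OF annealed_fst step_coordinate_measurable]) simp
  have distr: "distr (annealed_law \<beta> \<pi>) (count_space UNIV) (\<lambda>s. fst s (Suc i)) = measure_pmf (step_pmf \<beta>)" for i
  proof -
    have "distr (annealed_law \<beta> \<pi>) (count_space UNIV) (\<lambda>s. fst s (Suc i)) =
        distr (distr (annealed_law \<beta> \<pi>) (step_law \<beta>) fst) (count_space UNIV) (\<lambda>\<sigma>. \<sigma> (Suc i))"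
      using step_coordinate_measurable[of "Suc i" \<beta>] by (subst distr_distr[OF _ annealed_fst]) (auto simp: comp_def)
    also have "\<dots> = distr (step_law \<beta>) (measure_pmf (step_pmf \<beta>)) (\<lambda>\<sigma>. \<sigma> (Suc i))"
      unfolding annealed_distr_fst by (rule distr_cong) auto
    also have "\<dots> = measure_pmf (step_pmf \<beta>)"
      unfolding step_law_def by (rule distr_PiM_component) (auto intro: measure_pmf.prob_space_axioms)
    finally show ?thesis .
  qed
  show ?thesis
  proof
    have "A.indep_vars (\<lambda>_. count_space UNIV) (\<lambda>i s. fst s (Suc i)) UNIV"
      using indep_vars_pullback[OF annealed_prob prob_space_step_law annealed_fst annealed_distr_fst _ _ ind, of Suc] by auto
    then have "A.indep_vars (\<lambda>_. borel) (\<lambda>i s. real_of_int (fst s (Suc i))) UNIV"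
      by (rule A.indep_vars_compose2) simp
    then show "A.indep_vars (\<lambda>_. borel) walk_step UNIV" by (simp add: walk_step_def[abs_def])
  next
    fix i
    have "AE x in measure_pmf (step_pmf \<beta>). real_of_int x = -1 \<or> real_of_int x = 1"
      by (auto simp: AE_measure_pmf_iff step_pmf_def)
    then have "AE x in distr (annealed_law \<beta> \<pi>) (count_space UNIV) (\<lambda>s. fst s (Suc i)). real_of_int x = -1 \<or> real_of_int x = 1"
      unfolding distr .
    then show "AE w in annealed_law \<beta> \<pi>. walk_step i w = -1 \<or> walk_step i w = 1"
      unfolding walk_step_def by (subst (asm) AE_distr_iff[OF coord]) auto
    have "A.expectation (walk_step i) = (\<integral>x. real_of_int x \<partial>distr (annealed_law \<beta> \<pi>) (count_space UNIV) (\<lambda>s. fst s (Suc i)))"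
      unfolding walk_step_def by (subst integral_distr[OF coord]) auto
    also have "\<dots> = (\<integral>b. real_of_int (if b then -1 else 1) \<partial>bernoulli_pmf (1 / (\<beta> + 1)))"
      unfolding distr step_pmf_def by simp
    also have "\<dots> = 1 - 2 / (\<beta> + 1)"
    proof -
      have "2 / (\<beta> + 1) = 1 / (\<beta> + 1) + 1 / (\<beta> + 1)" by (simp add: add_divide_distrib[symmetric])
      then show ?thesis using \<beta> by (subst integral_bernoulli_pmf) auto
    qed
    also have "\<dots> = (\<beta> - 1) / (\<beta> + 1)" using \<beta> by (simp add: eq_divide_eq left_diff_distrib)
    finally show "A.expectation (walk_step i) = (\<beta> - 1) / (\<beta> + 1)" .
  qed
qed

section \<open>The clock and the speed\<close>

lemma clock_mono:
  assumes "\<And>k. 0 < holding_time s k" and "j \<le> k" shows "clock s j \<le> clock s k"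
  unfolding clock_def using assms by (intro sum_mono2) (auto simp: less_imp_le)

lemma clock_inverse_bounds:
  assumes pos: "\<And>k. 0 < holding_time s k" and t: "0 \<le> t" "t < clock s k0"
  shows "clock s (clock_inverse s t) \<le> t" "t < clock s (Suc (clock_inverse s t))"
    "\<And>k. clock s k \<le> t \<Longrightarrow> k \<le> clock_inverse s t" "clock_inverse s t < k0"
proof -
  define A where "A = {k. clock s k \<le> t}"
  have sub: "A \<subseteq> {..<k0}"
  proof
    fix k assume "k \<in> A"
    then have "clock s k < clock s k0" using t by (simp add: A_def)
    then have "\<not> k0 \<le> k" using clock_mono[OF pos, of k0 k] by auto
    then show "k \<in> {..<k0}" by simp
  qed
  then have fin: "finite A" by (rule finite_subset) simp
  have "0 \<in> A" using t by (simp add: A_def clock_def)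
  then have "Max A \<in> A" using fin by (intro Max_in) auto
  moreover have "Suc (Max A) \<notin> A" using Max_ge[OF fin, of "Suc (Max A)"] by auto
  moreover have "clock_inverse s t = Max A" by (simp add: clock_inverse_def A_def)
  ultimately show "clock s (clock_inverse s t) \<le> t" "t < clock s (Suc (clock_inverse s t))"
    "clock_inverse s t < k0" using sub by (auto simp: A_def)
  show "k \<le> clock_inverse s t" if "clock s k \<le> t" for k
    unfolding \<open>clock_inverse s t = Max A\<close> using that by (intro Max_ge[OF fin]) (simp add: A_def)
qed

text \<open>
  With K n the inverse of the clock at n, the clock at K n and at K n + 1 encloses n, so that n / K n
  tends to \<mu>.
\<close>

lemma trapped_walk_speed:
  assumes pos: "\<And>k. 0 < holding_time s k" and \<mu>: "0 < \<mu>"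
    and S: "(\<lambda>n. clock s n / real n) \<longlonglongrightarrow> \<mu>" and Y: "(\<lambda>n. real_of_int (walk s n) / real n) \<longlonglongrightarrow> v"
  shows "(\<lambda>n. real_of_int (trapped_walk s (real n)) / real n) \<longlonglongrightarrow> v / \<mu>"
proof -
  define K where "K n = clock_inverse s (real n)" for n :: nat
  have "filterlim (\<lambda>n. (clock s n / real n) * real n) at_top sequentially"
    by (rule filterlim_tendsto_pos_mult_at_top[OF S \<mu> filterlim_real_sequentially])
  moreover have "(\<lambda>n. (clock s n / real n) * real n) = clock s" by (auto simp: fun_eq_iff clock_def)
  ultimately have top: "filterlim (clock s) at_top sequentially" by simp
  have unbounded: "\<exists>k. t < clock s k" for t
  proof -
    have "eventually (\<lambda>k. t < clock s k) sequentially" using top unfolding filterlim_at_top_dense by blast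
    then show ?thesis unfolding eventually_sequentially by blast
  qed
  have K: "clock s (K n) \<le> real n" "real n < clock s (Suc (K n))" "clock s k \<le> real n \<Longrightarrow> k \<le> K n" for n k
  proof -
    obtain k0 where "real n < clock s k0" using unbounded by blast
    from clock_inverse_bounds[OF pos _ this]
    show "clock s (K n) \<le> real n" "real n < clock s (Suc (K n))" "clock s k \<le> real n \<Longrightarrow> k \<le> K n"
      by (auto simp: K_def)
  qed
  have K_lim: "filterlim K at_top sequentially"
    unfolding filterlim_at_top eventually_sequentially
  proof
    fix Z :: nat
    obtain N :: nat where N: "clock s Z \<le> real N" using real_arch_simple by blast
    have "Z \<le> K n" if "n \<ge> N" for n using N that by (intro K(3)) linarith
    then show "\<exists>N. \<forall>n\<ge>N. Z \<le> K n" by blast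
  qed
  have Kpos: "eventually (\<lambda>n. 0 < K n) sequentially"
  proof -
    have "eventually (\<lambda>n. 1 \<le> K n) sequentially" using K_lim unfolding filterlim_at_top by blast
    then show ?thesis by eventually_elim simp
  qed
  have n_K: "(\<lambda>n. real n / real (K n)) \<longlonglongrightarrow> \<mu>"
  proof (rule tendsto_sandwich)
    show "(\<lambda>n. clock s (K n) / real (K n)) \<longlonglongrightarrow> \<mu>" by (rule filterlim_compose[OF S K_lim])
    have "(\<lambda>k. (clock s (Suc k) / real (Suc k)) * (real (Suc k) / real k)) \<longlonglongrightarrow> \<mu> * 1"
      by (intro tendsto_mult LIMSEQ_Suc[OF S]) real_asymp
    then have "(\<lambda>k. clock s (Suc k) / real k) \<longlonglongrightarrow> \<mu>" by (simp del: of_nat_Suc)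
    then show "(\<lambda>n. clock s (Suc (K n)) / real (K n)) \<longlonglongrightarrow> \<mu>" by (rule filterlim_compose[OF _ K_lim])
    show "\<forall>\<^sub>F n in sequentially. clock s (K n) / real (K n) \<le> real n / real (K n)"
      by (intro always_eventually allI divide_right_mono K(1)) simp
    show "\<forall>\<^sub>F n in sequentially. real n / real (K n) \<le> clock s (Suc (K n)) / real (K n)"
      by (intro always_eventually allI divide_right_mono less_imp_le[OF K(2)]) simp
  qed
  have "(\<lambda>n. (real_of_int (walk s (K n)) / real (K n)) / (real n / real (K n))) \<longlonglongrightarrow> v / \<mu>"
    using \<mu> by (intro tendsto_divide filterlim_compose[OF Y K_lim] n_K) auto
  moreover have "eventually (\<lambda>n. (real_of_int (walk s (K n)) / real (K n)) / (real n / real (K n)) =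
      real_of_int (trapped_walk s (real n)) / real n) sequentially"
    using Kpos by eventually_elim (simp add: trapped_walk_def K_def)
  ultimately show ?thesis by (rule Lim_transform_eventually)
qed

text \<open>
  The fourth moments of the averages of centred steps are of order 1/n^2 and hence summable.
\<close>

lemma (in sign_steps) strong_law_sign_steps: "AE w in M. (\<lambda>n. (\<Sum>i<n. \<xi> i w) / real n) \<longlonglongrightarrow> v"
proof -
  have v1: "\<bar>v\<bar> \<le> 1"
  proof -
    have "\<bar>expectation (\<xi> 0)\<bar> \<le> expectation (\<lambda>w. \<bar>\<xi> 0 w\<bar>)" by (rule integral_abs_bound)
    also have "\<dots> \<le> expectation (\<lambda>_. 1)"
      using sign[of 0] integrable_sign_step[of 0] by (intro integral_mono_AE) (auto elim!: eventually_mono)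
    finally show ?thesis by (simp add: mean prob_space)
  qed
  \<comment> \<open>Division by 2 keeps the centred steps bounded by 1.\<close>
  define \<zeta> where "\<zeta> i w = (\<xi> i w - v) / 2" for i w
  interpret Z: centered_steps M \<zeta>
  proof
    show "indep_vars (\<lambda>_. borel) \<zeta> UNIV"
      unfolding \<zeta>_def[abs_def] by (rule indep_vars_compose2[OF indep]) simp
    show "AE w in M. \<bar>\<zeta> i w\<bar> \<le> 1" for i
      using sign[of i] by eventually_elim (use v1 in \<open>auto simp: \<zeta>_def\<close>)
    show "expectation (\<zeta> i) = 0" for i
      unfolding \<zeta>_def[abs_def] using integrable_sign_step[of i] by (simp add: mean prob_space)
  qed
  have "AE w in M. summable (\<lambda>n. (Z.block 0 n w / real n) ^ 4)"
  proof (rule AE_summable_of_summable_expectation)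
    show "integrable M (\<lambda>w. (Z.block 0 n w / real n) ^ 4)" for n
      using Z.integrable_block_power[of 0 n 4] by (simp add: power_divide)
    show "summable (\<lambda>n. expectation (\<lambda>w. (Z.block 0 n w / real n) ^ 4))"
    proof (rule summable_comparison_test')
      show "summable (\<lambda>n. 3 * (1 / real n ^ 2))"
        by (intro summable_mult) (use inverse_power_summable[of 2, where 'a=real] in \<open>simp add: inverse_eq_divide\<close>)
      show "norm (expectation (\<lambda>w. (Z.block 0 n w / real n) ^ 4)) \<le> 3 * (1 / real n ^ 2)" if "n \<ge> 0" for n
      proof (cases "n = 0")
        case False
        have "expectation (\<lambda>w. (Z.block 0 n w / real n) ^ 4) = expectation (\<lambda>w. Z.block 0 n w ^ 4) / real n ^ 4"
          by (simp add: power_divide)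
        also have "\<dots> \<le> 3 * (real n)\<^sup>2 / real n ^ 4"
          using Z.fourth_moment_block[of 0 n] by (rule divide_right_mono) simp
        also have "\<dots> = 3 * (1 / real n ^ 2)" using False by (simp add: power2_eq_square power4_eq_xxxx)
        finally have "expectation (\<lambda>w. (Z.block 0 n w / real n) ^ 4) \<le> 3 * (1 / real n ^ 2)" .
        moreover have "0 \<le> expectation (\<lambda>w. (Z.block 0 n w / real n) ^ 4)" by (intro integral_nonneg_AE) auto
        ultimately show ?thesis by simp
      qed simp
    qed
  qed simp
  then show ?thesis
  proof eventually_elim
    case (elim w)
    have "(\<lambda>n. sqrt (sqrt ((Z.block 0 n w / real n) ^ 4))) \<longlonglongrightarrow> sqrt (sqrt 0)"
      by (intro tendsto_real_sqrt summable_LIMSEQ_zero elim)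
    moreover have "sqrt (sqrt (x ^ 4)) = \<bar>x\<bar>" for x :: real
      using real_sqrt_abs[of "x\<^sup>2"] by (simp add: power_mult[symmetric])
    ultimately have "(\<lambda>n. Z.block 0 n w / real n) \<longlonglongrightarrow> 0"
      by (intro tendsto_rabs_zero_cancel[of "\<lambda>n. Z.block 0 n w / real n"]) simp
    then have "(\<lambda>n. 2 * (Z.block 0 n w / real n) + v) \<longlonglongrightarrow> 2 * 0 + v" by (intro tendsto_intros)
    then have "(\<lambda>n. 2 * (Z.block 0 n w / real n) + v) \<longlonglongrightarrow> v" by simp
    moreover have "eventually (\<lambda>n. 2 * (Z.block 0 n w / real n) + v = (\<Sum>i<n. \<xi> i w) / real n) sequentially"
      using eventually_gt_at_top[of 0]
    proof eventually_elim
      case (elim n)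
      have "2 * Z.block 0 n w = (\<Sum>i<n. \<xi> i w) - real n * v"
      proof -
        have "2 * Z.block 0 n w = (\<Sum>i<n. 2 * \<zeta> i w)"
          by (simp add: Z.block_def sum_distrib_left lessThan_atLeast0)
        also have "\<dots> = (\<Sum>i<n. \<xi> i w - v)" by (rule sum.cong) (simp_all add: \<zeta>_def)
        finally show ?thesis by (simp add: sum_subtractf)
      qed
      then have "2 * Z.block 0 n w / real n = (\<Sum>i<n. \<xi> i w) / real n - v"
        using elim by (simp add: diff_divide_distrib)
      then show ?case by simp
    qed
    ultimately show ?case by (rule Lim_transform_eventually)
  qed
qed

context integrable_random_traps
begin

lemma meeting_prob_eq:
  "meeting_prob \<beta> k l = measure (annealed_law \<beta> \<pi>) {s \<in> space (annealed_law \<beta> \<pi>). (\<Sum>i\<in>{min k l..<min k l + ((k - l) + (l - k))}. walk_step i s) = 0}"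
proof -
  have "walk s k = walk s l \<longleftrightarrow> (\<Sum>i\<in>{min k l..<min k l + ((k - l) + (l - k))}. walk_step i s) = 0" for s
  proof -
    have diff: "(\<Sum>i\<in>{a..<b}. walk_step i s) = real_of_int (walk s b - walk s a)" if "a \<le> b" for a b
      using sum.atLeastLessThan_concat[of 0 a b "\<lambda>i. walk_step i s"] that
      by (simp add: walk_eq_sum_steps lessThan_atLeast0)
    show ?thesis
    proof (cases "k \<le> l")
      case True
      then show ?thesis using diff[of k l] by (auto simp: min_def)
    next
      case False
      then show ?thesis using diff[of l k] by (auto simp: min_def)
    qed
  qed
  then show ?thesis unfolding meeting_prob_def by simp
qed

lemma mean_holding_time_indep: "mean_holding_time \<beta> \<pi> = mean_holding_time 1 \<pi>"
  by (simp add: mean_holding_time_eq)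

text \<open>
  For a bias \<beta> > 1 the probability that the walk returns after m steps is at most \<rho>^m with
  \<rho> = 2 sqrt \<beta> / (\<beta> + 1) < 1. Hence the sum of the meeting probabilities up to time n is of order n, as
  the strong law requires.
\<close>

theorem biased_walk_speed:
  assumes \<beta>: "1 < \<beta>"
  shows "AE s in annealed_law \<beta> \<pi>. (\<lambda>n. real_of_int (trapped_walk s (real n)) / real n) \<longlonglongrightarrow> speed \<beta> \<pi>"
proof -
  interpret W: sign_steps "annealed_law \<beta> \<pi>" walk_step "(\<beta> - 1) / (\<beta> + 1)"
    using \<beta> by (intro walk_sign_steps) simp
  interpret H: weakly_dependent_sequence "annealed_law \<beta> \<pi>" "\<lambda>k s. holding_time s k" "meeting_prob \<beta>"
    by (rule holding_times_weakly_dependent)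
  define A where "A = sqrt \<beta>"
  have A: "1 < A" "A\<^sup>2 = \<beta>" using \<beta> by (auto simp: A_def)
  define \<rho> where "\<rho> = 2 * A / (A\<^sup>2 + 1)"
  have sq: "0 < A\<^sup>2 + 1" by (intro add_nonneg_pos) auto
  have "0 < (A - 1)\<^sup>2" using A by simp
  then have "2 * A < A\<^sup>2 + 1" by (simp add: power2_eq_square algebra_simps)
  then have \<rho>: "0 \<le> \<rho>" "\<rho> < 1" using A sq by (auto simp: \<rho>_def)
  have meet: "meeting_prob \<beta> k l \<le> \<rho> ^ ((k - l) + (l - k))" for k l
    unfolding meeting_prob_eq \<rho>_def using A by (intro W.prob_block_eq_0_le) auto
  have "AE s in annealed_law \<beta> \<pi>. (\<lambda>n. (\<Sum>k<n. holding_time s k) / real n) \<longlonglongrightarrow> W.expectation (\<lambda>s. holding_time s 0)"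
  proof (rule H.strong_law_of_large_numbers)
    fix n
    have "(\<Sum>k<n. \<Sum>l<n. meeting_prob \<beta> k l) \<le> (\<Sum>k<n. \<Sum>l<n. \<rho> ^ ((k - l) + (l - k)))"
      by (intro sum_mono meet)
    also have "\<dots> \<le> 2 * real n * (\<Sum>m<n. \<rho> ^ m)" by (rule sum_of_distances_le) (use \<rho> in simp)
    also have "\<dots> \<le> 2 * real n * (1 / (1 - \<rho>))"
    proof (rule mult_left_mono)
      have "(\<Sum>m<n. \<rho> ^ m) \<le> (\<Sum>m. \<rho> ^ m)" using \<rho> by (intro sum_le_suminf summable_geometric) auto
      also have "\<dots> = 1 / (1 - \<rho>)" using \<rho> by (intro suminf_geometric) auto
      finally show "(\<Sum>m<n. \<rho> ^ m) \<le> 1 / (1 - \<rho>)" .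
    qed simp
    finally show "(\<Sum>k<n. \<Sum>l<n. meeting_prob \<beta> k l) \<le> 2 / (1 - \<rho>) * real n" by simp
  qed (simp add: meeting_prob_def)
  then have clock: "AE s in annealed_law \<beta> \<pi>. (\<lambda>n. clock s n / real n) \<longlonglongrightarrow> mean_holding_time \<beta> \<pi>"
    by (simp add: clock_def mean_holding_time_def)
  show ?thesis
    using clock W.strong_law_sign_steps AE_space
  proof eventually_elim
    case (elim s)
    have "(\<lambda>n. real_of_int (trapped_walk s (real n)) / real n) \<longlonglongrightarrow> (\<beta> - 1) / (\<beta> + 1) / mean_holding_time \<beta> \<pi>"
      by (rule trapped_walk_speed[OF holding_time_positive[OF elim(3)] mean_holding_time_positive elim(1)])
        (use elim(2) in \<open>simp add: walk_eq_sum_steps\<close>)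
    then show ?case by (simp add: speed_def mult.commute)
  qed
qed

theorem speed_derivative_at_1:
  "((\<lambda>\<beta>. speed \<beta> \<pi> / (\<beta> - 1)) \<longlongrightarrow> inverse (mean_holding_time 1 \<pi>) / 2) (at_right 1)"
proof -
  let ?\<mu> = "mean_holding_time 1 \<pi>"
  have "((\<lambda>\<beta>. inverse ?\<mu> / (\<beta> + 1)) \<longlongrightarrow> inverse ?\<mu> / (1 + 1)) (at_right 1)"
    by (intro tendsto_intros) simp
  moreover have "eventually (\<lambda>\<beta>. inverse ?\<mu> / (\<beta> + 1) = speed \<beta> \<pi> / (\<beta> - 1)) (at_right 1)"
    using eventually_at_right_less[of "1::real"]
  proof eventually_elim
    case (elim \<beta>)
    then have "(\<beta> - 1) / (?\<mu> * (\<beta> + 1)) / (\<beta> - 1) = 1 / (?\<mu> * (\<beta> + 1))" by simp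
    then show ?case
      unfolding speed_def mean_holding_time_indep[of \<beta>] by (simp add: inverse_eq_divide)
  qed
  ultimately show ?thesis by (simp add: tendsto_cong)
qed

lemma unbiased_walk_steps: "simple_random_walk_steps (annealed_law 1 \<pi>) walk_step"
  unfolding simple_random_walk_steps_def using walk_sign_steps[of 1] by simp

text \<open>
  Without bias the return probability r m tends to 0, and so do its averages; these bound the sum of
  the meeting probabilities up to time n, divided by n^2.
\<close>

theorem unbiased_clock_mean_convergence:
  "(\<lambda>n. (\<integral>s. \<bar>clock s n - real n * mean_holding_time 1 \<pi>\<bar> \<partial>annealed_law 1 \<pi>) / real n) \<longlonglongrightarrow> 0"
proof -
  interpret W: simple_random_walk_steps "annealed_law 1 \<pi>" walk_step by (rule unbiased_walk_steps)
  interpret H: weakly_dependent_sequence "annealed_law 1 \<pi>" "\<lambda>k s. holding_time s k" "meeting_prob 1"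
    by (rule holding_times_weakly_dependent)
  define r where "r m = W.prob {w \<in> space (annealed_law 1 \<pi>). W.block 0 m w = 0}" for m
  have meet: "meeting_prob 1 k l = r ((k - l) + (l - k))" for k l
    unfolding meeting_prob_eq r_def W.block_def[symmetric] by (rule W.prob_block_eq_0_shift)
  have "(\<lambda>n. (\<Sum>k<n. \<Sum>l<n. meeting_prob 1 k l) / (real n)\<^sup>2) \<longlonglongrightarrow> 0"
  proof (rule tendsto_sandwich[of "\<lambda>_. 0"])
    have "r \<longlonglongrightarrow> 0" unfolding r_def[abs_def] by (rule W.prob_block_eq_0_tendsto)
    then show "(\<lambda>n. 2 * ((\<Sum>m<n. r m) / real n)) \<longlonglongrightarrow> 0"
      by (intro tendsto_mult_right_zero averages_tendsto)
    show "\<forall>\<^sub>F n in sequentially. (\<Sum>k<n. \<Sum>l<n. meeting_prob 1 k l) / (real n)\<^sup>2 \<le> 2 * ((\<Sum>m<n. r m) / real n)"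
    proof (intro always_eventually allI)
      fix n
      have "(\<Sum>k<n. \<Sum>l<n. meeting_prob 1 k l) / (real n)\<^sup>2 \<le> (2 * real n * (\<Sum>m<n. r m)) / (real n)\<^sup>2"
        unfolding meet by (intro divide_right_mono sum_of_distances_le) (simp_all add: r_def)
      then show "(\<Sum>k<n. \<Sum>l<n. meeting_prob 1 k l) / (real n)\<^sup>2 \<le> 2 * ((\<Sum>m<n. r m) / real n)"
        by (cases "n = 0") (simp_all add: power2_eq_square)
    qed
  qed (auto intro!: always_eventually divide_nonneg_nonneg sum_nonneg simp: meeting_prob_def)
  then have "(\<lambda>n. W.expectation (\<lambda>s. \<bar>(\<Sum>k<n. holding_time s k) - real n * W.expectation (\<lambda>s. holding_time s 0)\<bar>) / real n) \<longlonglongrightarrow> 0"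
    by (rule H.averages_converge_in_mean) (simp add: meeting_prob_def)
  then show ?thesis by (simp add: clock_def mean_holding_time_def)
qed

lemma clock_measurable [measurable]: "(\<lambda>s. clock s k) \<in> borel_measurable (annealed_law \<beta> \<pi>)"
  unfolding clock_def by (intro borel_measurable_sum holding_time_measurable)

text \<open>
  The maximum takes one fixed value on all infinite sets, and it has a fixed value on the empty set,
  which occurs for negative t. Each of the three cases is described by countably many conditions on the clock.
\<close>

lemma clock_inverse_measurable: "(\<lambda>s. clock_inverse s t) \<in> annealed_law \<beta> \<pi> \<rightarrow>\<^sub>M count_space UNIV"
proof (subst measurable_count_space_eq_countable)
  have "(\<lambda>s. clock_inverse s t) -` {j} \<inter> space (annealed_law \<beta> \<pi>) \<in> sets (annealed_law \<beta> \<pi>)" for j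
  proof -
    define I where "I s \<longleftrightarrow> (\<forall>N. \<exists>k\<in>{N..}. clock s k \<le> t)" for s
    define E where "E s \<longleftrightarrow> (\<forall>k. \<not> clock s k \<le> t)" for s
    define R where "R s \<longleftrightarrow> clock s j \<le> t \<and> (\<forall>k\<in>{j<..}. \<not> clock s k \<le> t)" for s
    \<comment> \<open>For infinite sets the maximum is defined as \<open>the None\<close>.\<close>
    have eq: "clock_inverse s t = j \<longleftrightarrow>
      (I s \<and> the None = j) \<or> (\<not> I s \<and> E s \<and> Max {} = j) \<or> (\<not> I s \<and> \<not> E s \<and> R s)" for s
    proof -
      let ?A = "{k. clock s k \<le> t}"
      have inf: "I s \<longleftrightarrow> infinite ?A"
        unfolding I_def infinite_nat_iff_unbounded_le by auto
      have inv: "clock_inverse s t = Max ?A" by (simp add: clock_inverse_def)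
      consider "infinite ?A" | "finite ?A" "?A = {}" | "finite ?A" "?A \<noteq> {}" by blast
      then show ?thesis
      proof cases
        case 1
        then have "Max ?A = the None" by (rule Max.infinite)
        moreover have "I s" using 1 inf by blast
        ultimately show ?thesis unfolding inv by simp
      next
        case 2
        then have "\<not> I s" "E s" using inf by (auto simp: E_def)
        then show ?thesis unfolding inv 2(2) by simp
      next
        case 3
        then have IE: "\<not> I s" "\<not> E s" using inf by (auto simp: E_def)
        have "Max ?A = j \<longleftrightarrow> j \<in> ?A \<and> (\<forall>k\<in>?A. k \<le> j)" using 3 by (rule Max_eq_iff)
        also have "\<dots> \<longleftrightarrow> R s" unfolding R_def by (simp add: Ball_def) (meson not_less)
        finally show ?thesis unfolding inv using IE by blast
      qed
    qed
    have [measurable]: "Measurable.pred (annealed_law \<beta> \<pi>) I" unfolding I_def[abs_def] by measurable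
    have [measurable]: "Measurable.pred (annealed_law \<beta> \<pi>) E" unfolding E_def[abs_def] by measurable
    have [measurable]: "Measurable.pred (annealed_law \<beta> \<pi>) R" unfolding R_def[abs_def] by measurable
    have "(\<lambda>s. clock_inverse s t) -` {j} \<inter> space (annealed_law \<beta> \<pi>) = {s \<in> space (annealed_law \<beta> \<pi>).
        (I s \<and> the None = j) \<or> (\<not> I s \<and> E s \<and> Max {} = j) \<or> (\<not> I s \<and> \<not> E s \<and> R s)}"
      using eq by blast
    also have "\<dots> \<in> sets (annealed_law \<beta> \<pi>)" by measurable
    finally show ?thesis .
  qed
  then show "(\<lambda>s. clock_inverse s t) \<in> space (annealed_law \<beta> \<pi>) \<rightarrow> UNIV \<and>
    (\<forall>j\<in>UNIV. (\<lambda>s. clock_inverse s t) -` {j} \<inter> space (annealed_law \<beta> \<pi>) \<in> sets (annealed_law \<beta> \<pi>))" by auto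
qed simp

lemma trapped_walk_measurable: "(\<lambda>s. trapped_walk s t) \<in> annealed_law \<beta> \<pi> \<rightarrow>\<^sub>M count_space UNIV"
  unfolding trapped_walk_def by (rule measurable_compose_countable[OF walk_measurable clock_inverse_measurable])

end

section \<open>Paths with finitely many independent increments\<close>

lemma joint_law_eq:
  assumes M: "prob_space M" and N: "prob_space N" and I: "I \<noteq> {}"
    and X: "prob_space.indep_vars M (\<lambda>_. borel) X I" and Y: "prob_space.indep_vars N (\<lambda>_. borel) Y I"
    and XY: "\<And>i. i \<in> I \<Longrightarrow> distr M borel (X i) = (distr N borel (Y i) :: real measure)"
  shows "distr M (PiM I (\<lambda>_. borel)) (\<lambda>w. \<lambda>i\<in>I. X i w) = distr N (PiM I (\<lambda>_. borel)) (\<lambda>w. \<lambda>i\<in>I. Y i w)"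
proof -
  interpret M: prob_space M by fact
  interpret N: prob_space N by fact
  have "distr M (PiM I (\<lambda>_. borel)) (\<lambda>w. \<lambda>i\<in>I. X i w) = PiM I (\<lambda>i. distr M borel (X i))"
    using X by (subst M.indep_vars_iff_distr_eq_PiM'[OF I, symmetric]) (auto simp: M.indep_vars_def2)
  also have "\<dots> = PiM I (\<lambda>i. distr N borel (Y i))" by (rule PiM_cong) (use XY in auto)
  also have "\<dots> = distr N (PiM I (\<lambda>_. borel)) (\<lambda>w. \<lambda>i\<in>I. Y i w)"
  proof -
    have "N.random_variable borel (Y i)" if "i \<in> I" for i using Y that by (auto simp: N.indep_vars_def2)
    from N.indep_vars_iff_distr_eq_PiM'[OF I this, THEN iffD1, OF _ Y] show ?thesis by simp
  qed
  finally show ?thesis .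
qed

text \<open>
  Skorohod's representation theorem on the line realises each coordinate with pointwise convergence on
  its own probability space. On the product of these spaces the coordinates are independent, so the
  joint laws are the given ones, and dominated convergence applies.
\<close>

proposition independent_weak_convergence:
  fixes X :: "nat \<Rightarrow> 'i \<Rightarrow> 'a \<Rightarrow> real" and Z :: "'i \<Rightarrow> 'b \<Rightarrow> real" and G :: "('i \<Rightarrow> real) \<Rightarrow> real"
  assumes M: "prob_space M" and Q: "prob_space Q" and I: "finite I" "I \<noteq> {}"
    and X: "\<And>n. prob_space.indep_vars M (\<lambda>_. borel) (X n) I"
    and Z: "prob_space.indep_vars Q (\<lambda>_. borel) Z I"
    and wc: "\<And>i. i \<in> I \<Longrightarrow> weak_conv_m (\<lambda>n. distr M borel (X n i)) (distr Q borel (Z i))"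
    and G: "G \<in> borel_measurable (PiM I (\<lambda>_. borel))" "\<And>x. \<bar>G x\<bar> \<le> C"
    and G_cont: "\<And>x y. (\<And>i. i \<in> I \<Longrightarrow> (\<lambda>n. x n i) \<longlonglongrightarrow> y i) \<Longrightarrow>
      (\<lambda>n. G (\<lambda>i\<in>I. x n i)) \<longlonglongrightarrow> G (\<lambda>i\<in>I. y i)"
  shows "(\<lambda>n. \<integral>w. G (\<lambda>i\<in>I. X n i w) \<partial>M) \<longlonglongrightarrow> (\<integral>w. G (\<lambda>i\<in>I. Z i w) \<partial>Q)"
proof -
  interpret M: prob_space M by fact
  interpret Q: prob_space Q by fact
  have Xm: "X n i \<in> borel_measurable M" if "i \<in> I" for n i using X[of n] that by (auto simp: M.indep_vars_def2)
  have Zm: "Z i \<in> borel_measurable Q" if "i \<in> I" for i using Z that by (auto simp: Q.indep_vars_def2)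
  have "\<forall>i\<in>I. \<exists>(\<Omega> :: real measure) Yn Y. prob_space \<Omega> \<and> (\<forall>n. Yn n \<in> measurable \<Omega> borel) \<and>
      (\<forall>n. distr \<Omega> borel (Yn n) = distr M borel (X n i)) \<and> Y \<in> measurable \<Omega> borel \<and>
      distr \<Omega> borel Y = distr Q borel (Z i) \<and> (\<forall>x\<in>space \<Omega>. (\<lambda>n. Yn n x) \<longlonglongrightarrow> Y x)"
  proof
    fix i assume i: "i \<in> I"
    have "\<exists>(\<Omega> :: real measure) (Yn :: nat \<Rightarrow> real \<Rightarrow> real) (Y :: real \<Rightarrow> real).
      prob_space \<Omega> \<and> (\<forall>n. Yn n \<in> measurable \<Omega> borel) \<and> (\<forall>n. distr \<Omega> borel (Yn n) = distr M borel (X n i)) \<and>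
      Y \<in> measurable \<Omega> lborel \<and> distr \<Omega> borel Y = distr Q borel (Z i) \<and> (\<forall>x\<in>space \<Omega>. (\<lambda>n. Yn n x) \<longlonglongrightarrow> Y x)"
      by (rule Skorohod[OF _ _ wc[OF i]]) (auto intro!: M.real_distribution_distr Q.real_distribution_distr Xm Zm i)
    then show "\<exists>(\<Omega> :: real measure) Yn Y. prob_space \<Omega> \<and> (\<forall>n. Yn n \<in> measurable \<Omega> borel) \<and>
      (\<forall>n. distr \<Omega> borel (Yn n) = distr M borel (X n i)) \<and> Y \<in> measurable \<Omega> borel \<and>
      distr \<Omega> borel Y = distr Q borel (Z i) \<and> (\<forall>x\<in>space \<Omega>. (\<lambda>n. Yn n x) \<longlonglongrightarrow> Y x)" by simp
  qed
  from bchoice[OF this] obtain \<Omega> :: "'i \<Rightarrow> real measure" where "\<forall>i\<in>I. \<exists>Yn Y. prob_space (\<Omega> i) \<and> (\<forall>n. Yn n \<in> measurable (\<Omega> i) borel) \<and>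
      (\<forall>n. distr (\<Omega> i) borel (Yn n) = distr M borel (X n i)) \<and> Y \<in> measurable (\<Omega> i) borel \<and>
      distr (\<Omega> i) borel Y = distr Q borel (Z i) \<and> (\<forall>x\<in>space (\<Omega> i). (\<lambda>n. Yn n x) \<longlonglongrightarrow> Y x)" by blast
  from bchoice[OF this] obtain Yn where "\<forall>i\<in>I. \<exists>Y. prob_space (\<Omega> i) \<and> (\<forall>n. Yn i n \<in> measurable (\<Omega> i) borel) \<and>
      (\<forall>n. distr (\<Omega> i) borel (Yn i n) = distr M borel (X n i)) \<and> Y \<in> measurable (\<Omega> i) borel \<and>
      distr (\<Omega> i) borel Y = distr Q borel (Z i) \<and> (\<forall>x\<in>space (\<Omega> i). (\<lambda>n. Yn i n x) \<longlonglongrightarrow> Y x)" by blast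
  from bchoice[OF this] obtain Y where Y: "\<And>i. i \<in> I \<Longrightarrow> prob_space (\<Omega> i)" "\<And>i n. i \<in> I \<Longrightarrow> Yn i n \<in> borel_measurable (\<Omega> i)"
      "\<And>i n. i \<in> I \<Longrightarrow> distr (\<Omega> i) borel (Yn i n) = distr M borel (X n i)" "\<And>i. i \<in> I \<Longrightarrow> Y i \<in> borel_measurable (\<Omega> i)"
      "\<And>i. i \<in> I \<Longrightarrow> distr (\<Omega> i) borel (Y i) = distr Q borel (Z i)" "\<And>i x. i \<in> I \<Longrightarrow> x \<in> space (\<Omega> i) \<Longrightarrow> (\<lambda>n. Yn i n x) \<longlonglongrightarrow> Y i x"
    by blast
  define P where "P = PiM I \<Omega>"
  interpret P: prob_space P unfolding P_def by (rule prob_space_PiM) (rule Y)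
  have coord: "(\<lambda>u. u i) \<in> P \<rightarrow>\<^sub>M \<Omega> i" if "i \<in> I" for i
    unfolding P_def using that by (rule measurable_component_singleton)
  have ind: "P.indep_vars (\<lambda>_. borel) (\<lambda>i u. f i (u i)) I"
    and law: "\<And>i. i \<in> I \<Longrightarrow> distr P borel (\<lambda>u. f i (u i)) = distr (\<Omega> i) borel (f i)"
    if f: "\<And>i. i \<in> I \<Longrightarrow> f i \<in> borel_measurable (\<Omega> i)" for f :: "'i \<Rightarrow> real \<Rightarrow> real"
  proof -
    have "P.indep_vars \<Omega> (\<lambda>i u. u i) I"
      unfolding P_def by (rule product_coordinates_indep) (use Y I in auto)
    then show "P.indep_vars (\<lambda>_. borel) (\<lambda>i u. f i (u i)) I" by (rule P.indep_vars_compose2) (rule f)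
    fix i assume i: "i \<in> I"
    have "distr P borel (\<lambda>u. f i (u i)) = distr (distr P (\<Omega> i) (\<lambda>u. u i)) borel (f i)"
      using f[OF i] coord[OF i] by (subst distr_distr) (auto simp: comp_def)
    also have "distr P (\<Omega> i) (\<lambda>u. u i) = \<Omega> i" unfolding P_def by (rule distr_PiM_component) (use Y i in auto)
    finally show "distr P borel (\<lambda>u. f i (u i)) = distr (\<Omega> i) borel (f i)" .
  qed
  have transfer: "(\<integral>u. G (\<lambda>i\<in>I. f i (u i)) \<partial>P) = (\<integral>w. G (\<lambda>i\<in>I. W i w) \<partial>N)"
    if N: "prob_space N" and f: "\<And>i. i \<in> I \<Longrightarrow> f i \<in> borel_measurable (\<Omega> i)"
      and W: "prob_space.indep_vars N (\<lambda>_. borel) W I" "\<And>i. i \<in> I \<Longrightarrow> distr (\<Omega> i) borel (f i) = distr N borel (W i)"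
    for f :: "'i \<Rightarrow> real \<Rightarrow> real" and N :: "'c measure" and W
  proof -
    interpret N: prob_space N by fact
    have fm: "(\<lambda>u. f i (u i)) \<in> borel_measurable P" if "i \<in> I" for i by (rule measurable_compose[OF coord[OF that] f[OF that]])
    have Wm: "W i \<in> borel_measurable N" if "i \<in> I" for i using W(1) that by (auto simp: N.indep_vars_def2)
    have "distr P (PiM I (\<lambda>_. borel)) (\<lambda>u. \<lambda>i\<in>I. f i (u i)) = distr N (PiM I (\<lambda>_. borel)) (\<lambda>w. \<lambda>i\<in>I. W i w)"
      using W law[of f] f by (intro joint_law_eq[OF P.prob_space_axioms N I(2) ind]) auto
    then have "(\<integral>x. G x \<partial>distr P (PiM I (\<lambda>_. borel)) (\<lambda>u. \<lambda>i\<in>I. f i (u i))) =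
        (\<integral>x. G x \<partial>distr N (PiM I (\<lambda>_. borel)) (\<lambda>w. \<lambda>i\<in>I. W i w))" by simp
    then show ?thesis
      by (subst (asm) (1 2) integral_distr) (auto intro!: measurable_restrict fm Wm G)
  qed
  have "(\<lambda>n. \<integral>u. G (\<lambda>i\<in>I. Yn i n (u i)) \<partial>P) \<longlonglongrightarrow> (\<integral>u. G (\<lambda>i\<in>I. Y i (u i)) \<partial>P)"
  proof (rule integral_dominated_convergence[where w="\<lambda>_. C"])
    show "AE u in P. (\<lambda>n. G (\<lambda>i\<in>I. Yn i n (u i))) \<longlonglongrightarrow> G (\<lambda>i\<in>I. Y i (u i))"
      using measurable_space[OF coord] Y(6) by (intro AE_I2 G_cont) auto
    show "(\<lambda>u. G (\<lambda>i\<in>I. Y i (u i))) \<in> borel_measurable P"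
      by (rule measurable_compose[OF measurable_restrict G(1)]) (rule measurable_compose[OF coord Y(4)])
    show "(\<lambda>u. G (\<lambda>i\<in>I. Yn i n (u i))) \<in> borel_measurable P" for n
      by (rule measurable_compose[OF measurable_restrict G(1)]) (rule measurable_compose[OF coord Y(2)])
  qed (use G(2) in auto)
  moreover have "(\<integral>u. G (\<lambda>i\<in>I. Yn i n (u i)) \<partial>P) = (\<integral>w. G (\<lambda>i\<in>I. X n i w) \<partial>M)" for n
    using Y by (intro transfer[OF M _ X]) auto
  moreover have "(\<integral>u. G (\<lambda>i\<in>I. Y i (u i)) \<partial>P) = (\<integral>w. G (\<lambda>i\<in>I. Z i w) \<partial>Q)"
    using Y by (intro transfer[OF Q _ Z]) auto
  ultimately show ?thesis by simp
qed

lemma skorohod_dist_le_uniform: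
  assumes e: "0 \<le> e" and le: "\<And>t. 0 \<le> t \<Longrightarrow> \<bar>x t - y t\<bar> \<le> e"
  shows "skorohod_dist x y \<le> e"
proof -
  have "(\<lambda>T. e + (1/2) ^ T) \<longlonglongrightarrow> e + 0" by (intro tendsto_intros LIMSEQ_realpow_zero) auto
  then show ?thesis
    using skorohod_dist_le_locally_uniform[OF e le] by (intro LIMSEQ_le_const[of "\<lambda>T. e + (1/2) ^ T"]) auto
qed

definition increments_path :: "real \<Rightarrow> nat \<Rightarrow> (nat \<Rightarrow> real) \<Rightarrow> real \<Rightarrow> real" where
  "increments_path a K x = (\<lambda>t\<in>{0..}. \<Sum>j<staircase a K t. x j)"

lemma increments_path_in_skorohod_space: "0 \<le> a \<Longrightarrow> increments_path a K x \<in> skorohod_space"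
  unfolding increments_path_def by (rule staircase_path_in_skorohod_space)

lemma increments_path_measurable:
  assumes a: "0 \<le> a"
  shows "increments_path a K \<in> PiM {..<K} (\<lambda>_. borel) \<rightarrow>\<^sub>M borel_of_topology skorohod_topology"
proof (rule skorohod_measurable_of_staircase_samples[where a="\<lambda>_. a" and K="\<lambda>_. K" and S="\<lambda>m k x. \<Sum>j<min k K. x j"])
  show "increments_path a K x \<in> skorohod_space" for x by (rule increments_path_in_skorohod_space[OF a])
  show "(\<lambda>x. \<Sum>j<min k K. x j :: real) \<in> borel_measurable (PiM {..<K} (\<lambda>_. borel))" for k
    by (intro borel_measurable_sum measurable_component_singleton) auto
  show "\<forall>\<^sub>F m in sequentially. \<forall>t\<in>{0..real T}. \<bar>(\<Sum>j<min (staircase a K t) K. x j) - increments_path a K x t\<bar> \<le> e"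
    if "0 < e" for x T e
    using that by (intro always_eventually allI ballI) (auto simp: increments_path_def staircase_def)
qed (rule a)

lemma increments_path_dist:
  "skorohod_dist (increments_path a K x) (increments_path a K y) \<le> (\<Sum>j<K. \<bar>x j - y j\<bar>)"
proof (rule skorohod_dist_le_uniform)
  fix t :: real assume t: "0 \<le> t"
  have "\<bar>increments_path a K x t - increments_path a K y t\<bar> = \<bar>\<Sum>j<staircase a K t. x j - y j\<bar>"
    using t by (simp add: increments_path_def sum_subtractf)
  also have "\<dots> \<le> (\<Sum>j<staircase a K t. \<bar>x j - y j\<bar>)" by (rule sum_abs)
  also have "\<dots> \<le> (\<Sum>j<K. \<bar>x j - y j\<bar>)" by (intro sum_mono2) (auto simp: staircase_def)
  finally show "\<bar>increments_path a K x t - increments_path a K y t\<bar> \<le> (\<Sum>j<K. \<bar>x j - y j\<bar>)" .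
qed (auto intro: sum_nonneg)

lemma continuous_path_staircase_limit:
  fixes x :: "real \<Rightarrow> real"
  assumes x: "continuous_on {0..} x" and a: "filterlim a at_top sequentially"
    and K: "eventually (\<lambda>m. a m * real T \<le> real (K m)) sequentially" and e: "0 < e"
  shows "eventually (\<lambda>m. \<forall>t\<in>{0..real T}. \<bar>x (real (staircase (a m) (K m) t) / a m) - x t\<bar> \<le> e) sequentially"
proof -
  have "uniformly_continuous_on {0..real T} x"
    by (rule compact_uniformly_continuous[OF continuous_on_subset[OF x]]) auto
  then obtain d where d: "0 < d" "\<And>s t. s \<in> {0..real T} \<Longrightarrow> t \<in> {0..real T} \<Longrightarrow> dist s t < d \<Longrightarrow> dist (x s) (x t) < e"
    using e unfolding uniformly_continuous_on_def by metis
  have "eventually (\<lambda>m. 1 / d < a m) sequentially" using a by (simp add: filterlim_at_top_dense)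
  with K show ?thesis
  proof eventually_elim
    case (elim m)
    have "0 < 1 / d" using d by simp
    then have am: "0 < a m" using elim(2) by linarith
    show ?case
    proof
      fix t assume t: "t \<in> {0..real T}"
      have at: "0 \<le> a m * t" using am t by simp
      have "a m * t \<le> a m * real T" using am t by (intro mult_left_mono) auto
      then have "nat \<lfloor>a m * t\<rfloor> \<le> K m" using elim(1) by linarith
      then have st: "staircase (a m) (K m) t = nat \<lfloor>a m * t\<rfloor>" by (simp add: staircase_def)
      define s where "s = real (staircase (a m) (K m) t) / a m"
      have r: "real (nat \<lfloor>a m * t\<rfloor>) \<le> a m * t" "a m * t - 1 < real (nat \<lfloor>a m * t\<rfloor>)" using at by linarith+
      have "s \<le> a m * t / a m" unfolding s_def st by (rule divide_right_mono[OF r(1)]) (use am in simp)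
      moreover have "(a m * t - 1) / a m < s" unfolding s_def st by (rule divide_strict_right_mono[OF r(2) am])
      moreover have "0 \<le> s" using am by (simp add: s_def)
      ultimately have "s \<le> t" "t - 1 / a m < s" "0 \<le> s" using am by (simp_all add: diff_divide_distrib)
      moreover have "1 / a m < d" using elim(2) am d by (simp add: field_simps)
      ultimately have "dist (x s) (x t) < e" using t by (intro d(2)) (auto simp: dist_real_def)
      then show "\<bar>x (real (staircase (a m) (K m) t) / a m) - x t\<bar> \<le> e" by (simp add: s_def dist_real_def)
    qed
  qed
qed

lemma scaled_brownian_path_in_skorohod_space: "(\<lambda>t\<in>{0..}. c * brownian_path t w) \<in> skorohod_space"
  by (rule continuous_path_in_skorohod_space) (intro continuous_intros brownian_path_continuous)

lemma scaled_brownian_path_measurable: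
  "(\<lambda>w. \<lambda>t\<in>{0..}. c * brownian_path t w) \<in> white_noise \<rightarrow>\<^sub>M borel_of_topology skorohod_topology"
proof (rule skorohod_measurable_of_staircase_samples[where a="\<lambda>m. real m" and K="\<lambda>m. m * m"
      and S="\<lambda>m k w. c * brownian_path (real k / real m) w"])
  fix w T and e :: real assume e: "0 < e"
  have "eventually (\<lambda>m. \<forall>t\<in>{0..real T}. \<bar>c * brownian_path (real (staircase (real m) (m * m) t) / real m) w - c * brownian_path t w\<bar> \<le> e) sequentially"
  proof (rule continuous_path_staircase_limit[where x="\<lambda>t. c * brownian_path t w"])
    show "continuous_on {0..} (\<lambda>t. c * brownian_path t w)" by (intro continuous_intros brownian_path_continuous)
    show "filterlim (\<lambda>m. real m) at_top sequentially" by (rule filterlim_real_sequentially)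
    show "\<forall>\<^sub>F m in sequentially. real m * real T \<le> real (m * m)"
      using eventually_ge_at_top[of T] by eventually_elim (simp add: mult_left_mono)
  qed (rule e)
  then show "\<forall>\<^sub>F m in sequentially. \<forall>t\<in>{0..real T}. \<bar>c * brownian_path (real (staircase (real m) (m * m) t) / real m) w -
      (\<lambda>t\<in>{0..}. c * brownian_path t w) t\<bar> \<le> e" by eventually_elim simp
qed (use scaled_brownian_path_in_skorohod_space in auto)

lemma distr_scaled_gaussian:
  assumes X: "X \<in> borel_measurable M" and g: "distr M borel X = gaussian a" and c: "0 \<le> c"
  shows "distr M borel (\<lambda>w. sqrt c * X w) = gaussian (c * a)"
proof -
  have "distr M borel (\<lambda>w. sqrt c * X w) = distr (distr M borel X) borel (\<lambda>x. sqrt c * x)"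
    using X by (subst distr_distr) (auto simp: comp_def)
  also have "\<dots> = distr std_normal_distribution borel (\<lambda>x. sqrt c * (sqrt a * x))"
    unfolding g gaussian_def by (subst distr_distr) (auto simp: comp_def)
  also have "\<dots> = gaussian (c * a)"
  proof -
    have "(\<lambda>x. sqrt c * (sqrt a * x)) = (\<lambda>x. sqrt (c * a) * x)" by (simp add: fun_eq_iff real_sqrt_mult)
    then show ?thesis by (simp add: gaussian_def)
  qed
  finally show ?thesis .
qed

lemma scaled_brownian_increments:
  assumes N: "0 < N" and c: "0 \<le> c"
  defines "\<delta> \<equiv> \<lambda>k w. sqrt c * (brownian_path (real (Suc k) / real N) w - brownian_path (real k / real N) w)"
  shows "white_noise.indep_vars (\<lambda>_. borel) \<delta> UNIV" "distr white_noise borel (\<delta> k) = gaussian (c / real N)"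
    "(\<Sum>j<m. \<delta> j w) = sqrt c * brownian_path (real m / real N) w"
proof -
  define t where "t k = real k / real N" for k
  have "mono t" "0 \<le> t 0" unfolding t_def by (intro monoI divide_right_mono) auto
  moreover have "\<forall>t. 0 \<le> t 0 \<and> mono t \<longrightarrow>
      white_noise.indep_vars (\<lambda>_. borel) (\<lambda>i w. brownian_path (t (Suc i)) w - brownian_path (t i) w) UNIV"
    using standard_brownian_motion_brownian_path unfolding standard_brownian_motion_def by blast
  ultimately have "white_noise.indep_vars (\<lambda>_. borel) (\<lambda>i w. brownian_path (t (Suc i)) w - brownian_path (t i) w) UNIV"
    by blast
  then show "white_noise.indep_vars (\<lambda>_. borel) \<delta> UNIV"
    unfolding \<delta>_def t_def by (rule white_noise.indep_vars_compose2) simp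
  have "distr white_noise borel (\<lambda>w. brownian_path (real (Suc k) / real N) w - brownian_path (real k / real N) w) =
      gaussian (real (Suc k) / real N - real k / real N)"
    by (rule distr_brownian_increment) (auto intro: divide_right_mono)
  also have "real (Suc k) / real N - real k / real N = 1 / real N" by (simp add: diff_divide_distrib[symmetric])
  finally show "distr white_noise borel (\<delta> k) = gaussian (c / real N)"
    unfolding \<delta>_def using c by (subst distr_scaled_gaussian) auto
  show "(\<Sum>j<m. \<delta> j w) = sqrt c * brownian_path (real m / real N) w"
    unfolding \<delta>_def sum_distrib_left[symmetric]
    using sum_lessThan_telescope[of "\<lambda>k. brownian_path (real k / real N) w" m] by (simp add: brownian_path_0)
qed

section \<open>The trapped walk and its skeleton\<close>

text \<open>
  Go from i to the start of its block, over at most q blocks to the start of the block of j, and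
  from there to j.
\<close>

lemma oscillation_from_blocks:
  fixes y :: "nat \<Rightarrow> real"
  assumes h: "0 < h" and L: "0 \<le> L" and osc: "\<And>b j. b < R \<Longrightarrow> j \<le> h \<Longrightarrow> \<bar>y (b * h + j) - y (b * h)\<bar> \<le> L"
    and i: "i \<le> R * h" and j: "j \<le> R * h" and ij: "(i - j) + (j - i) \<le> q * h"
  shows "\<bar>y i - y j\<bar> \<le> (real q + 2) * L"
proof -
  have grid: "\<bar>y ((b + m) * h) - y (b * h)\<bar> \<le> real m * L" if "b + m \<le> R" for b m
    using that
  proof (induction m)
    case (Suc m)
    have "(b + Suc m) * h = (b + m) * h + h" by simp
    then have "\<bar>y ((b + Suc m) * h) - y ((b + m) * h)\<bar> \<le> L"
      using Suc.prems by (simp only:) (intro osc, auto)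
    moreover have "real (Suc m) * L = L + real m * L" by (simp add: distrib_right)
    moreover have "\<bar>y ((b + m) * h) - y (b * h)\<bar> \<le> real m * L" using Suc by simp
    ultimately show ?case by linarith
  qed simp
  have near: "\<bar>y i - y (i div h * h)\<bar> \<le> L" if "i \<le> R * h" for i
  proof (cases "i div h < R")
    case True
    have "\<bar>y (i div h * h + i mod h) - y (i div h * h)\<bar> \<le> L" using h by (intro osc True) (simp add: less_imp_le)
    then show ?thesis by simp
  next
    case False
    then have "R * h \<le> i div h * h" by simp
    also have "\<dots> \<le> i" by simp
    finally have "i div h * h = i" using that by (metis div_times_less_eq_dividend h le_antisym nonzero_mult_div_cancel_right not_gr_zero)
    then show ?thesis using L by simp
  qed
  have ordered: "\<bar>y i - y j\<bar> \<le> (real q + 2) * L" if "i \<le> j" "j \<le> R * h" "j - i \<le> q * h" for i j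
  proof -
    have "i < Suc (i div h) * h" using dividend_less_div_times[OF h, of i] by simp
    then have "j < Suc (i div h) * h + q * h" using that by linarith
    then have "j < (Suc (i div h) + q) * h" by (simp add: distrib_right)
    then have "j div h < Suc (i div h) + q" by (simp add: div_less_iff_less_mult h)
    then have m: "j div h - i div h \<le> q" "i div h \<le> j div h" using div_le_mono[OF that(1), of h] by auto
    have "j div h \<le> R" using div_le_mono[OF that(2), of h] h by simp
    then have "\<bar>y (j div h * h) - y (i div h * h)\<bar> \<le> real (j div h - i div h) * L"
      using grid[of "i div h" "j div h - i div h"] m by simp
    also have "\<dots> \<le> real q * L" using m L by (intro mult_right_mono) auto
    finally have "\<bar>y (j div h * h) - y (i div h * h)\<bar> \<le> real q * L" .
    moreover have "\<bar>y i - y (i div h * h)\<bar> \<le> L" "\<bar>y j - y (j div h * h)\<bar> \<le> L" using near that by auto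
    ultimately show ?thesis unfolding distrib_right by linarith
  qed
  show ?thesis
  proof (cases "i \<le> j")
    case True then show ?thesis using ordered[of i j] j ij by simp
  next
    case False then show ?thesis using ordered[of j i] i ij by (simp add: abs_minus_commute)
  qed
qed

text \<open>
  The clock is monotone, so its values at the two ends of the block that contains the inverse enclose
  t. Both are known up to \<mu> h.
\<close>

lemma clock_inverse_near:
  assumes pos: "\<And>k. 0 < holding_time s k" and h: "0 < h" and \<mu>: "0 < \<mu>"
    and close: "\<And>j. j \<le> R \<Longrightarrow> \<bar>clock s (j * h) - real (j * h) * \<mu>\<bar> \<le> \<mu> * real h"
    and t: "0 \<le> t" "t < \<mu> * real h * (real R - 1)"
  shows "clock_inverse s t < R * h" "\<bar>real (clock_inverse s t) - t / \<mu>\<bar> \<le> 2 * real h"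
proof -
  define k where "k = clock_inverse s t"
  have "\<mu> * real h * (real R - 1) \<le> clock s (R * h)" using close[of R] by (simp add: algebra_simps)
  then have "t < clock s (R * h)" using t by linarith
  note b = clock_inverse_bounds[OF pos t(1) this, folded k_def]
  show "clock_inverse s t < R * h" using b(4) by (simp add: k_def)
  define q where "q = k div h"
  have k_low: "q * h \<le> k" and k_up: "k < Suc q * h"
    using dividend_less_div_times[OF h, of k] by (simp_all add: q_def)
  have "q < R" using b(4) by (simp add: q_def div_less_iff_less_mult h)
  have "clock s (q * h) \<le> t" using clock_mono[OF pos k_low] b(1) by linarith
  have grid: "real (j * h) * \<mu> = \<mu> * (real j * real h)" for j by (simp add: mult_ac)
  have low: "\<mu> * (real q * real h) - \<mu> * real h \<le> t"
    using close[of q] \<open>q < R\<close> \<open>clock s (q * h) \<le> t\<close> unfolding grid by linarith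
  have "Suc k \<le> Suc q * h" using k_up by simp
  then have "t < clock s (Suc q * h)" using clock_mono[OF pos, of "Suc k" "Suc q * h"] b(2) by linarith
  then have up: "t \<le> \<mu> * (real (Suc q) * real h) + \<mu> * real h"
    using close[of "Suc q"] \<open>q < R\<close> unfolding grid by linarith
  have "real q * real h - real h \<le> t / \<mu>" "t / \<mu> \<le> real (Suc q) * real h + real h"
    using low up \<mu> by (simp_all add: field_simps)
  moreover have "real q * real h \<le> real k" "real k \<le> real (Suc q) * real h"
    using k_low k_up by (metis of_nat_le_iff of_nat_mult, metis less_imp_le of_nat_le_iff of_nat_mult)
  ultimately show "\<bar>real (clock_inverse s t) - t / \<mu>\<bar> \<le> 2 * real h" unfolding k_def[symmetric] by (simp add: distrib_right abs_le_iff)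
qed

lemma nat_floor_ratio_tendsto:
  assumes x: "0 \<le> x"
  shows "(\<lambda>n. real (nat \<lfloor>x * real n\<rfloor>) / real n) \<longlonglongrightarrow> x"
proof (rule tendsto_sandwich)
  show "(\<lambda>n. x - 1 / real n) \<longlonglongrightarrow> x" using tendsto_diff[OF tendsto_const lim_1_over_n, of x] by simp
  show "\<forall>\<^sub>F n in sequentially. x - 1 / real n \<le> real (nat \<lfloor>x * real n\<rfloor>) / real n"
    using eventually_gt_at_top[of 0]
  proof eventually_elim
    case (elim n)
    have "x * real n - 1 \<le> real (nat \<lfloor>x * real n\<rfloor>)" by linarith
    then have "(x * real n - 1) / real n \<le> real (nat \<lfloor>x * real n\<rfloor>) / real n" by (rule divide_right_mono) simp
    then show ?case using elim by (simp add: diff_divide_distrib)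
  qed
  show "\<forall>\<^sub>F n in sequentially. real (nat \<lfloor>x * real n\<rfloor>) / real n \<le> x"
    using eventually_gt_at_top[of 0]
  proof eventually_elim
    case (elim n)
    have "0 \<le> x * real n" using x by simp
    then have "real (nat \<lfloor>x * real n\<rfloor>) \<le> x * real n" by linarith
    then have "real (nat \<lfloor>x * real n\<rfloor>) / real n \<le> x * real n / real n" by (rule divide_right_mono) simp
    then show ?case using elim by simp
  qed
qed auto

lemma nat_ceiling_ratio_tendsto:
  assumes x: "0 \<le> x"
  shows "(\<lambda>n. real (nat \<lceil>x * real n\<rceil>) / real n) \<longlonglongrightarrow> x"
proof (rule tendsto_sandwich[of "\<lambda>_. x"])
  show "(\<lambda>n. x + 1 / real n) \<longlonglongrightarrow> x" using tendsto_add[OF tendsto_const lim_1_over_n, of x] by simp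
  show "\<forall>\<^sub>F n in sequentially. x \<le> real (nat \<lceil>x * real n\<rceil>) / real n"
    using eventually_gt_at_top[of 0]
  proof eventually_elim
    case (elim n)
    have "x * real n \<le> real (nat \<lceil>x * real n\<rceil>)" by linarith
    then have "x * real n / real n \<le> real (nat \<lceil>x * real n\<rceil>) / real n" by (rule divide_right_mono) simp
    then show ?case using elim by simp
  qed
  show "\<forall>\<^sub>F n in sequentially. real (nat \<lceil>x * real n\<rceil>) / real n \<le> x + 1 / real n"
    using eventually_gt_at_top[of 0]
  proof eventually_elim
    case (elim n)
    have "0 \<le> x * real n" using x by simp
    then have "real (nat \<lceil>x * real n\<rceil>) \<le> x * real n + 1" by linarith
    then have "real (nat \<lceil>x * real n\<rceil>) / real n \<le> (x * real n + 1) / real n" by (rule divide_right_mono) simp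
    then show ?case using elim by (simp add: add_divide_distrib)
  qed
qed auto

context integrable_random_traps
begin

definition diffusivity :: real where "diffusivity = inverse (mean_holding_time 1 \<pi>)"

lemma diffusivity_pos: "0 < diffusivity"
  unfolding diffusivity_def using mean_holding_time_positive[of 1] by simp

definition rescaled_path :: "nat \<Rightarrow> sample \<Rightarrow> real \<Rightarrow> real" where
  "rescaled_path n s = (\<lambda>t\<in>{0..}. real_of_int (trapped_walk s (real_of_int \<lfloor>real n * t\<rfloor>)) / sqrt (real n))"

lemma rescaled_path_eq:
  "rescaled_path n s = (\<lambda>t\<in>{0..}. real_of_int (trapped_walk s (real (nat \<lfloor>real n * t\<rfloor>))) / sqrt (real n))"
  unfolding rescaled_path_def by (rule restrict_ext) simp

lemma rescaled_path_in_skorohod_space: "rescaled_path n s \<in> skorohod_space"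
  unfolding rescaled_path_eq by (rule floor_path_in_skorohod_space) simp

lemma rescaled_path_measurable:
  "rescaled_path n \<in> annealed_law 1 \<pi> \<rightarrow>\<^sub>M borel_of_topology skorohod_topology"
proof (rule skorohod_measurable_of_staircase_samples[where a="\<lambda>_. real n" and K="\<lambda>m. m"
      and S="\<lambda>m k s. real_of_int (trapped_walk s (real k)) / sqrt (real n)"])
  show "(\<lambda>s. real_of_int (trapped_walk s (real k)) / sqrt (real n)) \<in> borel_measurable (annealed_law 1 \<pi>)" for k
    by (intro borel_measurable_divide measurable_compose[OF trapped_walk_measurable]) auto
  fix s T and e :: real assume e: "0 < e"
  show "\<forall>\<^sub>F m in sequentially. \<forall>t\<in>{0..real T}.
      \<bar>real_of_int (trapped_walk s (real (staircase (real n) m t))) / sqrt (real n) - rescaled_path n s t\<bar> \<le> e"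
    using eventually_ge_at_top[of "n * T"]
  proof eventually_elim
    case (elim m)
    show ?case
    proof
      fix t assume t: "t \<in> {0..real T}"
      have "real n * t \<le> real n * real T" using t by (intro mult_left_mono) auto
      also have "\<dots> \<le> real m" using elim by (metis of_nat_le_iff of_nat_mult)
      finally have "nat \<lfloor>real n * t\<rfloor> \<le> m" by linarith
      then show "\<bar>real_of_int (trapped_walk s (real (staircase (real n) m t))) / sqrt (real n) - rescaled_path n s t\<bar> \<le> e"
        using t e by (simp add: staircase_def rescaled_path_eq)
    qed
  qed
qed (use rescaled_path_in_skorohod_space in auto)

text \<open>
  Up to time n k / N the clock lets the embedded walk make about n k / (\<mu> N) steps.
\<close>

definition skeleton_time :: "nat \<Rightarrow> nat \<Rightarrow> nat \<Rightarrow> nat" where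
  "skeleton_time N n k = nat \<lfloor>(diffusivity * real k / real N) * real n\<rfloor>"

lemma skeleton_time_mono: "mono (skeleton_time N n)"
  unfolding skeleton_time_def using diffusivity_pos
  by (intro monoI nat_mono floor_mono mult_right_mono divide_right_mono mult_left_mono) auto

definition skeleton_increment :: "nat \<Rightarrow> nat \<Rightarrow> nat \<Rightarrow> sample \<Rightarrow> real" where
  "skeleton_increment N n k s = (\<Sum>i\<in>{skeleton_time N n k..<skeleton_time N n (Suc k)}. walk_step i s) / sqrt (real n)"

definition skeleton_path :: "nat \<Rightarrow> nat \<Rightarrow> nat \<Rightarrow> sample \<Rightarrow> real \<Rightarrow> real" where
  "skeleton_path N K n s = increments_path (real N) K (\<lambda>k\<in>{..<K}. skeleton_increment N n k s)"

lemma skeleton_path_eq: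
  assumes t: "0 \<le> t"
  shows "skeleton_path N K n s t = real_of_int (walk s (skeleton_time N n (staircase (real N) K t))) / sqrt (real n)"
proof -
  have partial: "(\<Sum>k<m. \<Sum>i\<in>{skeleton_time N n k..<skeleton_time N n (Suc k)}. walk_step i s) = (\<Sum>i<skeleton_time N n m. walk_step i s)" for m
  proof (induction m)
    case 0 then show ?case by (simp add: skeleton_time_def)
  next
    case (Suc m)
    then show ?case
      using sum.atLeastLessThan_concat[of 0 "skeleton_time N n m" "skeleton_time N n (Suc m)" "\<lambda>i. walk_step i s"]
        monoD[OF skeleton_time_mono, of m "Suc m"] by (simp add: lessThan_atLeast0)
  qed
  have le: "staircase (real N) K t \<le> K" by (simp add: staircase_def)
  have "skeleton_path N K n s t = (\<Sum>k<staircase (real N) K t. skeleton_increment N n k s)"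
  proof -
    have "skeleton_path N K n s t = (\<Sum>k<staircase (real N) K t. (\<lambda>k\<in>{..<K}. skeleton_increment N n k s) k)"
      unfolding skeleton_path_def increments_path_def using t by (simp only: restrict_apply' atLeast_iff)
    also have "\<dots> = (\<Sum>k<staircase (real N) K t. skeleton_increment N n k s)"
      using le by (intro sum.cong) auto
    finally show ?thesis .
  qed
  also have "\<dots> = (\<Sum>i<skeleton_time N n (staircase (real N) K t). walk_step i s) / sqrt (real n)"
    unfolding skeleton_increment_def sum_divide_distrib[symmetric] partial ..
  finally show ?thesis by (simp add: walk_eq_sum_steps)
qed

text \<open>
  A block has h steps, the number made by the embedded walk in n/N units of time. At time n t
  the inverse of the clock is within 2 h of the line, and the time of the preceding skeleton point
  within 2 h as well; with rounding the two differ by at most 5 h, which the oscillation bound turns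
  into 7 e. Two blocks beyond the horizon leave room for the error of the clock at the end.
\<close>

lemma rescaled_path_near_skeleton:
  assumes s: "s \<in> space (annealed_law 1 \<pi>)" and n: "0 < n" and N: "0 < N" and e: "0 \<le> e"
    and h: "h = nat \<lceil>(diffusivity / real N) * real n\<rceil>" "diffusivity \<le> real h" "1 \<le> h"
    and osc: "\<And>b j. b < N * T + 2 \<Longrightarrow> j \<le> h \<Longrightarrow>
      \<bar>real_of_int (walk s (b * h + j)) - real_of_int (walk s (b * h))\<bar> \<le> e * sqrt (real n)"
    and close: "\<And>j. j \<le> N * T + 2 \<Longrightarrow> \<bar>clock s (j * h) - real (j * h) * mean_holding_time 1 \<pi>\<bar> \<le> mean_holding_time 1 \<pi> * real h"
    and t: "0 \<le> t" "t \<le> real T"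
  shows "\<bar>rescaled_path n s t - skeleton_path N (N * T) n s t\<bar> \<le> 7 * e"
proof -
  let ?c = diffusivity and ?\<mu> = "mean_holding_time 1 \<pi>"
  have \<mu>: "0 < ?\<mu>" by (rule mean_holding_time_positive)
  have c: "0 < ?c" by (rule diffusivity_pos)
  have \<mu>c: "?\<mu> * ?c = 1" "x / ?\<mu> = ?c * x" for x
    using \<mu> by (simp_all add: diffusivity_def divide_inverse mult.commute)
  define u where "u = (?c / real N) * real n"
  have u: "0 < u" using c N n by (simp add: u_def)
  have uh: "u \<le> real h" unfolding h(1) u_def by linarith
  note u = u uh
  have Nu: "real N * u = ?c * real n" using N by (simp add: u_def)
  define t' where "t' = real_of_int \<lfloor>real n * t\<rfloor>"
  have nt: "0 \<le> real n * t" using t by simp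
  have "0 \<le> t'" using nt unfolding t'_def by simp
  moreover have "t' \<le> real n * t" "real n * t - 1 < t'" unfolding t'_def by linarith+
  ultimately have t': "0 \<le> t'" "t' \<le> real n * t" "real n * t - 1 < t'" by auto
  have "t' \<le> real n * real T" using t'(2) mult_left_mono[OF t(2), of "real n"] by simp
  also have "real n * real T = ?\<mu> * (u * (real N * real T))"
    using Nu \<mu>c(1) by (metis mult.assoc mult.commute mult.left_neutral)
  also have "\<dots> < ?\<mu> * (u * (real N * real T + 1))" using \<mu> u by simp
  also have "\<dots> \<le> ?\<mu> * (real h * (real N * real T + 1))" using \<mu> u by (intro mult_left_mono mult_right_mono) auto
  finally have t'_lt: "t' < ?\<mu> * real h * (real (N * T + 2) - 1)" by (simp add: mult.assoc add.commute)
  define k where "k = clock_inverse s t'"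
  have k: "k < (N * T + 2) * h" "\<bar>real k - t' / ?\<mu>\<bar> \<le> 2 * real h"
    using clock_inverse_near[OF holding_time_positive[OF s] _ \<mu> close t'(1) t'_lt] h(3) by (auto simp: k_def)
  define m where "m = staircase (real N) (N * T) t"
  have "real N * t \<le> real N * real T" using t by (intro mult_left_mono) auto
  then have Nt: "0 \<le> real N * t" "real N * t \<le> real (N * T)" using t by simp_all
  have fl: "nat \<lfloor>real N * t\<rfloor> \<le> N * T" using Nt(2) by linarith
  then have m_eq: "m = nat \<lfloor>real N * t\<rfloor>" by (simp add: m_def staircase_def)
  have "real (nat \<lfloor>real N * t\<rfloor>) \<le> real N * t" "real N * t - 1 < real (nat \<lfloor>real N * t\<rfloor>)" using Nt(1) by linarith+
  then have m: "real m \<le> real N * t" "real N * t - 1 < real m" "m \<le> N * T" using fl by (simp_all only: m_eq)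
  define a where "a = skeleton_time N n m"
  have um: "(?c * real m / real N) * real n = u * real m" by (simp add: u_def)
  have a: "real a \<le> u * real m" "u * real m - 1 < real a"
  proof -
    have "0 \<le> u * real m" using u by simp
    then show "real a \<le> u * real m" "u * real m - 1 < real a" unfolding a_def skeleton_time_def um by linarith+
  qed
  have "u * real m \<le> u * (real N * t)" "u * (real N * t) - u < u * real m"
    using mult_left_mono[OF m(1), of u] mult_strict_left_mono[OF m(2), of u] u by (simp_all add: right_diff_distrib)
  moreover have uNt: "u * (real N * t) = ?c * real n * t" using Nu by (metis mult.assoc mult.commute)
  ultimately have am: "u * real m \<le> ?c * real n * t" "?c * real n * t - u < u * real m" by simp_all
  have tm: "t' / ?\<mu> \<le> ?c * real n * t" "?c * real n * t - ?c \<le> t' / ?\<mu>"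
    using mult_left_mono[OF t'(2), of ?c] mult_left_mono[OF less_imp_le[OF t'(3)], of ?c] c
    unfolding \<mu>c(2) by (simp_all add: right_diff_distrib mult.assoc)
  have h1: "1 \<le> real h" using h(3) by simp
  have "real k - t' / ?\<mu> \<le> 2 * real h" "t' / ?\<mu> - real k \<le> 2 * real h"
    using abs_le_D1[OF k(2)] abs_le_D2[OF k(2)] by linarith+
  then have "real k - real a \<le> 5 * real h" "real a - real k \<le> 5 * real h"
    using a am tm u(2) h(2) h1 by linarith+
  then have ka: "(k - a) + (a - k) \<le> 5 * h" by linarith
  have "real m \<le> real (N * T)" using m(3) by (rule of_nat_mono)
  then have "u * real m \<le> real h * real (N * T)" using mult_mono[OF u(2), of "real m" "real (N * T)"] by simp
  then have "real a \<le> real (N * T * h)" using a(1) by (simp add: mult_ac)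
  then have "a \<le> N * T * h" by (simp only: of_nat_le_iff)
  then have a_le: "a \<le> (N * T + 2) * h" by (simp add: distrib_right)
  have "\<bar>real_of_int (walk s k) - real_of_int (walk s a)\<bar> \<le> (real 5 + 2) * (e * sqrt (real n))"
    using h(3) e k(1) by (intro oscillation_from_blocks[where R="N * T + 2" and h=h] osc a_le ka) auto
  then have "\<bar>real_of_int (walk s k) - real_of_int (walk s a)\<bar> / sqrt (real n) \<le> 7 * e"
    using n by (simp add: divide_le_eq)
  moreover have "rescaled_path n s t = real_of_int (walk s k) / sqrt (real n)"
    using t by (simp add: rescaled_path_def trapped_walk_def k_def t'_def)
  moreover have "skeleton_path N (N * T) n s t = real_of_int (walk s a) / sqrt (real n)"
    using skeleton_path_eq[OF t(1)] by (simp add: a_def m_def)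
  ultimately show ?thesis by (simp add: diff_divide_distrib[symmetric])
qed

definition clock_error :: "nat \<Rightarrow> real" where
  "clock_error m = (\<integral>s. \<bar>clock s m - real m * mean_holding_time 1 \<pi>\<bar> \<partial>annealed_law 1 \<pi>)"

text \<open>
  The exceptional event of the comparison for R blocks of h steps, at the spatial scale x.
\<close>

definition irregular :: "real \<Rightarrow> nat \<Rightarrow> nat \<Rightarrow> real \<Rightarrow> sample set" where
  "irregular e R h x = {s \<in> space (annealed_law 1 \<pi>).
    (\<exists>b<R. \<exists>j\<le>h. e * x \<le> \<bar>real_of_int (walk s (b * h + j)) - real_of_int (walk s (b * h))\<bar>) \<or>
    (\<exists>j\<le>R. mean_holding_time 1 \<pi> * real h \<le> \<bar>clock s (j * h) - real (j * h) * mean_holding_time 1 \<pi>\<bar>)}"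

lemma walk_borel_measurable [measurable]: "(\<lambda>s. real_of_int (walk s k)) \<in> borel_measurable (annealed_law \<beta> \<pi>)"
  by (rule measurable_compose[OF walk_measurable]) simp

lemma irregular_measurable [measurable]: "irregular e R h x \<in> sets (annealed_law 1 \<pi>)"
  unfolding irregular_def by measurable

lemma prob_irregular_le:
  assumes ex: "0 < e * x" and h: "0 < h"
  shows "measure (annealed_law 1 \<pi>) (irregular e R h x) \<le>
    real R * (3 * (real h)\<^sup>2 / (e * x) ^ 4) + (\<Sum>j\<le>R. clock_error (j * h) / (mean_holding_time 1 \<pi> * real h))"
proof -
  interpret W: simple_random_walk_steps "annealed_law 1 \<pi>" walk_step by (rule unbiased_walk_steps)
  let ?\<mu> = "mean_holding_time 1 \<pi>"
  have \<mu>h: "0 < ?\<mu> * real h" using mean_holding_time_positive[of 1] h by simp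
  define E1 where "E1 b = {s \<in> space (annealed_law 1 \<pi>). \<exists>j\<le>h. e * x \<le> \<bar>W.block (b * h) j s\<bar>}" for b
  define E2 where "E2 j = {s \<in> space (annealed_law 1 \<pi>). ?\<mu> * real h \<le> \<bar>clock s (j * h) - real (j * h) * ?\<mu>\<bar>}" for j
  have E1: "E1 b \<in> W.events" for b unfolding E1_def by measurable
  have E2: "E2 b \<in> W.events" for b unfolding E2_def by measurable
  have blk: "W.block a j s = real_of_int (walk s (a + j)) - real_of_int (walk s a)" for a j s
    using sum.atLeastLessThan_concat[of 0 a "a + j" "\<lambda>i. walk_step i s"]
    by (simp add: W.block_def walk_eq_sum_steps lessThan_atLeast0)
  have eq: "irregular e R h x = (\<Union>b\<in>{..<R}. E1 b) \<union> (\<Union>j\<in>{..R}. E2 j)"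
    unfolding irregular_def E1_def E2_def blk by auto
  have "W.prob (irregular e R h x) \<le> W.prob (\<Union>b\<in>{..<R}. E1 b) + W.prob (\<Union>j\<in>{..R}. E2 j)"
    unfolding eq using E1 E2 by (intro measure_Un_le) auto
  also have "\<dots> \<le> (\<Sum>b<R. W.prob (E1 b)) + (\<Sum>j\<le>R. W.prob (E2 j))"
    using E1 E2 by (intro add_mono W.finite_measure_subadditive_finite) auto
  also have "\<dots> \<le> (\<Sum>b<R. 3 * (real h)\<^sup>2 / (e * x) ^ 4) + (\<Sum>j\<le>R. clock_error (j * h) / (?\<mu> * real h))"
  proof (intro add_mono sum_mono)
    show "W.prob (E1 b) \<le> 3 * (real h)\<^sup>2 / (e * x) ^ 4" for b
      unfolding E1_def by (rule W.maximal_inequality[OF ex])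
    show "W.prob (E2 j) \<le> clock_error (j * h) / (?\<mu> * real h)" for j
      unfolding E2_def clock_error_def
    proof (rule integral_Markov_inequality_measure[where A="{}"])
      have "integrable (annealed_law 1 \<pi>) (\<lambda>s. clock s k)" for k
        unfolding clock_def by (intro Bochner_Integration.integrable_sum integrable_holding_time)
      then show "integrable (annealed_law 1 \<pi>) (\<lambda>s. \<bar>clock s (j * h) - real (j * h) * ?\<mu>\<bar>)" by auto
    qed (use \<mu>h in auto)
  qed
  finally show ?thesis by simp
qed

text \<open>
  The length h of a block is asymptotically n/N times the diffusivity, so the contribution of the
  oscillations converges to a positive limit of order R / N^2. The contribution of the clock vanishes.
\<close>

lemma prob_irregular_limit:
  assumes e: "0 < e" and N: "0 < N"
  defines "h \<equiv> \<lambda>n. nat \<lceil>(diffusivity / real N) * real n\<rceil>"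
  shows "(\<lambda>n. real R * (3 * (real (h n))\<^sup>2 / (e * sqrt (real n)) ^ 4) +
      (\<Sum>j\<le>R. clock_error (j * h n) / (mean_holding_time 1 \<pi> * real (h n))))
    \<longlonglongrightarrow> real R * (3 * (diffusivity / real N)\<^sup>2 / e ^ 4)"
    "filterlim h at_top sequentially"
proof -
  let ?\<mu> = "mean_holding_time 1 \<pi>"
  have x: "0 < diffusivity / real N" using diffusivity_pos N by simp
  have ratio: "(\<lambda>n. real (h n) / real n) \<longlonglongrightarrow> diffusivity / real N"
    unfolding h_def using x by (intro nat_ceiling_ratio_tendsto) simp
  show h_top: "filterlim h at_top sequentially"
  proof -
    have "filterlim (\<lambda>n. (diffusivity / real N) * real n) at_top sequentially"
      by (rule filterlim_tendsto_pos_mult_at_top[OF tendsto_const x filterlim_real_sequentially])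
    then have "filterlim (\<lambda>n. real (h n)) at_top sequentially"
    proof (rule filterlim_at_top_mono)
      have "diffusivity / real N * real n \<le> real (h n)" for n unfolding h_def by linarith
      then show "\<forall>\<^sub>F n in sequentially. diffusivity / real N * real n \<le> real (h n)" by (intro always_eventually allI)
    qed
    then show ?thesis by (simp add: filterlim_sequentially_iff_filterlim_real)
  qed
  have "(\<lambda>n. real R * (3 * (real (h n) / real n)\<^sup>2 / e ^ 4)) \<longlonglongrightarrow> real R * (3 * (diffusivity / real N)\<^sup>2 / e ^ 4)"
    using e by (intro tendsto_intros ratio) auto
  moreover have "eventually (\<lambda>n. real R * (3 * (real (h n) / real n)\<^sup>2 / e ^ 4) =
      real R * (3 * (real (h n))\<^sup>2 / (e * sqrt (real n)) ^ 4)) sequentially"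
    using eventually_gt_at_top[of 0]
  proof eventually_elim
    case (elim n)
    have "sqrt (real n) ^ 4 = ((sqrt (real n))\<^sup>2)\<^sup>2" by (simp only: power_mult[symmetric]) simp
    then have "sqrt (real n) ^ 4 = (real n)\<^sup>2" by simp
    then show ?case by (simp add: power_mult_distrib power_divide mult.commute)
  qed
  ultimately have one: "(\<lambda>n. real R * (3 * (real (h n))\<^sup>2 / (e * sqrt (real n)) ^ 4)) \<longlonglongrightarrow> real R * (3 * (diffusivity / real N)\<^sup>2 / e ^ 4)"
    by (rule Lim_transform_eventually)
  have two: "(\<lambda>n. clock_error (j * h n) / (?\<mu> * real (h n))) \<longlonglongrightarrow> 0" for j
  proof (cases "j = 0")
    case True
    have "clock_error 0 = 0" by (simp add: clock_error_def clock_def)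
    then show ?thesis using True by simp
  next
    case False
    have "filterlim (\<lambda>n. j * h n) at_top sequentially"
      by (rule filterlim_at_top_mono[OF h_top]) (use False in \<open>auto intro!: always_eventually\<close>)
    from filterlim_compose[OF unbiased_clock_mean_convergence this]
    have "(\<lambda>n. clock_error (j * h n) / real (j * h n)) \<longlonglongrightarrow> 0" by (simp add: clock_error_def)
    then have "(\<lambda>n. real j / ?\<mu> * (clock_error (j * h n) / real (j * h n))) \<longlonglongrightarrow> 0" by (rule tendsto_mult_right_zero)
    then show ?thesis using False by simp
  qed
  have "(\<lambda>n. real R * (3 * (real (h n))\<^sup>2 / (e * sqrt (real n)) ^ 4) + (\<Sum>j\<le>R. clock_error (j * h n) / (?\<mu> * real (h n))))
      \<longlonglongrightarrow> real R * (3 * (diffusivity / real N)\<^sup>2 / e ^ 4) + (\<Sum>j\<le>R. 0)"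
    by (intro tendsto_add one tendsto_sum two)
  then show "(\<lambda>n. real R * (3 * (real (h n))\<^sup>2 / (e * sqrt (real n)) ^ 4) + (\<Sum>j\<le>R. clock_error (j * h n) / (?\<mu> * real (h n))))
      \<longlonglongrightarrow> real R * (3 * (diffusivity / real N)\<^sup>2 / e ^ 4)" by simp
qed

end

section \<open>The invariance principle\<close>

text \<open>
  The counterpart of the skeleton of the walk, written as the same function of the Gaussian increments.
\<close>

definition brownian_skeleton :: "real \<Rightarrow> nat \<Rightarrow> nat \<Rightarrow> (real \<Rightarrow> real) \<Rightarrow> real \<Rightarrow> real" where
  "brownian_skeleton c N K w = increments_path (real N) K
     (\<lambda>k\<in>{..<K}. sqrt c * (brownian_path (real (Suc k) / real N) w - brownian_path (real k / real N) w))"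

lemma brownian_skeleton_eq:
  assumes N: "0 < N" and c: "0 \<le> c" and t: "0 \<le> t"
  shows "brownian_skeleton c N K w t = sqrt c * brownian_path (real (staircase (real N) K t) / real N) w"
proof -
  have le: "staircase (real N) K t \<le> K" by (simp add: staircase_def)
  have "brownian_skeleton c N K w t = (\<Sum>k<staircase (real N) K t. (\<lambda>k\<in>{..<K}. sqrt c *
      (brownian_path (real (Suc k) / real N) w - brownian_path (real k / real N) w)) k)"
    unfolding brownian_skeleton_def increments_path_def using t by (simp only: restrict_apply' atLeast_iff)
  also have "\<dots> = (\<Sum>k<staircase (real N) K t. sqrt c * (brownian_path (real (Suc k) / real N) w - brownian_path (real k / real N) w))"
    using le by (intro sum.cong) auto
  also have "\<dots> = sqrt c * brownian_path (real (staircase (real N) K t) / real N) w"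
    by (rule scaled_brownian_increments(3)[OF N c])
  finally show ?thesis .
qed

lemma brownian_skeleton_in_skorohod_space: "brownian_skeleton c N K w \<in> skorohod_space"
  unfolding brownian_skeleton_def by (rule increments_path_in_skorohod_space) simp

lemma brownian_skeleton_measurable:
  "brownian_skeleton c N K \<in> white_noise \<rightarrow>\<^sub>M borel_of_topology skorohod_topology"
  unfolding brownian_skeleton_def[abs_def]
  by (rule measurable_compose[OF measurable_restrict increments_path_measurable]) auto

text \<open>
  The mesh width T to the power -3 and the horizon T are coupled. The paths are continuous, so they are
  approximated uniformly on every fixed interval.
\<close>

lemma brownian_skeleton_converges:
  assumes c: "0 \<le> c"
  shows "(\<lambda>T. skorohod_dist (brownian_skeleton c (T ^ 3) (T ^ 3 * T) w) (\<lambda>t\<in>{0..}. sqrt c * brownian_path t w)) \<longlonglongrightarrow> 0"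
proof (rule LIMSEQ_I)
  fix e :: real assume e: "0 < e"
  obtain T0 where T0: "(1/2) ^ T0 < e / 2" using e real_arch_pow_inv[of "e/2" "1/2"] by auto
  have "eventually (\<lambda>T. \<forall>t\<in>{0..real T0}. \<bar>sqrt c * brownian_path (real (staircase (real (T ^ 3)) (T ^ 3 * T) t) / real (T ^ 3)) w
      - sqrt c * brownian_path t w\<bar> \<le> e / 2) sequentially"
  proof (rule continuous_path_staircase_limit[where x="\<lambda>t. sqrt c * brownian_path t w"])
    show "continuous_on {0..} (\<lambda>t. sqrt c * brownian_path t w)" by (intro continuous_intros brownian_path_continuous)
    show "filterlim (\<lambda>T. real (T ^ 3)) at_top sequentially" by real_asymp
    show "\<forall>\<^sub>F T in sequentially. real (T ^ 3) * real T0 \<le> real (T ^ 3 * T)"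
      using eventually_ge_at_top[of T0]
    proof eventually_elim
      case (elim T)
      then have "T ^ 3 * T0 \<le> T ^ 3 * T" by (rule mult_le_mono2)
      then show ?case by (metis of_nat_le_iff of_nat_mult)
    qed
  qed (use e in simp)
  then have "eventually (\<lambda>T. skorohod_dist (brownian_skeleton c (T ^ 3) (T ^ 3 * T) w) (\<lambda>t\<in>{0..}. sqrt c * brownian_path t w) < e) sequentially"
    using eventually_gt_at_top[of 0]
  proof eventually_elim
    case (elim T)
    have "skorohod_dist (brownian_skeleton c (T ^ 3) (T ^ 3 * T) w) (\<lambda>t\<in>{0..}. sqrt c * brownian_path t w) \<le> e / 2 + (1/2) ^ T0"
    proof (rule skorohod_dist_le_locally_uniform)
      fix t assume t: "0 \<le> t" "t \<le> real T0"
      have "0 < T ^ 3" using elim by simp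
      from brownian_skeleton_eq[OF this c t(1)]
      show "\<bar>brownian_skeleton c (T ^ 3) (T ^ 3 * T) w t - (\<lambda>t\<in>{0..}. sqrt c * brownian_path t w) t\<bar> \<le> e / 2"
        using elim(1) t by (simp del: of_nat_power)
    qed (use e in simp)
    then show ?case using T0 by linarith
  qed
  then show "\<exists>no. \<forall>T\<ge>no. norm (skorohod_dist (brownian_skeleton c (T ^ 3) (T ^ 3 * T) w) (\<lambda>t\<in>{0..}. sqrt c * brownian_path t w) - 0) < e"
    by (auto simp: eventually_sequentially skorohod_dist_nonneg)
qed

context integrable_random_traps
begin

lemma skeleton_path_in_skorohod_space: "skeleton_path N K n s \<in> skorohod_space"
  unfolding skeleton_path_def by (rule increments_path_in_skorohod_space) simp

lemma walk_step_measurable: "walk_step i \<in> borel_measurable (annealed_law 1 \<pi>)"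
proof -
  interpret W: simple_random_walk_steps "annealed_law 1 \<pi>" walk_step by (rule unbiased_walk_steps)
  show ?thesis by simp
qed

lemma skeleton_increment_measurable: "skeleton_increment N n k \<in> borel_measurable (annealed_law 1 \<pi>)"
  unfolding skeleton_increment_def[abs_def]
  by (intro borel_measurable_divide borel_measurable_sum walk_step_measurable) simp

lemma skeleton_path_measurable:
  "skeleton_path N K n \<in> annealed_law 1 \<pi> \<rightarrow>\<^sub>M borel_of_topology skorohod_topology"
  unfolding skeleton_path_def[abs_def]
  by (rule measurable_compose[OF measurable_restrict increments_path_measurable]) (auto intro: skeleton_increment_measurable)

text \<open>
  For fixed N and K the path is a Lipschitz function of K independent increments, and each of them is a
  normalised block of the walk.
\<close>

proposition skeleton_converges:
  assumes N: "0 < N" and K: "0 < K"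
    and C: "\<And>x. x \<in> skorohod_space \<Longrightarrow> \<bar>f x\<bar> \<le> C"
    and L: "\<And>x y. x \<in> skorohod_space \<Longrightarrow> y \<in> skorohod_space \<Longrightarrow> \<bar>f x - f y\<bar> \<le> L * skorohod_dist x y"
  shows "(\<lambda>n. \<integral>s. f (skeleton_path N K n s) \<partial>annealed_law 1 \<pi>) \<longlonglongrightarrow>
    (\<integral>w. f (brownian_skeleton diffusivity N K w) \<partial>white_noise)"
proof -
  interpret W: simple_random_walk_steps "annealed_law 1 \<pi>" walk_step by (rule unbiased_walk_steps)
  define \<delta> where "\<delta> k w = sqrt diffusivity * (brownian_path (real (Suc k) / real N) w - brownian_path (real k / real N) w)" for k w
  have c: "0 \<le> diffusivity" using diffusivity_pos by simp
  have \<delta>: "white_noise.indep_vars (\<lambda>_. borel) \<delta> UNIV" "distr white_noise borel (\<delta> k) = gaussian (diffusivity / real N)" for k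
    using scaled_brownian_increments(1,2)[OF N c] unfolding \<delta>_def[abs_def] by auto
  have space: "increments_path (real N) K x \<in> skorohod_space" for x by (rule increments_path_in_skorohod_space) simp
  have fc: "continuous_map skorohod_topology euclideanreal f" using L by (rule skorohod_lipschitz_continuous_map)
  have "(\<lambda>n. \<integral>s. f (increments_path (real N) K (\<lambda>k\<in>{..<K}. skeleton_increment N n k s)) \<partial>annealed_law 1 \<pi>) \<longlonglongrightarrow>
      (\<integral>w. f (increments_path (real N) K (\<lambda>k\<in>{..<K}. \<delta> k w)) \<partial>white_noise)"
  proof (rule independent_weak_convergence[where G="\<lambda>x. f (increments_path (real N) K x)" and C=C])
    show "prob_space (annealed_law 1 \<pi>)" by (rule annealed_prob)
    show "prob_space white_noise" by (rule white_noise.prob_space_axioms)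
    show "{..<K} \<noteq> {}" using K by auto
    show "W.indep_vars (\<lambda>_. borel) (\<lambda>k. skeleton_increment N n k) {..<K}" for n
    proof (rule W.indep_vars_subset)
      show "W.indep_vars (\<lambda>_. borel) (\<lambda>k. skeleton_increment N n k) UNIV"
        unfolding skeleton_increment_def[abs_def]
        by (rule W.indep_vars_compose2[OF W.indep_vars_block_sums[OF W.indep skeleton_time_mono]]) simp
    qed simp
    show "white_noise.indep_vars (\<lambda>_. borel) \<delta> {..<K}" by (rule white_noise.indep_vars_subset[OF \<delta>(1)]) simp
    show "weak_conv_m (\<lambda>n. distr (annealed_law 1 \<pi>) borel (skeleton_increment N n k)) (distr white_noise borel (\<delta> k))"
      if "k \<in> {..<K}" for k
    proof -
      define l where "l n = skeleton_time N n (Suc k) - skeleton_time N n k" for n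
      have blk: "skeleton_increment N n k = (\<lambda>s. W.block (skeleton_time N n k) (l n) s / sqrt (real n))" for n
        using monoD[OF skeleton_time_mono, of k "Suc k" N n]
        by (simp add: fun_eq_iff skeleton_increment_def W.block_def l_def)
      have "(\<lambda>n. real (skeleton_time N n j) / real n) \<longlonglongrightarrow> diffusivity * real j / real N" for j
        unfolding skeleton_time_def using c by (intro nat_floor_ratio_tendsto) simp
      then have "(\<lambda>n. real (skeleton_time N n (Suc k)) / real n - real (skeleton_time N n k) / real n) \<longlonglongrightarrow>
          diffusivity * real (Suc k) / real N - diffusivity * real k / real N"
        by (intro tendsto_diff)
      moreover have "diffusivity * real (Suc k) / real N - diffusivity * real k / real N = diffusivity / real N"
        by (simp add: diff_divide_distrib[symmetric] algebra_simps)
      moreover have "real (skeleton_time N n (Suc k)) / real n - real (skeleton_time N n k) / real n = real (l n) / real n" for n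
        using monoD[OF skeleton_time_mono, of k "Suc k" N n] by (simp add: l_def of_nat_diff diff_divide_distrib)
      ultimately have "(\<lambda>n. real (l n) / real n) \<longlonglongrightarrow> diffusivity / real N" by simp
      then show ?thesis unfolding blk \<delta>(2) using c by (intro W.weak_conv_block) auto
    qed
    show "(\<lambda>x. f (increments_path (real N) K x)) \<in> borel_measurable (PiM {..<K} (\<lambda>_. borel))"
      by (rule skorohod_continuous_measurable[OF fc increments_path_measurable]) simp
    show "\<bar>f (increments_path (real N) K x)\<bar> \<le> C" for x using space by (rule C)
    fix x :: "nat \<Rightarrow> nat \<Rightarrow> real" and y assume xy: "\<And>i. i \<in> {..<K} \<Longrightarrow> (\<lambda>n. x n i) \<longlonglongrightarrow> y i"
    have "(\<lambda>n. f (increments_path (real N) K (\<lambda>i\<in>{..<K}. x n i)) - f (increments_path (real N) K (\<lambda>i\<in>{..<K}. y i))) \<longlonglongrightarrow> 0"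
    proof (rule Lim_null_comparison)
      have "(\<lambda>n. \<bar>L\<bar> * (\<Sum>j<K. \<bar>x n j - y j\<bar>)) \<longlonglongrightarrow> \<bar>L\<bar> * (\<Sum>j<K. \<bar>y j - y j\<bar>)"
        by (intro tendsto_intros xy)
      then show "(\<lambda>n. \<bar>L\<bar> * (\<Sum>j<K. \<bar>x n j - y j\<bar>)) \<longlonglongrightarrow> 0" by simp
      show "\<forall>\<^sub>F n in sequentially. norm (f (increments_path (real N) K (\<lambda>i\<in>{..<K}. x n i)) - f (increments_path (real N) K (\<lambda>i\<in>{..<K}. y i)))
          \<le> \<bar>L\<bar> * (\<Sum>j<K. \<bar>x n j - y j\<bar>)"
      proof (intro always_eventually allI)
        fix n
        let ?a = "increments_path (real N) K (\<lambda>i\<in>{..<K}. x n i)" and ?b = "increments_path (real N) K (\<lambda>i\<in>{..<K}. y i)"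
        have "\<bar>f ?a - f ?b\<bar> \<le> L * skorohod_dist ?a ?b" by (rule L[OF space space])
        also have "\<dots> \<le> \<bar>L\<bar> * skorohod_dist ?a ?b" by (intro mult_right_mono skorohod_dist_nonneg) simp
        also have "\<dots> \<le> \<bar>L\<bar> * (\<Sum>j<K. \<bar>(\<lambda>i\<in>{..<K}. x n i) j - (\<lambda>i\<in>{..<K}. y i) j\<bar>)"
          by (intro mult_left_mono increments_path_dist) simp
        finally show "norm (f ?a - f ?b) \<le> \<bar>L\<bar> * (\<Sum>j<K. \<bar>x n j - y j\<bar>)" by simp
      qed
    qed
    then show "(\<lambda>n. f (increments_path (real N) K (\<lambda>i\<in>{..<K}. x n i))) \<longlonglongrightarrow> f (increments_path (real N) K (\<lambda>i\<in>{..<K}. y i))"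
      by (simp add: LIM_zero_iff)
  qed simp
  then show ?thesis by (simp add: skeleton_path_def brownian_skeleton_def \<delta>_def)
qed

lemma rescaled_path_skeleton_expectation:
  assumes e: "0 < e" and n: "0 < n" and N: "0 < N" and L: "0 \<le> L"
    and h: "h = nat \<lceil>(diffusivity / real N) * real n\<rceil>" "diffusivity \<le> real h" "1 \<le> h"
    and C: "\<And>x. x \<in> skorohod_space \<Longrightarrow> \<bar>f x\<bar> \<le> C"
    and lip: "\<And>x y. x \<in> skorohod_space \<Longrightarrow> y \<in> skorohod_space \<Longrightarrow> \<bar>f x - f y\<bar> \<le> L * skorohod_dist x y"
  shows "\<bar>(\<integral>s. f (rescaled_path n s) \<partial>annealed_law 1 \<pi>) - (\<integral>s. f (skeleton_path N (N * T) n s) \<partial>annealed_law 1 \<pi>)\<bar>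
    \<le> L * (7 * e + (1/2) ^ T) + 2 * C * measure (annealed_law 1 \<pi>) (irregular e (N * T + 2) h (sqrt (real n)))"
proof -
  interpret A: prob_space "annealed_law 1 \<pi>" by (rule annealed_prob)
  let ?Z = "rescaled_path n" and ?S = "skeleton_path N (N * T) n" and ?I = "irregular e (N * T + 2) h (sqrt (real n))"
  have fc: "continuous_map skorohod_topology euclideanreal f" using lip by (rule skorohod_lipschitz_continuous_map)
  have iZ: "integrable (annealed_law 1 \<pi>) (\<lambda>s. f (?Z s))"
    by (rule A.integrable_const_bound[of _ C])
      (use C rescaled_path_in_skorohod_space skorohod_continuous_measurable[OF fc rescaled_path_measurable] in auto)
  have iS: "integrable (annealed_law 1 \<pi>) (\<lambda>s. f (?S s))"
    by (rule A.integrable_const_bound[of _ C])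
      (use C skeleton_path_in_skorohod_space skorohod_continuous_measurable[OF fc skeleton_path_measurable] in auto)
  have iI: "integrable (annealed_law 1 \<pi>) (indicat_real ?I)"
    by (intro A.integrable_const_bound[of _ 1]) (auto simp: indicator_def)
  have pt: "\<bar>f (?Z s) - f (?S s)\<bar> \<le> L * (7 * e + (1/2) ^ T) + 2 * C * indicator ?I s" if s: "s \<in> space (annealed_law 1 \<pi>)" for s
  proof (cases "s \<in> ?I")
    case True
    have "0 \<le> L * (7 * e + (1/2) ^ T)" using L e by (intro mult_nonneg_nonneg add_nonneg_nonneg) auto
    then show ?thesis
      using True C[OF rescaled_path_in_skorohod_space, of n s] C[OF skeleton_path_in_skorohod_space, of N "N * T" n s]
      by (simp add: abs_le_iff)
  next
    case False
    have osc: "\<bar>real_of_int (walk s (b * h + j)) - real_of_int (walk s (b * h))\<bar> \<le> e * sqrt (real n)"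
      if "b < N * T + 2" "j \<le> h" for b j
    proof (rule ccontr)
      assume "\<not> ?thesis"
      then have "e * sqrt (real n) \<le> \<bar>real_of_int (walk s (b * h + j)) - real_of_int (walk s (b * h))\<bar>" by simp
      then have "s \<in> ?I" unfolding irregular_def using s that by blast
      then show False using False by contradiction
    qed
    have clk: "\<bar>clock s (j * h) - real (j * h) * mean_holding_time 1 \<pi>\<bar> \<le> mean_holding_time 1 \<pi> * real h"
      if "j \<le> N * T + 2" for j
    proof (rule ccontr)
      assume "\<not> ?thesis"
      then have "mean_holding_time 1 \<pi> * real h \<le> \<bar>clock s (j * h) - real (j * h) * mean_holding_time 1 \<pi>\<bar>" by simp
      then have "s \<in> ?I" unfolding irregular_def using s that by blast
      then show False using False by contradiction
    qed
    have "skorohod_dist (?Z s) (?S s) \<le> 7 * e + (1/2) ^ T"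
      using e by (intro skorohod_dist_le_locally_uniform rescaled_path_near_skeleton[OF s n N _ h osc clk]) auto
    then have "L * skorohod_dist (?Z s) (?S s) \<le> L * (7 * e + (1/2) ^ T)" using L by (rule mult_left_mono)
    then show ?thesis
      using lip[OF rescaled_path_in_skorohod_space skeleton_path_in_skorohod_space, of n s N "N * T" n s] False by simp
  qed
  have "\<bar>(\<integral>s. f (?Z s) \<partial>annealed_law 1 \<pi>) - (\<integral>s. f (?S s) \<partial>annealed_law 1 \<pi>)\<bar> = \<bar>\<integral>s. f (?Z s) - f (?S s) \<partial>annealed_law 1 \<pi>\<bar>"
    using iZ iS by simp
  also have "\<dots> \<le> (\<integral>s. \<bar>f (?Z s) - f (?S s)\<bar> \<partial>annealed_law 1 \<pi>)" by (rule integral_abs_bound)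
  also have "\<dots> \<le> (\<integral>s. L * (7 * e + (1/2) ^ T) + 2 * C * indicator ?I s \<partial>annealed_law 1 \<pi>)"
    using iZ iS iI pt by (intro integral_mono integrable_abs Bochner_Integration.integrable_diff
        Bochner_Integration.integrable_add integrable_mult_right A.integrable_const) auto
  also have "\<dots> = L * (7 * e + (1/2) ^ T) + 2 * C * measure (annealed_law 1 \<pi>) ?I"
    using iI by (simp add: A.prob_space)
  finally show ?thesis .
qed

text \<open>
  Three comparisons, with T chosen before n: rescaled walk and skeleton, skeleton and Brownian
  skeleton, Brownian skeleton and Brownian path.
\<close>

lemma rescaled_path_expectation_limit:
  assumes C: "\<And>x. x \<in> skorohod_space \<Longrightarrow> \<bar>f x\<bar> \<le> C"
    and lip': "\<And>x y. x \<in> skorohod_space \<Longrightarrow> y \<in> skorohod_space \<Longrightarrow> \<bar>f x - f y\<bar> \<le> L' * skorohod_dist x y"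
  shows "(\<lambda>n. \<integral>s. f (rescaled_path n s) \<partial>annealed_law 1 \<pi>) \<longlonglongrightarrow>
    (\<integral>w. f (\<lambda>t\<in>{0..}. sqrt diffusivity * brownian_path t w) \<partial>white_noise)"
proof (rule LIMSEQ_I)
  fix e :: real assume e: "0 < e"
  let ?V = "\<lambda>w. \<lambda>t\<in>{0..}. sqrt diffusivity * brownian_path t w"
  let ?B = "\<lambda>T. brownian_skeleton diffusivity (T ^ 3) (T ^ 3 * T)"
  have c: "0 \<le> diffusivity" using diffusivity_pos by simp
  define L where "L = \<bar>L'\<bar> + 1"
  have L: "0 < L" by (simp add: L_def add_nonneg_pos)
  have lip: "\<bar>f x - f y\<bar> \<le> L * skorohod_dist x y" if "x \<in> skorohod_space" "y \<in> skorohod_space" for x y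
  proof -
    have "L' \<le> L" by (simp add: L_def)
    then show ?thesis using lip'[OF that] mult_right_mono[OF _ skorohod_dist_nonneg[of x y]] by (meson order_trans)
  qed
  have C0: "0 \<le> C" using C[OF rescaled_path_in_skorohod_space] abs_ge_zero order_trans by blast
  have fc: "continuous_map skorohod_topology euclideanreal f" using lip by (rule skorohod_lipschitz_continuous_map)
  \<comment> \<open>The paths differ by at most 7 \<epsilon> off the exceptional event, and f is L-Lipschitz.\<close>
  define \<epsilon> where "\<epsilon> = e / (28 * L)"
  have \<epsilon>: "0 < \<epsilon>" "L * (7 * \<epsilon>) = e / 4" using e L by (simp_all add: \<epsilon>_def)
  have Blim: "(\<lambda>T. \<integral>w. f (?B T w) \<partial>white_noise) \<longlonglongrightarrow> (\<integral>w. f (?V w) \<partial>white_noise)"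
  proof (rule integral_dominated_convergence[where w="\<lambda>_. C"])
    show "(\<lambda>w. f (?V w)) \<in> borel_measurable white_noise"
      by (rule skorohod_continuous_measurable[OF fc scaled_brownian_path_measurable])
    show "(\<lambda>w. f (?B T w)) \<in> borel_measurable white_noise" for T
      by (rule skorohod_continuous_measurable[OF fc brownian_skeleton_measurable])
    show "AE w in white_noise. norm (f (?B T w)) \<le> C" for T
      using C[OF brownian_skeleton_in_skorohod_space] by (intro AE_I2) simp
    show "AE w in white_noise. (\<lambda>T. f (?B T w)) \<longlonglongrightarrow> f (?V w)"
    proof (intro AE_I2)
      fix w
      have "(\<lambda>T. f (?B T w) - f (?V w)) \<longlonglongrightarrow> 0"
      proof (rule Lim_null_comparison)
        show "\<forall>\<^sub>F T in sequentially. norm (f (?B T w) - f (?V w)) \<le> L * skorohod_dist (?B T w) (?V w)"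
          using lip[OF brownian_skeleton_in_skorohod_space scaled_brownian_path_in_skorohod_space]
          by (intro always_eventually allI) simp
        show "(\<lambda>T. L * skorohod_dist (?B T w) (?V w)) \<longlonglongrightarrow> 0"
          by (intro tendsto_mult_right_zero brownian_skeleton_converges c)
      qed
      then show "(\<lambda>T. f (?B T w)) \<longlonglongrightarrow> f (?V w)" by (simp add: LIM_zero_iff)
    qed
  qed simp
  \<comment> \<open>About T^4 blocks, each with a contribution of order T^(-6).\<close>
  have bad: "(\<lambda>T. 2 * C * (real (T ^ 3 * T + 2) * (3 * (diffusivity / real (T ^ 3))\<^sup>2 / \<epsilon> ^ 4))) \<longlonglongrightarrow> 0"
  proof -
    have "(\<lambda>T. real (T ^ 3 * T + 2) * (1 / real (T ^ 3))\<^sup>2) \<longlonglongrightarrow> 0" by real_asymp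
    then have "(\<lambda>T. 2 * C * (3 * diffusivity\<^sup>2 / \<epsilon> ^ 4) * (real (T ^ 3 * T + 2) * (1 / real (T ^ 3))\<^sup>2)) \<longlonglongrightarrow> 0"
      by (rule tendsto_mult_right_zero)
    then show ?thesis by (simp add: power_divide mult_ac)
  qed
  have half: "(\<lambda>T. L * (1/2) ^ T) \<longlonglongrightarrow> 0" by (intro tendsto_mult_right_zero LIMSEQ_realpow_zero) auto
  have "eventually (\<lambda>T. 2 * C * (real (T ^ 3 * T + 2) * (3 * (diffusivity / real (T ^ 3))\<^sup>2 / \<epsilon> ^ 4)) < e / 8 \<and>
      L * (1/2) ^ T < e / 8 \<and> norm ((\<integral>w. f (?B T w) \<partial>white_noise) - (\<integral>w. f (?V w) \<partial>white_noise)) < e / 8 \<and> 0 < T) sequentially"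
    using e by (intro eventually_conj order_tendstoD(2)[OF bad] order_tendstoD(2)[OF half] eventually_gt_at_top
        tendstoD[OF Blim, unfolded dist_norm]) auto
  from eventually_happens[OF this] obtain T where T: "2 * C * (real (T ^ 3 * T + 2) * (3 * (diffusivity / real (T ^ 3))\<^sup>2 / \<epsilon> ^ 4)) < e / 8"
      "L * (1/2) ^ T < e / 8" "\<bar>(\<integral>w. f (?B T w) \<partial>white_noise) - (\<integral>w. f (?V w) \<partial>white_noise)\<bar> < e / 8" "0 < T"
    unfolding real_norm_def by auto
  define N where "N = T ^ 3"
  have N: "0 < N" using T by (simp add: N_def)
  define h where "h n = nat \<lceil>(diffusivity / real N) * real n\<rceil>" for n
  define b where "b n = real (N * T + 2) * (3 * (real (h n))\<^sup>2 / (\<epsilon> * sqrt (real n)) ^ 4) +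
      (\<Sum>j\<le>N * T + 2. clock_error (j * h n) / (mean_holding_time 1 \<pi> * real (h n)))" for n
  have "(\<lambda>n. 2 * C * b n) \<longlonglongrightarrow> 2 * C * (real (N * T + 2) * (3 * (diffusivity / real N)\<^sup>2 / \<epsilon> ^ 4))"
    unfolding b_def h_def by (intro tendsto_mult_left prob_irregular_limit(1) \<epsilon> N)
  then have ev1: "eventually (\<lambda>n. 2 * C * b n < e / 8) sequentially"
    by (rule order_tendstoD) (use T(1) in \<open>simp add: N_def\<close>)
  have h_top: "filterlim h at_top sequentially" unfolding h_def using prob_irregular_limit(2)[OF \<epsilon>(1) N] .
  have ev2: "eventually (\<lambda>n. nat \<lceil>diffusivity\<rceil> \<le> h n \<and> 1 \<le> h n) sequentially"
    by (intro eventually_conj h_top[unfolded filterlim_at_top, rule_format])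
  have "(\<lambda>n. \<integral>s. f (skeleton_path N (N * T) n s) \<partial>annealed_law 1 \<pi>) \<longlonglongrightarrow> (\<integral>w. f (?B T w) \<partial>white_noise)"
    unfolding N_def[symmetric] using N T(4) by (intro skeleton_converges[OF _ _ C lip]) auto
  then have ev3: "eventually (\<lambda>n. \<bar>(\<integral>s. f (skeleton_path N (N * T) n s) \<partial>annealed_law 1 \<pi>) - (\<integral>w. f (?B T w) \<partial>white_noise)\<bar> < e / 8) sequentially"
    unfolding dist_real_def[symmetric] using e by (intro tendstoD) auto
  have "eventually (\<lambda>n. norm ((\<integral>s. f (rescaled_path n s) \<partial>annealed_law 1 \<pi>) - (\<integral>w. f (?V w) \<partial>white_noise)) < e) sequentially"
    using ev1 ev2 ev3 eventually_gt_at_top[of 0]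
  proof eventually_elim
    case (elim n)
    have hn: "diffusivity \<le> real (h n)" "1 \<le> h n" using elim(2) by linarith+
    have "\<bar>(\<integral>s. f (rescaled_path n s) \<partial>annealed_law 1 \<pi>) - (\<integral>s. f (skeleton_path N (N * T) n s) \<partial>annealed_law 1 \<pi>)\<bar>
      \<le> L * (7 * \<epsilon> + (1/2) ^ T) + 2 * C * measure (annealed_law 1 \<pi>) (irregular \<epsilon> (N * T + 2) (h n) (sqrt (real n)))"
      using L by (intro rescaled_path_skeleton_expectation[OF \<epsilon>(1) elim(4) N _ _ hn C lip]) (auto simp: h_def)
    also have "\<dots> \<le> L * (7 * \<epsilon> + (1/2) ^ T) + 2 * C * b n"
      unfolding b_def using \<epsilon> elim(4) hn C0 by (intro add_left_mono mult_left_mono prob_irregular_le) auto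
    also have "\<dots> < e / 4 + e / 8 + e / 8" using elim(1) T(2) \<epsilon>(2) by (simp add: distrib_left)
    finally show ?case using elim(3) T(3) unfolding real_norm_def by linarith
  qed
  then show "\<exists>no. \<forall>n\<ge>no. norm ((\<integral>s. f (rescaled_path n s) \<partial>annealed_law 1 \<pi>) - (\<integral>w. f (?V w) \<partial>white_noise)) < e"
    by (simp add: eventually_sequentially)
qed

theorem invariance_principle:
  "converges_in_distribution skorohod_topology (\<lambda>n. annealed_law 1 \<pi>) rescaled_path
     white_noise (\<lambda>w. \<lambda>t\<in>{0..}. sqrt diffusivity * brownian_path t w)"
  by (rule converges_in_distribution_skorohod_lipschitz)
    (auto intro: annealed_prob white_noise.prob_space_axioms rescaled_path_measurable
      scaled_brownian_path_measurable rescaled_path_expectation_limit)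

end

theorem corollary2p3:
  fixes \<pi> :: "real measure measure" and \<Upsilon> :: real
  assumes "\<pi> \<in> space (prob_algebra trap_measures)"
    and "(\<integral>\<^sup>+ s. ennreal (holding_time s 0) \<partial>annealed_law 1 \<pi>) < \<infinity>"
    and "\<Upsilon> = inverse (mean_holding_time 1 \<pi>)"
  shows "(\<exists>(M :: (real \<Rightarrow> real) measure) B. standard_brownian_motion M B \<and>
           converges_in_distribution skorohod_topology
             (\<lambda>n. annealed_law 1 \<pi>)
             (\<lambda>n s. \<lambda>t\<in>{0..}. real_of_int (trapped_walk s (real_of_int \<lfloor>real n * t\<rfloor>)) / sqrt (real n))
             M (\<lambda>w. \<lambda>t\<in>{0..}. sqrt \<Upsilon> * B t w)) \<and>
         ((\<lambda>\<beta>. speed \<beta> \<pi> / (\<beta> - 1)) \<longlongrightarrow> \<Upsilon> / 2) (at_right 1) \<and>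
         (\<forall>\<beta>>1. AE s in annealed_law \<beta> \<pi>.
           (\<lambda>n. real_of_int (trapped_walk s (real n)) / real n) \<longlonglongrightarrow> speed \<beta> \<pi>)"
proof -
  interpret random_traps \<pi> by standard (rule assms(1))
  interpret integrable_random_traps \<pi>
    by standard (use assms(2) in \<open>simp add: nn_integral_holding_time\<close>)
  have \<Upsilon>: "\<Upsilon> = diffusivity" using assms(3) by (simp add: diffusivity_def)
  show ?thesis
  proof (intro conjI allI impI)
    show "\<exists>(M :: (real \<Rightarrow> real) measure) B. standard_brownian_motion M B \<and>
           converges_in_distribution skorohod_topology
             (\<lambda>n. annealed_law 1 \<pi>)
             (\<lambda>n s. \<lambda>t\<in>{0..}. real_of_int (trapped_walk s (real_of_int \<lfloor>real n * t\<rfloor>)) / sqrt (real n))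
             M (\<lambda>w. \<lambda>t\<in>{0..}. sqrt \<Upsilon> * B t w)"
      using standard_brownian_motion_brownian_path invariance_principle
      unfolding rescaled_path_def[abs_def] \<Upsilon> by blast
    show "((\<lambda>\<beta>. speed \<beta> \<pi> / (\<beta> - 1)) \<longlongrightarrow> \<Upsilon> / 2) (at_right 1)"
      unfolding assms(3) by (rule speed_derivative_at_1)
    show "AE s in annealed_law \<beta> \<pi>. (\<lambda>n. real_of_int (trapped_walk s (real n)) / real n) \<longlonglongrightarrow> speed \<beta> \<pi>"
      if "1 < \<beta>" for \<beta> using that by (rule biased_walk_speed)
  qed
qed

end
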